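(* Let $E$ denote the elliptic curve $$y^2=4x^3-432x+1188,$$ and let $P=(-6,54)\in E$. Then the relation $$16\,D^E(P)-11\,D^E(2P)=0$$ is equivalent to $$16\,n\left(\frac{7+\sqrt5}{\sqrt[3]{4}}\right)-8\,n\left(\frac{7-\sqrt5}{\sqrt[3]{4}}\right)=19\,n\left(\sqrt[3]{32}\right).$$
   Context: For real $\alpha$, $n(\alpha):=\int_0^1\int_0^1\log\left|x^3+y^3+1-\alpha xy\right|\,d\theta_1d\theta_2$ with $x=e^{2\pi i\theta_1}$, $y=e^{2\pi i\theta_2}$ (the logarithmic Mahler measure of $x^3+y^3+1-\alpha xy$). $D$ is the Bloch-Wigner dilogarithm $D(z)=\operatorname{Im}\left(\operatorname{Li}_2(z)+\log|z|\log(1-z)\right)$ (principal branches on $\mathbb{C}\setminus[1,\infty)$), extended continuously to $\mathbb{C}\cup\{\infty\}$ (so $D(0)=D(1)=D(\infty)=0$). Elliptic dilogarithm: let $E:y^2=4x^3-g_2x-g_3$ be an elliptic curve parameterized by $(x,y)=(\wp(u),\wp'(u))$, where $\wp$ is the Weierstrass function with period lattice generated by $\omega,\omega'$, and $\tau=\omega'/\omega$ has $\operatorname{Im}\tau>0$; put $q=e^{2\pi i\tau}$. For $P=(\wp(u),\wp'(u))$ on $E$, define $D^E(P):=\sum_{n\in\mathbb{Z}}D\left(e^{2\pi iu/\omega}q^n\right)$ (this does not depend on the choice of $u$ modulo the lattice). For the curve considered here $g_2=432$, $g_3=-1188$ and $g_2^3-27g_3^2>0$, and the periods are chosen with $\omega$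 the real period and $\omega'$ purely imaginary. $2P$ denotes the double of $P$ in the group law on $E$ (with the point at infinity as identity). *)

theory Defs
  imports "HOL-Complex_Analysis.Complex_Analysis"
begin

(* The zero set of the polynomial meets the torus in a null set, so the value 0 that ln takes
   at 0 does not affect the integral. *)
definition mahler_n :: "real \<Rightarrow> real" where
  "mahler_n \<alpha> = (LBINT \<theta>2=0..1. (LBINT \<theta>1=0..1.
     (let x = exp (2 * of_real pi * \<i> * of_real \<theta>1); y = exp (2 * of_real pi * \<i> * of_real \<theta>2)
      in ln (norm (x ^ 3 + y ^ 3 + 1 - of_real \<alpha> * x * y)))))"

(* The principal branch on the complement of [1, \<infinity>).  The integrand has a removable
   singularity at 0. *)
definition dilog :: "complex \<Rightarrow> complex" where
  "dilog z = contour_integral (linepath 0 z) (\<lambda>w. - Ln (1 - w) / w)"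

definition bloch_wigner_domain :: "complex set" where
  "bloch_wigner_domain = {z. z \<noteq> 0 \<and> \<not> (z \<in> \<real> \<and> Re z \<ge> 1)}"

(* The limit is the continuous extension to 0 and to the cut [1, \<infinity>).  The value at the point
   at infinity is left out, since only finite arguments occur in elliptic_dilog. *)
definition bloch_wigner :: "complex \<Rightarrow> real" where
  "bloch_wigner z =
     (let f = (\<lambda>w. Im (dilog w + of_real (ln (norm w)) * Ln (1 - w)))
      in if z \<in> bloch_wigner_domain then f z else Lim (at z within bloch_wigner_domain) f)"

definition period_lattice :: "complex \<Rightarrow> complex \<Rightarrow> complex set" where
  "period_lattice \<omega> \<omega>' = {of_int m * \<omega> + of_int n * \<omega>' | m n. True}"

definition wp :: "complex \<Rightarrow> complex \<Rightarrow> complex \<Rightarrow> complex" where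
  "wp \<omega> \<omega>' u = 1 / u ^ 2 +
     (\<Sum>\<^sub>\<infinity>l\<in>period_lattice \<omega> \<omega>' - {0}. 1 / (u - l) ^ 2 - 1 / l ^ 2)"

datatype ec_point = Infinity | Affine complex complex

definition weierstrass_curve :: "complex \<Rightarrow> complex \<Rightarrow> ec_point set" where
  "weierstrass_curve g2 g3 =
     insert Infinity {Affine x y | x y. y ^ 2 = 4 * x ^ 3 - g2 * x - g3}"

(* The chord-tangent law.  A line of slope s meets y^2 = 4 x^3 - g2 x - g3 in three points whose
   x-coordinates sum to s^2 / 4; the inverse of (x, y) is (x, -y).  The coefficient g3 does not
   enter the formulas. *)
fun ec_add :: "complex \<Rightarrow> ec_point \<Rightarrow> ec_point \<Rightarrow> ec_point" where
  "ec_add g2 Infinity Q = Q"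
| "ec_add g2 (Affine x1 y1) Infinity = Affine x1 y1"
| "ec_add g2 (Affine x1 y1) (Affine x2 y2) =
     (if x1 = x2 \<and> y1 = - y2 then Infinity
      else let s = (if x1 = x2 then (12 * x1 ^ 2 - g2) / (2 * y1) else (y2 - y1) / (x2 - x1));
               x3 = s ^ 2 / 4 - x1 - x2
           in Affine x3 (s * (x1 - x3) - y1))"

definition ec_double :: "complex \<Rightarrow> ec_point \<Rightarrow> ec_point" where
  "ec_double g2 P = ec_add g2 P P"

definition wp_point :: "complex \<Rightarrow> complex \<Rightarrow> complex \<Rightarrow> ec_point" where
  "wp_point \<omega> \<omega>' u =
     (if u \<in> period_lattice \<omega> \<omega>' then Infinity
      else Affine (wp \<omega> \<omega>' u) (deriv (wp \<omega> \<omega>') u))"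

(* Any two choices of u differ by a period, which does not change the sum. *)
definition elliptic_dilog :: "complex \<Rightarrow> complex \<Rightarrow> ec_point \<Rightarrow> real" where
  "elliptic_dilog \<omega> \<omega>' P =
     (let u = (SOME u. wp_point \<omega> \<omega>' u = P);
          q = exp (2 * of_real pi * \<i> * (\<omega>' / \<omega>))
      in \<Sum>\<^sub>\<infinity>n::int. bloch_wigner (exp (2 * of_real pi * \<i> * u / \<omega>) * q powi n))"

end

theory Submission
  imports Defs "HOL-Real_Asymp.Real_Asymp"
begin

text \<open>In the coordinate \<open>z = exp (2 \<pi> i u / \<omega>)\<close> the Weierstrass function is, up to an affine change, a
  \<open>q\<close>-series \<open>W\<close>, and the differences \<open>W z - W w\<close> are quotients of theta functions. The point of order three
  \<open>\<zeta> = exp (2 \<pi> i / 3)\<close> puts the curve into the form \<open>Y\<^sup>2 = 4 X\<^sup>3 - (A X - B)\<^sup>2\<close>, whose parameter is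
  \<open>\<alpha>(q)\<^sup>3 = A\<^sup>3 / B = 27 + 729 q \<Prod>((1 - q\<^sup>3\<^sup>n) / (1 - q\<^sup>n))\<^sup>1\<^sup>2\<close>.

  By Jensen's formula the derivative of \<open>n\<close> at \<open>\<alpha>(q)\<close> is a real period of this curve. As functions of \<open>q\<close>, both
  \<open>n(\<alpha>(q))\<close> and \<open>(9 / 2 \<pi>) S(q)\<close> with \<open>S(q) = \<Sum>D(\<zeta> q\<^sup>n)\<close> then have the same derivative, by an identity
  between an Eisenstein series of weight 3 and an eta quotient, and the same limit for \<open>q \<longrightarrow> 0\<close>. Hence
  \<open>n(\<alpha>(q)) = (9 / 2 \<pi>) S(q)\<close>.

  On the curve of the theorem, \<open>2P\<close> is, up to sign, the point of order three, with \<open>x\<close>-coordinate 12, and \<open>P\<close> has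
  order six. The duplication formula of \<open>D\<close> gives
  \<open>D\<^sup>E(P) = \<plusminus>(S(\<surd>q) - S(q) / 2 - S(q\<^sup>2) / 2)\<close> and \<open>D\<^sup>E(2P) = \<plusminus>S(q)\<close> with equal signs. The curves with nomes
  \<open>\<surd>q\<close> and \<open>q\<^sup>2\<close> are quotients by points of order two, and summing over translates by these points gives
  \<open>\<alpha>(\<surd>q)\<close>, \<open>\<alpha>(q\<^sup>2) = (7 \<plusminus> \<surd>5) / root 3 4\<close>, while \<open>\<alpha>(q) = root 3 32\<close>. Both relations therefore say
  \<open>16 S(\<surd>q) - 8 S(q\<^sup>2) - 19 S(q) = 0\<close>.\<close>

section \<open>Infinite \<open>q\<close>-products\<close>

text \<open>The modular identities all come from special values. Liouville's theorem enters only
  through the theta quotient for \<open>qW q z - qW q w\<close>; at points of order two or three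
  that quotient becomes an eta quotient, while the series defining \<open>qW\<close> turns the same
  values into Lambert series. Thus the inflection condition at \<open>zeta3\<close> expresses A^2 by
  divisor sums, which makes A^2 / 3 the logarithmic derivative of the Hauptmodul, and the derivative
  of the Weierstrass function of nome q^3 at z = q, computed in both ways, is the identity of weight
  3. The nome of the given curve is never known numerically. What can be computed is alpha(q)^3,
  because it equals the cube of the second derivative of \<open>qW\<close> over the fourth power of
  the first at \<open>zeta3\<close>: numerator and denominator both have weight 12 in the period, so
  the quotient can be read off from coordinates on the Weierstrass model. Reality and the order of
  the real roots decide which torsion point has which coordinates. The sign of the y-coordinate at
  \<open>zeta3\<close> depends on the sign of the real period and merely changes the sign of the
  whole relation.\<close>

lemma qscaled_series:
  fixes h h' :: "complex \<Rightarrow> complex" and q :: real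
  assumes q: "0 < q" "q < 1" and S: "open S"
    and der: "\<And>n z. z \<in> S \<Longrightarrow> (h has_field_derivative h' (of_real (q ^ n) * z)) (at (of_real (q ^ n) * z))"
    and bound: "\<And>x. norm x < 1 / 2 \<Longrightarrow> norm (h x) \<le> C * norm x"
    and z: "z \<in> S"
  shows "summable (\<lambda>n. h (of_real (q ^ n) * z))"
    and "summable (\<lambda>n. of_real (q ^ n) * h' (of_real (q ^ n) * z))"
    and "((\<lambda>z. \<Sum>n. h (of_real (q ^ n) * z)) has_field_derivative
          (\<Sum>n. of_real (q ^ n) * h' (of_real (q ^ n) * z))) (at z)"
proof -
  have "C * norm (1/4::complex) \<ge> norm (h (1/4))" by (rule bound) simp
  hence "0 \<le> C * norm (1/4::complex)" using norm_ge_zero order_trans by blast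
  hence C: "C \<ge> 0" by simp
  have "\<exists>g g'. \<forall>x\<in>S. ((\<lambda>n. h (of_real (q ^ n) * x)) sums g x) \<and>
      ((\<lambda>n. of_real (q ^ n) * h' (of_real (q ^ n) * x)) sums g' x) \<and> (g has_field_derivative g' x) (at x)"
  proof (rule series_and_derivative_comparison_complex[OF S])
    fix n x assume "x \<in> S"
    from DERIV_chain2[OF der[OF this, of n] DERIV_cmult_Id]
    show "((\<lambda>x. h (of_real (q ^ n) * x)) has_field_derivative of_real (q ^ n) * h' (of_real (q ^ n) * x)) (at x)"
      by (simp add: mult.commute)
  next
    fix x assume "x \<in> S"
    \<comment> \<open>On the unit ball about \<open>x\<close> the arguments have modulus at most q^n
      R. As soon as this drops below 1/2 the linear bound on \<open>h\<close> applies and gives the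
      geometric majorant C q^n R.\<close>
    define R where "R = norm x + 1"
    have R: "R > 0" by (simp add: R_def add_nonneg_pos)
    have "(\<lambda>n. q ^ n * R) \<longlonglongrightarrow> 0"
      using q by (intro tendsto_mult_left_zero LIMSEQ_realpow_zero) auto
    hence ev: "eventually (\<lambda>n. q ^ n * R < 1/2) sequentially"
      by (rule order_tendstoD) auto
    show "\<exists>d k. 0 < d \<and> summable k \<and> range k \<subseteq> \<real>\<^sub>\<ge>\<^sub>0 \<and>
        (\<forall>\<^sub>F n in sequentially. \<forall>y\<in>ball x d \<inter> S. cmod (h (complex_of_real (q ^ n) * y)) \<le> cmod (k n))"
    proof (intro exI[of _ 1] exI[of _ "\<lambda>n. of_real (C * (q ^ n * R))"] conjI)
      have "summable (\<lambda>n. q ^ n)" using q by (intro summable_geometric) auto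
      thus "summable (\<lambda>n. complex_of_real (C * (q ^ n * R)))"
        by (intro summable_of_real summable_mult summable_mult2)
      show "range (\<lambda>n. complex_of_real (C * (q ^ n * R))) \<subseteq> \<real>\<^sub>\<ge>\<^sub>0"
        using q C R by auto
      show "\<forall>\<^sub>F n in sequentially. \<forall>y\<in>ball x 1 \<inter> S. cmod (h (complex_of_real (q ^ n) * y))
               \<le> cmod (complex_of_real (C * (q ^ n * R)))"
        using ev
      proof eventually_elim
        case (elim n)
        show ?case
        proof
          fix y assume "y \<in> ball x 1 \<inter> S"
          hence "norm y \<le> R"
            unfolding R_def using norm_triangle_ineq2[of y x] by (auto simp: dist_norm norm_minus_commute)
          hence "norm (complex_of_real (q ^ n) * y) \<le> q ^ n * R"
            using q by (auto simp: norm_mult norm_power)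
          hence "cmod (h (complex_of_real (q ^ n) * y)) \<le> C * (q ^ n * R)"
            using elim C by (intro order_trans[OF bound] mult_left_mono) auto
          thus "cmod (h (complex_of_real (q ^ n) * y)) \<le> cmod (complex_of_real (C * (q ^ n * R)))"
            using q C R by (simp add: norm_mult norm_power)
        qed
      qed
    qed auto
  qed
  then obtain g g' where g: "\<And>x. x \<in> S \<Longrightarrow> (\<lambda>n. h (of_real (q ^ n) * x)) sums g x"
      "\<And>x. x \<in> S \<Longrightarrow> (\<lambda>n. of_real (q ^ n) * h' (of_real (q ^ n) * x)) sums g' x"
      "\<And>x. x \<in> S \<Longrightarrow> (g has_field_derivative g' x) (at x)" by blast
  show "summable (\<lambda>n. h (of_real (q ^ n) * z))" 
    "summable (\<lambda>n. of_real (q ^ n) * h' (of_real (q ^ n) * z))"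
    using g(1,2)[OF z] by (auto simp: sums_iff)
  have "eventually (\<lambda>x. x \<in> S) (nhds z)"
    using S z by (rule eventually_nhds_in_open)
  hence "eventually (\<lambda>x. g x = (\<Sum>n. h (of_real (q ^ n) * x))) (nhds z)"
    by eventually_elim (use g in \<open>auto simp: sums_iff\<close>)
  moreover have "g' z = (\<Sum>n. of_real (q ^ n) * h' (of_real (q ^ n) * z))"
    using g(2)[OF z] by (simp add: sums_iff)
  ultimately show "((\<lambda>z. \<Sum>n. h (of_real (q ^ n) * z)) has_field_derivative
          (\<Sum>n. of_real (q ^ n) * h' (of_real (q ^ n) * z))) (at z)"
    using g(3)[OF z] by (simp add: DERIV_cong_ev)
qed

text \<open>The infinite q-Pochhammer symbol (z; q), an entire function with simple zeros at q^(-n)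
  for n >= 0.\<close>

definition qprod :: "real \<Rightarrow> complex \<Rightarrow> complex" where
  "qprod q z = (\<Prod>n. 1 - of_real (q ^ n) * z)"

lemma qprod_convergent:
  assumes "0 < q" "q < 1"
  shows "convergent_prod (\<lambda>n. 1 - of_real (q ^ n) * z :: complex)"
proof -
  have "summable (\<lambda>n. norm (- (of_real (q ^ n) * z) :: complex))"
    using assms by (auto simp: norm_mult norm_power intro!: summable_mult2 summable_geometric)
  hence "abs_convergent_prod (\<lambda>n. 1 + - (of_real (q ^ n) * z) :: complex)"
    by (intro summable_imp_abs_convergent_prod) auto
  thus ?thesis by (auto dest: abs_convergent_prod_imp_convergent_prod)
qed

lemma qprod_LIMSEQ:
  assumes "0 < q" "q < 1"
  shows "(\<lambda>N. \<Prod>n<N. 1 - of_real (q ^ n) * z) \<longlonglongrightarrow> qprod q z"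
proof -
  have "(\<lambda>N. \<Prod>n\<le>N. 1 - of_real (q ^ n) * z) \<longlonglongrightarrow> qprod q z"
    unfolding qprod_def by (rule convergent_prod_LIMSEQ[OF qprod_convergent[OF assms]])
  thus ?thesis by (subst (asm) lessThan_Suc_atMost[symmetric]) (rule LIMSEQ_imp_Suc)
qed

lemma qprod_rec:
  assumes "0 < q" "q < 1"
  shows "qprod q z = (1 - z) * qprod q (of_real q * z)"
proof (rule LIMSEQ_unique)
  show "(\<lambda>N. \<Prod>n<Suc N. 1 - of_real (q ^ n) * z) \<longlonglongrightarrow> qprod q z"
    using qprod_LIMSEQ[OF assms] by (rule LIMSEQ_Suc)
  show "(\<lambda>N. \<Prod>n<Suc N. 1 - of_real (q ^ n) * z) \<longlonglongrightarrow> (1 - z) * qprod q (of_real q * z)"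
    using tendsto_mult[OF tendsto_const[of "1 - z"] qprod_LIMSEQ[OF assms, of "q * z"]]
    by (subst prod.lessThan_Suc_shift) (simp add: mult_ac power_Suc del: power_Suc2)
qed

lemma qprod_eq_0_iff:
  assumes "0 < q" "q < 1"
  shows "qprod q z = 0 \<longleftrightarrow> (\<exists>n. of_real (q ^ n) * z = 1)"
proof
  assume "\<exists>n. of_real (q ^ n) * z = 1"
  then obtain n where "of_real (q ^ n) * z = 1" by blast
  hence "eventually (\<lambda>N. (\<Prod>n<N. 1 - of_real (q ^ n) * z) = 0) sequentially"
    by (intro eventually_mono[OF eventually_gt_at_top[of n]]) auto
  with qprod_LIMSEQ[OF assms] show "qprod q z = 0"
    by (metis tendsto_eventually LIMSEQ_unique)
next
  assume "qprod q z = 0"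
  with prodinf_nonzero[OF qprod_convergent[OF assms, of z]]
  show "\<exists>n. of_real (q ^ n) * z = 1" unfolding qprod_def by force
qed

lemma prod_even_odd: "(\<Prod>n<2*N. f n) = (\<Prod>n<N. f (2*n)) * (\<Prod>n<N. f (Suc (2*n)) :: 'a :: comm_monoid_mult)"
  by (induct N) (simp_all add: mult_ac)

lemma prod_mod_3: "(\<Prod>n<3*(N::nat). f n) = (\<Prod>n<N. f (3*n)) * (\<Prod>n<N. f (3*n+1)) * (\<Prod>n<N. f (3*n+2) :: 'a :: comm_monoid_mult)"
proof (induction N)
  case (Suc N)
  have "{..<3 * Suc N} = insert (3*N+2) (insert (3*N+1) (insert (3*N) {..<3*N}))" by auto
  thus ?case using Suc by (simp add: mult_ac)
qed simp

lemma qprod_split2: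
  assumes q: "0 < q" "q < 1"
  shows "qprod q z = qprod (q\<^sup>2) z * qprod (q\<^sup>2) (of_real q * z)"
proof (rule LIMSEQ_unique)
  have q2: "0 < q\<^sup>2" "q\<^sup>2 < 1" using q by (auto simp: power_less_one_iff)
  show "(\<lambda>N. \<Prod>n<2*N. 1 - of_real (q ^ n) * z) \<longlonglongrightarrow> qprod q z"
    by (rule filterlim_compose[OF qprod_LIMSEQ[OF q]]) (auto intro!: filterlim_subseq strict_monoI)
  show "(\<lambda>N. \<Prod>n<2*N. 1 - of_real (q ^ n) * z) \<longlonglongrightarrow> qprod (q\<^sup>2) z * qprod (q\<^sup>2) (of_real q * z)"
    unfolding prod_even_odd
    using tendsto_mult[OF qprod_LIMSEQ[OF q2, of z] qprod_LIMSEQ[OF q2, of "q*z"]]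
    by (simp add: power_mult mult_ac flip: power_mult)
qed

lemma qprod_split3:
  assumes q: "0 < q" "q < 1"
  shows "qprod q z = qprod (q ^ 3) z * qprod (q ^ 3) (of_real q * z) * qprod (q ^ 3) (of_real (q\<^sup>2) * z)"
proof (rule LIMSEQ_unique)
  have q2: "0 < q ^ 3" "q ^ 3 < 1" using q by (auto simp: power_less_one_iff)
  show "(\<lambda>N. \<Prod>n<3*N. 1 - of_real (q ^ n) * z) \<longlonglongrightarrow> qprod q z"
    by (rule filterlim_compose[OF qprod_LIMSEQ[OF q]]) (auto intro!: filterlim_subseq strict_monoI)
  show "(\<lambda>N. \<Prod>n<3*N. 1 - of_real (q ^ n) * z) \<longlonglongrightarrow>
      qprod (q ^ 3) z * qprod (q ^ 3) (of_real q * z) * qprod (q ^ 3) (of_real (q\<^sup>2) * z)"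
    unfolding prod_mod_3
    using tendsto_mult[OF tendsto_mult[OF qprod_LIMSEQ[OF q2, of z] qprod_LIMSEQ[OF q2, of "q*z"]] 
       qprod_LIMSEQ[OF q2, of "of_real (q\<^sup>2)*z"]]
    by (simp add: power_mult power_add mult_ac power2_eq_square flip: power_mult)
qed

lemma qprod_mult_neg:
  assumes q: "0 < q" "q < 1"
  shows "qprod q z * qprod q (-z) = qprod (q\<^sup>2) (z\<^sup>2)"
proof (rule LIMSEQ_unique)
  have q2: "0 < q\<^sup>2" "q\<^sup>2 < 1" using q by (auto simp: power_less_one_iff)
  show "(\<lambda>N. (\<Prod>n<N. 1 - of_real (q ^ n) * z) * (\<Prod>n<N. 1 - of_real (q ^ n) * (-z))) \<longlonglongrightarrow> qprod q z * qprod q (-z)"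
    by (intro tendsto_mult qprod_LIMSEQ q)
  show "(\<lambda>N. (\<Prod>n<N. 1 - of_real (q ^ n) * z) * (\<Prod>n<N. 1 - of_real (q ^ n) * (-z))) \<longlonglongrightarrow> qprod (q\<^sup>2) (z\<^sup>2)"
    unfolding prod.distrib [symmetric]
    using qprod_LIMSEQ[OF q2, of "z\<^sup>2"]
    by (simp add: algebra_simps power2_eq_square flip: power_mult power_add mult_2 mult_2_right)
qed

lemma qprod_mult_cube_root:
  assumes q: "0 < q" "q < 1" and w: "w\<^sup>2 + w + 1 = 0"
  shows "qprod q z * qprod q (w * z) * qprod q (w\<^sup>2 * z) = qprod (q ^ 3) (z ^ 3)"
proof (rule LIMSEQ_unique)
  have q2: "0 < q ^ 3" "q ^ 3 < 1" using q by (auto simp: power_less_one_iff)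
  let ?P = "\<lambda>z N. \<Prod>n<N. 1 - of_real (q ^ n) * z"
  show "(\<lambda>N. ?P z N * ?P (w*z) N * ?P (w\<^sup>2 * z) N) \<longlonglongrightarrow> qprod q z * qprod q (w * z) * qprod q (w\<^sup>2 * z)"
    by (intro tendsto_mult qprod_LIMSEQ q)
  have *: "(1 - x) * (1 - w * x) * (1 - w\<^sup>2 * x) = 1 - x ^ 3" for x
  proof -
    have "(1 - x) * (1 - w * x) * (1 - w\<^sup>2 * x) = 1 - x ^ 3 + (w\<^sup>2 + w + 1) * (x ^ 3 * (1 - w) - x + w * x\<^sup>2)"
      by (simp add: algebra_simps power2_eq_square power3_eq_cube)
    thus ?thesis by (simp add: w)
  qed
  have **: "(1 - of_real (q ^ n) * z) * (1 - of_real (q ^ n) * (w * z)) * (1 - of_real (q ^ n) * (w\<^sup>2 * z))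
      = 1 - of_real ((q ^ 3) ^ n) * z ^ 3" for n
    using *[of "of_real (q ^ n) * z"] by (simp add: power_mult_distrib mult_ac flip: power_mult)
  show "(\<lambda>N. ?P z N * ?P (w*z) N * ?P (w\<^sup>2 * z) N) \<longlonglongrightarrow> qprod (q ^ 3) (z ^ 3)"
    unfolding prod.distrib [symmetric] ** by (rule qprod_LIMSEQ[OF q2])
qed

lemma power_mult_less:
  assumes "0 < q" "q < (1::real)" and "e > 0"
  obtains N :: nat where "norm (of_real (q ^ N) * z :: complex) < e"
proof -
  have "(\<lambda>n. q ^ n * norm z) \<longlonglongrightarrow> 0"
    using assms by (intro tendsto_mult_left_zero LIMSEQ_realpow_zero) auto
  hence "eventually (\<lambda>n. q ^ n * norm z < e) sequentially"
    using assms by (intro order_tendstoD) auto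
  then obtain N where "q ^ N * norm z < e" by (auto simp: eventually_sequentially)
  thus ?thesis using assms by (intro that[of N]) (simp add: norm_mult norm_power)
qed

text \<open>The complement of the zeros q^(-n) of \<open>qprod\<close>; the logarithmic derivative
  of the product and the series derived from it are regular here.\<close>

definition qdom :: "real \<Rightarrow> complex set" where
  "qdom q = {z. \<forall>n. of_real (q ^ n) * z \<noteq> 1}"

lemma qdom_scale: "z \<in> qdom q \<Longrightarrow> of_real q * z \<in> qdom q"
proof -
  assume z: "z \<in> qdom q"
  { fix n assume "of_real (q ^ n) * (of_real q * z) = 1"
    hence "of_real (q ^ Suc n) * z = 1" by (simp add: mult_ac)
    hence False using z unfolding qdom_def by blast }
  thus ?thesis unfolding qdom_def by blast
qed

lemma ball_subset_qdom: "0 < q \<Longrightarrow> q < 1 \<Longrightarrow> ball 0 1 \<subseteq> qdom q"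
proof
  fix z :: complex assume q: "0 < q" "q < 1" and z: "z \<in> ball 0 1"
  { fix n assume "of_real (q ^ n) * z = 1"
    hence "q ^ n * norm z = 1" using q by (metis norm_mult norm_of_real norm_one abs_of_pos zero_less_power)
    moreover have "q ^ n \<le> 1" using q by (simp add: power_le_one)
    hence "q ^ n * norm z \<le> 1 * norm z" by (intro mult_right_mono) auto
    ultimately have False using z by simp }
  thus "z \<in> qdom q" by (auto simp: qdom_def)
qed

text \<open>Inside the unit disc no factor meets the branch cut of \<open>Ln\<close>, so the product
  is the exponential of a sum of logarithms that may be differentiated termwise. The functional
  equation later carries the result to the whole plane.\<close>

lemma qprod_deriv_ball:
  assumes q: "0 < q" "q < 1" and z: "norm z < 1"
  shows "(qprod q has_field_derivative - qprod q z * (\<Sum>n. of_real (q ^ n) / (1 - of_real (q ^ n) * z))) (at z)"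
    and "summable (\<lambda>n. of_real (q ^ n) / (1 - of_real (q ^ n) * z))"
proof -
  define h where "h = (\<lambda>x::complex. Ln (1 - x))"
  define G where "G = (\<lambda>z. \<Sum>n. h (of_real (q ^ n) * z))"
  have small: "norm (of_real (q ^ n) * z) < 1" if "norm z < 1" for n and z :: complex
  proof -
    have "q ^ n \<le> 1" using q by (simp add: power_le_one)
    hence "q ^ n * norm z \<le> 1 * norm z" by (intro mult_right_mono) auto
    thus ?thesis using that q by (simp add: norm_mult norm_power)
  qed
  have der: "(h has_field_derivative (- 1 / (1 - x))) (at x)" if "norm x < 1" for x
  proof -
    have "Re x < 1" using that complex_Re_le_cmod[of x] by linarith
    thus ?thesis unfolding h_def
      by (auto intro!: derivative_eq_intros simp: complex_nonpos_Reals_iff field_simps)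
  qed
  note S = qscaled_series[of q "ball 0 1" h "\<lambda>x. - 1 / (1 - x)" 2]
  have bd: "norm (h x) \<le> 2 * norm x" if "norm x < 1/2" for x
    using norm_Ln_le[of "-x"] that by (simp add: h_def)
  have d: "(G has_field_derivative (\<Sum>n. of_real (q ^ n) * (- 1 / (1 - of_real (q ^ n) * z)))) (at z)"
    unfolding G_def by (rule S(3)) (use q z small der bd in auto)
  have s2: "summable (\<lambda>n. of_real (q ^ n) * (- 1 / (1 - of_real (q ^ n) * z)))"
    by (rule S(2)) (use q z small der bd in auto)
  from summable_minus[OF this] show s3: "summable (\<lambda>n. of_real (q ^ n) / (1 - of_real (q ^ n) * z))" by simp
  have G: "exp (G w) = qprod q w" if w: "norm w < 1" for w
  proof (rule LIMSEQ_unique)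
    have "summable (\<lambda>n. h (of_real (q ^ n) * w))"
      by (rule S(1)) (use q w small der bd in auto)
    hence "(\<lambda>N. \<Sum>n<N. h (of_real (q ^ n) * w)) \<longlonglongrightarrow> G w"
      unfolding G_def by (rule summable_LIMSEQ)
    thus "(\<lambda>N. exp (\<Sum>n<N. h (of_real (q ^ n) * w))) \<longlonglongrightarrow> exp (G w)"
      by (rule tendsto_exp)
    have "1 - of_real (q ^ n) * w \<noteq> 0" for n
      using small[OF w, of n] by auto
    hence "(\<lambda>N. exp (\<Sum>n<N. h (of_real (q ^ n) * w))) = (\<lambda>N. \<Prod>n<N. 1 - of_real (q ^ n) * w)"
      by (simp add: exp_sum h_def exp_Ln)
    thus "(\<lambda>N. exp (\<Sum>n<N. h (of_real (q ^ n) * w))) \<longlonglongrightarrow> qprod q w"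
      using qprod_LIMSEQ[OF q] by simp
  qed
  have "((\<lambda>z. exp (G z)) has_field_derivative exp (G z) * (\<Sum>n. of_real (q ^ n) * (- 1 / (1 - of_real (q ^ n) * z)))) (at z)"
    by (rule DERIV_fun_exp d)+
  moreover have "eventually (\<lambda>w. w \<in> ball 0 1) (nhds z)"
    using z by (intro eventually_nhds_in_open) auto
  hence "eventually (\<lambda>w. exp (G w) = qprod q w) (nhds z)"
    by eventually_elim (use G in auto)
  ultimately have "(qprod q has_field_derivative exp (G z) * (\<Sum>n. of_real (q ^ n) * (- 1 / (1 - of_real (q ^ n) * z)))) (at z)"
    by (simp add: DERIV_cong_ev)
  moreover have "(\<Sum>n. of_real (q ^ n) * (- 1 / (1 - of_real (q ^ n) * z))) = - (\<Sum>n. of_real (q ^ n) / (1 - of_real (q ^ n) * z))"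
    using suminf_minus[OF s3] by simp
  ultimately show "(qprod q has_field_derivative - qprod q z * (\<Sum>n. of_real (q ^ n) / (1 - of_real (q ^ n) * z))) (at z)"
    using G z by simp
qed

text \<open>Repeated multiplication by \<open>q\<close> brings every point into the unit disc. A
  property known there extends to the plane if it passes from q z to z, which is what the recursion
  \<open>qprod_rec\<close> usually provides.\<close>

lemma qprod_scale_induct [consumes 2, case_names small step]:
  assumes "0 < q" "q < (1::real)"
    and "\<And>z :: complex. norm z < 1 \<Longrightarrow> P z"
    and "\<And>z :: complex. P (of_real q * z) \<Longrightarrow> P z"
  shows "P z"
proof -
  obtain N where N: "norm (of_real (q ^ N) * z) < 1"
    using power_mult_less[of q 1 z] assms by auto
  have "\<forall>z. norm (of_real (q ^ N) * z) < 1 \<longrightarrow> P z"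
  proof (induction N)
    case (Suc N)
    show ?case
    proof (intro allI impI)
      fix z :: complex assume "norm (of_real (q ^ Suc N) * z) < 1"
      hence "P (of_real q * z)" using Suc by (simp add: mult_ac)
      thus "P z" by (rule assms)
    qed
  qed (use assms in auto)
  thus ?thesis using N by blast
qed

lemma qprod_field_differentiable:
  assumes q: "0 < q" "q < 1"
  shows "qprod q field_differentiable (at z)"
  using q
proof (induction z rule: qprod_scale_induct)
  case (small z)
  thus ?case using qprod_deriv_ball[OF q] field_differentiable_def by blast
next
  case (step z)
  then obtain D where D: "(qprod q has_field_derivative D) (at (of_real q * z))"
    using field_differentiable_def by blast
  have "((\<lambda>z. (1 - z) * qprod q (of_real q * z)) has_field_derivative
      (- 1 * qprod q (of_real q * z) + (D * of_real q) * (1 - z))) (at z)"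
    by (rule DERIV_mult DERIV_chain2[of "qprod q"] D derivative_eq_intros refl | simp)+
  hence "(qprod q has_field_derivative (- 1 * qprod q (of_real q * z) + (D * of_real q) * (1 - z))) (at z)"
    by (simp flip: qprod_rec[OF q])
  thus ?case using field_differentiable_def by blast
qed

lemma holomorphic_qprod:
  assumes "0 < q" "q < 1" and "f holomorphic_on A"
  shows "(\<lambda>z. qprod q (f z)) holomorphic_on A"
proof -
  have "qprod q holomorphic_on UNIV"
    using assms by (auto simp: holomorphic_on_def intro: field_differentiable_at_within qprod_field_differentiable)
  from holomorphic_on_compose_gen[OF assms(3) this] show ?thesis by (simp add: o_def)
qed

lemma qdom_eq: "0 < q \<Longrightarrow> q < 1 \<Longrightarrow> qdom q = {z. qprod q z \<noteq> 0}"
  by (auto simp: qdom_def qprod_eq_0_iff)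

lemma open_qdom: 
  assumes q: "0 < q" "q < 1"
  shows "open (qdom q)"
proof -
  have "continuous_on UNIV (qprod q)"
    using holomorphic_qprod[OF q, of "\<lambda>z. z" UNIV] holomorphic_on_imp_continuous_on by auto
  hence "open (qprod q -` (- {0}))" by (intro open_vimage) auto
  also have "qprod q -` (- {0}) = qdom q" using q by (auto simp: qdom_eq)
  finally show ?thesis .
qed

text \<open>With x = q^n z the summands x / (1 - x), x / (1 - x)^2 and x (1 + x) / (1 - x)^3 of this
  series and the next two arise from - log (1 - x) by applying x d/dx once, twice and three times.
  So \<open>qlog1\<close> is minus the logarithmic derivative of \<open>qprod\<close>, and each of
  the others is z d/dz of its predecessor.\<close>

definition qlog1 :: "real \<Rightarrow> complex \<Rightarrow> complex" where
  "qlog1 q z = (\<Sum>n. (of_real (q ^ n) * z) / (1 - of_real (q ^ n) * z))"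

definition qsum2 :: "real \<Rightarrow> complex \<Rightarrow> complex" where
  "qsum2 q z = (\<Sum>n. (of_real (q ^ n) * z) / (1 - of_real (q ^ n) * z)\<^sup>2)"

definition qsum3 :: "real \<Rightarrow> complex \<Rightarrow> complex" where
  "qsum3 q z = (\<Sum>n. (of_real (q ^ n) * z) * (1 + of_real (q ^ n) * z) / (1 - of_real (q ^ n) * z) ^ 3)"

lemma norm_one_minus_ge_half: "norm (x :: complex) < 1/2 \<Longrightarrow> norm (1 - x) \<ge> 1/2"
  using norm_triangle_ineq2[of 1 x] by simp

lemma qlog1_props:
  assumes q: "0 < q" "q < 1" and z: "z \<in> qdom q"
  shows "summable (\<lambda>n. (of_real (q ^ n) * z) / (1 - of_real (q ^ n) * z))"
    and "(\<lambda>n. of_real (q ^ n) / (1 - of_real (q ^ n) * z)\<^sup>2) sums (deriv (qlog1 q) z)"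
    and "(qlog1 q has_field_derivative deriv (qlog1 q) z) (at z)"
proof -
  have der: "((\<lambda>x. x / (1 - x)) has_field_derivative 1 / (1 - x)\<^sup>2) (at x)" if "x \<noteq> 1" for x :: complex
    using that by (auto intro!: derivative_eq_intros simp: power2_eq_square field_simps)
  have bd: "norm (x / (1 - x)) \<le> 2 * norm x" if "norm x < 1/2" for x :: complex
  proof -
    have "norm x \<le> norm x * (2 * norm (1 - x))"
      using norm_one_minus_ge_half[OF that] by (intro mult_right_le_one_le mult_le_cancel_left1[THEN iffD2]) auto
    moreover have "norm (1 - x) > 0" using norm_one_minus_ge_half[OF that] by linarith
    ultimately show ?thesis by (simp add: norm_divide field_simps)
  qed
  note S = qscaled_series[OF q open_qdom[OF q], of "\<lambda>x. x / (1 - x)" "\<lambda>x. 1 / (1 - x)\<^sup>2", OF der bd z]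
  have S1: "of_real (q ^ n) * w \<noteq> 1" if "w \<in> qdom q" for n w using that by (auto simp: qdom_def)
  show "summable (\<lambda>n. (of_real (q ^ n) * z) / (1 - of_real (q ^ n) * z))"
    using S(1) S1 by blast
  have "((qlog1 q) has_field_derivative (\<Sum>n. of_real (q ^ n) * (1 / (1 - of_real (q ^ n) * z)\<^sup>2))) (at z)"
    unfolding qlog1_def using S(3) S1 by blast
  moreover from this have "deriv (qlog1 q) z = (\<Sum>n. of_real (q ^ n) * (1 / (1 - of_real (q ^ n) * z)\<^sup>2))"
    by (rule DERIV_imp_deriv)
  moreover have "summable (\<lambda>n. of_real (q ^ n) * (1 / (1 - of_real (q ^ n) * z)\<^sup>2))"
    using S(2) S1 by blast
  ultimately show "(\<lambda>n. of_real (q ^ n) / (1 - of_real (q ^ n) * z)\<^sup>2) sums (deriv (qlog1 q) z)"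
    and "(qlog1 q has_field_derivative deriv (qlog1 q) z) (at z)"
    by (simp_all add: sums_iff)
qed

lemma qsum2_props:
  assumes q: "0 < q" "q < 1" and z: "z \<in> qdom q"
  shows "(\<lambda>n. (of_real (q ^ n) * z) / (1 - of_real (q ^ n) * z)\<^sup>2) sums qsum2 q z"
    and "(\<lambda>n. of_real (q ^ n) * ((1 + of_real (q ^ n) * z) / (1 - of_real (q ^ n) * z) ^ 3)) sums (deriv (qsum2 q) z)"
    and "(qsum2 q has_field_derivative deriv (qsum2 q) z) (at z)"
    and "z * deriv (qlog1 q) z = qsum2 q z"
    and "(\<lambda>n. (of_real (q ^ n) * z) * (1 + of_real (q ^ n) * z) / (1 - of_real (q ^ n) * z) ^ 3) sums (z * deriv (qsum2 q) z)"
    and "z * deriv (qsum2 q) z = qsum3 q z"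
proof -
  have der: "((\<lambda>x. x / (1 - x)\<^sup>2) has_field_derivative (1 + x) / (1 - x) ^ 3) (at x)" if "x \<noteq> 1" for x :: complex
  proof -
    have "((\<lambda>x. x / (1 - x)\<^sup>2) has_field_derivative (1 * (1 - x)\<^sup>2 - x * (2 * (1 - x) * (-1))) / ((1 - x)\<^sup>2 * (1 - x)\<^sup>2)) (at x)"
      using that by (auto intro!: derivative_eq_intros)
    also have "(1 * (1 - x)\<^sup>2 - x * (2 * (1 - x) * (-1))) / ((1 - x)\<^sup>2 * (1 - x)\<^sup>2) = (1 + x) / (1 - x) ^ 3"
    proof -
      have "1 - x \<noteq> 0" using that by auto
      have "1 * (1 - x)\<^sup>2 - x * (2 * (1 - x) * (-1)) = (1 + x) * (1 - x)" by (simp add: algebra_simps power2_eq_square)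
      moreover have "(1 - x)\<^sup>2 * (1 - x)\<^sup>2 = (1 - x) ^ 3 * (1 - x)" by (simp add: power2_eq_square power3_eq_cube)
      ultimately show ?thesis using \<open>1 - x \<noteq> 0\<close> by simp
    qed
    finally show ?thesis .
  qed
  have bd: "norm (x / (1 - x)\<^sup>2) \<le> 4 * norm x" if "norm x < 1/2" for x :: complex
  proof -
    have "norm (1 - x) \<ge> 1/2" by (rule norm_one_minus_ge_half[OF that])
    hence "(1/2)\<^sup>2 \<le> norm (1 - x) ^ 2" by (intro power_mono) auto
    hence 1: "1 \<le> 4 * norm (1 - x) ^ 2" by (simp add: power2_eq_square)
    hence "norm x * 1 \<le> norm x * (4 * norm (1 - x) ^ 2)"
      by (intro mult_left_mono) auto
    moreover have "norm (1 - x) ^ 2 > 0" using 1 by linarith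
    ultimately show ?thesis by (simp add: norm_divide norm_power field_simps)
  qed
  note S = qscaled_series[OF q open_qdom[OF q], of "\<lambda>x. x / (1 - x)\<^sup>2" "\<lambda>x. (1 + x) / (1 - x) ^ 3", OF der bd z]
  have S1: "of_real (q ^ n) * w \<noteq> 1" if "w \<in> qdom q" for n w using that by (auto simp: qdom_def)
  have "summable (\<lambda>n. (of_real (q ^ n) * z) / (1 - of_real (q ^ n) * z)\<^sup>2)"
    using S(1) S1 by blast
  thus *: "(\<lambda>n. (of_real (q ^ n) * z) / (1 - of_real (q ^ n) * z)\<^sup>2) sums qsum2 q z"
    by (simp add: sums_iff qsum2_def)
  have "((qsum2 q) has_field_derivative (\<Sum>n. of_real (q ^ n) * ((1 + of_real (q ^ n) * z) / (1 - of_real (q ^ n) * z) ^ 3))) (at z)"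
    unfolding qsum2_def using S(3) S1 by blast
  moreover from this have "deriv (qsum2 q) z = (\<Sum>n. of_real (q ^ n) * ((1 + of_real (q ^ n) * z) / (1 - of_real (q ^ n) * z) ^ 3))"
    by (rule DERIV_imp_deriv)
  moreover have "summable (\<lambda>n. of_real (q ^ n) * ((1 + of_real (q ^ n) * z) / (1 - of_real (q ^ n) * z) ^ 3))"
    using S(2) S1 by blast
  ultimately show **: "(\<lambda>n. of_real (q ^ n) * ((1 + of_real (q ^ n) * z) / (1 - of_real (q ^ n) * z) ^ 3)) sums (deriv (qsum2 q) z)"
    and "(qsum2 q has_field_derivative deriv (qsum2 q) z) (at z)"
    by (simp_all add: sums_iff)
  have "(\<lambda>n. z * (of_real (q ^ n) / (1 - of_real (q ^ n) * z)\<^sup>2)) sums (z * deriv (qlog1 q) z)"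
    using qlog1_props(2)[OF q z] by (rule sums_mult)
  with * show "z * deriv (qlog1 q) z = qsum2 q z"
    by (auto simp: sums_iff mult_ac)
  show "(\<lambda>n. (of_real (q ^ n) * z) * (1 + of_real (q ^ n) * z) / (1 - of_real (q ^ n) * z) ^ 3) sums (z * deriv (qsum2 q) z)"
    using sums_mult[OF **, of z] by (simp add: mult_ac)
  thus "z * deriv (qsum2 q) z = qsum3 q z" by (simp add: sums_iff qsum3_def)
qed

lemma qprod_deriv:
  assumes q: "0 < q" "q < 1" and z: "z \<in> qdom q"
  shows "z * deriv (qprod q) z = - qprod q z * qlog1 q z"
proof -
  have "z \<in> qdom q \<longrightarrow> z * deriv (qprod q) z = - qprod q z * qlog1 q z" using q
  proof (induction z rule: qprod_scale_induct)
    case (small z)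
    have "z * deriv (qprod q) z = - qprod q z * (z * (\<Sum>n. of_real (q ^ n) / (1 - of_real (q ^ n) * z)))"
      using qprod_deriv_ball(1)[OF q small, THEN DERIV_imp_deriv] by simp
    also have "z * (\<Sum>n. of_real (q ^ n) / (1 - of_real (q ^ n) * z)) = qlog1 q z"
      unfolding qlog1_def using qprod_deriv_ball(2)[OF q small]
      by (subst suminf_mult[symmetric]) (auto simp: mult_ac)
    finally show ?case by simp
  next
    case (step z)
    let ?D = "deriv (qprod q) (of_real q * z)"
    show ?case
    proof
      assume z: "z \<in> qdom q"
      hence z1: "z \<noteq> 1" by (auto simp: qdom_def dest: spec[of _ 0])
      have D: "(qprod q has_field_derivative ?D) (at (of_real q * z))"
        using qprod_field_differentiable[OF q] by (simp add: DERIV_deriv_iff_field_differentiable)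
      have "((\<lambda>z. (1 - z) * qprod q (of_real q * z)) has_field_derivative
          (- 1 * qprod q (of_real q * z) + (?D * of_real q) * (1 - z))) (at z)"
        by (rule DERIV_mult DERIV_chain2[of "qprod q"] D derivative_eq_intros refl | simp)+
      hence "(qprod q has_field_derivative (- 1 * qprod q (of_real q * z) + (?D * of_real q) * (1 - z))) (at z)"
        by (simp flip: qprod_rec[OF q])
      hence "z * deriv (qprod q) z = z * (- 1 * qprod q (of_real q * z) + (?D * of_real q) * (1 - z))"
        using DERIV_imp_deriv by metis
      also have "\<dots> = - z * qprod q (of_real q * z) + (1 - z) * ((of_real q * z) * ?D)"
        by (simp add: algebra_simps)
      also have "(of_real q * z) * ?D = - qprod q (of_real q * z) * qlog1 q (of_real q * z)"
        using step z qdom_scale by blast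
      also have "qlog1 q (of_real q * z) = qlog1 q z - z / (1 - z)"
        unfolding qlog1_def using suminf_split_head[OF qlog1_props(1)[OF q z]] by (simp add: mult_ac)
      finally show "z * deriv (qprod q) z = - qprod q z * qlog1 q z"
        using z1 by (simp add: qprod_rec[OF q, of z] right_diff_distrib)
    qed
  qed
  thus ?thesis using z by blast
qed

section \<open>Theta quotients and the multiplicative Weierstrass function\<close>

text \<open>Jacobi's theta function in product form, up to the factor \<open>qprod q q\<close> of
  the triple product. Its zeros are exactly the integral powers of \<open>q\<close>.\<close>

definition qtheta :: "real \<Rightarrow> complex \<Rightarrow> complex" where
  "qtheta q z = qprod q z * qprod q (of_real q / z)"

text \<open>The Weierstrass function with period lattice generated by \<open>\<omega>\<close> and \<open>\<omega>'\<close> is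
  \<open>(2 \<pi> i / \<omega>)\<^sup>2 qW q z + C\<close> with \<open>z = exp (2 \<pi> i u / \<omega>)\<close> and a constant \<open>C\<close>.\<close>

definition qW :: "real \<Rightarrow> complex \<Rightarrow> complex" where
  "qW q z = qsum2 q z + qsum2 q (of_real q / z)"

text \<open>The punctured plane without the powers of \<open>q\<close>
  (\<open>tdom_iff_powi\<close>). On the elliptic curve obtained by identifying z with q z these are
  all points except the origin.\<close>

definition tdom :: "real \<Rightarrow> complex set" where
  "tdom q = {z. z \<noteq> 0 \<and> qtheta q z \<noteq> 0}"

locale nome =
  fixes q :: real
  assumes q: "0 < q" "q < 1"
begin

abbreviation "Q \<equiv> qprod q (of_real q)"

lemma qprod_1 [simp]: "qprod q 1 = 0"
  using qprod_rec[OF q, of 1] by simp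

lemma qprod_nonzero: "norm z < 1 \<Longrightarrow> qprod q z \<noteq> 0"
  using ball_subset_qdom[OF q] q by (auto simp: qdom_eq[OF q])

lemma Q_nonzero [simp]: "Q \<noteq> 0"
  using q by (intro qprod_nonzero) auto

lemma qtheta_inverse: "z \<noteq> 0 \<Longrightarrow> qtheta q (1 / z) = - qtheta q z / z"
proof -
  assume z: "z \<noteq> 0"
  show ?thesis
  proof (cases "z = 1")
    case False
    define A where "A = qprod q (of_real q / z) * qprod q (of_real q * z)"
    have t1: "qtheta q (1 / z) = (1 - 1 / z) * A"
      unfolding qtheta_def A_def by (subst qprod_rec[OF q, of "1 / z"]) simp
    have t2: "qtheta q z = (1 - z) * A"
      unfolding qtheta_def A_def by (subst qprod_rec[OF q, of "z"]) simp
    show ?thesis unfolding t1 t2 using z by (simp add: field_simps)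
  qed (simp add: qtheta_def)
qed

lemma qtheta_scale: "z \<noteq> 0 \<Longrightarrow> qtheta q (of_real q * z) = - qtheta q z / z"
  using qtheta_inverse[of z] q by (simp add: qtheta_def mult_ac)

lemma tdom_iff: "z \<in> tdom q \<longleftrightarrow> z \<noteq> 0 \<and> z \<in> qdom q \<and> of_real q / z \<in> qdom q"
  by (auto simp: tdom_def qtheta_def qdom_eq[OF q])

lemma tdom_scale_iff: "of_real q * z \<in> tdom q \<longleftrightarrow> z \<in> tdom q"
  using q by (cases "z = 0") (auto simp: tdom_def qtheta_scale)

lemma tdom_inverse_iff: "1 / z \<in> tdom q \<longleftrightarrow> z \<in> tdom q"
  using q by (cases "z = 0") (auto simp: tdom_def qtheta_inverse)

lemma tdom_iff_powi: "z \<in> tdom q \<longleftrightarrow> z \<noteq> 0 \<and> (\<forall>n. z \<noteq> of_real q powi n)"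
proof (intro iffI conjI allI notI)
  fix n assume "z \<in> tdom q" "z = of_real q powi n"
  moreover have "of_real q powi n \<notin> tdom q" for n
  proof (induction n rule: int_induct[where k = 0])
    case base thus ?case by (auto simp: tdom_def qtheta_def)
  next
    case (step1 i)
    thus ?case using tdom_scale_iff[of "of_real q powi i"] q by (simp add: power_int_add mult.commute)
  next
    case (step2 i)
    thus ?case using tdom_scale_iff[of "of_real q powi (i - 1)"] q by (simp add: power_int_diff)
  qed
  ultimately show False by blast
next
  assume *: "z \<noteq> 0 \<and> (\<forall>n. z \<noteq> of_real q powi n)"
  show "z \<in> tdom q"
  proof (rule ccontr)
    assume "z \<notin> tdom q"
    then consider n where "of_real (q ^ n) * z = 1" | n where "of_real (q ^ n) * (of_real q / z) = 1"
      using * unfolding tdom_iff qdom_def by blast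
    thus False
    proof cases
      case (1 n)
      hence "z = of_real q powi (- int n)" using q by (simp add: power_int_minus field_simps)
      thus ?thesis using * by blast
    next
      case (2 n)
      hence "z = of_real q powi (int (Suc n))" using * q by (simp add: field_simps del: of_nat_Suc)
      thus ?thesis using * by blast
    qed
  qed
qed (auto simp: tdom_def)

lemma tdom_0 [simp]: "0 \<notin> tdom q" and tdom_1 [simp]: "1 \<notin> tdom q"
  by (auto simp: tdom_def qtheta_def)

lemma holomorphic_qtheta:
  assumes "f holomorphic_on A" "\<And>z. z \<in> A \<Longrightarrow> f z \<noteq> 0"
  shows "(\<lambda>z. qtheta q (f z)) holomorphic_on A"
  unfolding qtheta_def using assms by (intro holomorphic_intros holomorphic_qprod q) auto

lemma open_tdom: "open (tdom q)"
proof -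
  have "continuous_on (- {0}) (qtheta q)"
    using holomorphic_qtheta[of "\<lambda>z. z" "- {0}"] holomorphic_on_imp_continuous_on by auto
  hence "open (- {0} \<inter> qtheta q -` (- {0}))"
    by (intro continuous_open_preimage) auto
  also have "- {0} \<inter> qtheta q -` (- {0}) = tdom q" by (auto simp: tdom_def)
  finally show ?thesis .
qed

lemma holomorphic_qsum2:
  assumes "f holomorphic_on A" "\<And>z. z \<in> A \<Longrightarrow> f z \<in> qdom q"
  shows "(\<lambda>z. qsum2 q (f z)) holomorphic_on A"
proof -
  have "qsum2 q holomorphic_on qdom q"
    using qsum2_props(3)[OF q] by (meson field_differentiable_at_within field_differentiable_def holomorphic_on_def)
  from holomorphic_on_compose_gen[OF assms(1) this] assms(2) show ?thesis by (auto simp: o_def)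
qed

lemma holomorphic_qW: "qW q holomorphic_on tdom q"
  unfolding qW_def by (intro holomorphic_intros holomorphic_qsum2) (auto simp: tdom_iff)

lemma qsum2_rec:
  assumes "z \<in> qdom q"
  shows "qsum2 q z = z / (1 - z)\<^sup>2 + qsum2 q (of_real q * z)"
proof -
  have "(\<lambda>n. (of_real (q ^ Suc n) * z) / (1 - of_real (q ^ Suc n) * z)\<^sup>2) sums (qsum2 q z - z / (1 - z)\<^sup>2)"
    using qsum2_props(1)[OF q assms] by (subst sums_Suc_iff) simp
  moreover have "(\<lambda>n. (of_real (q ^ n) * (of_real q * z)) / (1 - of_real (q ^ n) * (of_real q * z))\<^sup>2) sums qsum2 q (of_real q * z)"
    by (rule qsum2_props(1)[OF q qdom_scale[OF assms]])
  ultimately show ?thesis by (simp add: sums_iff mult_ac diff_eq_eq add.commute)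
qed

lemma qW_inverse: "z \<in> tdom q \<Longrightarrow> qW q (1 / z) = qW q z"
proof -
  assume z: "z \<in> tdom q"
  hence "1 / z \<in> tdom q" by (simp add: tdom_inverse_iff)
  with z have "z \<in> qdom q" "1 / z \<in> qdom q" "z \<noteq> 0" "z \<noteq> 1" using tdom_1 by (auto simp: tdom_iff)
  note * = qsum2_rec[OF this(1)] qsum2_rec[OF this(2)]
  have "(1 / z) / (1 - 1 / z)\<^sup>2 = z / (1 - z)\<^sup>2"
  proof -
    have "1 - 1 / z = (z - 1) / z" using \<open>z \<noteq> 0\<close> by (simp add: field_simps)
    hence "(1 - 1 / z)\<^sup>2 = (1 - z)\<^sup>2 / z\<^sup>2" by (simp add: power_divide power2_commute)
    thus ?thesis using \<open>z \<noteq> 0\<close> by (simp add: power2_eq_square)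
  qed
  thus ?thesis unfolding qW_def using * by simp
qed

lemma qW_scale: "z \<in> tdom q \<Longrightarrow> qW q (of_real q * z) = qW q z"
  using qW_inverse[of z] q by (simp add: qW_def add_ac)

text \<open>The closed annulus between \<open>q\<close> and 1 meets every orbit of multiplication by
  \<open>q\<close>; it is the compact set on which periodic functions are bounded below.\<close>

lemma int_power_window:
  assumes "z \<noteq> (0 :: complex)"
  obtains n :: int where "q \<le> norm (of_real q powi n * z)" "norm (of_real q powi n * z) \<le> 1"
proof -
  define x where "x = ln (norm z) / - ln q"
  have lq: "ln q < 0" using q by simp
  define n where "n = \<lceil>x\<rceil>"
  have n: "x \<le> n" "n < x + 1" unfolding n_def by linarith+
  have eq: "norm (of_real q powi n * z) = exp (n * ln q + ln (norm z))"
  proof -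
    have "norm (of_real q powi n * z) = q powi n * norm z"
      using q by (simp add: norm_mult norm_power_int)
    also have "q powi n = exp (n * ln q)"
      using q powr_real_of_int'[of q n] by (simp add: powr_def)
    finally show ?thesis using assms by (simp add: exp_add)
  qed
  have lz: "ln (norm z) = - x * ln q" using lq by (simp add: x_def)
  have "n * ln q + ln (norm z) = (n - x) * ln q" by (simp add: lz algebra_simps)
  moreover have "(n - x) * ln q \<le> 0" using n lq by (intro mult_nonneg_nonpos) auto
  moreover have "1 * ln q \<le> (n - x) * ln q" using n lq by (intro mult_right_mono_neg) auto
  ultimately have "ln q \<le> n * ln q + ln (norm z)" "n * ln q + ln (norm z) \<le> 0" by linarith+
  hence "exp (ln q) \<le> exp (n * ln q + ln (norm z))" "exp (n * ln q + ln (norm z)) \<le> 1" by (simp_all del: exp_ln)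
  thus ?thesis using q eq by (intro that[of n]) auto
qed

text \<open>\<open>K\<close> shows that the singularity at 1 is removable, and periodicity then
  removes those at all powers of \<open>q\<close>. Composed with \<open>exp\<close> the extended
  function is entire, and since all its values are already taken on a compact annulus it is bounded,
  so Liouville's theorem applies.\<close>

lemma q_periodic_constant:
  assumes holf: "f holomorphic_on tdom q"
    and per: "\<And>z. z \<in> tdom q \<Longrightarrow> f (of_real q * z) = f z"
    and holK: "K holomorphic_on ball 1 d" and d: "d > 0"
    and eq: "\<And>z. z \<in> ball 1 d \<Longrightarrow> z \<noteq> 1 \<Longrightarrow> z \<in> tdom q \<and> f z = K z"
  shows "\<exists>c. \<forall>z\<in>tdom q. f z = c"
proof -
  define F where "F = (\<lambda>z. if z \<in> tdom q then f z else K 1)"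
  have F_scale: "F (of_real q * z) = F z" for z
    using per by (auto simp: F_def tdom_scale_iff)
  have F_powi: "F (of_real q powi n * z) = F z" for n z
  proof (induction n rule: int_induct[where k = 0])
    case (step1 i)
    thus ?case using F_scale[of "of_real q powi i * z"] q by (simp add: power_int_add mult_ac)
  next
    case (step2 i)
    thus ?case using F_scale[of "of_real q powi (i - 1) * z"] q by (simp add: power_int_diff)
  qed auto
  have diff: "F field_differentiable (at z)" if z0: "z \<noteq> 0" for z
  proof (cases "z \<in> tdom q")
    case True
    have "f field_differentiable (at z)"
      using holf True open_tdom by (simp add: holomorphic_on_imp_differentiable_at)
    then obtain D where D: "(f has_field_derivative D) (at z)" by (auto simp: field_differentiable_def)
    have "eventually (\<lambda>w. w \<in> tdom q) (nhds z)"
      using open_tdom True by (rule eventually_nhds_in_open)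
    hence ev: "eventually (\<lambda>w. f w = F w) (nhds z)"
      by eventually_elim (auto simp: F_def)
    show ?thesis
      unfolding field_differentiable_def using DERIV_cong_ev[THEN iffD1, OF refl ev refl D] by blast
  next
    case False
    hence "\<not> (z \<noteq> 0 \<and> (\<forall>n. z \<noteq> of_real q powi n))" by (simp only: tdom_iff_powi not_False_eq_True)
    then obtain n where n: "z = of_real q powi n" using z0 by blast
    \<comment> \<open>Near the power z of \<open>q\<close> a point w is moved by periodicity to w /
      z, which lies close to 1, where \<open>K\<close> describes the function.\<close>
    have "K field_differentiable (at 1)"
      using holK d by (auto intro: holomorphic_on_imp_differentiable_at)
    then obtain D where D: "(K has_field_derivative D) (at (z / z))"
      using z0 by (auto simp: field_differentiable_def)
    have DK: "((\<lambda>w. K (w / z)) has_field_derivative D * (1 / z)) (at z)"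
      by (rule DERIV_chain2[where f = K and g = "\<lambda>w. w / z" and x = z, OF D]) (use z0 in \<open>auto intro!: derivative_eq_intros\<close>)
    have "((\<lambda>w. w / z) \<longlongrightarrow> 1) (at z)"
      using that by (auto intro!: tendsto_eq_intros)
    hence "((\<lambda>w. w / z) \<longlongrightarrow> 1) (nhds z)"
      using that by (auto simp: tendsto_nhds_iff)
    hence "eventually (\<lambda>w. w / z \<in> ball 1 d) (nhds z)"
      using d by (intro topological_tendstoD) auto
    hence ev: "eventually (\<lambda>w. K (w / z) = F w) (nhds z)"
    proof eventually_elim
      case (elim w)
      have "F w = F (of_real q powi n * (w / z))" using n that by simp
      also have "\<dots> = F (w / z)" by (rule F_powi)
      also have "\<dots> = K (w / z)"
      proof (cases "w / z = 1")
        case True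
        show ?thesis unfolding True by (simp add: F_def)
      next
        case False
        thus ?thesis using eq[OF elim False] by (simp add: F_def)
      qed
      finally show ?case ..
    qed
    show ?thesis
      unfolding field_differentiable_def using DERIV_cong_ev[THEN iffD1, OF refl ev refl DK] by blast
  qed
  hence holF: "F holomorphic_on - {0}"
    by (auto simp: holomorphic_on_def intro: field_differentiable_at_within)
  have "(F \<circ> exp) holomorphic_on UNIV"
    by (rule holomorphic_on_compose_gen[OF _ holF]) (auto intro: holomorphic_intros)
  moreover have "bounded (range (F \<circ> exp))"
  proof -
    let ?A = "cball 0 1 - ball (0::complex) q"
    have "compact ?A" by (intro compact_diff) auto
    moreover have "continuous_on ?A F"
      by (rule continuous_on_subset[OF holomorphic_on_imp_continuous_on[OF holF]]) (use q in auto)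
    ultimately have "bounded (F ` ?A)" by (intro compact_imp_bounded compact_continuous_image)
    moreover have "range (F \<circ> exp) \<subseteq> F ` ?A"
    proof safe
      fix u :: complex
      obtain n where n: "q \<le> norm (of_real q powi n * exp u)" "norm (of_real q powi n * exp u) \<le> 1"
        using int_power_window[of "exp u"] by auto
      have "(F \<circ> exp) u = F (of_real q powi n * exp u)" by (simp add: F_powi)
      thus "(F \<circ> exp) u \<in> F ` ?A" using n by (intro image_eqI[of _ _ "of_real q powi n * exp u"]) auto
    qed
    ultimately show ?thesis by (rule bounded_subset)
  qed
  ultimately obtain c where c: "\<And>u. (F \<circ> exp) u = c"
    using Liouville_theorem by (metis constant_on_def UNIV_I)
  have "f z = c" if z: "z \<in> tdom q" for z
  proof -
    have "z \<noteq> 0" using z tdom_0 by blast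
    thus ?thesis using c[of "Ln z"] z by (simp add: F_def)
  qed
  thus ?thesis by blast
qed

lemma ball_1_annulus:
  fixes z :: complex
  assumes "z \<in> ball 1 (1 - q)"
  shows "norm (of_real q * z) < 1" "norm (of_real q / z) < 1" "z \<noteq> 0"
proof -
  have 1: "norm (z - 1) < 1 - q" using assms by (simp add: dist_norm norm_minus_commute)
  have "norm z > q" using norm_triangle_ineq2[of 1 "1 - z"] 1 by (simp add: norm_minus_commute)
  thus "z \<noteq> 0" "norm (of_real q / z) < 1" using q by (auto simp: norm_divide divide_simps)
  have "norm z < 2 - q" using norm_triangle_ineq[of "z - 1" 1] 1 by simp
  hence "q * norm z < q * (2 - q)" using q by simp
  also have "q * (2 - q) \<le> 1" using zero_le_power2[of "1 - q"] by (simp add: power2_eq_square algebra_simps)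
  finally show "norm (of_real q * z) < 1" using q by (simp add: norm_mult)
qed

lemma ball_1_tdom:
  assumes "z \<in> ball 1 (1 - q)" "z \<noteq> 1"
  shows "z \<in> tdom q"
  using ball_1_annulus[OF assms(1)] assms(2) qprod_nonzero
  by (simp add: tdom_def qtheta_def qprod_rec[OF q, of z])

text \<open>The difference of the two sides is \<open>q\<close>-periodic with at most a double pole at \<open>1\<close>.
  The leading coefficient vanishes, and the symmetry under inversion then excludes a simple pole,
  so the difference is constant; it vanishes at \<open>w\<close>.\<close>

theorem qW_diff:
  assumes z: "z \<in> tdom q" and w: "w \<in> tdom q"
  shows "qW q z - qW q w = - w * qtheta q (z / w) * qtheta q (z * w) * Q ^ 4 / (qtheta q z ^ 2 * qtheta q w ^ 2)"
proof -
  have w0: "w \<noteq> 0" "qtheta q w \<noteq> 0" using w by (auto simp: tdom_def)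
  define f where "f = (\<lambda>z. qW q z - qW q w + w * qtheta q (z / w) * qtheta q (z * w) * Q ^ 4 / (qtheta q z ^ 2 * qtheta q w ^ 2))"
  \<comment> \<open>\<open>T\<close> is \<open>qtheta\<close> without its factor 1 - z, and
    \<open>g\<close> is (1 - z)^2 times the part of \<open>f\<close> that is singular at 1: the head
    z / (1 - z)^2 of the series and the theta quotient.\<close>
  define T where "T = (\<lambda>z. qprod q (of_real q * z) * qprod q (of_real q / z))"
  define g where "g = (\<lambda>z. z + w * qtheta q (z / w) * qtheta q (z * w) * Q ^ 4 / (T z ^ 2 * qtheta q w ^ 2))"
  let ?B = "ball (1::complex) (1 - q)"
  have one: "1 \<in> ?B" using q by simp
  have holf: "f holomorphic_on tdom q"
    unfolding f_def using w0 by (intro holomorphic_intros holomorphic_qW holomorphic_qtheta) (auto simp: tdom_def)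
  have T0: "T z \<noteq> 0" if "z \<in> ?B" for z
    using ball_1_annulus[OF that] qprod_nonzero by (simp add: T_def)
  have holT: "T holomorphic_on ?B"
    unfolding T_def using ball_1_annulus by (intro holomorphic_intros holomorphic_qprod q) auto
  have holg: "g holomorphic_on ?B"
    unfolding g_def using w0 T0 ball_1_annulus by (intro holomorphic_intros holomorphic_qtheta holT) auto
  have g_inv: "g (1 / z) = g z / z\<^sup>2" if "z \<noteq> 0" for z
  proof -
    have 1: "T (1 / z) = T z" by (simp add: T_def mult.commute)
    have 2: "qtheta q (1 / z / w) = - qtheta q (z * w) / (z * w)"
      using qtheta_inverse[of "z * w"] that w0 by (simp add: divide_divide_eq_left)
    have "qtheta q (1 / z * w) = qtheta q (1 / (z / w))" by simp
    also have "\<dots> = - qtheta q (z / w) / (z / w)" using that w0 by (intro qtheta_inverse) auto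
    finally have 3: "qtheta q (1 / z * w) = - qtheta q (z / w) * w / z" by simp
    show ?thesis unfolding g_def 1 2 3 using that w0
      by (simp add: add_divide_distrib power2_eq_square mult_ac)
  qed
  have g1: "g 1 = 0"
  proof -
    have "qtheta q (1 / w) = - qtheta q w / w" using w0 by (intro qtheta_inverse) auto
    hence "w * qtheta q (1 / w) * qtheta q w * Q ^ 4 / (T 1 ^ 2 * qtheta q w ^ 2) = - (Q ^ 4 / T 1 ^ 2)"
      using w0 by (simp add: power2_eq_square)
    moreover have "T 1 ^ 2 = Q ^ 4" by (simp add: T_def power2_eq_square power4_eq_xxxx)
    ultimately show ?thesis by (simp add: g_def)
  qed
  have dg1: "deriv g 1 = 0"
  proof -
    have D: "(g has_field_derivative deriv g 1) (at 1)"
      using holg one by (intro holomorphic_derivI) auto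
    have D': "((\<lambda>z. g (1 / z)) has_field_derivative deriv g 1 * (- 1)) (at 1)"
      by (rule DERIV_chain2[where f = g and g = "\<lambda>z. 1 / z" and x = 1])
         (use D in \<open>auto intro!: derivative_eq_intros\<close>)
    have D2: "((\<lambda>z. z\<^sup>2 * g (1 / z)) has_field_derivative - deriv g 1) (at 1)"
      by (rule derivative_eq_intros D' refl | simp add: g1)+
    have "eventually (\<lambda>z::complex. z \<noteq> 0) (nhds 1)" by (rule t1_space_nhds) simp
    hence ev: "eventually (\<lambda>z. z\<^sup>2 * g (1 / z) = g z) (nhds 1)"
      by eventually_elim (simp add: g_inv)
    have "(g has_field_derivative - deriv g 1) (at 1)"
      by (rule DERIV_cong_ev[THEN iffD1, OF refl ev refl D2])
    hence "deriv g 1 = - deriv g 1" by (rule DERIV_imp_deriv)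
    thus ?thesis by (simp add: eq_neg_iff_add_eq_0)
  qed
  \<comment> \<open>\<open>g\<close> and its derivative vanish at 1, so two divided differences give
    the holomorphic function g / (1 - z)^2.\<close>
  define g' where "g' = (\<lambda>z. if z = 1 then deriv g 1 else (g z - g 1) / (z - 1))"
  define g'' where "g'' = (\<lambda>z. if z = 1 then deriv g' 1 else (g' z - g' 1) / (z - 1))"
  have "g' holomorphic_on ?B" unfolding g'_def by (rule pole_lemma_open[OF holg]) auto
  hence holg'': "g'' holomorphic_on ?B" unfolding g''_def by (rule pole_lemma_open) auto
  have g'': "g z / (1 - z)\<^sup>2 = g'' z" if "z \<noteq> 1" for z
    using that by (simp add: g'_def g''_def g1 dg1 power2_eq_square divide_simps) (simp add: algebra_simps)
  define K where "K = (\<lambda>z. g'' z + (qsum2 q (of_real q * z) + qsum2 q (of_real q / z)) - qW q w)"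
  have "\<exists>c. \<forall>z\<in>tdom q. f z = c"
  proof (rule q_periodic_constant[OF holf])
    have "of_real q * z \<in> qdom q" "of_real q / z \<in> qdom q" "z \<noteq> 0" if "z \<in> ?B" for z
      using ball_1_annulus[OF that] ball_subset_qdom[OF q] by auto
    thus "K holomorphic_on ?B"
      unfolding K_def by (intro holomorphic_intros holg'' holomorphic_qsum2) auto
    fix z assume z: "z \<in> ?B" "z \<noteq> 1"
    have zt: "z \<in> tdom q" by (rule ball_1_tdom) fact+
    hence "qsum2 q z = z / (1 - z)\<^sup>2 + qsum2 q (of_real q * z)" by (intro qsum2_rec) (auto simp: tdom_iff)
    moreover have "qtheta q z = (1 - z) * T z"
      by (simp add: qtheta_def T_def qprod_rec[OF q, of z])
    ultimately have "f z = g z / (1 - z)\<^sup>2 + (qsum2 q (of_real q * z) + qsum2 q (of_real q / z)) - qW q w"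
      unfolding f_def g_def qW_def by (simp add: add_divide_distrib power_mult_distrib mult_ac)
    with zt show "z \<in> tdom q \<and> f z = K z" by (simp add: g'' z K_def)
  next
    fix z assume z: "z \<in> tdom q"
    hence z0: "z \<noteq> 0" by (auto simp: tdom_def)
    have "qtheta q (of_real q * z / w) = - qtheta q (z / w) / (z / w)"
      using z0 w0 qtheta_scale[of "z / w"] by simp
    moreover have "qtheta q (of_real q * z * w) = - qtheta q (z * w) / (z * w)"
      using z0 w0 qtheta_scale[of "z * w"] by (simp add: mult_ac)
    ultimately show "f (of_real q * z) = f z"
      unfolding f_def using z0 w0 by (simp add: qW_scale[OF z] qtheta_scale power2_eq_square)
  qed (use q in auto)
  then obtain c where c: "\<And>z. z \<in> tdom q \<Longrightarrow> f z = c" by blast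
  have "f w = 0" using w0 by (simp add: f_def qtheta_def)
  with c w z have "f z = 0" by simp
  thus ?thesis by (simp add: f_def eq_neg_iff_add_eq_0 add_eq_0_iff)
qed

lemma deriv_qtheta_1: "(qtheta q has_field_derivative - (Q\<^sup>2)) (at 1)"
proof -
  define T where "T = (\<lambda>z. qprod q (of_real q * z) * qprod q (of_real q / z))"
  have "T holomorphic_on - {0}" unfolding T_def by (intro holomorphic_intros holomorphic_qprod q) auto
  hence "(T has_field_derivative deriv T 1) (at 1)" by (intro holomorphic_derivI) auto
  hence "((\<lambda>z. (1 - z) * T z) has_field_derivative (- 1 * T 1 + deriv T 1 * (1 - 1))) (at 1)"
    by (intro DERIV_mult) (auto intro!: derivative_eq_intros)
  moreover have "(1 - z) * T z = qtheta q z" for z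
    by (simp add: T_def qtheta_def qprod_rec[OF q, of z])
  ultimately show ?thesis by (simp add: T_def power2_eq_square)
qed

text \<open>In \<open>qW_diff\<close> the factor \<open>qtheta q (z / w)\<close> has a simple zero
  at z = w. The derivative of \<open>qW\<close> is therefore the derivative of \<open>qtheta\<close>
  at 1 times the value of the other factors.\<close>

lemma qW_has_deriv:
  assumes w: "w \<in> tdom q"
  shows "(qW q has_field_derivative Q ^ 6 * qtheta q (w\<^sup>2) / qtheta q w ^ 4) (at w)"
proof -
  have w0: "w \<noteq> 0" "qtheta q w \<noteq> 0" using w by (auto simp: tdom_def)
  define H where "H = (\<lambda>z. - w * qtheta q (z * w) * Q ^ 4 / (qtheta q z ^ 2 * qtheta q w ^ 2))"
  have "H holomorphic_on tdom q"
    unfolding H_def using w0 by (intro holomorphic_intros holomorphic_qtheta) (auto simp: tdom_def)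
  hence H: "(H has_field_derivative deriv H w) (at w)" using w open_tdom by (intro holomorphic_derivI) auto
  have "((\<lambda>z. qtheta q (z / w)) has_field_derivative - (Q\<^sup>2) * (1 / w)) (at w)"
    by (rule DERIV_chain2[where f = "qtheta q" and g = "\<lambda>z. z / w" and x = w])
       (use w0 deriv_qtheta_1 in \<open>auto intro!: derivative_eq_intros\<close>)
  from DERIV_mult[OF this H]
  have D2: "((\<lambda>z. qtheta q (z / w) * H z + qW q w) has_field_derivative - (Q\<^sup>2) * (1 / w) * H w + 0) (at w)"
    using w0 by (intro DERIV_add) (auto simp: qtheta_def)
  have ev: "eventually (\<lambda>z. z \<in> tdom q) (nhds w)"
    using open_tdom w by (rule eventually_nhds_in_open)
  have ev2: "eventually (\<lambda>z. qtheta q (z / w) * H z + qW q w = qW q z) (nhds w)"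
    using ev
  proof eventually_elim
    case (elim z)
    have "qW q z - qW q w = qtheta q (z / w) * H z"
      unfolding qW_diff[OF elim w] H_def by (simp add: mult_ac)
    thus ?case by (simp add: algebra_simps)
  qed
  have "(qW q has_field_derivative - (Q\<^sup>2) * (1 / w) * H w + 0) (at w)"
    by (rule DERIV_cong_ev[THEN iffD1, OF refl ev2 refl D2])
  also have "- (Q\<^sup>2) * (1 / w) * H w + 0 = Q ^ 6 * qtheta q (w\<^sup>2) / qtheta q w ^ 4"
    using w0 by (simp add: H_def power2_eq_square eval_nat_numeral mult_ac)
  finally show ?thesis .
qed

text \<open>\<open>DW\<close> is the derivative \<open>z d/dz\<close> of \<open>qW q\<close>, written as a theta quotient.\<close>

definition DW :: "complex \<Rightarrow> complex" where "DW z = z * Q ^ 6 * qtheta q (z\<^sup>2) / qtheta q z ^ 4"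
definition DDW :: "complex \<Rightarrow> complex" where "DDW z = z * deriv DW z"

lemma holomorphic_DW: "DW holomorphic_on tdom q"
  unfolding DW_def by (intro holomorphic_intros holomorphic_qtheta) (auto simp: tdom_def)

lemma DW_nonzero_iff: "z \<in> tdom q \<Longrightarrow> DW z \<noteq> 0 \<longleftrightarrow> z\<^sup>2 \<in> tdom q"
  by (auto simp: DW_def tdom_def)

text \<open>Minus the logarithmic derivative z d/dz of \<open>qtheta\<close>, hence the analogue of
  the Weierstrass zeta function up to sign and normalisation: z d/dz maps it to
  \<open>qW\<close>.\<close>

definition qlog1' :: "complex \<Rightarrow> complex" where "qlog1' z = qlog1 q z - qlog1 q (of_real q / z)"

lemma qlog1'_deriv:
  assumes z: "z \<in> tdom q"
  shows "(qlog1' has_field_derivative qW q z / z) (at z)"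
proof -
  have zz: "z \<in> qdom q" "of_real q / z \<in> qdom q" "z \<noteq> 0" using z by (auto simp: tdom_iff)
  have "((\<lambda>z. qlog1 q (of_real q / z)) has_field_derivative deriv (qlog1 q) (of_real q / z) * (- of_real q / z\<^sup>2)) (at z)"
    by (rule DERIV_chain2[where f = "qlog1 q" and g = "\<lambda>z. of_real q / z" and x = z])
       (use zz qlog1_props(3)[OF q] in \<open>auto intro!: derivative_eq_intros simp: power2_eq_square\<close>)
  from DERIV_diff[OF qlog1_props(3)[OF q zz(1)] this]
  have "(qlog1' has_field_derivative deriv (qlog1 q) z - deriv (qlog1 q) (of_real q / z) * (- of_real q / z\<^sup>2)) (at z)"
    by (simp add: qlog1'_def [abs_def])
  also have "deriv (qlog1 q) z - deriv (qlog1 q) (of_real q / z) * (- of_real q / z\<^sup>2) = 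
     (z * deriv (qlog1 q) z + of_real q / z * deriv (qlog1 q) (of_real q / z)) / z"
    using zz by (simp add: field_simps power2_eq_square)
  also have "\<dots> = qW q z / z" using qsum2_props(4)[OF q zz(1)] qsum2_props(4)[OF q zz(2)] by (simp add: qW_def)
  finally show ?thesis .
qed

lemma qtheta_deriv:
  assumes z: "z \<in> tdom q"
  shows "(qtheta q has_field_derivative - qtheta q z * qlog1' z / z) (at z)"
proof -
  have zz: "z \<in> qdom q" "of_real q / z \<in> qdom q" "z \<noteq> 0" using z by (auto simp: tdom_iff)
  let ?d = "deriv (qprod q)"
  have d: "(qprod q has_field_derivative ?d w) (at w)" for w
    using qprod_field_differentiable[OF q] by (simp add: DERIV_deriv_iff_field_differentiable)
  have "((\<lambda>z. qprod q (of_real q / z)) has_field_derivative ?d (of_real q / z) * (- of_real q / z\<^sup>2)) (at z)"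
    by (rule DERIV_chain2[where f = "qprod q" and g = "\<lambda>z. of_real q / z" and x = z])
       (use zz d in \<open>auto intro!: derivative_eq_intros simp: power2_eq_square\<close>)
  from DERIV_mult[OF d this]
  have "(qtheta q has_field_derivative ?d z * qprod q (of_real q / z) + (?d (of_real q / z) * (- of_real q / z\<^sup>2)) * qprod q z) (at z)"
    by (simp add: qtheta_def [abs_def])
  also have "?d z * qprod q (of_real q / z) + (?d (of_real q / z) * (- of_real q / z\<^sup>2)) * qprod q z =
     ((z * ?d z) * qprod q (of_real q / z) - (of_real q / z * ?d (of_real q / z)) * qprod q z) / z"
    using zz by (simp add: field_simps power2_eq_square)
  also have "\<dots> = - qtheta q z * qlog1' z / z"
    unfolding qprod_deriv[OF q zz(1)] qprod_deriv[OF q zz(2)] by (simp add: qtheta_def qlog1'_def algebra_simps)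
  finally show ?thesis .
qed

lemma tdom_sq: "z\<^sup>2 \<in> tdom q \<Longrightarrow> z \<in> tdom q"
proof (rule ccontr)
  assume z: "z\<^sup>2 \<in> tdom q" and "z \<notin> tdom q"
  then consider "z = 0" | n where "z = of_real q powi n" unfolding tdom_iff_powi[of z] by blast
  thus False
  proof cases
    case (2 n)
    hence "z\<^sup>2 = of_real q powi (n + n)" using q power_int_add[of "of_real q :: complex" n n] by (simp only: power2_eq_square) simp
    thus ?thesis using z unfolding tdom_iff_powi by blast
  qed (use z in auto)
qed

lemma DW_deriv:
  assumes z: "z\<^sup>2 \<in> tdom q"
  shows "(DW has_field_derivative DW z * (1 - 2 * qlog1' (z\<^sup>2) + 4 * qlog1' z) / z) (at z)"
proof -
  have z1: "z \<in> tdom q" by (rule tdom_sq) fact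
  have zz: "z \<noteq> 0" "qtheta q z \<noteq> 0" "qtheta q (z\<^sup>2) \<noteq> 0" using z z1 by (auto simp: tdom_def)
  have "((\<lambda>z. qtheta q (z\<^sup>2)) has_field_derivative (- qtheta q (z\<^sup>2) * qlog1' (z\<^sup>2) / z\<^sup>2) * (2 * z)) (at z)"
    by (rule DERIV_chain2[where f = "qtheta q" and g = "\<lambda>z. z\<^sup>2" and x = z])
       (use zz qtheta_deriv[OF z] in \<open>auto intro!: derivative_eq_intros\<close>)
  note d = derivative_eq_intros this qtheta_deriv[OF z1]
  have "(DW has_field_derivative ((Q ^ 6 * qtheta q (z\<^sup>2) + (- qtheta q (z\<^sup>2) * qlog1' (z\<^sup>2) / z\<^sup>2) * (2 * z) * (z * Q ^ 6)) * qtheta q z ^ 4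
      - (z * Q ^ 6 * qtheta q (z\<^sup>2)) * (4 * qtheta q z ^ 3 * (- qtheta q z * qlog1' z / z))) / (qtheta q z ^ 4 * qtheta q z ^ 4)) (at z)"
    unfolding DW_def [abs_def] by (rule d refl | simp add: zz)+
  also have "((Q ^ 6 * qtheta q (z\<^sup>2) + (- qtheta q (z\<^sup>2) * qlog1' (z\<^sup>2) / z\<^sup>2) * (2 * z) * (z * Q ^ 6)) * qtheta q z ^ 4
      - (z * Q ^ 6 * qtheta q (z\<^sup>2)) * (4 * qtheta q z ^ 3 * (- qtheta q z * qlog1' z / z))) / (qtheta q z ^ 4 * qtheta q z ^ 4)
      = DW z * (1 - 2 * qlog1' (z\<^sup>2) + 4 * qlog1' z) / z"
    unfolding DW_def using zz by (simp add: divide_simps) (simp add: algebra_simps eval_nat_numeral)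
  finally show ?thesis .
qed

lemma DDW_eq:
  assumes z: "z\<^sup>2 \<in> tdom q"
  shows "DDW z = DW z * (1 - 2 * qlog1' (z\<^sup>2) + 4 * qlog1' z)"
  using DERIV_imp_deriv[OF DW_deriv[OF z]] z by (auto simp: DDW_def)

text \<open>\<open>DW\<close> is a quotient of \<open>qtheta\<close> at z^2 by the fourth power of
  \<open>qtheta\<close> at z, so its logarithmic derivative is a combination of two values of
  \<open>qlog1'\<close>, and differentiating once more gives \<open>qW\<close>. At a point of order
  three z^2 is the inverse of z, the two values of \<open>qW\<close> agree, and the derivative
  vanishes.\<close>

lemma DDW_over_DW_deriv:
  assumes z: "z\<^sup>2 \<in> tdom q"
  shows "((\<lambda>z. DDW z / DW z) has_field_derivative 4 * (qW q z - qW q (z\<^sup>2)) / z) (at z)"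
proof -
  have z1: "z \<in> tdom q" by (rule tdom_sq) fact
  have zz: "z \<noteq> 0" using z1 by (auto simp: tdom_def)
  have "((\<lambda>z. qlog1' (z\<^sup>2)) has_field_derivative (qW q (z\<^sup>2) / z\<^sup>2) * (2 * z)) (at z)"
    by (rule DERIV_chain2[where f = "qlog1'" and g = "\<lambda>z. z\<^sup>2" and x = z])
       (use zz qlog1'_deriv[OF z] in \<open>auto intro!: derivative_eq_intros\<close>)
  hence "((\<lambda>z. 1 - 2 * qlog1' (z\<^sup>2) + 4 * qlog1' z) has_field_derivative
      0 - 2 * (qW q (z\<^sup>2) / z\<^sup>2 * (2 * z)) + 4 * (qW q z / z)) (at z)"
    by (intro DERIV_add DERIV_diff DERIV_cmult qlog1'_deriv z1) auto
  also have "0 - 2 * (qW q (z\<^sup>2) / z\<^sup>2 * (2 * z)) + 4 * (qW q z / z) = 4 * (qW q z - qW q (z\<^sup>2)) / z"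
    using zz by (simp add: field_simps power2_eq_square)
  finally have D: "((\<lambda>z. 1 - 2 * qlog1' (z\<^sup>2) + 4 * qlog1' z) has_field_derivative 4 * (qW q z - qW q (z\<^sup>2)) / z) (at z)" .
  have "open ((\<lambda>z. z\<^sup>2) -` tdom q)" by (intro open_vimage open_tdom continuous_intros)
  hence "eventually (\<lambda>w. w \<in> (\<lambda>z. z\<^sup>2) -` tdom q) (nhds z)"
    by (rule eventually_nhds_in_open) (use z in auto)
  hence ev: "eventually (\<lambda>w. 1 - 2 * qlog1' (w\<^sup>2) + 4 * qlog1' w = DDW w / DW w) (nhds z)"
  proof eventually_elim
    case (elim w)
    hence w: "w\<^sup>2 \<in> tdom q" by simp
    hence "DW w \<noteq> 0" using DW_nonzero_iff tdom_sq by blast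
    thus ?case by (simp add: DDW_eq[OF w])
  qed
  show ?thesis by (rule DERIV_cong_ev[THEN iffD1, OF refl ev refl D])
qed

end

section \<open>Half periods and the point of order three\<close>

lemma sums_add_unique: "f sums a \<Longrightarrow> g sums b \<Longrightarrow> (\<lambda>n. f n + g n) sums c \<Longrightarrow> a + b = (c :: complex)"
  using sums_add sums_unique2 by blast

lemma qsum2_split2:
  assumes q: "0 < q" "q < 1" and z: "z \<in> qdom q"
  shows "qsum2 q z = qsum2 (q\<^sup>2) z + qsum2 (q\<^sup>2) (of_real q * z)"
proof -
  have q2: "0 < q\<^sup>2" "q\<^sup>2 < 1" using q by (auto simp: power_less_one_iff)
  let ?f = "\<lambda>n. (of_real (q ^ n) * z) / (1 - of_real (q ^ n) * z)\<^sup>2"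
  have z1: "z \<in> qdom (q\<^sup>2)" using z by (auto simp: qdom_def simp flip: power_mult of_real_power)
  have z2: "of_real q * z \<in> qdom (q\<^sup>2)"
    using qdom_scale[OF z] by (auto simp: qdom_def simp flip: power_mult of_real_power)
  have 1: "(\<lambda>n. ?f (2 * n)) sums qsum2 (q\<^sup>2) z"
    using qsum2_props(1)[OF q2 z1] by (simp only: power_mult)
  have 2: "(\<lambda>n. ?f (2 * n + 1)) sums qsum2 (q\<^sup>2) (of_real q * z)"
    using qsum2_props(1)[OF q2 z2] by (simp only: power_mult power_add power_one_right of_real_mult mult.assoc)
  have "(\<lambda>n. sum ?f {n * 2..<n * 2 + 2}) sums qsum2 q z"
    by (rule sums_group[OF qsum2_props(1)[OF q z]]) auto
  moreover have "sum ?f {n * 2..<n * 2 + 2} = ?f (2 * n) + ?f (2 * n + 1)" for n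
    by (simp add: eval_nat_numeral mult_ac)
  ultimately show ?thesis using sums_add_unique[OF 1 2] by simp
qed

lemma qsum2_neg:
  assumes q: "0 < q" "q < 1" and z: "z \<in> qdom q" "- z \<in> qdom q"
  shows "qsum2 q z + qsum2 q (- z) = 4 * qsum2 (q\<^sup>2) (z\<^sup>2)"
proof (rule sums_add_unique[OF qsum2_props(1)[OF q z(1)] qsum2_props(1)[OF q z(2)]])
  have q2: "0 < q\<^sup>2" "q\<^sup>2 < 1" using q by (auto simp: power_less_one_iff)
  have ne: "of_real (q ^ n) * z \<noteq> 1" "of_real (q ^ n) * z \<noteq> - 1" for n
    using z by (auto simp: qdom_def) (metis minus_minus)
  have sq: "of_real ((q\<^sup>2) ^ n) * z\<^sup>2 = (of_real (q ^ n) * z)\<^sup>2" for n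
    by (simp add: power_mult_distrib mult.commute flip: power_mult)
  have "z\<^sup>2 \<in> qdom (q\<^sup>2)"
    unfolding qdom_def mem_Collect_eq sq using ne power2_eq_1_iff by blast
  from sums_mult[OF qsum2_props(1)[OF q2 this], of 4]
  have "(\<lambda>n. 4 * ((of_real (q ^ n) * z)\<^sup>2 / (1 - (of_real (q ^ n) * z)\<^sup>2)\<^sup>2)) sums (4 * qsum2 (q\<^sup>2) (z\<^sup>2))"
    unfolding sq by simp
  moreover have "4 * (x\<^sup>2 / (1 - x\<^sup>2)\<^sup>2) = x / (1 - x)\<^sup>2 + (- x) / (1 - (- x))\<^sup>2" if "x \<noteq> 1" "x \<noteq> - 1" for x :: complex
  proof -
    have "1 - x \<noteq> 0" "1 + x \<noteq> 0" using that by (auto simp: add_eq_0_iff)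
    moreover have "1 - x\<^sup>2 = (1 - x) * (1 + x)" by (simp add: algebra_simps power2_eq_square)
    ultimately show ?thesis by (simp add: power_mult_distrib divide_simps) (simp add: algebra_simps power2_eq_square)
  qed
  ultimately show "(\<lambda>n. complex_of_real (q ^ n) * z / (1 - complex_of_real (q ^ n) * z)\<^sup>2 +
         complex_of_real (q ^ n) * - z / (1 - complex_of_real (q ^ n) * - z)\<^sup>2) sums (4 * qsum2 (q\<^sup>2) (z\<^sup>2))"
    using ne by simp
qed

text \<open>Apply x d/dx twice to the factorisation log (1 - x^3) = log (1 - x) + log (1 - w x) +
  log (1 - w^2 x); the factor 9 is the square of the exponent 3. The factor 4 in
  \<open>qsum2_neg\<close> has the same origin.\<close>

lemma cube_root_identity:
  fixes x w :: complex
  assumes w: "w\<^sup>2 + w + 1 = 0" and x: "x ^ 3 \<noteq> 1"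
  shows "x / (1 - x)\<^sup>2 + w * x / (1 - w * x)\<^sup>2 + w\<^sup>2 * x / (1 - w\<^sup>2 * x)\<^sup>2 = 9 * (x ^ 3 / (1 - x ^ 3)\<^sup>2)"
proof -
  define v where "v = w\<^sup>2"
  have v: "v = - 1 - w" using w v_def by algebra
  have ww: "w * w = - 1 - w" using v by (simp add: v_def power2_eq_square)
  have prod: "(1 - x) * (1 - w * x) * (1 - v * x) = 1 - x ^ 3"
  proof -
    have "(1 - x) * (1 - w * x) * (1 - v * x) = 1 - x - (w + v) * x + (w + v) * x * x + (w * v) * x * x - (w * v) * x * x * x"
      by (simp add: algebra_simps)
    moreover have "w * v = 1" "w + v = - 1" using ww v by algebra+
    ultimately show ?thesis by (simp add: power3_eq_cube)
  qed
  define a b c where "a = 1 - x" "b = 1 - w * x" "c = 1 - v * x"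
  have nz: "a \<noteq> 0" "b \<noteq> 0" "c \<noteq> 0" using prod x by (auto simp: a_b_c_def)
  have num: "x * (b * c)\<^sup>2 + w * x * (a * c)\<^sup>2 + v * x * (a * b)\<^sup>2 = 9 * x ^ 3"
    unfolding a_b_c_def v using ww by algebra
  have "x / a\<^sup>2 + w * x / b\<^sup>2 + v * x / c\<^sup>2 = (x * (b * c)\<^sup>2 + w * x * (a * c)\<^sup>2 + v * x * (a * b)\<^sup>2) / (a * b * c)\<^sup>2"
    using nz by (simp add: divide_simps) (simp add: algebra_simps power2_eq_square)
  also have "\<dots> = 9 * x ^ 3 / (1 - x ^ 3)\<^sup>2" using num prod by (simp add: a_b_c_def)
  finally show ?thesis by (simp add: a_b_c_def v_def)
qed

lemma qsum2_cube:
  assumes q: "0 < q" "q < 1" and w: "w\<^sup>2 + w + 1 = 0" and z: "z ^ 3 \<in> qdom (q ^ 3)"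
  shows "qsum2 q z + qsum2 q (w * z) + qsum2 q (w\<^sup>2 * z) = 9 * qsum2 (q ^ 3) (z ^ 3)"
proof -
  have q3: "0 < q ^ 3" "q ^ 3 < 1" using q by (auto simp: power_less_one_iff)
  have w3: "w ^ 3 = 1"
  proof -
    have "w ^ 3 - 1 = (w - 1) * (w\<^sup>2 + w + 1)" by (simp add: algebra_simps power2_eq_square power3_eq_cube)
    thus ?thesis using w by simp
  qed
  have cu: "of_real ((q ^ 3) ^ n) * z ^ 3 = (of_real (q ^ n) * z) ^ 3" for n
    by (simp add: power_mult_distrib mult.commute flip: power_mult)
  have ne: "(of_real (q ^ n) * z) ^ 3 \<noteq> 1" for n using z unfolding qdom_def mem_Collect_eq cu by blast
  have dom: "u * z \<in> qdom q" if "u ^ 3 = 1" for u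
    unfolding qdom_def
  proof (safe)
    fix n assume "of_real (q ^ n) * (u * z) = 1"
    hence "(of_real (q ^ n) * (u * z)) ^ 3 = 1" by simp
    thus False using ne[of n] that by (simp add: power_mult_distrib mult_ac)
  qed
  have "(w\<^sup>2) ^ 3 = 1" using w3 by (metis power_mult mult.commute power_one)
  hence s: "(\<lambda>n. of_real (q ^ n) * z / (1 - of_real (q ^ n) * z)\<^sup>2 + 
        of_real (q ^ n) * (w * z) / (1 - of_real (q ^ n) * (w * z))\<^sup>2 + 
        of_real (q ^ n) * (w\<^sup>2 * z) / (1 - of_real (q ^ n) * (w\<^sup>2 * z))\<^sup>2) sums
     (qsum2 q z + qsum2 q (w * z) + qsum2 q (w\<^sup>2 * z))"
    by (intro sums_add qsum2_props(1)[OF q] dom w3) (use dom[of 1] in auto)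
  have "(\<lambda>n. 9 * ((of_real (q ^ n) * z) ^ 3 / (1 - (of_real (q ^ n) * z) ^ 3)\<^sup>2)) sums (9 * qsum2 (q ^ 3) (z ^ 3))"
    using sums_mult[OF qsum2_props(1)[OF q3 z], of 9] unfolding cu .
  also have "(\<lambda>n. 9 * ((of_real (q ^ n) * z) ^ 3 / (1 - (of_real (q ^ n) * z) ^ 3)\<^sup>2)) =
      (\<lambda>n. of_real (q ^ n) * z / (1 - of_real (q ^ n) * z)\<^sup>2 + 
        of_real (q ^ n) * (w * z) / (1 - of_real (q ^ n) * (w * z))\<^sup>2 + 
        of_real (q ^ n) * (w\<^sup>2 * z) / (1 - of_real (q ^ n) * (w\<^sup>2 * z))\<^sup>2)"
    using cube_root_identity[OF w ne] by (simp add: mult_ac)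
  finally show ?thesis using s by (blast intro: sums_unique2)
qed

lemma qsum2_cnj:
  assumes "0 < q" "q < 1" "z \<in> qdom q" shows "qsum2 q (cnj z) = cnj (qsum2 q z)"
proof -
  have c: "of_real (q ^ n) * cnj z = cnj (of_real (q ^ n) * z)" for n by simp
  have "cnj z \<in> qdom q"
    unfolding qdom_def mem_Collect_eq c using assms(3) by (simp add: qdom_def del: complex_cnj_mult)
  from qsum2_props(1)[OF assms(1,2) this]
  have "(\<lambda>n. cnj (of_real (q ^ n) * z / (1 - of_real (q ^ n) * z)\<^sup>2)) sums qsum2 q (cnj z)" by simp
  moreover have "(\<lambda>n. cnj (of_real (q ^ n) * z / (1 - of_real (q ^ n) * z)\<^sup>2)) sums cnj (qsum2 q z)"
    using qsum2_props(1)[OF assms] by (subst sums_cnj)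
  ultimately show ?thesis by (rule sums_unique2)
qed

lemma qprod_cnj:
  assumes "0 < q" "q < 1" shows "qprod q (cnj z) = cnj (qprod q z)"
proof (rule LIMSEQ_unique)
  show "(\<lambda>N. \<Prod>n<N. 1 - of_real (q ^ n) * cnj z) \<longlonglongrightarrow> qprod q (cnj z)" by (rule qprod_LIMSEQ[OF assms])
  have "(\<lambda>N. cnj (\<Prod>n<N. 1 - of_real (q ^ n) * z)) \<longlonglongrightarrow> cnj (qprod q z)"
    by (intro tendsto_intros qprod_LIMSEQ[OF assms])
  thus "(\<lambda>N. \<Prod>n<N. 1 - of_real (q ^ n) * cnj z) \<longlonglongrightarrow> cnj (qprod q z)" by simp
qed

lemma qprod_real: "0 < q \<Longrightarrow> q < 1 \<Longrightarrow> z \<in> \<real> \<Longrightarrow> qprod q z \<in> \<real>"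
  by (metis Reals_cnj_iff qprod_cnj)

context nome
begin

section \<open>The half periods -1, sqrt q, -sqrt q and the Weierstrass equation\<close>

abbreviation "r \<equiv> sqrt q"

lemma r: "0 < r" "r < 1" "r * r = q" "r\<^sup>2 = q" using q by (simp_all flip: power2_eq_square)

lemma rc: "complex_of_real r * complex_of_real r = of_real q" "(complex_of_real r)\<^sup>2 = of_real q"
  using r(3,4) by (metis of_real_mult, metis of_real_power)

lemma tdom_not_real: "z \<notin> \<real> \<Longrightarrow> z \<in> tdom q"
  unfolding tdom_iff_powi by (auto simp flip: of_real_power_int)

lemma tdom_of_real: "of_real x \<in> tdom q \<longleftrightarrow> x \<noteq> 0 \<and> (\<forall>n. x \<noteq> q powi n)"
  unfolding tdom_iff_powi by (auto simp flip: of_real_power_int simp del: of_real_power_int)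

lemma tdom_neg: "x > 0 \<Longrightarrow> - of_real x \<in> tdom q"
proof -
  assume x: "x > 0"
  have "- x \<noteq> q powi n" for n using zero_less_power_int[OF q(1), of n] x by linarith
  thus ?thesis using tdom_of_real[of "- x"] x by simp
qed

lemma tdom_m1: "- 1 \<in> tdom q" using tdom_neg[of 1] by simp
lemma tdom_mr: "- of_real r \<in> tdom q" using tdom_neg[of r] r by simp

lemma tdom_annulus: "q < x \<Longrightarrow> x < 1 \<Longrightarrow> of_real x \<in> tdom q"
  unfolding tdom_of_real
proof (intro conjI allI notI)
  fix n assume x: "q < x" "x < 1" and e: "x = q powi n"
  show False
  proof (cases "n \<le> 0")
    case True
    have "q powi 0 \<le> q powi n" by (rule power_int_decreasing) (use True q in auto)
    thus False using x e by simp
  next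
    case False
    have "q powi n \<le> q powi 1" by (rule power_int_decreasing) (use False q in auto)
    thus False using x e by simp
  qed
qed (use q in auto)

lemma tdom_r: "of_real r \<in> tdom q"
proof (rule tdom_annulus)
  have "r * r < r * 1" using r by (intro mult_strict_left_mono) auto
  thus "q < r" using r by simp
qed (use r in auto)

lemma qtheta_half: "z \<noteq> 0 \<Longrightarrow> qtheta q (z / of_real r) = - (z / of_real r) * qtheta q (of_real r * z)"
proof -
  assume z: "z \<noteq> 0"
  have "of_real q * (z / of_real r) = of_real r * z" using r by (simp flip: rc(1))
  thus ?thesis using qtheta_scale[of "z / of_real r"] r z by simp
qed

text \<open>The values at the three half periods, that is at the points whose square is a power of
  \<open>q\<close>. The numbering follows their size: \<open>e_order\<close> shows that they are
  increasing.\<close>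

definition "e1 = qW q (- 1)"
definition "e2 = qW q (- of_real r)"
definition "e3 = qW q (of_real r)"

text \<open>At a half period w the numbers w and 1 / w differ by a power of \<open>q\<close>, so the
  two theta factors of \<open>qW_diff\<close> coincide up to an elementary factor. The difference
  becomes a square here, and z times a square in \<open>W_e2\<close> and
  \<open>W_e3\<close>.\<close>

lemma W_e1: "z \<in> tdom q \<Longrightarrow> qW q z - e1 = qtheta q (- z) ^ 2 * Q ^ 4 / (qtheta q z ^ 2 * qtheta q (- 1) ^ 2)"
  using qW_diff[OF _ tdom_m1] by (simp add: e1_def power2_eq_square)

lemma W_e3:
  assumes z: "z \<in> tdom q"
  shows "qW q z - e3 = z * qtheta q (of_real r * z) ^ 2 * Q ^ 4 / (qtheta q z ^ 2 * qtheta q (of_real r) ^ 2)"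
proof -
  have z0: "z \<noteq> 0" using z by (auto simp: tdom_def)
  show ?thesis unfolding e3_def qW_diff[OF z tdom_r] qtheta_half[OF z0] using r
    by (simp add: power2_eq_square mult_ac)
qed

lemma W_e2:
  assumes z: "z \<in> tdom q"
  shows "qW q z - e2 = z * qtheta q (- of_real r * z) ^ 2 * Q ^ 4 / (qtheta q z ^ 2 * qtheta q (- of_real r) ^ 2)"
proof -
  have z0: "- z \<noteq> 0" using z by (auto simp: tdom_def)
  show ?thesis unfolding e2_def qW_diff[OF z tdom_mr] using r qtheta_half[OF z0]
    by (simp add: power2_eq_square mult_ac)
qed

text \<open>Behind the constant stands Euler's identity that the product of (1 + q^n) (1 - q^(2n-1))
  over n >= 1 is 1, which is fact 7; the 2 is the factor 1 - (-1) of \<open>qtheta\<close> at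
  -1.\<close>

lemma qtheta_halves: "qtheta q (- 1) * qtheta q (of_real r) * qtheta q (- of_real r) = 2"
proof -
  have q2: "0 < q\<^sup>2" "q\<^sup>2 < 1" using q by (auto simp: power_less_one_iff)
  have rr: "of_real q / of_real r = complex_of_real r" using r rc by (simp add: field_simps)
  have 1: "qtheta q (- 1) = 2 * qprod q (- of_real q) ^ 2"
    unfolding qtheta_def by (simp add: qprod_rec[OF q, of "- 1"] power2_eq_square)
  have 2: "qtheta q (of_real r) = qprod q (of_real r) ^ 2" unfolding qtheta_def rr by (simp add: power2_eq_square)
  have 3: "qtheta q (- of_real r) = qprod q (- of_real r) ^ 2" unfolding qtheta_def using rr by (simp add: power2_eq_square)
  have 4: "qprod q (of_real r) * qprod q (- of_real r) = qprod (q\<^sup>2) (of_real q)"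
    using qprod_mult_neg[OF q, of "of_real r"] rc by simp
  have 5: "Q * qprod q (- of_real q) = qprod (q\<^sup>2) ((of_real q)\<^sup>2)"
    using qprod_mult_neg[OF q, of "of_real q"] by simp
  have 6: "Q = qprod (q\<^sup>2) (of_real q) * qprod (q\<^sup>2) ((of_real q)\<^sup>2)"
    using qprod_split2[OF q, of "of_real q"] by (simp add: power2_eq_square)
  have "Q * (qprod q (- of_real q) * qprod (q\<^sup>2) (of_real q)) = Q * 1"
    using 5 6 by (simp add: mult_ac)
  hence 7: "qprod q (- of_real q) * (qprod q (of_real r) * qprod q (- of_real r)) = 1"
    unfolding 4 by (simp del: mult_1_right) 
  have "qtheta q (- 1) * qtheta q (of_real r) * qtheta q (- of_real r) =
     2 * (qprod q (- of_real q) * (qprod q (of_real r) * qprod q (- of_real r)))\<^sup>2"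
    unfolding 1 2 3 by (simp add: power_mult_distrib mult_ac)
  thus ?thesis by (simp add: 7)
qed

lemma qprod_sq: "qprod q (z\<^sup>2) = qprod q z * qprod q (of_real r * z) * (qprod q (- z) * qprod q (- of_real r * z))"
  using qprod_mult_neg[OF r(1,2), of z] qprod_split2[OF r(1,2), of z] qprod_split2[OF r(1,2), of "- z"] r(4) by simp

text \<open>The zeros of the left-hand side are those of \<open>qtheta\<close> translated by the
  four points of order dividing two. The product for z^2 splits accordingly, by sign and by parity
  of the exponent.\<close>

lemma qtheta_sq: "z \<noteq> 0 \<Longrightarrow> qtheta q (z\<^sup>2) = qtheta q z * qtheta q (- z) * qtheta q (of_real r * z) * qtheta q (- of_real r * z)"
proof -
  assume z: "z \<noteq> 0"
  have 1: "of_real q / z\<^sup>2 = (of_real r / z)\<^sup>2" using rc by (simp add: power_divide)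
  have 2: "of_real r * (of_real r / z) = of_real q / z" "- of_real r * (of_real r / z) = - (of_real q / z)"
    by (simp_all flip: rc(1))
  have 3: "of_real q / (of_real r * z) = of_real r / z" "of_real q / (- of_real r * z) = - (of_real r / z)"
    using r z by (simp_all flip: rc(1))
  have 4: "of_real q / (- z) = - (of_real q / z)" by simp
  show ?thesis unfolding qtheta_def 1 qprod_sq[of z] qprod_sq[of "of_real r / z"] 2 3 4
    by (simp only: mult_ac)
qed

text \<open>The Weierstrass equation without a pole comparison: the numerator of \<open>DW\<close>
  splits by \<open>qtheta_sq\<close> into the theta factors of the three differences, and
  \<open>qtheta_halves\<close> turns the constant into 4.\<close>

lemma DW_squared:
  assumes z: "z \<in> tdom q"
  shows "DW z ^ 2 = 4 * (qW q z - e1) * (qW q z - e2) * (qW q z - e3)"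
proof -
  have z0: "z \<noteq> 0" "qtheta q z \<noteq> 0" using z by (auto simp: tdom_def)
  define a b c where "a = qtheta q (- z)" "b = qtheta q (of_real r * z)" "c = qtheta q (- of_real r * z)"
  define u v w where "u = qtheta q (- 1)" "v = qtheta q (of_real r)" "w = qtheta q (- of_real r)"
  define t where "t = qtheta q z"
  have nz: "u \<noteq> 0" "v \<noteq> 0" "w \<noteq> 0" "t \<noteq> 0" using tdom_m1 tdom_r tdom_mr z0 by (auto simp: tdom_def u_v_w_def t_def)
  have uvw: "u * v * w = 2" using qtheta_halves by (simp add: u_v_w_def)
  have "4 * (qW q z - e1) * (qW q z - e2) * (qW q z - e3) = 
     4 * (a\<^sup>2 * Q ^ 4 / (t\<^sup>2 * u\<^sup>2)) * (z * c\<^sup>2 * Q ^ 4 / (t\<^sup>2 * w\<^sup>2)) * (z * b\<^sup>2 * Q ^ 4 / (t\<^sup>2 * v\<^sup>2))"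
    unfolding W_e1[OF z] W_e2[OF z] W_e3[OF z] a_b_c_def u_v_w_def t_def ..
  also have "\<dots> = 4 * z\<^sup>2 * (a * b * c)\<^sup>2 * Q ^ 12 / (t ^ 6 * (u * v * w)\<^sup>2)"
    using nz by (simp add: divide_simps) (simp add: algebra_simps eval_nat_numeral)
  also have "\<dots> = z\<^sup>2 * (a * b * c)\<^sup>2 * Q ^ 12 / t ^ 6" unfolding uvw by simp
  also have "\<dots> = (z * Q ^ 6 * (t * a * b * c) / t ^ 4)\<^sup>2"
    using nz by (simp add: field_simps eval_nat_numeral)
  also have "z * Q ^ 6 * (t * a * b * c) / t ^ 4 = DW z"
    unfolding DW_def qtheta_sq[OF z0(1)] a_b_c_def t_def ..
  finally show ?thesis ..
qed

lemma e_diff: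
  defines "u \<equiv> qtheta q (- 1)" and "v \<equiv> qtheta q (of_real r)" and "w \<equiv> qtheta q (- of_real r)"
  shows "e1 - e3 = - (w\<^sup>2 * Q ^ 4 / (u\<^sup>2 * v\<^sup>2))" "e1 - e2 = - (v\<^sup>2 * Q ^ 4 / (u\<^sup>2 * w\<^sup>2))"
    "e2 - e3 = - (of_real r * u\<^sup>2 * Q ^ 4 / (w\<^sup>2 * v\<^sup>2))"
proof -
  show "e1 - e3 = - (w\<^sup>2 * Q ^ 4 / (u\<^sup>2 * v\<^sup>2))"
    using W_e3[OF tdom_m1] by (simp add: u_def v_def w_def flip: e1_def)
  show "e1 - e2 = - (v\<^sup>2 * Q ^ 4 / (u\<^sup>2 * w\<^sup>2))"
    using W_e2[OF tdom_m1] by (simp add: u_def v_def w_def flip: e1_def)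
  have "qtheta q (- of_real q) = u"
    using qtheta_scale[of "-1"] by (simp add: u_def)
  thus "e2 - e3 = - (of_real r * u\<^sup>2 * Q ^ 4 / (w\<^sup>2 * v\<^sup>2))"
    using W_e3[OF tdom_mr] rc by (simp add: u_def v_def w_def flip: e2_def)
qed

text \<open>In the product of the differences \<open>e_diff\<close> the theta values at the half
  periods combine to (u v w)^2 = 4, leaving the product for the modular discriminant.\<close>

lemma discriminant: "16 * ((e1 - e2) * (e1 - e3) * (e2 - e3))\<^sup>2 = of_real q * Q ^ 24"
proof -
  define u v w where "u = qtheta q (- 1)" "v = qtheta q (of_real r)" "w = qtheta q (- of_real r)"
  have nz: "u \<noteq> 0" "v \<noteq> 0" "w \<noteq> 0" using tdom_m1 tdom_r tdom_mr by (auto simp: tdom_def u_v_w_def)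
  have uvw: "u * v * w = 2" using qtheta_halves by (simp add: u_v_w_def)
  have "(e1 - e2) * (e1 - e3) * (e2 - e3) = - (of_real r * Q ^ 12 / (u * v * w)\<^sup>2)"
    unfolding e_diff u_v_w_def[symmetric] using nz
    by (simp add: divide_simps) (simp add: algebra_simps eval_nat_numeral)
  hence "16 * ((e1 - e2) * (e1 - e3) * (e2 - e3))\<^sup>2 = (of_real r * Q ^ 12)\<^sup>2" unfolding uvw
    by (simp add: power_divide)
  thus ?thesis using rc by (simp add: power_mult_distrib)
qed

end

section \<open>The point of order three and the curve in Hesse-type normal form\<close>

definition zeta3 :: complex where "zeta3 = Complex (- 1 / 2) (sqrt 3 / 2)"

lemma zeta3_sq: "zeta3\<^sup>2 = Complex (- 1 / 2) (- sqrt 3 / 2)"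
  by (simp add: zeta3_def power2_eq_square complex_eq_iff)

lemma zeta3_root: "zeta3\<^sup>2 + zeta3 + 1 = 0"
  unfolding zeta3_sq by (simp add: zeta3_def complex_eq_iff)

lemma zeta3_cube [simp]: "zeta3 ^ 3 = 1"
proof -
  have "zeta3 ^ 3 - 1 = (zeta3 - 1) * (zeta3\<^sup>2 + zeta3 + 1)"
    by (simp add: algebra_simps power2_eq_square power3_eq_cube)
  thus ?thesis by (simp add: zeta3_root)
qed

lemma zeta3_nonzero [simp]: "zeta3 \<noteq> 0" by (simp add: zeta3_def complex_eq_iff)
lemma zeta3_inverse: "1 / zeta3 = zeta3\<^sup>2"
  using zeta3_cube by (simp add: field_simps power2_eq_square power3_eq_cube)

lemma cis_2pi3: "cis (2 * pi / 3) = zeta3"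
  by (simp add: zeta3_def complex_eq_iff cos_120 sin_120)

text \<open>\<open>eul\<close> is Euler's product of 1 - q^n over n >= 1. \<open>sig\<close>,
  defined next, is the generating series of the divisor sums sigma(n), so that 1 - 24
  \<open>sig\<close> is the Eisenstein series of weight two; its Lambert form is
  \<open>sig_lambert\<close>.\<close>

definition eul :: "real \<Rightarrow> real" where "eul q = Re (qprod q (of_real q))"
definition sig :: "real \<Rightarrow> real" where "sig q = Re (qsum2 q (of_real q))"

lemma qprod_pos:
  assumes q: "0 < q" "q < 1" and x: "x < 1"
  shows "Re (qprod q (of_real x)) > 0" "qprod q (of_real x) = of_real (Re (qprod q (of_real x)))"
proof -
  show 1: "qprod q (of_real x) = of_real (Re (qprod q (of_real x)))"
    using qprod_real[OF q, of "of_real x"] by (simp add: of_real_Re)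
  have pos: "1 - q ^ n * x > 0" for n
  proof (cases "x \<le> 0")
    case True thus ?thesis using q by (smt (verit) mult_nonneg_nonpos zero_le_power)
  next
    case False
    have "q ^ n * x \<le> 1 * x" using False q by (intro mult_right_mono power_le_one) auto
    thus ?thesis using x by simp
  qed
  have "(\<lambda>N. Re (\<Prod>n<N. 1 - of_real (q ^ n) * of_real x)) \<longlonglongrightarrow> Re (qprod q (of_real x))"
    by (intro tendsto_intros qprod_LIMSEQ q)
  also have "(\<lambda>N. Re (\<Prod>n<N. 1 - of_real (q ^ n) * of_real x)) = (\<lambda>N. \<Prod>n<N. 1 - q ^ n * x)"
  proof
    fix N
    have "(\<Prod>n<N. 1 - of_real (q ^ n) * of_real x) = complex_of_real (\<Prod>n<N. 1 - q ^ n * x)" by simp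
    thus "Re (\<Prod>n<N. 1 - of_real (q ^ n) * of_real x) = (\<Prod>n<N. 1 - q ^ n * x)" by (simp only: Re_complex_of_real)
  qed
  finally have "Re (qprod q (of_real x)) \<ge> 0"
    by (rule LIMSEQ_le_const) (auto intro!: exI[of _ 0] prod_nonneg less_imp_le[OF pos])
  moreover have "qprod q (of_real x) \<noteq> 0"
    unfolding qprod_eq_0_iff[OF q] using pos by (metis diff_gt_0_iff_gt less_irrefl of_real_eq_1_iff of_real_mult)
  hence "Re (qprod q (of_real x)) \<noteq> 0" using 1 by auto
  ultimately show "Re (qprod q (of_real x)) > 0" by simp
qed

lemma theta_quotient_arith:
  fixes z x y e f :: complex
  assumes "y \<noteq> 0" "e \<noteq> 0" "f \<noteq> 0"
  shows "z * e ^ 6 * (x * (f / e)) / (y * (f / e)) ^ 4 = (z * x / y ^ 4) * (e ^ 9 / f ^ 3)"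
  using assms by (simp add: field_simps eval_nat_numeral)

context nome
begin

lemma eul_pos: "eul q > 0" and Q_eul: "Q = of_real (eul q)"
  using qprod_pos[OF q, of q] q by (auto simp: eul_def)

lemma qdom_of_real: "x < 1 \<Longrightarrow> of_real x \<in> qdom q"
  using qprod_pos[OF q, of x] by (auto simp: qdom_eq[OF q])

lemma qW_cnj: "z \<in> tdom q \<Longrightarrow> qW q (cnj z) = cnj (qW q z)"
  using qsum2_cnj[OF q, of z] qsum2_cnj[OF q, of "of_real q / z"] by (auto simp: qW_def tdom_iff)

lemma qtheta_cnj: "qtheta q (cnj z) = cnj (qtheta q z)"
  using qprod_cnj[OF q, of z] qprod_cnj[OF q, of "of_real q / z"] by (auto simp: qtheta_def)

lemma qW_real: "z \<in> tdom q \<Longrightarrow> z \<in> \<real> \<Longrightarrow> qW q z \<in> \<real>"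
  by (metis Reals_cnj_iff qW_cnj)

lemma qtheta_Real: "z \<in> \<real> \<Longrightarrow> qtheta q z \<in> \<real>"
  by (metis Reals_cnj_iff qtheta_cnj)

lemma e_real: "e1 \<in> \<real>" "e2 \<in> \<real>" "e3 \<in> \<real>"
  unfolding e1_def e2_def e3_def using tdom_m1 tdom_mr tdom_r by (auto intro!: qW_real)

text \<open>By \<open>e_diff\<close> both differences are minus positive multiples of squares of
  real theta values. This order later decides which half period carries which root of the given
  cubic.\<close>

lemma e_order: "Re e1 < Re e2" "Re e2 < Re e3"
proof -
  define u v w where "u = Re (qtheta q (- 1))" "v = Re (qtheta q (of_real r))" "w = Re (qtheta q (- of_real r))"
  have uvw: "qtheta q (- 1) = of_real u" "qtheta q (of_real r) = of_real v" "qtheta q (- of_real r) = of_real w"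
    unfolding u_v_w_def by (auto intro!: of_real_Re[symmetric] qtheta_Real)
  have "u \<noteq> 0" "v \<noteq> 0" "w \<noteq> 0" using tdom_m1 tdom_r tdom_mr uvw by (auto simp: tdom_def)
  moreover have "e1 - e2 = of_real (- (v\<^sup>2 * eul q ^ 4 / (u\<^sup>2 * w\<^sup>2)))" "e2 - e3 = of_real (- (r * u\<^sup>2 * eul q ^ 4 / (w\<^sup>2 * v\<^sup>2)))"
    unfolding e_diff uvw Q_eul by simp_all
  hence "Re e1 - Re e2 = - (v\<^sup>2 * eul q ^ 4 / (u\<^sup>2 * w\<^sup>2))" "Re e2 - Re e3 = - (r * u\<^sup>2 * eul q ^ 4 / (w\<^sup>2 * v\<^sup>2))"
    by (metis Re_complex_of_real minus_complex.sel(1))+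
  moreover have "v\<^sup>2 * eul q ^ 4 / (u\<^sup>2 * w\<^sup>2) > 0" "r * u\<^sup>2 * eul q ^ 4 / (w\<^sup>2 * v\<^sup>2) > 0"
    using calculation(1-3) eul_pos r by (auto intro!: divide_pos_pos mult_pos_pos)
  ultimately show "Re e1 < Re e2" "Re e2 < Re e3" by linarith+
qed

lemma tdom_zeta3: "zeta3 \<in> tdom q" "zeta3\<^sup>2 \<in> tdom q"
proof -
  have "zeta3 \<notin> \<real>" by (simp add: zeta3_def complex_is_Real_iff)
  moreover have "zeta3\<^sup>2 \<notin> \<real>" by (simp add: zeta3_sq complex_is_Real_iff)
  ultimately show "zeta3 \<in> tdom q" "zeta3\<^sup>2 \<in> tdom q" by (auto intro: tdom_not_real)
qed

definition "W0 = qW q zeta3"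

lemma W_zeta3_sq: "qW q (zeta3\<^sup>2) = W0"
  using qW_inverse[OF tdom_zeta3(1)] by (simp add: zeta3_inverse W0_def)

lemma W0_real: "W0 \<in> \<real>"
proof -
  have "cnj zeta3 = zeta3\<^sup>2" unfolding zeta3_sq by (simp add: zeta3_def complex_eq_iff)
  thus ?thesis using qW_cnj[OF tdom_zeta3(1)] W_zeta3_sq by (metis Reals_cnj_iff W0_def)
qed

lemma q_pow_nome: "nome (q ^ Suc n)"
  using q by unfold_locales (auto simp: power_Suc_less_one simp del: power_Suc)

lemma q2: "0 < q\<^sup>2" "q\<^sup>2 < 1" and q3: "0 < q ^ 3" "q ^ 3 < 1"
  using q by (auto simp: power_less_one_iff)

lemma sig_eq: "qsum2 q (of_real q) = of_real (sig q)"
  using qsum2_cnj[OF q qdom_of_real[of q]] q by (metis Reals_cnj_iff complex_cnj_complex_of_real of_real_Re sig_def)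

text \<open>The series at \<open>zeta3\<close> and at its square, completed by the one for 1, run
  over all cube roots of unity, and \<open>qsum2_cube\<close> turns the total into a series in q^3.
  The constant -1/3 is the leading term zeta3 / (1 - zeta3)^2.\<close>

lemma W0_eq: "W0 = - 1 / 3 - of_real (sig q) + 9 * of_real (sig (q ^ 3))"
proof -
  interpret c: nome "q ^ 3" using q3 by unfold_locales
  have z: "zeta3 \<in> qdom q" using tdom_zeta3(1) by (auto simp: tdom_iff)
  have "(of_real q :: complex) ^ 3 \<in> qdom (q ^ 3)" using c.qdom_of_real[of "q ^ 3"] q3 by simp
  note * = qsum2_cube[OF q zeta3_root this]
  have "of_real q / zeta3 = zeta3\<^sup>2 * of_real q" by (simp flip: zeta3_inverse)
  moreover have "zeta3 / (1 - zeta3)\<^sup>2 = - 1 / 3"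
  proof -
    have "(1 - zeta3)\<^sup>2 = - 3 * zeta3" using zeta3_root by algebra
    thus ?thesis by simp
  qed
  ultimately have "W0 = - 1 / 3 + qsum2 q (zeta3 * of_real q) + qsum2 q (zeta3\<^sup>2 * of_real q)"
    unfolding W0_def qW_def using qsum2_rec[OF z] by (simp add: mult_ac)
  moreover have "of_real (sig q) + qsum2 q (zeta3 * of_real q) + qsum2 q (zeta3\<^sup>2 * of_real q) = 9 * of_real (sig (q ^ 3))"
    using * sig_eq c.sig_eq by simp
  ultimately show ?thesis by algebra
qed

text \<open>\<open>qW\<close> lacks the additive constant of the Weierstrass function, so these
  three values need not have sum zero. Their sum is found as in \<open>W0_eq\<close>, with sign
  changes and the splitting by parity in place of cube roots.\<close>

lemma sum_e_eq: "e1 + e2 + e3 = - 1 / 4 + 6 * of_real (sig q)"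
proof -
  have q2': "(of_real q :: complex)\<^sup>2 = of_real (q\<^sup>2)" by simp
  have m1: "- 1 \<in> qdom q" "- of_real q \<in> qdom q" "- of_real r \<in> qdom q" "of_real r \<in> qdom q" "of_real q \<in> qdom q"
    using qdom_of_real[of "-1"] qdom_of_real[of "-q"] qdom_of_real[of "-r"] qdom_of_real[of r] qdom_of_real[of q] q r by auto
  have rr: "of_real q / of_real r = complex_of_real r" "of_real q / - of_real r = - complex_of_real r"
    using r by (simp_all flip: rc(1))
  have 1: "e1 = - 1 / 4 + 2 * qsum2 q (- of_real q)"
    unfolding e1_def qW_def using qsum2_rec[OF m1(1)] by (simp add: power2_eq_square)
  have 2: "qsum2 q (of_real q) + qsum2 q (- of_real q) = 4 * qsum2 (q\<^sup>2) (of_real (q\<^sup>2))"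
    using qsum2_neg[OF q m1(5,2)] by simp
  have 3: "e2 = 2 * qsum2 q (- of_real r)" unfolding e2_def qW_def using rr by simp
  have 4: "e3 = 2 * qsum2 q (of_real r)" unfolding e3_def qW_def using rr by simp
  have 5: "qsum2 q (of_real r) + qsum2 q (- of_real r) = 4 * qsum2 (q\<^sup>2) (of_real q)"
    using qsum2_neg[OF q m1(4,3)] rc by simp
  have 6: "qsum2 q (of_real q) = qsum2 (q\<^sup>2) (of_real q) + qsum2 (q\<^sup>2) (of_real (q\<^sup>2))"
    using qsum2_split2[OF q m1(5)] by (simp add: power2_eq_square)
  show ?thesis unfolding sig_eq[symmetric] using 1 2 3 4 5 6 by algebra
qed

text \<open>The derivative at \<open>w\<close> of the monic cubic with roots \<open>e1\<close>,
  \<open>e2\<close>, \<open>e3\<close>.\<close>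

definition "S2 w = (w - e1) * (w - e2) + (w - e1) * (w - e3) + (w - e2) * (w - e3)"

lemma qW_deriv_DW: "z \<in> tdom q \<Longrightarrow> (qW q has_field_derivative DW z / z) (at z)"
  using qW_has_deriv[of z] by (simp add: DW_def tdom_def)

lemma DDW_S2:
  assumes z: "z\<^sup>2 \<in> tdom q"
  shows "DDW z = 2 * S2 (qW q z)"
proof -
  have z1: "z \<in> tdom q" and z0: "z \<noteq> 0" using tdom_sq[OF z] by (auto simp: tdom_def)
  have nz: "DW z \<noteq> 0" using DW_nonzero_iff[OF z1] z by simp
  have "((\<lambda>z. DW z ^ 2) has_field_derivative 2 * DW z * deriv DW z) (at z)"
    using holomorphic_derivI[OF holomorphic_DW open_tdom z1] by (auto intro!: derivative_eq_intros)
  moreover have D2: "((\<lambda>z. 4 * (qW q z - e1) * (qW q z - e2) * (qW q z - e3)) has_field_derivative 4 * (DW z / z) * S2 (qW q z)) (at z)"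
    unfolding S2_def by (rule derivative_eq_intros qW_deriv_DW z1 refl)+ (use z0 in \<open>simp add: field_simps\<close>)
  have "eventually (\<lambda>z. z \<in> tdom q) (nhds z)" using open_tdom z1 by (rule eventually_nhds_in_open)
  hence ev: "eventually (\<lambda>z. 4 * (qW q z - e1) * (qW q z - e2) * (qW q z - e3) = DW z ^ 2) (nhds z)"
    by eventually_elim (simp add: DW_squared)
  have "((\<lambda>z. DW z ^ 2) has_field_derivative 4 * (DW z / z) * S2 (qW q z)) (at z)"
    by (rule DERIV_cong_ev[THEN iffD1, OF refl ev refl D2])
  ultimately have "2 * DW z * deriv DW z = 4 * (DW z / z) * S2 (qW q z)" by (rule DERIV_unique)
  thus ?thesis using nz z0 by (simp add: DDW_def field_simps)
qed

text \<open>The tangent at a point of order three is an inflection tangent.\<close>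

lemma zeta3_inflection: "(DDW zeta3 / DW zeta3)\<^sup>2 = 12 * W0 - 4 * (e1 + e2 + e3)"
proof -
  note z2 = tdom_zeta3(2) and z1 = tdom_zeta3(1)
  have nz: "DW zeta3 \<noteq> 0" using DW_nonzero_iff[OF z1] z2 by simp
  \<comment> \<open>The square of \<open>zeta3\<close> is its inverse, so the two values of
    \<open>qW\<close> in the general formula agree: the slope of the tangent is stationary.
    Computing the same derivative through \<open>S2\<close> turns this into an algebraic
    equation.\<close>
  have "((\<lambda>z. DDW z / DW z) has_field_derivative 0) (at zeta3)"
    using DDW_over_DW_deriv[OF z2] by (simp add: W_zeta3_sq flip: W0_def)
  moreover have "open ((\<lambda>z. z\<^sup>2) -` tdom q)" by (intro open_vimage open_tdom continuous_intros)
  hence "eventually (\<lambda>w. w \<in> (\<lambda>z. z\<^sup>2) -` tdom q) (nhds zeta3)"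
    by (rule eventually_nhds_in_open) (use z2 in auto)
  hence ev: "eventually (\<lambda>w. 2 * S2 (qW q w) / DW w = DDW w / DW w) (nhds zeta3)"
    by eventually_elim (simp add: DDW_S2)
  have dS: "((\<lambda>z. 2 * S2 (qW q z)) has_field_derivative 2 * (2 * (3 * W0 - (e1 + e2 + e3))) * (DW zeta3 / zeta3)) (at zeta3)"
    unfolding S2_def by (rule derivative_eq_intros qW_deriv_DW z1 refl)+ (simp add: algebra_simps W0_def)
  have D2: "((\<lambda>z. 2 * S2 (qW q z) / DW z) has_field_derivative 
      ((2 * (2 * (3 * W0 - (e1 + e2 + e3))) * (DW zeta3 / zeta3)) * DW zeta3 - (2 * S2 (qW q zeta3)) * deriv DW zeta3)
       / (DW zeta3 * DW zeta3)) (at zeta3)"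
    by (rule DERIV_divide dS holomorphic_derivI[OF holomorphic_DW open_tdom z1] nz)+
  have "((\<lambda>z. DDW z / DW z) has_field_derivative 
      ((2 * (2 * (3 * W0 - (e1 + e2 + e3))) * (DW zeta3 / zeta3)) * DW zeta3 - (2 * S2 (qW q zeta3)) * deriv DW zeta3)
       / (DW zeta3 * DW zeta3)) (at zeta3)"
    by (rule DERIV_cong_ev[THEN iffD1, OF refl ev refl D2])
  ultimately have "0 = ((2 * (2 * (3 * W0 - (e1 + e2 + e3))) * (DW zeta3 / zeta3)) * DW zeta3 - (2 * S2 (qW q zeta3)) * deriv DW zeta3)
       / (DW zeta3 * DW zeta3)" by (rule DERIV_unique)
  hence "2 * (2 * (3 * W0 - (e1 + e2 + e3))) * DW zeta3 * DW zeta3 = DDW zeta3 * (zeta3 * deriv DW zeta3)"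
    using nz by (simp add: DDW_S2[OF z2] field_simps)
  hence e: "DDW zeta3 ^ 2 = 4 * (3 * W0 - (e1 + e2 + e3)) * DW zeta3 ^ 2"
    unfolding DDW_def by algebra
  have "12 * W0 - 4 * (e1 + e2 + e3) = 4 * (3 * W0 - (e1 + e2 + e3))" by algebra
  thus ?thesis unfolding power_divide e using nz by simp
qed

text \<open>The tangent at \<open>zeta3\<close> to the curve with coordinates \<open>qW q - W0\<close> and \<open>DW\<close> has slope and
  intercept \<open>\<i> A\<close> and \<open>- \<i> B\<close>.\<close>

definition "B = eul q ^ 9 / eul (q ^ 3) ^ 3 / (3 * sqrt 3)"

lemma B_pos: "B > 0"
  using eul_pos nome.eul_pos[OF q_pow_nome[of 2]] by (simp add: B_def eval_nat_numeral)

text \<open>The nontrivial factors of \<open>qtheta\<close> at \<open>zeta3\<close> and at its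
  square are those of a product over all cube roots of unity with the trivial root left out. Both
  equal \<open>eul (q ^ 3) / eul q\<close> up to an elementary factor, which makes the value an eta
  quotient.\<close>

lemma DW_zeta3: "DW zeta3 = - \<i> * of_real B"
proof -
  interpret c: nome "q ^ 3" using q3 by unfold_locales
  define E E3 where "E = complex_of_real (eul q)" "E3 = complex_of_real (eul (q ^ 3))"
  have E0: "E \<noteq> 0" "E3 \<noteq> 0" using eul_pos c.eul_pos by (auto simp: E_E3_def)
  have "qprod q (of_real q) * qprod q (zeta3 * of_real q) * qprod q (zeta3\<^sup>2 * of_real q) = E3"
    using qprod_mult_cube_root[OF q zeta3_root, of "of_real q"] c.Q_eul by (simp add: E_E3_def)
  hence 1: "qprod q (zeta3 * of_real q) * qprod q (zeta3\<^sup>2 * of_real q) = E3 / E"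
    using E0 Q_eul by (simp add: E_E3_def field_simps)
  have i: "of_real q / zeta3 = zeta3\<^sup>2 * of_real q" by (simp flip: zeta3_inverse)
  have "1 / zeta3\<^sup>2 = zeta3" by (simp flip: zeta3_inverse)
  hence i2: "of_real q / zeta3\<^sup>2 = zeta3 * of_real q" by (simp add: field_simps)
  have 2: "qtheta q zeta3 = (1 - zeta3) * (E3 / E)"
    unfolding 1[symmetric] qtheta_def i qprod_rec[OF q, of zeta3] by (simp add: mult_ac)
  have 3: "qtheta q (zeta3\<^sup>2) = (1 - zeta3\<^sup>2) * (E3 / E)"
    unfolding 1[symmetric] qtheta_def i2 qprod_rec[OF q, of "zeta3\<^sup>2"] by (simp add: mult_ac)
  have z1: "1 - zeta3 \<noteq> 0" by (simp add: zeta3_def complex_eq_iff)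
  have "DW zeta3 = (zeta3 * (1 - zeta3\<^sup>2) / (1 - zeta3) ^ 4) * (E ^ 9 / E3 ^ 3)"
    unfolding DW_def 2 3 using theta_quotient_arith[OF z1 E0] Q_eul by (simp only: E_E3_def)
  also have "zeta3 * (1 - zeta3\<^sup>2) / (1 - zeta3) ^ 4 = - \<i> / of_real (3 * sqrt 3)"
  proof -
    have "(1 - zeta3)\<^sup>2 = - 3 * zeta3" using zeta3_root by algebra
    hence "(1 - zeta3) ^ 4 = 9 * zeta3\<^sup>2" by (simp add: power4_eq_xxxx power2_eq_square)
    hence "zeta3 * (1 - zeta3\<^sup>2) / (1 - zeta3) ^ 4 = (1 - zeta3\<^sup>2) / (9 * zeta3)" by (simp add: power2_eq_square)
    also have "\<dots> = (zeta3\<^sup>2 - zeta3) / 9"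
      using zeta3_cube by (simp add: field_simps power2_eq_square power3_eq_cube)
    also have "\<dots> = - \<i> * of_real (sqrt 3 / 9)"
      unfolding zeta3_sq by (simp add: zeta3_def complex_eq_iff)
    also have "sqrt 3 / 9 = 1 / (3 * sqrt 3)"
      by (simp add: field_simps)
    finally show ?thesis by simp
  qed
  finally show ?thesis by (simp add: B_def E_E3_def)
qed

definition "A = Re (DDW zeta3) / B"

lemma DDW_zeta3: "DDW zeta3 = of_real (A * B)"
proof -
  have "DDW zeta3 \<in> \<real>"
    unfolding DDW_S2[OF tdom_zeta3(2)] S2_def W0_def[symmetric] using W0_real e_real by auto
  thus ?thesis using B_pos by (simp add: A_def)
qed

text \<open>Combines \<open>zeta3_inflection\<close> with the two Lambert series. The bracket is the
  logarithmic derivative of \<open>hauptmodul\<close>, which is why A^2 / 3 reappears in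
  \<open>hauptmodul_deriv\<close>.\<close>

lemma A_sq: "A\<^sup>2 = 3 * (1 + 12 * sig q - 36 * sig (q ^ 3))"
proof -
  have "complex_of_real (- (A\<^sup>2)) = (DDW zeta3 / DW zeta3)\<^sup>2"
    unfolding DDW_zeta3 DW_zeta3 using B_pos by (simp add: power_divide power_mult_distrib)
  also have "\<dots> = 12 * (- 1 / 3 - of_real (sig q) + 9 * of_real (sig (q ^ 3))) - 4 * (- 1 / 4 + 6 * of_real (sig q))"
    unfolding zeta3_inflection W0_eq sum_e_eq ..
  also have "\<dots> = of_real (- (3 * (1 + 12 * sig q - 36 * sig (q ^ 3))))" by simp
  finally show ?thesis unfolding of_real_eq_iff by simp
qed

text \<open>The three symmetric functions come from three facts at \<open>zeta3\<close>: the
  inflection condition, the value of \<open>DDW\<close> as twice \<open>S2\<close>, and the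
  Weierstrass equation for \<open>DW\<close>.\<close>

lemma curve_symm:
  shows "(e1 - W0) + (e2 - W0) + (e3 - W0) = of_real (A\<^sup>2 / 4)"
    "(e1 - W0) * (e2 - W0) + (e1 - W0) * (e3 - W0) + (e2 - W0) * (e3 - W0) = of_real (A * B / 2)"
    "(e1 - W0) * (e2 - W0) * (e3 - W0) = of_real (B\<^sup>2 / 4)"
proof -
  have "complex_of_real (- (A\<^sup>2)) = (DDW zeta3 / DW zeta3)\<^sup>2"
    unfolding DDW_zeta3 DW_zeta3 using B_pos by (simp add: power_divide power_mult_distrib)
  also have "\<dots> = 12 * W0 - 4 * (e1 + e2 + e3)" by (rule zeta3_inflection)
  finally show "(e1 - W0) + (e2 - W0) + (e3 - W0) = of_real (A\<^sup>2 / 4)" by (simp add: field_simps)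
  have "2 * S2 W0 = of_real (A * B)"
    using DDW_zeta3 DDW_S2[OF tdom_zeta3(2)] by (simp add: W0_def)
  thus "(e1 - W0) * (e2 - W0) + (e1 - W0) * (e3 - W0) + (e2 - W0) * (e3 - W0) = of_real (A * B / 2)"
    unfolding S2_def by (simp add: algebra_simps)
  have "- of_real (B\<^sup>2) = 4 * (W0 - e1) * (W0 - e2) * (W0 - e3)"
    using DW_squared[OF tdom_zeta3(1)] DW_zeta3 by (simp add: W0_def power_mult_distrib)
  also have "\<dots> = - 4 * ((e1 - W0) * (e2 - W0) * (e3 - W0))" by (simp add: algebra_simps)
  finally show "(e1 - W0) * (e2 - W0) * (e3 - W0) = of_real (B\<^sup>2 / 4)" by simp
qed

lemma cubic_discriminant:
  fixes a b c :: complex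
  defines "s \<equiv> a + b + c" and "t \<equiv> a * b + a * c + b * c" and "p \<equiv> a * b * c"
  shows "((a - b) * (a - c) * (b - c))\<^sup>2 = s\<^sup>2 * t\<^sup>2 - 4 * t ^ 3 - 4 * s ^ 3 * p + 18 * s * t * p - 27 * p\<^sup>2"
  unfolding s_def t_def p_def by algebra

text \<open>Two evaluations of 16 times the squared product of the root differences: by the
  coefficients of 4 X^3 - (A X - B)^2 and by the theta values in
  \<open>discriminant\<close>.\<close>

lemma A_B_discriminant: "B ^ 3 * (A ^ 3 - 27 * B) = q * eul q ^ 24"
proof -
  have "complex_of_real (q * eul q ^ 24) = 16 * ((e1 - e2) * (e1 - e3) * (e2 - e3))\<^sup>2"
    unfolding discriminant Q_eul by simp
  also have "((e1 - e2) * (e1 - e3) * (e2 - e3))\<^sup>2 =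
     (((e1 - W0) - (e2 - W0)) * ((e1 - W0) - (e3 - W0)) * ((e2 - W0) - (e3 - W0)))\<^sup>2" by simp
  also have "16 * \<dots> = of_real (B ^ 3 * (A ^ 3 - 27 * B))"
    unfolding cubic_discriminant curve_symm by (simp add: field_simps eval_nat_numeral)
  finally show ?thesis unfolding of_real_eq_iff ..
qed

lemma zeta3_curve_eq:
  assumes z: "z \<in> tdom q"
  defines "X \<equiv> qW q z - W0"
  shows "DW z ^ 2 = 4 * X ^ 3 - (of_real A * X - of_real B)\<^sup>2"
proof -
  have "DW z ^ 2 = 4 * (X - (e1 - W0)) * (X - (e2 - W0)) * (X - (e3 - W0))"
    unfolding DW_squared[OF z] X_def by simp
  also have "\<dots> = 4 * X ^ 3 - 4 * ((e1 - W0) + (e2 - W0) + (e3 - W0)) * X\<^sup>2 + 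
     4 * ((e1 - W0) * (e2 - W0) + (e1 - W0) * (e3 - W0) + (e2 - W0) * (e3 - W0)) * X - 4 * ((e1 - W0) * (e2 - W0) * (e3 - W0))"
    by algebra
  also have "\<dots> = 4 * X ^ 3 - (of_real A * X - of_real B)\<^sup>2"
    unfolding curve_symm by (simp add: power2_eq_square algebra_simps)
  finally show ?thesis .
qed

lemma A_pos: "A > 0"
proof -
  have "B ^ 3 * (A ^ 3 - 27 * B) > 0" unfolding A_B_discriminant using q eul_pos by simp
  hence "A ^ 3 - 27 * B > 0" using B_pos by (simp add: zero_less_mult_iff)
  hence "A ^ 3 > 0" using B_pos by linarith
  thus ?thesis by (simp add: zero_less_power_eq)
qed

end

text \<open>With \<open>\<eta>\<close> the Dedekind eta function this is \<open>729 (\<eta>(3 \<tau>) / \<eta>(\<tau>))\<^sup>1\<^sup>2\<close>, a Hauptmodul of \<open>\<Gamma>\<^sub>0(3)\<close>.\<close>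

definition hauptmodul :: "real \<Rightarrow> real" where
  "hauptmodul q = 729 * q * (eul (q ^ 3) / eul q) ^ 12"

context nome
begin

lemma hauptmodul_pos: "hauptmodul q > 0"
  using q eul_pos nome.eul_pos[OF q_pow_nome[of 2]] by (simp add: hauptmodul_def eval_nat_numeral)

lemma hauptmodul_eq: "A ^ 3 / B = 27 + hauptmodul q"
proof -
  interpret c: nome "q ^ 3" using q3 by unfold_locales
  have "B ^ 4 * hauptmodul q = q * eul q ^ 24"
  proof -
    have s: "(3 * sqrt 3) ^ 4 = (729 :: real)" by (simp add: power4_eq_xxxx)
    have "B ^ 4 = eul q ^ 36 / eul (q ^ 3) ^ 12 / 729"
      unfolding B_def power_divide s by (simp flip: power_mult)
    moreover have "eul q ^ 36 = eul q ^ 24 * eul q ^ 12" by (simp flip: power_add)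
    ultimately have "B ^ 4 * hauptmodul q = (eul q ^ 24 * eul q ^ 12) / eul (q ^ 3) ^ 12 / 729 * (729 * q * (eul (q ^ 3) ^ 12 / eul q ^ 12))"
      unfolding hauptmodul_def power_divide by (simp only:)
    also have "\<dots> = q * eul q ^ 24"
      using eul_pos c.eul_pos by (simp add: divide_simps)
    finally show ?thesis .
  qed
  also have "\<dots> = B ^ 3 * (A ^ 3 - 27 * B)" using A_B_discriminant ..
  finally have "B ^ 3 * (B * hauptmodul q) = B ^ 3 * (A ^ 3 - 27 * B)" by (simp add: eval_nat_numeral mult_ac)
  hence "B * hauptmodul q = A ^ 3 - 27 * B" using B_pos by simp
  thus ?thesis using B_pos by (simp add: field_simps)
qed

text \<open>The quotient does not change when \<open>DW\<close> is multiplied by c^3 and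
  \<open>DDW\<close> by c^4. It can therefore be computed on any Weierstrass model of the curve,
  without knowledge of the nome or the periods.\<close>

lemma invariant: "of_real (27 + hauptmodul q) = DDW zeta3 ^ 3 / DW zeta3 ^ 4"
proof -
  have "DDW zeta3 ^ 3 / DW zeta3 ^ 4 = of_real ((A * B) ^ 3 / B ^ 4)"
    unfolding DDW_zeta3 DW_zeta3 by (simp add: power_mult_distrib)
  also have "(A * B) ^ 3 / B ^ 4 = A ^ 3 / B" using B_pos by (simp add: field_simps eval_nat_numeral)
  finally show ?thesis by (simp add: hauptmodul_eq)
qed

end

section \<open>Translations and isogenies of degree two\<close>

context nome
begin

lemma qW_eq_imp:
  assumes z: "z \<in> tdom q" and w: "w \<in> tdom q" and eq: "qW q z = qW q w"
  shows "\<exists>n. z = w * of_real q powi n \<or> z = of_real q powi n / w"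
proof -
  have nz: "z \<noteq> 0" "w \<noteq> 0" "qtheta q z \<noteq> 0" "qtheta q w \<noteq> 0" using z w by (auto simp: tdom_def)
  have "w * qtheta q (z / w) * qtheta q (z * w) * Q ^ 4 / (qtheta q z ^ 2 * qtheta q w ^ 2) = 0"
    using qW_diff[OF z w] eq by simp
  hence "qtheta q (z / w) = 0 \<or> qtheta q (z * w) = 0" using nz by simp
  hence "z / w \<notin> tdom q \<or> z * w \<notin> tdom q" by (auto simp: tdom_def)
  moreover have "z / w \<noteq> 0" "z * w \<noteq> 0" using nz by auto
  ultimately obtain n where "z / w = of_real q powi n \<or> z * w = of_real q powi n"
    unfolding tdom_iff_powi by blast
  thus ?thesis using nz by (intro exI[of _ n]) (auto simp: field_simps)
qed

lemma tdom_powi: "z \<in> tdom q \<Longrightarrow> z * of_real q powi n \<in> tdom q"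
proof (induction n rule: int_induct[where k = 0])
  case (step1 i)
  thus ?case using tdom_scale_iff[of "z * of_real q powi i"] q by (simp add: power_int_add mult_ac)
next
  case (step2 i)
  thus ?case using tdom_scale_iff[of "z * of_real q powi (i - 1)"] q by (simp add: power_int_diff)
qed auto

lemma DW_has_deriv: "z \<in> tdom q \<Longrightarrow> (DW has_field_derivative DDW z / z) (at z)"
  using holomorphic_derivI[OF holomorphic_DW open_tdom] by (auto simp: DDW_def)

lemma DW_inverse:
  assumes z: "z \<in> tdom q"
  shows "DW (1 / z) = - DW z"
proof -
  have z0: "z \<noteq> 0" using z by (auto simp: tdom_def)
  have D: "((\<lambda>z. qW q (1 / z)) has_field_derivative DW (1 / z) / (1 / z) * (- 1 / z\<^sup>2)) (at z)"
    by (rule DERIV_chain2[where f = "qW q" and g = "\<lambda>z. 1 / z" and x = z])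
       (use z0 z qW_deriv_DW[of "1 / z"] in \<open>auto intro!: derivative_eq_intros simp: tdom_inverse_iff power2_eq_square\<close>)
  have "eventually (\<lambda>z. z \<in> tdom q) (nhds z)" using open_tdom z by (rule eventually_nhds_in_open)
  hence ev: "eventually (\<lambda>z. qW q (1 / z) = qW q z) (nhds z)"
    by eventually_elim (simp add: qW_inverse)
  have "DW z / z = DW (1 / z) / (1 / z) * (- 1 / z\<^sup>2)"
    by (rule DERIV_unique[OF qW_deriv_DW[OF z] DERIV_cong_ev[THEN iffD1, OF refl ev refl D]])
  thus ?thesis using z0 by (simp add: field_simps power2_eq_square)
qed

lemma DW_scale:
  assumes z: "z \<in> tdom q"
  shows "DW (of_real q * z) = DW z"
proof -
  have z0: "z \<noteq> 0" using z by (auto simp: tdom_def)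
  have D: "((\<lambda>z. qW q (of_real q * z)) has_field_derivative DW (of_real q * z) / (of_real q * z) * of_real q) (at z)"
    by (rule DERIV_chain2[where f = "qW q" and g = "\<lambda>z. of_real q * z" and x = z])
       (use z qW_deriv_DW in \<open>auto intro!: derivative_eq_intros simp: tdom_scale_iff\<close>)
  have "eventually (\<lambda>z. z \<in> tdom q) (nhds z)" using open_tdom z by (rule eventually_nhds_in_open)
  hence ev: "eventually (\<lambda>z. qW q (of_real q * z) = qW q z) (nhds z)"
    by eventually_elim (simp add: qW_scale)
  have "DW z / z = DW (of_real q * z) / (of_real q * z) * of_real q"
    by (rule DERIV_unique[OF qW_deriv_DW[OF z] DERIV_cong_ev[THEN iffD1, OF refl ev refl D]])
  thus ?thesis using z0 q by (simp add: field_simps)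
qed

lemma DW_powi: "z \<in> tdom q \<Longrightarrow> DW (z * of_real q powi n) = DW z"
proof (induction n rule: int_induct[where k = 0])
  case (step1 i)
  thus ?case using DW_scale[OF tdom_powi, of z i] q by (simp add: power_int_add mult_ac)
next
  case (step2 i)
  thus ?case using DW_scale[OF tdom_powi, of z "i - 1"] q by (simp add: power_int_diff)
qed auto

lemma DW_zeta3_sq: "DW (zeta3\<^sup>2) = - DW zeta3"
  using DW_inverse[OF tdom_zeta3(1)] by (simp add: zeta3_inverse)

lemma zeta3_4: "(zeta3\<^sup>2)\<^sup>2 = zeta3"
proof -
  have "(zeta3\<^sup>2)\<^sup>2 = zeta3 ^ 3 * zeta3" by (simp add: power2_eq_square power3_eq_cube)
  thus ?thesis by simp
qed

lemma DDW_zeta3_sq: "DDW (zeta3\<^sup>2) = DDW zeta3"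
  using DDW_S2[of "zeta3\<^sup>2", unfolded zeta3_4, OF tdom_zeta3(1)] DDW_S2[OF tdom_zeta3(2)]
  by (simp add: W_zeta3_sq flip: W0_def)

lemma qtheta_half_half: "z \<in> tdom q \<Longrightarrow> qtheta q (of_real r * (of_real r * z)) = - qtheta q z / z"
  using qtheta_scale[of z] by (auto simp: tdom_def mult.assoc[symmetric] rc)

text \<open>Translation by the half period \<open>r\<close> exchanges the double pole and the double
  zero of \<open>qW q z - e3\<close>, so the product is constant. Its value is read off at z = -1,
  whose translate is -\<open>r\<close>. The next two lemmas do the same for the other half
  periods.\<close>

lemma translate_e3:
  assumes z: "z \<in> tdom q" "of_real r * z \<in> tdom q"
  shows "(qW q (of_real r * z) - e3) * (qW q z - e3) = (e1 - e3) * (e2 - e3)"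
proof -
  have *: "(qW q (of_real r * z) - e3) * (qW q z - e3) = of_real r * Q ^ 8 / qtheta q (of_real r) ^ 4"
    if z: "z \<in> tdom q" "of_real r * z \<in> tdom q" for z
  proof -
    have "z \<noteq> 0" "qtheta q z \<noteq> 0" "qtheta q (of_real r * z) \<noteq> 0" "qtheta q (of_real r) \<noteq> 0"
      using z tdom_r by (auto simp: tdom_def)
    thus ?thesis unfolding W_e3[OF z(1)] W_e3[OF z(2)] qtheta_half_half[OF z(1)]
      by (simp add: field_simps eval_nat_numeral)
  qed
  show ?thesis using *[OF z] *[of "-1"] tdom_m1 tdom_mr by (simp add: e1_def e2_def mult.commute)
qed

lemma translate_e2:
  assumes z: "z \<in> tdom q" "- of_real r * z \<in> tdom q"
  shows "(qW q (- of_real r * z) - e2) * (qW q z - e2) = (e1 - e2) * (e3 - e2)"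
proof -
  have *: "(qW q (- of_real r * z) - e2) * (qW q z - e2) = - of_real r * Q ^ 8 / qtheta q (- of_real r) ^ 4"
    if z: "z \<in> tdom q" "- of_real r * z \<in> tdom q" for z
  proof -
    have "- of_real r * (- of_real r * z) = of_real r * (of_real r * z)" by simp
    hence 1: "qtheta q (- of_real r * (- of_real r * z)) = - qtheta q z / z" using qtheta_half_half[OF z(1)] by simp
    have "z \<noteq> 0" "qtheta q z \<noteq> 0" "qtheta q (- of_real r * z) \<noteq> 0" "qtheta q (- of_real r) \<noteq> 0"
      using z tdom_mr by (auto simp: tdom_def)
    thus ?thesis unfolding W_e2[OF z(1)] W_e2[OF z(2)] 1
      by (simp add: field_simps eval_nat_numeral)
  qed
  show ?thesis using *[OF z] *[of "-1"] tdom_m1 tdom_r by (simp add: e1_def e3_def mult.commute)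
qed

lemma translate_e1:
  assumes z: "z \<in> tdom q" "- z \<in> tdom q"
  shows "(qW q (- z) - e1) * (qW q z - e1) = (e2 - e1) * (e3 - e1)"
proof -
  have *: "(qW q (- z) - e1) * (qW q z - e1) = Q ^ 8 / qtheta q (- 1) ^ 4"
    if z: "z \<in> tdom q" "- z \<in> tdom q" for z
  proof -
    have "z \<noteq> 0" "qtheta q z \<noteq> 0" "qtheta q (- z) \<noteq> 0" "qtheta q (- 1) \<noteq> 0"
      using z tdom_m1 by (auto simp: tdom_def)
    thus ?thesis unfolding W_e1[OF z(1)] W_e1[OF z(2)]
      by (simp add: field_simps eval_nat_numeral)
  qed
  show ?thesis using *[OF z] *[of "of_real r"] tdom_mr tdom_r by (simp add: e2_def e3_def mult.commute)
qed

text \<open>The product in the translation formula is constant, so its derivative z d/dz vanishes.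
  This yields the second coordinate of a translated point.\<close>

lemma translate_deriv:
  assumes z: "z \<in> tdom q" "c * z \<in> tdom q" and "c \<noteq> 0"
    and eq: "\<And>z. z \<in> tdom q \<Longrightarrow> c * z \<in> tdom q \<Longrightarrow> (qW q (c * z) - e) * (qW q z - e) = k"
  shows "DW (c * z) * (qW q z - e) + (qW q (c * z) - e) * DW z = 0"
proof -
  have z0: "z \<noteq> 0" using z by (auto simp: tdom_def)
  have "((\<lambda>z. qW q (c * z)) has_field_derivative DW (c * z) / (c * z) * c) (at z)"
    by (rule DERIV_chain2[where f = "qW q" and g = "\<lambda>z. c * z" and x = z])
       (use z qW_deriv_DW in \<open>auto intro!: derivative_eq_intros\<close>)
  hence D: "((\<lambda>z. (qW q (c * z) - e) * (qW q z - e)) has_field_derivative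
     (DW (c * z) / (c * z) * c - 0) * (qW q z - e) + (DW z / z - 0) * (qW q (c * z) - e)) (at z)"
    by (intro DERIV_mult DERIV_diff qW_deriv_DW z DERIV_const) 
  have "open (tdom q \<inter> (\<lambda>z. c * z) -` tdom q)"
    by (intro open_Int open_vimage open_tdom continuous_intros)
  hence "eventually (\<lambda>z. z \<in> tdom q \<inter> (\<lambda>z. c * z) -` tdom q) (nhds z)"
    by (rule eventually_nhds_in_open) (use z in auto)
  hence ev: "eventually (\<lambda>z. (qW q (c * z) - e) * (qW q z - e) = k) (nhds z)"
    by eventually_elim (use eq in auto)
  have "((\<lambda>z. k) has_field_derivative
     (DW (c * z) / (c * z) * c - 0) * (qW q z - e) + (DW z / z - 0) * (qW q (c * z) - e)) (at z)"
    by (rule DERIV_cong_ev[THEN iffD1, OF refl ev refl D])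
  from DERIV_unique[OF this DERIV_const]
  have "(DW (c * z) * (qW q z - e) + (qW q (c * z) - e) * DW z) / z = 0"
    using \<open>c \<noteq> 0\<close> by (simp add: add_divide_distrib mult_ac)
  thus ?thesis using z0 by simp
qed

section \<open>The two isogenies: from nome q to sqrt q and to q^2\<close>

lemma nome_r: "nome r" using r by unfold_locales auto
lemma nome_q2: "nome (q\<^sup>2)" using q2 by unfold_locales auto
lemma nome_q3: "nome (q ^ 3)" using q3 by unfold_locales auto

lemma tdom_sqrt:
  assumes "z \<in> tdom r"
  shows "z \<in> tdom q" "of_real r * z \<in> tdom q"
proof -
  have pw: "(of_real q :: complex) powi n = of_real r powi (2 * n)" for n
    by (simp add: power_int_mult rc(2))
  have *: "z \<noteq> 0" "\<And>n. z \<noteq> of_real r powi n" using assms nome.tdom_iff_powi[OF nome_r] by auto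
  show "z \<in> tdom q" using * by (simp add: tdom_iff_powi pw)
  have "of_real r * z \<noteq> of_real q powi n" for n
  proof
    assume "of_real r * z = of_real q powi n"
    hence "z = of_real r powi (2 * n) / of_real r" using r by (simp add: pw field_simps)
    also have "\<dots> = of_real r powi (2 * n - 1)" using r by (simp add: power_int_diff)
    finally show False using * by blast
  qed
  thus "of_real r * z \<in> tdom q" using * r by (simp add: tdom_iff_powi)
qed

text \<open>The curve of nome sqrt q is the quotient of that of nome q by the point \<open>r\<close>
  of order two. Its function is the sum over the two points of a fibre, z and \<open>r\<close> z,
  which separates even and odd powers of \<open>r\<close>.\<close>

lemma qW_sqrt: "z \<in> tdom r \<Longrightarrow> qW r z = qW q z + qW q (of_real r * z)"
proof -
  assume z: "z \<in> tdom r"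
  interpret h: nome r by (rule nome_r)
  have z0: "z \<noteq> 0" "z \<in> qdom r" "of_real r / z \<in> qdom r" using z by (auto simp: h.tdom_iff)
  have "of_real r * (of_real r / z) = of_real q / z" using rc by simp
  moreover have "of_real q / (of_real r * z) = of_real r / z" using r z0 by (simp flip: rc(1))
  ultimately show ?thesis
    using qsum2_split2[OF r(1,2) z0(2)] qsum2_split2[OF r(1,2) z0(3)] r(4) by (simp add: qW_def rc(1))
qed

lemma DW_sqrt:
  assumes z: "z \<in> tdom r"
  shows "nome.DW r z = DW z + DW (of_real r * z)"
proof -
  interpret h: nome r by (rule nome_r)
  have z0: "z \<noteq> 0" using z by (auto simp: tdom_def)
  have "((\<lambda>z. qW q (of_real r * z)) has_field_derivative DW (of_real r * z) / (of_real r * z) * of_real r) (at z)"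
    by (rule DERIV_chain2[where f = "qW q" and g = "\<lambda>z. of_real r * z" and x = z])
       (use tdom_sqrt[OF z] qW_deriv_DW in \<open>auto intro!: derivative_eq_intros\<close>)
  from DERIV_add[OF qW_deriv_DW[OF tdom_sqrt(1)[OF z]] this]
  have D: "((\<lambda>z. qW q z + qW q (of_real r * z)) has_field_derivative DW z / z + DW (of_real r * z) / (of_real r * z) * of_real r) (at z)" .
  have "eventually (\<lambda>z. z \<in> tdom r) (nhds z)" using h.open_tdom z by (rule eventually_nhds_in_open)
  hence ev: "eventually (\<lambda>z. qW q z + qW q (of_real r * z) = qW r z) (nhds z)"
    by eventually_elim (simp add: qW_sqrt)
  have "h.DW z / z = DW z / z + DW (of_real r * z) / (of_real r * z) * of_real r"
    by (rule DERIV_unique[OF h.qW_deriv_DW[OF z] DERIV_cong_ev[THEN iffD1, OF refl ev refl D]])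
  thus ?thesis using z0 r by (simp add: field_simps)
qed

lemma DDW_sqrt:
  assumes z: "z \<in> tdom r"
  shows "nome.DDW r z = DDW z + DDW (of_real r * z)"
proof -
  interpret h: nome r by (rule nome_r)
  have z0: "z \<noteq> 0" using z by (auto simp: tdom_def)
  have "((\<lambda>z. DW (of_real r * z)) has_field_derivative DDW (of_real r * z) / (of_real r * z) * of_real r) (at z)"
    by (rule DERIV_chain2[where f = "DW" and g = "\<lambda>z. of_real r * z" and x = z])
       (use tdom_sqrt[OF z] DW_has_deriv in \<open>auto intro!: derivative_eq_intros\<close>)
  from DERIV_add[OF DW_has_deriv[OF tdom_sqrt(1)[OF z]] this]
  have D: "((\<lambda>z. DW z + DW (of_real r * z)) has_field_derivative DDW z / z + DDW (of_real r * z) / (of_real r * z) * of_real r) (at z)" .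
  have "eventually (\<lambda>z. z \<in> tdom r) (nhds z)" using h.open_tdom z by (rule eventually_nhds_in_open)
  hence ev: "eventually (\<lambda>z. DW z + DW (of_real r * z) = h.DW z) (nhds z)"
    by eventually_elim (simp add: DW_sqrt)
  have "h.DDW z / z = DDW z / z + DDW (of_real r * z) / (of_real r * z) * of_real r"
    by (rule DERIV_unique[OF h.DW_has_deriv[OF z] DERIV_cong_ev[THEN iffD1, OF refl ev refl D]])
  thus ?thesis using z0 r by (simp add: field_simps)
qed

lemma invariant_sqrt:
  "of_real (27 + hauptmodul r) = (DDW zeta3 + DDW (of_real r * zeta3)) ^ 3 / (DW zeta3 + DW (of_real r * zeta3)) ^ 4"
proof -
  interpret h: nome r by (rule nome_r)
  show ?thesis using h.invariant DW_sqrt[OF h.tdom_zeta3(1)] DDW_sqrt[OF h.tdom_zeta3(1)] by simp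
qed

lemma tdom_square:
  assumes "z \<in> tdom q" "- z \<in> tdom q"
  shows "z\<^sup>2 \<in> tdom (q\<^sup>2)"
proof -
  have *: "z \<noteq> 0" "\<And>n. z \<noteq> of_real q powi n" "\<And>n. - z \<noteq> of_real q powi n" using assms tdom_iff_powi by auto
  have "z\<^sup>2 \<noteq> of_real (q\<^sup>2) powi n" for n
  proof
    assume "z\<^sup>2 = of_real (q\<^sup>2) powi n"
    also have "of_real (q\<^sup>2) powi n = (of_real q powi n :: complex)\<^sup>2"
      by (simp add: power_int_power' power_int_power mult.commute)
    finally show False using *(2,3)[of n] by (auto simp: power2_eq_iff) 
  qed
  thus ?thesis using * nome.tdom_iff_powi[OF nome_q2] by simp
qed

text \<open>Squaring maps the curve of nome q onto that of nome q^2 with kernel 1, -1. The factor 4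
  arises because z d/dz doubles on functions of z^2 and \<open>qW\<close> involves it twice; the
  factors 8 and 16 for \<open>DW\<close> and \<open>DDW\<close> continue the pattern.\<close>

lemma qW_square: "z \<in> tdom q \<Longrightarrow> - z \<in> tdom q \<Longrightarrow> 4 * qW (q\<^sup>2) (z\<^sup>2) = qW q z + qW q (- z)"
proof -
  assume z: "z \<in> tdom q" "- z \<in> tdom q"
  have d: "z \<in> qdom q" "- z \<in> qdom q" "of_real q / z \<in> qdom q" "- (of_real q / z) \<in> qdom q"
    using z by (auto simp: tdom_iff)
  have "of_real (q\<^sup>2) / z\<^sup>2 = (of_real q / z)\<^sup>2" by (simp add: power_divide)
  thus ?thesis using qsum2_neg[OF q d(1,2)] qsum2_neg[OF q d(3,4)] by (simp add: qW_def algebra_simps)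
qed

lemma DW_square:
  assumes z: "z \<in> tdom q" "- z \<in> tdom q"
  shows "8 * nome.DW (q\<^sup>2) (z\<^sup>2) = DW z + DW (- z)"
proof -
  interpret h: nome "q\<^sup>2" by (rule nome_q2)
  have z0: "z \<noteq> 0" using z by (auto simp: tdom_def)
  have "((\<lambda>z. qW q (- z)) has_field_derivative DW (- z) / (- z) * (- 1)) (at z)"
    by (rule DERIV_chain2[where f = "qW q" and g = "\<lambda>z. - z" and x = z])
       (use z qW_deriv_DW[of "- z"] in \<open>auto intro!: derivative_eq_intros\<close>)
  from DERIV_add[OF qW_deriv_DW[OF z(1)] this]
  have D: "((\<lambda>z. qW q z + qW q (- z)) has_field_derivative DW z / z + DW (- z) / (- z) * (- 1)) (at z)" .
  have "((\<lambda>z. qW (q\<^sup>2) (z\<^sup>2)) has_field_derivative h.DW (z\<^sup>2) / z\<^sup>2 * (2 * z)) (at z)"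
    by (rule DERIV_chain2[where f = "qW (q\<^sup>2)" and g = "\<lambda>z. z\<^sup>2" and x = z])
       (use h.qW_deriv_DW tdom_square[OF z] in \<open>auto intro!: derivative_eq_intros\<close>)
  from DERIV_cmult[OF this, of 4]
  have D': "((\<lambda>z. 4 * qW (q\<^sup>2) (z\<^sup>2)) has_field_derivative 4 * (h.DW (z\<^sup>2) / z\<^sup>2 * (2 * z))) (at z)" .
  have "open (tdom q \<inter> uminus -` tdom q)"
    by (intro open_Int open_vimage open_tdom continuous_intros)
  hence "eventually (\<lambda>z. z \<in> tdom q \<inter> uminus -` tdom q) (nhds z)"
    by (rule eventually_nhds_in_open) (use z in auto)
  hence ev: "eventually (\<lambda>z. qW q z + qW q (- z) = 4 * qW (q\<^sup>2) (z\<^sup>2)) (nhds z)"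
    by eventually_elim (simp add: qW_square)
  have "4 * (h.DW (z\<^sup>2) / z\<^sup>2 * (2 * z)) = DW z / z + DW (- z) / (- z) * (- 1)"
    by (rule DERIV_unique[OF D' DERIV_cong_ev[THEN iffD1, OF refl ev refl D]])
  thus ?thesis using z0 by (simp add: field_simps power2_eq_square)
qed

lemma DDW_square:
  assumes z: "z \<in> tdom q" "- z \<in> tdom q"
  shows "16 * nome.DDW (q\<^sup>2) (z\<^sup>2) = DDW z + DDW (- z)"
proof -
  interpret h: nome "q\<^sup>2" by (rule nome_q2)
  have z0: "z \<noteq> 0" using z by (auto simp: tdom_def)
  have "((\<lambda>z. DW (- z)) has_field_derivative DDW (- z) / (- z) * (- 1)) (at z)"
    by (rule DERIV_chain2[where f = "DW" and g = "\<lambda>z. - z" and x = z])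
       (use z DW_has_deriv[of "- z"] in \<open>auto intro!: derivative_eq_intros\<close>)
  from DERIV_add[OF DW_has_deriv[OF z(1)] this]
  have D: "((\<lambda>z. DW z + DW (- z)) has_field_derivative DDW z / z + DDW (- z) / (- z) * (- 1)) (at z)" .
  have "((\<lambda>z. h.DW (z\<^sup>2)) has_field_derivative h.DDW (z\<^sup>2) / z\<^sup>2 * (2 * z)) (at z)"
    by (rule DERIV_chain2[where f = "h.DW" and g = "\<lambda>z. z\<^sup>2" and x = z])
       (use h.DW_has_deriv tdom_square[OF z] in \<open>auto intro!: derivative_eq_intros\<close>)
  from DERIV_cmult[OF this, of 8]
  have D': "((\<lambda>z. 8 * h.DW (z\<^sup>2)) has_field_derivative 8 * (h.DDW (z\<^sup>2) / z\<^sup>2 * (2 * z))) (at z)" .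
  have "open (tdom q \<inter> uminus -` tdom q)"
    by (intro open_Int open_vimage open_tdom continuous_intros)
  hence "eventually (\<lambda>z. z \<in> tdom q \<inter> uminus -` tdom q) (nhds z)"
    by (rule eventually_nhds_in_open) (use z in auto)
  hence ev: "eventually (\<lambda>z. DW z + DW (- z) = 8 * h.DW (z\<^sup>2)) (nhds z)"
    by eventually_elim (simp add: DW_square)
  have "8 * (h.DDW (z\<^sup>2) / z\<^sup>2 * (2 * z)) = DDW z / z + DDW (- z) / (- z) * (- 1)"
    by (rule DERIV_unique[OF D' DERIV_cong_ev[THEN iffD1, OF refl ev refl D]])
  thus ?thesis using z0 by (simp add: field_simps power2_eq_square)
qed

lemma tdom_m_zeta3: "- zeta3 \<in> tdom q" "of_real r * zeta3 \<in> tdom q" "- of_real r * zeta3 \<in> tdom q"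
  using r by (intro tdom_not_real; simp add: zeta3_def complex_is_Real_iff)+

lemma invariant_square:
  "of_real (27 + hauptmodul (q\<^sup>2)) = (DDW zeta3 + DDW (- zeta3)) ^ 3 / (DW zeta3 + DW (- zeta3)) ^ 4"
proof -
  interpret h: nome "q\<^sup>2" by (rule nome_q2)
  define X Y where "X = DW zeta3 + DW (- zeta3)" and "Y = DDW zeta3 + DDW (- zeta3)"
  \<comment> \<open>Squaring sends \<open>zeta3\<close> to its inverse. \<open>DDW\<close> takes the
    same value there, while \<open>DW\<close> changes sign, which the fourth power absorbs.\<close>
  have 1: "h.DDW zeta3 = Y / 16"
    using DDW_square[OF tdom_zeta3(1) tdom_m_zeta3(1)] h.DDW_zeta3_sq by (simp add: Y_def mult.commute)
  have "h.DW zeta3 = - (8 * h.DW (zeta3\<^sup>2)) / 8" using h.DW_zeta3_sq by simp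
  hence 2: "h.DW zeta3 = - (X / 8)"
    unfolding DW_square[OF tdom_zeta3(1) tdom_m_zeta3(1)] unfolding X_def by (metis minus_divide_left)
  \<comment> \<open>The normalising factors cancel because 16^3 = 8^4.\<close>
  have "(Y / 16) ^ 3 / (- (X / 8)) ^ 4 = Y ^ 3 / X ^ 4" by (simp add: power_divide)
  thus ?thesis unfolding h.invariant 1 2 X_def Y_def .
qed

end

section \<open>Eisenstein series and eta quotients\<close>

text \<open>Tonelli's theorem for ordered series. It converts series of rational functions of powers
  of \<open>q\<close> into Lambert series, where expanding a summand and exchanging the order leaves
  geometric series.\<close>

lemma double_sums_swap:
  fixes a :: "nat \<Rightarrow> nat \<Rightarrow> real"
  assumes nonneg: "\<And>m k. a m k \<ge> 0" and row: "\<And>m. a m sums b m" and tot: "b sums c"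
    and col: "\<And>k. (\<lambda>m. a m k) sums d k"
  shows "d sums c"
proof -
  have row': "(a m has_sum b m) UNIV" for m using row nonneg by (intro sums_nonneg_imp_has_sum) auto
  have bn: "b m \<ge> 0" for m using row' nonneg by (rule has_sum_nonneg)
  have col': "((\<lambda>m. a m k) has_sum d k) UNIV" for k using col nonneg by (intro sums_nonneg_imp_has_sum) auto
  have tot': "(b has_sum c) UNIV" using tot bn by (intro sums_nonneg_imp_has_sum) auto
  have inf: "infsum (\<lambda>k. norm (a m k)) UNIV = b m" for m
    using row'[of m] nonneg by (simp add: infsumI)
  have "(\<lambda>x. norm ((\<lambda>(m, k). a m k) x)) summable_on (UNIV \<times> UNIV)"
  proof (rule Infinite_Sum.abs_summable_on_Sigma_iff[THEN iffD2], intro conjI ballI)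
    show "(\<lambda>k. norm (case (m, k) of (m, k) \<Rightarrow> a m k)) summable_on UNIV" for m
      using row'[of m] nonneg by (simp add: has_sum_imp_summable)
    show "(\<lambda>m. norm (\<Sum>\<^sub>\<infinity>k. norm (case (m, k) of (m, k) \<Rightarrow> a m k))) summable_on UNIV"
      using tot' bn inf by (simp add: has_sum_imp_summable)
  qed
  hence summ: "(\<lambda>(m, k). a m k) summable_on (UNIV \<times> UNIV)" by (rule abs_summable_summable)
  hence "((\<lambda>(m, k). a m k) has_sum c) (UNIV \<times> UNIV)"
    using infsum_Sigma'_banach[OF summ] row' tot' by (metis (mono_tags, lifting) has_sum_infsum infsumI infsum_cong)
  hence swap: "((\<lambda>(k, m). a m k) has_sum c) (UNIV \<times> UNIV)"
    by (subst has_sum_swap) (simp add: case_prod_unfold)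
  have "(d has_sum c) UNIV"
    by (rule has_sum_SigmaD[OF swap]) (use col' in auto)
  thus ?thesis by (rule has_sum_imp_sums)
qed

lemma second_geometric_sums:
  fixes x :: real
  assumes "\<bar>x\<bar> < 1"
  shows "(\<lambda>n. real (Suc n) ^ 2 * x ^ Suc n) sums (x * (1 + x) / (1 - x) ^ 3)"
proof -
  have "(\<lambda>n. diffs (\<lambda>n. of_nat (Suc n)) n * x ^ n) sums (2 / (1 - x) ^ 3)"
  proof (rule termdiffs_sums_strong)
    fix z :: real assume "norm z < 1"
    thus "(\<lambda>n. of_nat (Suc n) * z ^ n) sums (1 / (1 - z)\<^sup>2)" by (rule geometric_deriv_sums)
  next
    have "1 - x \<noteq> 0" using assms by auto
    thus "((\<lambda>z. 1 / (1 - z)\<^sup>2) has_field_derivative 2 / (1 - x) ^ 3) (at x)"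
      by (auto intro!: derivative_eq_intros simp: divide_simps eval_nat_numeral)
  qed (use assms in auto)
  from sums_mult[OF sums_diff[OF this geometric_deriv_sums[of x]], of x] assms
  have "(\<lambda>n. x * (diffs (\<lambda>n. of_nat (Suc n)) n * x ^ n - of_nat (Suc n) * x ^ n)) sums (x * (2 / (1 - x) ^ 3 - 1 / (1 - x)\<^sup>2))"
    by simp
  also have "(\<lambda>n. x * (diffs (\<lambda>n. of_nat (Suc n)) n * x ^ n - of_nat (Suc n) * x ^ n)) = (\<lambda>n. real (Suc n) ^ 2 * x ^ Suc n)"
    by (rule ext) (simp add: diffs_def algebra_simps power2_eq_square)
  also have "x * (2 / (1 - x) ^ 3 - 1 / (1 - x)\<^sup>2) = x * (1 + x) / (1 - x) ^ 3"
  proof -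
    have "1 - x \<noteq> 0" using assms by auto
    hence "1 / (1 - x)\<^sup>2 = (1 - x) / (1 - x) ^ 3" by (simp add: power2_eq_square power3_eq_cube)
    thus ?thesis by (simp add: diff_divide_distrib[symmetric])
  qed
  finally show ?thesis .
qed

context nome
begin

lemma q_pow_less: "q ^ Suc n < 1" "0 < q ^ Suc n"
  using q by (auto simp: power_Suc_less_one simp del: power_Suc)

lemma sig_sums: "(\<lambda>n. q ^ Suc n / (1 - q ^ Suc n)\<^sup>2) sums sig q"
proof -
  have "of_real q \<in> qdom q" using qdom_of_real[of q] q by simp
  from sums_Re[OF qsum2_props(1)[OF q this]]
  have "(\<lambda>n. Re ((of_real (q ^ n) * of_real q) / (1 - of_real (q ^ n) * of_real q)\<^sup>2)) sums sig q"
    unfolding sig_def .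
  also have "(\<lambda>n. Re ((of_real (q ^ n) * of_real q) / (1 - of_real (q ^ n) * of_real q)\<^sup>2)) = (\<lambda>n. q ^ Suc n / (1 - q ^ Suc n)\<^sup>2)"
  proof
    fix n
    have "(of_real (q ^ n) * of_real q) / (1 - of_real (q ^ n) * of_real q)\<^sup>2 = complex_of_real (q ^ Suc n / (1 - q ^ Suc n)\<^sup>2)"
      by (simp add: mult.commute)
    thus "Re ((of_real (q ^ n) * of_real q) / (1 - of_real (q ^ n) * of_real q)\<^sup>2) = q ^ Suc n / (1 - q ^ Suc n)\<^sup>2"
      by (simp only: Re_complex_of_real)
  qed
  finally show ?thesis .
qed

lemma sig_lambert: "(\<lambda>k. real (Suc k) * q ^ Suc k / (1 - q ^ Suc k)) sums sig q"
proof (rule double_sums_swap[OF _ _ sig_sums])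
  fix m k :: nat
  show "real (Suc k) * (q ^ Suc m) ^ Suc k \<ge> 0" using q by simp
next
  fix m
  have "norm (q ^ Suc m) < 1" using q_pow_less[of m] by simp
  from sums_mult[OF geometric_deriv_sums[OF this], of "q ^ Suc m"]
  show "(\<lambda>k. real (Suc k) * (q ^ Suc m) ^ Suc k) sums (q ^ Suc m / (1 - q ^ Suc m)\<^sup>2)"
    by (simp add: mult_ac)
next
  fix k
  have "norm (q ^ Suc k) < 1" using q_pow_less[of k] by simp
  from sums_mult[OF geometric_sums[OF this], of "real (Suc k) * q ^ Suc k"]
  have "(\<lambda>m. real (Suc k) * q ^ Suc k * (q ^ Suc k) ^ m) sums (real (Suc k) * q ^ Suc k / (1 - q ^ Suc k))"
    by simp
  also have "(\<lambda>m. real (Suc k) * q ^ Suc k * (q ^ Suc k) ^ m) = (\<lambda>m. real (Suc k) * (q ^ Suc m) ^ Suc k)"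
  proof
    fix m
    have "q ^ Suc k * (q ^ Suc k) ^ m = (q ^ Suc k) ^ Suc m" by simp
    also have "\<dots> = (q ^ Suc m) ^ Suc k" by (simp only: power_mult[symmetric] mult.commute)
    finally have "q ^ Suc k * (q ^ Suc k) ^ m = (q ^ Suc m) ^ Suc k" .
    thus "real (Suc k) * q ^ Suc k * (q ^ Suc k) ^ m = real (Suc k) * (q ^ Suc m) ^ Suc k" by (simp only: mult.assoc)
  qed
  finally show "(\<lambda>m. real (Suc k) * (q ^ Suc m) ^ Suc k) sums (real (Suc k) * q ^ Suc k / (1 - q ^ Suc k))" .
qed

lemma ln_eul_sums: "(\<lambda>n. ln (1 - q ^ Suc n)) sums ln (eul q)"
proof -
  have "(\<lambda>N. Re (\<Prod>n<N. 1 - of_real (q ^ n) * of_real q)) \<longlonglongrightarrow> eul q"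
    unfolding eul_def by (intro tendsto_intros qprod_LIMSEQ q)
  also have "(\<lambda>N. Re (\<Prod>n<N. 1 - of_real (q ^ n) * of_real q)) = (\<lambda>N. \<Prod>n<N. 1 - q ^ Suc n)"
  proof
    fix N
    have "(\<Prod>n<N. 1 - of_real (q ^ n) * of_real q) = complex_of_real (\<Prod>n<N. 1 - q ^ Suc n)"
      by (simp add: mult.commute)
    thus "Re (\<Prod>n<N. 1 - of_real (q ^ n) * of_real q) = (\<Prod>n<N. 1 - q ^ Suc n)" by (simp only: Re_complex_of_real)
  qed
  finally have "(\<lambda>N. ln (\<Prod>n<N. 1 - q ^ Suc n)) \<longlonglongrightarrow> ln (eul q)"
    using eul_pos by (intro tendsto_ln) auto
  moreover have "ln (\<Prod>n<N. 1 - q ^ Suc n) = (\<Sum>n<N. ln (1 - q ^ Suc n))" for N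
  proof (intro ln_prod)
    fix i show "1 - q ^ Suc i \<noteq> 0" using q_pow_less(1)[of i] by linarith
  qed auto
  ultimately show ?thesis by (simp add: sums_def)
qed

lemma eul_deriv: "(eul has_real_derivative - eul q * sig q / q) (at q)"
proof -
  define b where "b = (1 + q) / 2"
  have b: "q < b" "0 < b" "b < 1" using q by (auto simp: b_def)
  define f' where "f' = (\<lambda>n x. - (real (Suc n) * x ^ n) / (1 - x ^ Suc n))"
  have pw: "x ^ Suc n \<le> b" "x ^ Suc n < 1" "0 < x ^ Suc n" if "x \<in> {q/2..b}" for x n
  proof -
    have "0 < x" "x \<le> b" using that q by auto
    have "x ^ Suc n \<le> x ^ 1" by (rule power_decreasing) (use \<open>0 < x\<close> \<open>x \<le> b\<close> b in auto)
    thus "x ^ Suc n \<le> b" "x ^ Suc n < 1" using \<open>x \<le> b\<close> b by auto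
    show "0 < x ^ Suc n" using \<open>0 < x\<close> by simp
  qed
  have D: "((\<lambda>x. \<Sum>n. ln (1 - x ^ Suc n)) has_field_derivative (\<Sum>n. f' n q)) (at q)"
  proof (rule has_field_derivative_series'(2)[where S = "{q/2..b}" and x0 = q])
    fix n x assume x: "x \<in> {q/2..b}"
    show "((\<lambda>x. ln (1 - x ^ Suc n)) has_field_derivative f' n x) (at x within {q/2..b})"
      using pw(2)[OF x, of n] unfolding f'_def
      by (auto intro!: derivative_eq_intros simp del: power_Suc simp: divide_simps)
  next
    show "uniformly_convergent_on {q/2..b} (\<lambda>n x. \<Sum>i<n. f' i x)"
    proof (rule Weierstrass_m_test')
      show "summable (\<lambda>n. real (Suc n) * b ^ n / (1 - b))"
        using geometric_deriv_sums[of b] b by (intro summable_divide) (auto simp: sums_iff)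
      fix n x assume x: "x \<in> {q/2..b}"
      have "x > 0" using x q by auto
      have "real (Suc n) * x ^ n / (1 - x ^ Suc n) \<le> real (Suc n) * b ^ n / (1 - b)"
        using pw[OF x, of n] x b \<open>x > 0\<close> by (intro frac_le mult_left_mono power_mono) auto
      moreover have "norm (f' n x) = real (Suc n) * x ^ n / (1 - x ^ Suc n)"
        using pw[OF x, of n] \<open>x > 0\<close> by (simp add: f'_def abs_mult del: power_Suc)
      ultimately show "norm (f' n x) \<le> real (Suc n) * b ^ n / (1 - b)" by simp
    qed
  next
    show "convex {q/2..b}" "q \<in> {q/2..b}" using q b by auto
    show "summable (\<lambda>n. ln (1 - q ^ Suc n))" using ln_eul_sums by (simp only: sums_iff)
    show "q \<in> interior {q/2..b}" using q b by (simp add: interior_atLeastAtMost_real)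
  qed
  have s: "(\<Sum>n. f' n q) = - (sig q / q)"
  proof -
    have "(\<lambda>n. - (real (Suc n) * q ^ Suc n / (1 - q ^ Suc n) / q)) sums - (sig q / q)"
      by (intro sums_minus sums_divide sig_lambert)
    moreover have "(\<lambda>n. - (real (Suc n) * q ^ Suc n / (1 - q ^ Suc n) / q)) = (\<lambda>n. f' n q)"
      using q by (intro ext) (simp add: f'_def)
    ultimately show ?thesis by (simp add: sums_iff)
  qed
  have "eventually (\<lambda>x. x \<in> {0<..<1}) (nhds q)" using q by (intro eventually_nhds_in_open) auto
  hence ev: "eventually (\<lambda>x. exp (\<Sum>n. ln (1 - x ^ Suc n)) = eul x) (nhds q)"
  proof eventually_elim
    case (elim x)
    then interpret x: nome x by unfold_locales auto
    show ?case using x.ln_eul_sums x.eul_pos by (simp add: sums_iff)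
  qed
  have "((\<lambda>x. exp (\<Sum>n. ln (1 - x ^ Suc n))) has_field_derivative exp (\<Sum>n. ln (1 - q ^ Suc n)) * (\<Sum>n. f' n q)) (at q)"
    by (rule DERIV_fun_exp[OF D])
  hence "(eul has_field_derivative exp (\<Sum>n. ln (1 - q ^ Suc n)) * (\<Sum>n. f' n q)) (at q)"
    by (rule DERIV_cong_ev[THEN iffD1, OF refl ev refl])
  moreover have "exp (\<Sum>n. ln (1 - q ^ Suc n)) = eul q" using ln_eul_sums eul_pos by (simp add: sums_iff)
  ultimately show ?thesis by (simp add: s)
qed

text \<open>Each \<open>eul\<close> contributes minus \<open>sig\<close> to the logarithmic
  derivative q d/dq, so the total is 1 + 12 sig(q) - 36 sig(q^3), identified by
  \<open>A_sq\<close>.\<close>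

lemma hauptmodul_deriv: "(hauptmodul has_real_derivative hauptmodul q * (A\<^sup>2 / 3) / q) (at q)"
proof -
  interpret c: nome "q ^ 3" by (rule nome_q3)
  let ?e = "eul q" and ?f = "eul (q ^ 3)"
  have ne: "?e \<noteq> 0" "?f \<noteq> 0" "q \<noteq> 0" using eul_pos c.eul_pos q by auto
  have d3: "((\<lambda>q. eul (q ^ 3)) has_real_derivative (- ?f * sig (q ^ 3) / q ^ 3) * (3 * q\<^sup>2)) (at q)"
    by (rule DERIV_chain2[where f = eul and g = "\<lambda>q. q ^ 3" and x = q])
       (use c.eul_deriv in \<open>auto intro!: derivative_eq_intros\<close>)
  define v where "v = ((- ?f * sig (q ^ 3) / q ^ 3) * (3 * q\<^sup>2) * ?e - ?f * (- ?e * sig q / q)) / (?e * ?e)"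
  have "((\<lambda>q. eul (q ^ 3) / eul q) has_real_derivative v) (at q)"
    unfolding v_def by (rule DERIV_divide d3 eul_deriv ne)+
  from DERIV_mult[OF DERIV_cmult_Id DERIV_power[OF this, of 12]]
  have dd: "((\<lambda>q. 729 * q * (eul (q ^ 3) / eul q) ^ 12) has_real_derivative
     (729 * (?f / ?e) ^ 12 + real 12 * (v * (?f / ?e) ^ (12 - Suc 0)) * (729 * q))) (at q)" .
  define R where "R = ?f / ?e"
  have v: "v = R * (sig q - 3 * sig (q ^ 3)) / q"
    unfolding v_def R_def using ne by (simp add: field_simps eval_nat_numeral)
  have "729 * R ^ 12 + real 12 * (v * R ^ (12 - Suc 0)) * (729 * q) = 729 * R ^ 12 * (1 + 12 * (sig q - 3 * sig (q ^ 3)))"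
  proof -
    have "v * (729 * q) = 729 * R * (sig q - 3 * sig (q ^ 3))" unfolding v using ne by simp
    hence "729 * R ^ 12 + real 12 * (v * R ^ (12 - Suc 0)) * (729 * q) =
        729 * R ^ 12 + 12 * R ^ 11 * (729 * R * (sig q - 3 * sig (q ^ 3)))" by simp
    thus ?thesis by (simp add: algebra_simps eval_nat_numeral)
  qed
  also have "\<dots> = hauptmodul q * (A\<^sup>2 / 3) / q"
    unfolding A_sq hauptmodul_def R_def using ne by simp
  finally show ?thesis using dd by (simp add: hauptmodul_def [abs_def] R_def)
qed

lemma DW_qsum3:
  assumes z: "z \<in> tdom q"
  shows "DW z = qsum3 q z - qsum3 q (of_real q / z)"
proof -
  have zz: "z \<in> qdom q" "of_real q / z \<in> qdom q" "z \<noteq> 0" using z by (auto simp: tdom_iff)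
  have "((\<lambda>z. qsum2 q (of_real q / z)) has_field_derivative deriv (qsum2 q) (of_real q / z) * (- of_real q / z\<^sup>2)) (at z)"
    by (rule DERIV_chain2[where f = "qsum2 q" and g = "\<lambda>z. of_real q / z" and x = z])
       (use zz qsum2_props(3)[OF q] in \<open>auto intro!: derivative_eq_intros simp: power2_eq_square\<close>)
  from DERIV_add[OF qsum2_props(3)[OF q zz(1)] this]
  have "(qW q has_field_derivative deriv (qsum2 q) z + deriv (qsum2 q) (of_real q / z) * (- of_real q / z\<^sup>2)) (at z)"
    by (simp add: qW_def [abs_def])
  from DERIV_unique[OF this qW_deriv_DW[OF z]]
  have "DW z = z * (deriv (qsum2 q) z + deriv (qsum2 q) (of_real q / z) * (- of_real q / z\<^sup>2))"
    using zz by simp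
  also have "\<dots> = z * deriv (qsum2 q) z - of_real q / z * deriv (qsum2 q) (of_real q / z)"
    using zz by (simp add: field_simps power2_eq_square)
  also have "\<dots> = qsum3 q z - qsum3 q (of_real q / z)"
    by (simp only: qsum2_props(6)[OF q zz(1)] qsum2_props(6)[OF q zz(2)])
  finally show ?thesis .
qed

text \<open>The derivative \<open>DW\<close> of nome q^3 at the point z = q is evaluated twice. As a
  theta quotient it is the eta quotient on the right, since the residue classes mod 3 of
  \<open>qprod_split3\<close> reassemble. As a difference of two series \<open>qsum3\<close> it
  expands into a double series whose columns are the terms on the left.\<close>

lemma eisenstein_sums:
  "(\<lambda>k. real (Suc k) ^ 2 * (q ^ Suc k / (1 + q ^ Suc k + (q ^ Suc k)\<^sup>2))) sums (q * eul (q ^ 3) ^ 9 / eul q ^ 3)"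
proof -
  interpret c: nome "q ^ 3" by (rule nome_q3)
  have lt: "q ^ 3 < q" "q ^ 3 < q\<^sup>2" "q\<^sup>2 < 1" "q < 1" "0 < q\<^sup>2"
    using q power_strict_decreasing[of 1 3 q] power_strict_decreasing[of 2 3 q] q2 by auto
  have dom: "of_real q \<in> tdom (q ^ 3)" using lt q by (intro c.tdom_annulus) auto
  have qd: "of_real q \<in> qdom (q ^ 3)" "(of_real q)\<^sup>2 \<in> qdom (q ^ 3)"
    using c.qdom_of_real[of q] c.qdom_of_real[of "q\<^sup>2"] lt by auto
  have dv: "of_real (q ^ 3) / of_real q = (of_real q :: complex)\<^sup>2" "of_real (q ^ 3) / (of_real q)\<^sup>2 = complex_of_real q"
    using q by (simp_all add: eval_nat_numeral)
  have s3: "Q = qprod (q ^ 3) (of_real q) * qprod (q ^ 3) ((of_real q)\<^sup>2) * c.Q"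
    using qprod_split3[OF q, of "of_real q"] by (simp add: mult_ac eval_nat_numeral)
  have th: "qtheta (q ^ 3) (of_real q) = Q / c.Q" "qtheta (q ^ 3) ((of_real q)\<^sup>2) = Q / c.Q"
    unfolding qtheta_def dv s3 using c.Q_nonzero by simp_all
  have "c.DW (of_real q) = of_real q * c.Q ^ 6 * (Q / c.Q) / (Q / c.Q) ^ 4"
    unfolding c.DW_def th ..
  also have "\<dots> = of_real (q * eul (q ^ 3) ^ 9 / eul q ^ 3)"
    unfolding Q_eul c.Q_eul using eul_pos c.eul_pos by (simp add: field_simps eval_nat_numeral)
  finally have DW1: "c.DW (of_real q) = of_real (q * eul (q ^ 3) ^ 9 / eul q ^ 3)" .
  define g where "g = (\<lambda>x::real. x * (1 + x) / (1 - x) ^ 3)"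
  define x where "x = (\<lambda>m. (q ^ 3) ^ m * q)"
  define y where "y = (\<lambda>m. (q ^ 3) ^ m * q\<^sup>2)"
  have xy: "0 < y m" "y m \<le> x m" "x m < 1" for m
  proof -
    have "(q ^ 3) ^ m \<le> 1" "0 < (q ^ 3) ^ m" using q3 by (auto intro: power_le_one)
    moreover have "q\<^sup>2 \<le> q" using q by (simp add: power2_eq_square)
    moreover have xl: "(q ^ 3) ^ m * q \<le> 1 * q" using calculation q by (intro mult_right_mono) auto
    ultimately show "0 < y m" "y m \<le> x m" using q by (auto simp: x_def y_def)
    show "x m < 1" unfolding x_def using xl q by linarith
  qed
  have sx: "(\<lambda>m. complex_of_real (g (x m))) sums qsum3 (q ^ 3) (of_real q)"
    using c.q qsum2_props(5,6)[OF c.q qd(1)] by (simp add: g_def x_def)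
  have sy: "(\<lambda>m. complex_of_real (g (y m))) sums qsum3 (q ^ 3) ((of_real q)\<^sup>2)"
    using c.q qsum2_props(5,6)[OF c.q qd(2)] by (simp add: g_def y_def)
  have "(\<lambda>m. complex_of_real (g (x m) - g (y m))) sums c.DW (of_real q)"
    unfolding c.DW_qsum3[OF dom] dv using sums_diff[OF sx sy] by simp
  hence tot: "(\<lambda>m. g (x m) - g (y m)) sums (q * eul (q ^ 3) ^ 9 / eul q ^ 3)"
    unfolding DW1 by (simp only: sums_of_real_iff)
  show ?thesis
  proof (rule double_sums_swap[OF _ _ tot])
    fix m k
    have "y m ^ Suc k \<le> x m ^ Suc k" using xy[of m] by (intro power_mono) auto
    thus "0 \<le> real (Suc k) ^ 2 * x m ^ Suc k - real (Suc k) ^ 2 * y m ^ Suc k"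
      by (simp add: mult_left_mono del: power_Suc)
  next
    fix m
    have "\<bar>x m\<bar> < 1" "\<bar>y m\<bar> < 1" using xy[of m] by auto
    thus "(\<lambda>k. real (Suc k) ^ 2 * x m ^ Suc k - real (Suc k) ^ 2 * y m ^ Suc k) sums (g (x m) - g (y m))"
      unfolding g_def by (intro sums_diff second_geometric_sums)
  next
    fix k
    define w where "w = q ^ Suc k"
    have w: "0 < w" "w < 1" using q_pow_less by (auto simp: w_def)
    have w3: "norm (w ^ 3) < 1" using w by (simp add: power_less_one_iff)
    \<comment> \<open>Column k consists of the powers of w with exponent 1 mod 3 minus those with
      exponent 2 mod 3, weighted by the square of the index: the nontrivial character mod 3.\<close>
    have "1 - w ^ 3 = (1 - w) * (1 + w + w\<^sup>2)" by (simp add: algebra_simps eval_nat_numeral)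
    moreover have "w - w\<^sup>2 = w * (1 - w)" by (simp add: algebra_simps power2_eq_square)
    ultimately have e: "(w - w\<^sup>2) / (1 - w ^ 3) = w / (1 + w + w\<^sup>2)" using w by simp
    from sums_mult[OF geometric_sums[OF w3], of "real (Suc k) ^ 2 * (w - w\<^sup>2)"]
    have "(\<lambda>m. real (Suc k) ^ 2 * (w - w\<^sup>2) * (w ^ 3) ^ m) sums (real (Suc k) ^ 2 * (w / (1 + w + w\<^sup>2)))"
      unfolding e[symmetric] by simp
    also have "(\<lambda>m. real (Suc k) ^ 2 * (w - w\<^sup>2) * (w ^ 3) ^ m) = 
       (\<lambda>m. real (Suc k) ^ 2 * x m ^ Suc k - real (Suc k) ^ 2 * y m ^ Suc k)"
    proof
      fix m
      have p: "((q ^ 3) ^ m) ^ Suc k = (w ^ 3) ^ m"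
        unfolding w_def by (simp only: power_mult[symmetric] mult_ac)
      have "x m ^ Suc k = (w ^ 3) ^ m * w" unfolding x_def power_mult_distrib p w_def ..
      moreover have "y m ^ Suc k = (w ^ 3) ^ m * w\<^sup>2"
      proof -
        have "(q\<^sup>2) ^ Suc k = w\<^sup>2" unfolding w_def by (simp only: power_mult[symmetric] mult.commute)
        thus ?thesis unfolding y_def power_mult_distrib p by simp
      qed
      ultimately show "real (Suc k) ^ 2 * (w - w\<^sup>2) * (w ^ 3) ^ m =
        real (Suc k) ^ 2 * x m ^ Suc k - real (Suc k) ^ 2 * y m ^ Suc k" by (simp add: algebra_simps)
    qed
    finally show "(\<lambda>m. real (Suc k) ^ 2 * x m ^ Suc k - real (Suc k) ^ 2 * y m ^ Suc k) sums
       (real (Suc k) ^ 2 * (q ^ Suc k / (1 + q ^ Suc k + (q ^ Suc k)\<^sup>2)))" by (simp only: w_def)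
  qed
qed

end

section \<open>The Mahler measure by Jensen's formula\<close>

text \<open>By compactness \<open>h\<close> is still free of zeros on a slightly larger disc, where
  it has a holomorphic logarithm; the claim is the real part of the mean value property for that
  logarithm.\<close>

lemma jensen_zero_free:
  assumes h: "h holomorphic_on UNIV" and nz: "\<And>z. norm z \<le> 1 \<Longrightarrow> h z \<noteq> 0"
  shows "(LBINT t=0..1. ln (norm (h (exp (2 * of_real pi * \<i> * of_real t))))) = ln (norm (h 0))"
proof -
  have cont: "continuous_on UNIV h" using h by (rule holomorphic_on_imp_continuous_on)
  hence op: "open (h -` (- {0}))" by (intro open_vimage) auto
  have sub0: "cball 0 1 \<subseteq> h -` (- {0})" using nz by auto
  obtain e where e: "e > 0" "(\<Union>x\<in>cball 0 1. ball x e) \<subseteq> h -` (- {0})"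
    using compact_subset_open_imp_ball_epsilon_subset[OF compact_cball op sub0] by blast
  have nz': "h z \<noteq> 0" if z: "z \<in> ball 0 (1 + e)" for z
  proof (cases "norm z \<le> 1")
    case False
    define w where "w = z / of_real (norm z)"
    have "norm w = 1" using False by (auto simp: w_def norm_divide)
    moreover have "z = of_real (norm z) * w" using False by (auto simp: w_def)
    hence "w - z = of_real (1 - norm z) * w" by (metis left_diff_distrib mult_1 of_real_1 of_real_diff)
    hence "norm (w - z) = norm z - 1" using False \<open>norm w = 1\<close> by (simp add: norm_mult del: of_real_diff)
    hence "z \<in> ball w e" using z by (simp add: dist_norm)
    ultimately have "z \<in> (\<Union>x\<in>cball 0 1. ball x e)" by (intro UN_I[of w]) auto
    with e(2) show ?thesis by blast
  qed (use nz in auto)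
  obtain L where L: "L holomorphic_on ball 0 (1 + e)" "\<And>z. z \<in> ball 0 (1 + e) \<Longrightarrow> exp (L z) = h z"
    using holomorphic_logarithm_exists[of "ball 0 (1 + e)" h 0] h nz' e(1) holomorphic_on_subset[OF h] by auto
  have sub: "cball 0 1 \<subseteq> ball (0::complex) (1 + e)" using e(1) by auto
  have "((\<lambda>w. L w / (w - 0)) has_contour_integral 2 * of_real pi * \<i> * L 0) (circlepath 0 1)"
    by (rule Cauchy_integral_circlepath_simple) (use holomorphic_on_subset[OF L(1) sub] in auto)
  hence "((\<lambda>t. L (circlepath 0 1 t) / (circlepath 0 1 t - 0) * vector_derivative (circlepath 0 1) (at t))
      has_integral 2 * of_real pi * \<i> * L 0) {0..1}"
    unfolding has_contour_integral .
  hence "((\<lambda>t. 2 * of_real pi * \<i> * L (exp (2 * of_real pi * \<i> * of_real t))) has_integral 2 * of_real pi * \<i> * L 0) {0..1}"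
    by (rule has_integral_eq[rotated]) (subst vector_derivative_circlepath, simp add: circlepath)
  hence "((\<lambda>t. (2 * of_real pi * \<i> * L (exp (2 * of_real pi * \<i> * of_real t))) / (2 * of_real pi * \<i>)) has_integral 
     (2 * of_real pi * \<i> * L 0) / (2 * of_real pi * \<i>)) {0..1}"
    by (intro has_integral_divide)
  hence "((\<lambda>t. L (exp (2 * of_real pi * \<i> * of_real t))) has_integral L 0) {0..1}" by simp
  hence 1: "((\<lambda>t. Re (L (exp (2 * of_real pi * \<i> * of_real t)))) has_integral Re (L 0)) {0..1}"
    by (rule has_integral_Re)
  have inb: "exp (2 * of_real pi * \<i> * of_real t) \<in> ball (0::complex) (1 + e)" for t :: real
    using e(1) by simp
  have ln: "Re (L z) = ln (norm (h z))" if "z \<in> ball 0 (1 + e)" for z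
    using L(2)[OF that] by (metis norm_exp_eq_Re ln_exp)
  have "continuous_on {0..1} (\<lambda>t. ln (norm (h (exp (2 * of_real pi * \<i> * of_real t)))))"
    using nz by (intro continuous_intros continuous_on_compose2[OF cont]) auto
  hence "set_integrable lborel {0..1} (\<lambda>t. ln (norm (h (exp (2 * of_real pi * \<i> * of_real t)))))"
    by (rule borel_integrable_atLeastAtMost')
  from interval_integral_eq_integral[OF _ this]
  have "(LBINT t=0..1. ln (norm (h (exp (2 * of_real pi * \<i> * of_real t))))) = integral {0..1} (\<lambda>t. ln (norm (h (exp (2 * of_real pi * \<i> * of_real t)))))"
    by (simp add: zero_ereal_def one_ereal_def)
  also have "\<dots> = integral {0..1} (\<lambda>t. Re (L (exp (2 * of_real pi * \<i> * of_real t))))"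
    using ln[OF inb] by simp
  also have "\<dots> = ln (norm (h 0))" using 1 ln[of 0] e(1) by (simp add: integral_unique)
  finally show ?thesis .
qed

text \<open>The root \<open>p\<close> of \<open>\<alpha> p - p\<^sup>3 = 2 c\<close> of smallest modulus, in trigonometric form.\<close>

definition cubp :: "real \<Rightarrow> real \<Rightarrow> real" where
  "cubp \<alpha> c = 2 * sqrt (\<alpha> / 3) * sin (arcsin (c / sqrt (\<alpha> / 3) ^ 3) / 3)"

lemma sin_treble: "sin (3 * x) = 3 * sin x - 4 * sin x ^ 3" for x :: real
proof -
  have "sin (3 * x) = sin (2 * x + x)" by simp
  also have "\<dots> = 2 * sin x * (cos x)\<^sup>2 + (1 - 2 * (sin x)\<^sup>2) * sin x"
    unfolding sin_add sin_double cos_double_sin by (simp add: power2_eq_square)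
  also have "\<dots> = 3 * sin x - 4 * sin x ^ 3"
    unfolding cos_squared_eq by (simp add: algebra_simps power2_eq_square power3_eq_cube)
  finally show ?thesis .
qed

lemma cubp_arg:
  assumes "\<alpha> \<ge> 3" "\<bar>c\<bar> \<le> 1"
  shows "sqrt (\<alpha> / 3) \<ge> 1" "-1 \<le> c / sqrt (\<alpha> / 3) ^ 3" "c / sqrt (\<alpha> / 3) ^ 3 \<le> 1"
proof -
  show a: "sqrt (\<alpha> / 3) \<ge> 1" using assms by simp
  define b where "b = sqrt (\<alpha> / 3) ^ 3"
  have "1 \<le> b" unfolding b_def using a by (rule one_le_power)
  hence "\<bar>c / b\<bar> \<le> 1" using assms by (simp add: abs_divide pos_divide_le_eq)
  hence "-1 \<le> c / b" "c / b \<le> 1" unfolding abs_le_iff by linarith+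
  thus "-1 \<le> c / sqrt (\<alpha> / 3) ^ 3" "c / sqrt (\<alpha> / 3) ^ 3 \<le> 1" by (simp_all only: b_def)
qed

lemma cubp_eq:
  assumes "\<alpha> \<ge> 3" "\<bar>c\<bar> \<le> 1"
  shows "cubp \<alpha> c * (\<alpha> - cubp \<alpha> c ^ 2) = 2 * c"
proof -
  define a where "a = sqrt (\<alpha> / 3)"
  define s where "s = sin (arcsin (c / a ^ 3) / 3)"
  have a: "a \<ge> 1" "\<alpha> = 3 * a\<^sup>2" using assms by (auto simp: a_def)
  have "3 * s - 4 * s ^ 3 = sin (arcsin (c / a ^ 3))" unfolding s_def sin_treble[symmetric] by simp
  also have "\<dots> = c / a ^ 3" using cubp_arg[OF assms] by (intro sin_arcsin) (auto simp: a_def)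
  finally have s: "a ^ 3 * (3 * s - 4 * s ^ 3) = c" using a by simp
  have "cubp \<alpha> c = 2 * a * s" by (simp add: cubp_def a_def s_def)
  hence "cubp \<alpha> c * (\<alpha> - cubp \<alpha> c ^ 2) = 2 * (a ^ 3 * (3 * s - 4 * s ^ 3))"
    unfolding a(2) by (simp add: algebra_simps power2_eq_square power3_eq_cube)
  thus ?thesis by (simp add: s)
qed

lemma cubp_le_sqrt:
  assumes "\<alpha> \<ge> 3" "\<bar>c\<bar> \<le> 1"
  shows "\<bar>cubp \<alpha> c\<bar> \<le> sqrt (\<alpha> / 3)"
proof -
  define \<psi> where "\<psi> = arcsin (c / sqrt (\<alpha> / 3) ^ 3) / 3"
  have "\<bar>arcsin (c / sqrt (\<alpha> / 3) ^ 3)\<bar> \<le> pi / 2"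
    using arcsin_bounded[OF cubp_arg(2,3)[OF assms]] by auto
  hence p: "- (pi / 6) \<le> \<psi>" "\<psi> \<le> pi / 6" by (auto simp: \<psi>_def)
  have "sin \<psi> \<le> sin (pi / 6)" using p pi_gt_zero by (intro sin_monotone_2pi_le) auto
  moreover have "sin (- (pi / 6)) \<le> sin \<psi>" using p pi_gt_zero by (intro sin_monotone_2pi_le) auto
  ultimately have "\<bar>sin \<psi>\<bar> \<le> 1 / 2" by (simp add: sin_30)
  hence "sqrt (\<alpha> / 3) * \<bar>2 * sin \<psi>\<bar> \<le> sqrt (\<alpha> / 3) * 1" using assms by (intro mult_left_mono) auto
  moreover have "\<bar>cubp \<alpha> c\<bar> = sqrt (\<alpha> / 3) * \<bar>2 * sin \<psi>\<bar>" using assms by (simp add: cubp_def \<psi>_def abs_mult)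
  ultimately show ?thesis by simp
qed

lemma cubp_sq_le: 
  assumes "\<alpha> \<ge> 3" "\<bar>c\<bar> \<le> 1"
  shows "3 * cubp \<alpha> c ^ 2 \<le> \<alpha>" "\<bar>cubp \<alpha> c\<bar> \<le> 1"
proof -
  define p where "p = \<bar>cubp \<alpha> c\<bar>"
  have "p ^ 2 \<le> sqrt (\<alpha> / 3) ^ 2" using cubp_le_sqrt[OF assms] by (intro power_mono) (auto simp: p_def)
  hence 1: "3 * p ^ 2 \<le> \<alpha>" using assms by simp
  thus "3 * cubp \<alpha> c ^ 2 \<le> \<alpha>" by (simp add: p_def)
  have "\<bar>cubp \<alpha> c * (\<alpha> - cubp \<alpha> c ^ 2)\<bar> = \<bar>2 * c\<bar>" using cubp_eq[OF assms] by simp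
  hence 2: "p * \<bar>\<alpha> - p\<^sup>2\<bar> = 2 * \<bar>c\<bar>" by (simp add: abs_mult p_def)
  have "p \<le> 1"
  proof (rule ccontr)
    assume "\<not> p \<le> 1"
    hence p: "p > 1" by simp
    hence p2: "p\<^sup>2 > 1" by simp
    have "2 * 1 < 2 * (p * p\<^sup>2)" using p p2 by (metis less_1_mult mult_less_cancel_left_pos zero_less_numeral)
    also have "\<dots> = p * (2 * p\<^sup>2)" by simp
    also have "\<dots> \<le> p * \<bar>\<alpha> - p\<^sup>2\<bar>" using 1 p by (intro mult_left_mono) auto
    finally show False using 2 assms by simp
  qed
  thus "\<bar>cubp \<alpha> c\<bar> \<le> 1" by (simp add: p_def)
qed

lemma cubp_lt_1:
  assumes "\<alpha> > 3" "\<bar>c\<bar> \<le> 1"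
  shows "\<bar>cubp \<alpha> c\<bar> < 1" "\<alpha> - 3 * cubp \<alpha> c ^ 2 > 0" "\<alpha> - cubp \<alpha> c ^ 2 > 0"
proof -
  have a: "\<alpha> \<ge> 3" using assms by simp
  have "\<bar>cubp \<alpha> c\<bar> \<noteq> 1"
  proof
    assume 1: "\<bar>cubp \<alpha> c\<bar> = 1"
    hence "cubp \<alpha> c ^ 2 = 1" by (metis power2_abs power_one)
    moreover have "\<bar>cubp \<alpha> c * (\<alpha> - cubp \<alpha> c ^ 2)\<bar> = \<bar>2 * c\<bar>" using cubp_eq[OF a assms(2)] by simp
    ultimately have "\<bar>\<alpha> - 1\<bar> = 2 * \<bar>c\<bar>" using 1 by (simp add: abs_mult)
    thus False using assms by simp
  qed
  thus 1: "\<bar>cubp \<alpha> c\<bar> < 1" using cubp_sq_le(2)[OF a assms(2)] by simp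
  hence "cubp \<alpha> c ^ 2 < 1" by (simp add: abs_square_less_1)
  thus "\<alpha> - 3 * cubp \<alpha> c ^ 2 > 0" "\<alpha> - cubp \<alpha> c ^ 2 > 0" using assms by auto
qed

lemma cubp_minus: "\<alpha> \<ge> 3 \<Longrightarrow> \<bar>c\<bar> \<le> 1 \<Longrightarrow> cubp \<alpha> (- c) = - cubp \<alpha> c"
  using cubp_arg[of \<alpha> c] by (simp add: cubp_def arcsin_minus)

text \<open>Two different roots r and p satisfy r^2 + r p + p^2 = alpha, which is impossible in the
  unit interval for alpha > 3. This later identifies a root given by coordinates of the curve with
  the trigonometric one.\<close>

lemma cubp_unique:
  assumes "\<alpha> > 3" "\<bar>c\<bar> \<le> 1" and p: "\<bar>p\<bar> \<le> 1" "p * (\<alpha> - p\<^sup>2) = 2 * c"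
  shows "cubp \<alpha> c = p"
proof (rule ccontr)
  define r where "r = cubp \<alpha> c"
  assume "cubp \<alpha> c \<noteq> p"
  moreover have "r * (\<alpha> - r\<^sup>2) = 2 * c" using cubp_eq[of \<alpha> c] assms by (simp add: r_def)
  hence "(r - p) * (\<alpha> - (r\<^sup>2 + r * p + p\<^sup>2)) = 0" using p by (simp add: algebra_simps power2_eq_square)
  ultimately have "\<alpha> = r\<^sup>2 + r * p + p\<^sup>2" by (simp add: r_def)
  moreover have r: "\<bar>r\<bar> < 1" using cubp_lt_1 assms by (simp add: r_def)
  have "\<bar>r * p\<bar> \<le> 1 * 1" unfolding abs_mult using p r by (intro mult_mono) auto
  moreover have "r\<^sup>2 \<le> 1" "p\<^sup>2 \<le> 1" using r p by (simp_all add: abs_square_le_1)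
  ultimately show False using assms by linarith
qed

text \<open>With x = s \<xi> the polynomial is s^3 (\<xi> - p) (\<xi>^2 + p \<xi> + p^2 - alpha),
  and only p lies in the unit disc. On the unit circle \<xi> - p may be replaced by 1 - p \<xi>,
  which has the same modulus; the new product has no zeros in the closed disc and equals p^2 - alpha
  at 0.\<close>

lemma jensen_inner:
  fixes \<kappa> :: real and s :: complex
  assumes \<alpha>: "\<alpha> > 3" and \<kappa>: "\<bar>\<kappa>\<bar> \<le> 1" and s: "norm s = 1"
  shows "(LBINT t=0..1. ln (norm ((exp (2 * of_real pi * \<i> * of_real t)) ^ 3 + s ^ 3 * of_real (2 * \<kappa>)
      - of_real \<alpha> * exp (2 * of_real pi * \<i> * of_real t) * s\<^sup>2))) = ln (\<alpha> - (cubp \<alpha> \<kappa>)\<^sup>2)"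
proof -
  define p where "p = cubp \<alpha> \<kappa>"
  have p: "\<bar>p\<bar> < 1" "\<alpha> - p\<^sup>2 > 0" using cubp_lt_1[OF \<alpha> \<kappa>] by (auto simp: p_def)
  have pe: "p * (\<alpha> - p\<^sup>2) = 2 * \<kappa>" using cubp_eq[of \<alpha> \<kappa>] \<alpha> \<kappa> by (simp add: p_def)
  have s0: "s \<noteq> 0" using s by auto
  define h where "h = (\<lambda>x. (1 - of_real p * (x / s)) * ((x / s)\<^sup>2 + of_real p * (x / s) + of_real (p\<^sup>2 - \<alpha>)))"
  have hol: "h holomorphic_on UNIV" unfolding h_def using s0 by (intro holomorphic_intros) auto
  have nz: "h x \<noteq> 0" if x: "norm x \<le> 1" for x
  proof -
    define \<xi> where "\<xi> = x / s"
    have xi: "norm \<xi> \<le> 1" using x s by (simp add: \<xi>_def norm_divide)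
    have "norm (of_real p * \<xi>) \<le> \<bar>p\<bar> * 1" unfolding norm_mult using xi by (intro mult_mono) auto
    hence n1: "norm (of_real p * \<xi>) < 1" using p by simp
    hence "1 - of_real p * \<xi> \<noteq> 0" by auto
    moreover have "\<xi>\<^sup>2 + of_real p * \<xi> + of_real (p\<^sup>2 - \<alpha>) \<noteq> 0"
    proof
      assume "\<xi>\<^sup>2 + of_real p * \<xi> + of_real (p\<^sup>2 - \<alpha>) = 0"
      hence "complex_of_real \<alpha> = \<xi>\<^sup>2 + of_real p * \<xi> + of_real (p\<^sup>2)" by (simp add: algebra_simps)
      hence "\<bar>\<alpha>\<bar> = norm (\<xi>\<^sup>2 + of_real p * \<xi> + of_real (p\<^sup>2))" by (metis norm_of_real)
      also have "\<dots> \<le> norm (\<xi>\<^sup>2) + norm (of_real p * \<xi>) + norm (complex_of_real (p\<^sup>2))"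
        by (meson add_mono norm_triangle_ineq order_refl order_trans)
      also have "norm (\<xi>\<^sup>2) \<le> 1" using xi by (simp add: norm_power power_le_one)
      also have "norm (complex_of_real (p\<^sup>2)) \<le> 1" using p by (simp add: abs_square_le_1 norm_power power_le_one)
      finally show False using n1 \<alpha> by simp
    qed
    ultimately show ?thesis by (simp add: h_def \<xi>_def)
  qed
  have eq: "norm (x ^ 3 + s ^ 3 * of_real (2 * \<kappa>) - of_real \<alpha> * x * s\<^sup>2) = norm (h x)" if x: "norm x = 1" for x
  proof -
    define \<xi> where "\<xi> = x / s"
    have xs: "x = s * \<xi>" using s0 by (simp add: \<xi>_def)
    have xi: "norm \<xi> = 1" using x s by (simp add: \<xi>_def norm_divide)
    have "x ^ 3 + s ^ 3 * of_real (2 * \<kappa>) - of_real \<alpha> * x * s\<^sup>2 = s ^ 3 * ((\<xi> - of_real p) * (\<xi>\<^sup>2 + of_real p * \<xi> + of_real (p\<^sup>2 - \<alpha>)))"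
      unfolding xs pe[symmetric] by (simp add: algebra_simps power2_eq_square power3_eq_cube)
    hence "norm (x ^ 3 + s ^ 3 * of_real (2 * \<kappa>) - of_real \<alpha> * x * s\<^sup>2) = 
        norm (\<xi> - of_real p) * norm (\<xi>\<^sup>2 + of_real p * \<xi> + of_real (p\<^sup>2 - \<alpha>))"
      using s by (simp add: norm_mult norm_power)
    also have "norm (\<xi> - of_real p) = norm (1 - of_real p * \<xi>)"
    proof -
      have "\<xi> * cnj \<xi> = 1" using complex_norm_square[of \<xi>] xi by simp
      hence "\<xi> * cnj (1 - of_real p * \<xi>) = \<xi> - of_real p" by (simp add: algebra_simps)
      hence "norm (\<xi> - of_real p) = norm \<xi> * norm (cnj (1 - of_real p * \<xi>))" by (metis norm_mult)
      also have "norm (cnj (1 - of_real p * \<xi>)) = norm (1 - of_real p * \<xi>)" by (rule complex_mod_cnj)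
      finally show ?thesis using xi by simp
    qed
    finally show ?thesis by (simp add: h_def \<xi>_def norm_mult)
  qed
  have "norm (exp (2 * of_real pi * \<i> * of_real t)) = 1" for t :: real by simp
  hence "(LBINT t=0..1. ln (norm ((exp (2 * of_real pi * \<i> * of_real t)) ^ 3 + s ^ 3 * of_real (2 * \<kappa>)
      - of_real \<alpha> * exp (2 * of_real pi * \<i> * of_real t) * s\<^sup>2))) = 
     (LBINT t=0..1. ln (norm (h (exp (2 * of_real pi * \<i> * of_real t)))))"
    by (simp only: eq)
  also have "\<dots> = ln (norm (h 0))" by (rule jensen_zero_free[OF hol nz])
  also have "norm (h 0) = \<alpha> - p\<^sup>2"
  proof -
    have "h 0 = complex_of_real (p\<^sup>2 - \<alpha>)" by (simp add: h_def)
    thus ?thesis using p by (simp only: norm_of_real)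
  qed
  finally show ?thesis by (simp add: p_def)
qed

lemma mahler_n_single:
  assumes \<alpha>: "\<alpha> > 3"
  shows "mahler_n \<alpha> = (LBINT \<theta>=0..1. ln (\<alpha> - (cubp \<alpha> (cos (3 * pi * \<theta>)))\<^sup>2))"
proof -
  have "(LBINT \<theta>1=0..1. (let x = exp (2 * of_real pi * \<i> * of_real \<theta>1); y = exp (2 * of_real pi * \<i> * of_real \<theta>2)
      in ln (norm (x ^ 3 + y ^ 3 + 1 - of_real \<alpha> * x * y)))) = ln (\<alpha> - (cubp \<alpha> (cos (3 * pi * \<theta>2)))\<^sup>2)" for \<theta>2 :: real
  proof -
    \<comment> \<open>With the square root s of y one has y^3 + 1 = s^3 (s^3 + s^(-3)), a real
      number 2 cos (3 pi \<theta>2) times s^3. The number plays the part of the constant 2 \<kappa>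
      in \<open>jensen_inner\<close>.\<close>
    define s where "s = exp (of_real pi * \<i> * of_real \<theta>2)"
    have y: "exp (2 * of_real pi * \<i> * of_real \<theta>2) = s\<^sup>2" unfolding s_def exp_double[symmetric] by (simp add: mult_ac)
    have s: "norm s = 1" by (simp add: s_def)
    have s3: "s ^ 3 = cis (3 * pi * \<theta>2)" unfolding s_def by (simp add: cis_conv_exp mult_ac flip: exp_of_nat_mult)
    have "2 * cos x = 2 * Re (cis x)" for x by simp
    have c: "complex_of_real (2 * cos x) = cis x + cis (- x)" for x by (simp add: complex_eq_iff)
    have "s ^ 3 * of_real (2 * cos (3 * pi * \<theta>2)) = s ^ 3 * s ^ 3 + cis 0"
      unfolding c s3 distrib_left cis_mult by simp
    hence k: "(s\<^sup>2) ^ 3 + 1 = s ^ 3 * of_real (2 * cos (3 * pi * \<theta>2))" 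
      by (simp flip: power_mult power_add)
    have "(LBINT \<theta>1=0..1. (let x = exp (2 * of_real pi * \<i> * of_real \<theta>1); y = exp (2 * of_real pi * \<i> * of_real \<theta>2)
      in ln (norm (x ^ 3 + y ^ 3 + 1 - of_real \<alpha> * x * y)))) =
      (LBINT t=0..1. ln (norm ((exp (2 * of_real pi * \<i> * of_real t)) ^ 3 + s ^ 3 * of_real (2 * cos (3 * pi * \<theta>2))
      - of_real \<alpha> * exp (2 * of_real pi * \<i> * of_real t) * s\<^sup>2)))"
      unfolding Let_def y k[symmetric] by (simp only: add.assoc)
    also have "\<dots> = ln (\<alpha> - (cubp \<alpha> (cos (3 * pi * \<theta>2)))\<^sup>2)" by (rule jensen_inner[OF \<alpha> _ s]) simp
    finally show ?thesis .
  qed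
  thus ?thesis unfolding mahler_n_def by simp
qed

text \<open>As F is even, F (sin t) is even in t and has period pi. The substitution t = pi/2 - 3 pi
  \<theta> runs over an interval of length 3 pi, which consists of six copies of [0, pi/2] up to
  shift and reflection.\<close>

lemma cos_average:
  fixes F :: "real \<Rightarrow> real"
  assumes cont: "continuous_on {-1..1} F" and even: "\<And>c. \<bar>c\<bar> \<le> 1 \<Longrightarrow> F (- c) = F c"
  shows "(LBINT \<theta>=0..1. F (cos (3 * pi * \<theta>))) = 2 / pi * integral {0..pi/2} (\<lambda>t. F (sin t))"
proof -
  define f where "f = (\<lambda>t. F (sin t))"
  have contf: "continuous_on S f" for S
    unfolding f_def by (rule continuous_on_compose2[OF cont]) (auto intro!: continuous_intros)
  \<comment> \<open>An antiderivative on an interval that is simply large enough: the arguments run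
    from -5 pi/2 to pi/2, and one further shift by pi must stay inside.\<close>
  obtain I where I0: "\<And>x. x \<in> {-20..20} \<Longrightarrow> (I has_vector_derivative f x) (at x within {-20..20})"
    using antiderivative_continuous[OF contf] by blast
  have I: "(I has_real_derivative f x) (at x)" if "x \<in> {-20<..<20}" for x
    using that at_within_Icc_at[of "-20" x 20] I0[of x] by (simp add: has_real_derivative_iff_has_vector_derivative)
  have sh: "f (x - pi) = f x" "f (- x) = f x" for x
    using even[of "sin x"] by (simp_all add: f_def sin_diff)
  have pi: "3 < pi" "pi < 4" using pi_gt3 pi_less_4 by auto
  have c1: "I x - I (x - pi) = I y - I (y - pi)" if "x \<in> {-10<..<10}" "y \<in> {-10<..<10}" for x y
  proof (rule DERIV_isconst3[where a = "-10" and b = 10 and f = "\<lambda>x. I x - I (x - pi)"])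
    fix z :: real assume z: "z \<in> {-10<..<10}"
    have "((\<lambda>x. I (x - pi)) has_real_derivative f (z - pi) * 1) (at z)"
      by (rule DERIV_chain2[OF I]) (use z pi in \<open>auto intro!: derivative_eq_intros\<close>)
    moreover have "(I has_real_derivative f z) (at z)" using z by (intro I) auto
    ultimately show "((\<lambda>x. I x - I (x - pi)) has_real_derivative 0) (at z)"
      using DERIV_diff sh by fastforce
  qed (use that in auto)
  have c2: "I x + I (- x) = I y + I (- y)" if "x \<in> {-10<..<10}" "y \<in> {-10<..<10}" for x y
  proof (rule DERIV_isconst3[where a = "-10" and b = 10 and f = "\<lambda>x. I x + I (- x)"])
    fix z :: real assume z: "z \<in> {-10<..<10}"
    have "((\<lambda>x. I (- x)) has_real_derivative f (- z) * (- 1)) (at z)"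
      by (rule DERIV_chain2[OF I]) (use z pi in \<open>auto intro!: derivative_eq_intros\<close>)
    moreover have "(I has_real_derivative f z) (at z)" using z by (intro I) auto
    ultimately show "((\<lambda>x. I x + I (- x)) has_real_derivative 0) (at z)"
      using DERIV_add sh by fastforce
  qed (use that in auto)
  have 1: "I (pi / 2) - I (- pi / 2) = I (- pi / 2) - I (- 3 * pi / 2)"
    using c1[of "pi / 2" "- pi / 2"] pi by (simp add: field_simps)
  have 2: "I (pi / 2) - I (- pi / 2) = I (- 3 * pi / 2) - I (- 5 * pi / 2)"
    using c1[of "pi / 2" "- 3 * pi / 2"] pi by (simp add: field_simps)
  have 3: "I (pi / 2) + I (- pi / 2) = 2 * I 0" using c2[of "pi / 2" 0] pi by simp
  have tot: "I (pi / 2) - I (- 5 * pi / 2) = 6 * (I (pi / 2) - I 0)"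
  proof -
    have "a - d = 6 * (a - z)" if "a - b = b - c" "a - b = c - d" "a + b = 2 * z" for a b c d z :: real
      using that by algebra
    from this[OF 1 2 3] show ?thesis .
  qed
  have "(f has_integral I (pi / 2) - I 0) {0..pi/2}"
  proof (rule fundamental_theorem_of_calculus)
    fix x :: real assume "x \<in> {0..pi/2}"
    hence "x \<in> {-20<..<20}" using pi by simp
    hence "(I has_real_derivative f x) (at x)" by (rule I)
    thus "(I has_vector_derivative f x) (at x within {0..pi/2})"
      by (simp add: has_real_derivative_iff_has_vector_derivative has_vector_derivative_at_within)
  qed auto
  hence int: "integral {0..pi/2} f = I (pi / 2) - I 0" by (rule integral_unique)
  have "((\<lambda>\<theta>. F (cos (3 * pi * \<theta>))) has_integral (- I (pi / 2 - 3 * pi * 1) / (3 * pi)) - (- I (pi / 2 - 3 * pi * 0) / (3 * pi))) {0..1}"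
  proof (rule fundamental_theorem_of_calculus)
    fix \<theta> :: real assume th: "\<theta> \<in> {0..1}"
    have "0 \<le> 3 * pi * \<theta>" "3 * pi * \<theta> \<le> 3 * pi * 1" using th pi by auto
    hence mem: "pi / 2 - 3 * pi * \<theta> \<in> {-20<..<20}"
      using pi unfolding greaterThanLessThan_iff by linarith
    have "((\<lambda>\<theta>. I (pi / 2 - 3 * pi * \<theta>)) has_real_derivative f (pi / 2 - 3 * pi * \<theta>) * (- (3 * pi))) (at \<theta>)"
      by (rule DERIV_chain2[where f = I and g = "\<lambda>\<theta>. pi / 2 - 3 * pi * \<theta>" and x = \<theta>, OF I[OF mem]]) (auto intro!: derivative_eq_intros)
    from DERIV_cdivide[OF DERIV_minus[OF this], of "3 * pi"]
    have "((\<lambda>\<theta>. - I (pi / 2 - 3 * pi * \<theta>) / (3 * pi)) has_real_derivative f (pi / 2 - 3 * pi * \<theta>)) (at \<theta>)"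
      by simp
    moreover have "sin (pi / 2 - 3 * pi * \<theta>) = cos (3 * pi * \<theta>)" by (simp add: sin_diff)
    hence "f (pi / 2 - 3 * pi * \<theta>) = F (cos (3 * pi * \<theta>))" by (simp only: f_def)
    ultimately show "((\<lambda>\<theta>. - I (pi / 2 - 3 * pi * \<theta>) / (3 * pi)) has_vector_derivative F (cos (3 * pi * \<theta>))) (at \<theta> within {0..1})"
      by (simp add: has_real_derivative_iff_has_vector_derivative has_vector_derivative_at_within)
  qed auto
  moreover have "pi / 2 - 3 * pi = - 5 * pi / 2" by simp
  ultimately have "integral {0..1} (\<lambda>\<theta>. F (cos (3 * pi * \<theta>))) = (I (pi / 2) - I (- 5 * pi / 2)) / (3 * pi)"
    by (simp add: integral_unique diff_divide_distrib)
  also have "\<dots> = 2 / pi * integral {0..pi/2} f" unfolding tot int by (simp add: field_simps)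
  finally have A: "integral {0..1} (\<lambda>\<theta>. F (cos (3 * pi * \<theta>))) = 2 / pi * integral {0..pi/2} f" .
  have "continuous_on {0..1} (\<lambda>\<theta>. F (cos (3 * pi * \<theta>)))"
    by (rule continuous_on_compose2[OF cont]) (auto intro!: continuous_intros)
  hence "set_integrable lborel {0..1} (\<lambda>\<theta>. F (cos (3 * pi * \<theta>)))"
    by (rule borel_integrable_atLeastAtMost')
  from interval_integral_eq_integral[OF _ this] A show ?thesis
    by (simp add: zero_ereal_def one_ereal_def f_def)
qed

text \<open>The equality with \<open>mahler_n\<close> is established for alpha > 3, but this
  expression is meaningful and continuous up to alpha = 3, where the constant of integration in
  \<open>mahler_alpha\<close> is determined.\<close>

definition mahler_jensen :: "real \<Rightarrow> real" where
  "mahler_jensen \<alpha> = 2 / pi * integral {0..pi/2} (\<lambda>t. ln (\<alpha> - (cubp \<alpha> (sin t))\<^sup>2))"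

lemma continuous_on_cubp:
  fixes S :: "'a :: metric_space set"
  assumes "continuous_on S f" "continuous_on S g" and "\<And>x. x \<in> S \<Longrightarrow> f x \<ge> 3" "\<And>x. x \<in> S \<Longrightarrow> \<bar>g x\<bar> \<le> 1"
  shows "continuous_on S (\<lambda>x. cubp (f x) (g x))"
proof -
  have nz: "sqrt (f x / 3) ^ 3 \<noteq> 0" if "x \<in> S" for x using assms(3)[OF that] by simp
  have "continuous_on S (\<lambda>x. g x / sqrt (f x / 3) ^ 3)"
    by (intro continuous_intros assms(1,2) ballI nz) auto
  moreover have "\<forall>x\<in>S. - 1 \<le> g x / sqrt (f x / 3) ^ 3 \<and> g x / sqrt (f x / 3) ^ 3 \<le> 1"
    using cubp_arg(2,3) assms(3,4) by blast
  ultimately have 1: "continuous_on S (\<lambda>x. arcsin (g x / sqrt (f x / 3) ^ 3))" by (rule continuous_on_arcsin)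
  have "continuous_on S (\<lambda>x. sin (arcsin (g x / sqrt (f x / 3) ^ 3) / 3))"
    by (intro continuous_on_sin continuous_on_divide continuous_on_const 1) auto
  thus ?thesis unfolding cubp_def by (intro continuous_on_mult continuous_on_const continuous_on_real_sqrt continuous_on_divide assms(1)) auto
qed

lemma mahler_n_eq_MM:
  assumes \<alpha>: "\<alpha> > 3"
  shows "mahler_n \<alpha> = mahler_jensen \<alpha>"
  unfolding mahler_n_single[OF \<alpha>] mahler_jensen_def
proof (rule cos_average)
  have nz: "\<alpha> - (cubp \<alpha> c)\<^sup>2 \<noteq> 0" if "c \<in> {-1..1}" for c using cubp_lt_1(3)[OF \<alpha>, of c] that by (simp add: abs_le_iff)
  show "continuous_on {-1..1} (\<lambda>c. ln (\<alpha> - (cubp \<alpha> c)\<^sup>2))"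
    using \<alpha> by (intro continuous_intros continuous_on_cubp ballI nz) auto
qed (use \<alpha> in \<open>simp add: cubp_minus\<close>)

text \<open>The trigonometric formula supplies differentiability only. The value of the derivative
  comes from differentiating the cubic equation \<open>cubp_eq\<close> implicitly.\<close>

lemma cubp_deriv:
  assumes \<alpha>: "\<alpha> > 3" and c: "\<bar>c\<bar> \<le> 1"
  shows "((\<lambda>x. cubp x c) has_real_derivative - cubp \<alpha> c / (\<alpha> - 3 * (cubp \<alpha> c)\<^sup>2)) (at \<alpha>)"
proof -
  define a where "a = sqrt (\<alpha> / 3)"
  have a: "a > 1" using \<alpha> by (simp add: a_def)
  have "1 < a ^ 3" using a by (simp add: one_less_power)
  hence "0 < a ^ 3" "- (a ^ 3) < c" "c < a ^ 3" using c by linarith+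
  hence ca: "-1 < c / a ^ 3" "c / a ^ 3 < 1" by (simp_all add: pos_divide_less_eq pos_less_divide_eq)
  have "((\<lambda>u. arcsin (c / u ^ 3)) has_real_derivative inverse (sqrt (1 - (c / a ^ 3)\<^sup>2)) * (- (c * (3 * a ^ 2)) / (a ^ 3 * a ^ 3))) (at a)"
    by (rule DERIV_chain2[where f = arcsin and g = "\<lambda>u. c / u ^ 3" and x = a, OF DERIV_arcsin[OF ca]])
       (use a in \<open>auto intro!: derivative_eq_intros\<close>)
  hence "((\<lambda>u. sin (arcsin (c / u ^ 3) / 3)) has_real_derivative cos (arcsin (c / a ^ 3) / 3) *
      (inverse (sqrt (1 - (c / a ^ 3)\<^sup>2)) * (- (c * (3 * a ^ 2)) / (a ^ 3 * a ^ 3)) / 3)) (at a)"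
    by (intro DERIV_fun_sin DERIV_cdivide)
  from DERIV_mult[OF DERIV_cmult_Id this, of 2]
  obtain D1 where D1: "((\<lambda>u. 2 * u * sin (arcsin (c / u ^ 3) / 3)) has_real_derivative D1) (at (sqrt (\<alpha> / 3)))"
    by (auto simp: a_def)
  have "((\<lambda>x. sqrt (x / 3)) has_real_derivative inverse (sqrt (\<alpha> / 3)) / 2 * (1 / 3)) (at \<alpha>)"
    by (rule DERIV_chain2[where f = sqrt and g = "\<lambda>x. x / 3" and x = \<alpha>, OF DERIV_real_sqrt])
       (use \<alpha> in \<open>auto intro!: derivative_eq_intros\<close>)
  from DERIV_chain2[where g = "\<lambda>x. sqrt (x / 3)" and x = \<alpha>, OF D1 this]
  obtain D where D: "((\<lambda>x. cubp x c) has_real_derivative D) (at \<alpha>)" by (auto simp: cubp_def)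
  define p where "p = cubp \<alpha> c"
  have "((\<lambda>x. cubp x c * (x - (cubp x c)\<^sup>2)) has_real_derivative D * (\<alpha> - p\<^sup>2) + (1 - 2 * p * D) * p) (at \<alpha>)"
    unfolding p_def by (rule derivative_eq_intros D refl | simp)+
  moreover have "eventually (\<lambda>x. x \<in> {3<..}) (nhds \<alpha>)" using \<alpha> by (intro eventually_nhds_in_open) auto
  hence ev: "eventually (\<lambda>x. cubp x c * (x - (cubp x c)\<^sup>2) = 2 * c) (nhds \<alpha>)"
    by eventually_elim (use cubp_eq c in auto)
  ultimately have "((\<lambda>x. 2 * c) has_real_derivative D * (\<alpha> - p\<^sup>2) + (1 - 2 * p * D) * p) (at \<alpha>)"
    using DERIV_cong_ev[OF refl ev refl] by blast
  from DERIV_unique[OF this DERIV_const] have "D * (\<alpha> - 3 * p\<^sup>2) = - p" by (simp add: algebra_simps power2_eq_square)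
  moreover have "\<alpha> - 3 * p\<^sup>2 > 0" using cubp_lt_1[OF \<alpha> c] by (simp add: p_def)
  ultimately have "D = - p / (\<alpha> - 3 * p\<^sup>2)" by (simp add: field_simps)
  thus ?thesis using D by (simp add: p_def)
qed

text \<open>Differentiation under the integral sign. The derivative of alpha - p^2 is (alpha - p^2)
  / (alpha - 3 p^2), so the denominator of the logarithmic derivative cancels; what is left is the
  integrand of a period of the curve.\<close>

lemma mahler_jensen_deriv:
  assumes \<alpha>: "\<alpha> > 3"
  shows "(mahler_jensen has_real_derivative 2 / pi * integral {0..pi/2} (\<lambda>t. 1 / (\<alpha> - 3 * (cubp \<alpha> (sin t))\<^sup>2))) (at \<alpha>)"
proof -
  have "((\<lambda>x. integral (cbox 0 (pi/2)) (\<lambda>t. ln (x - (cubp x (sin t))\<^sup>2))) has_field_derivative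
      integral (cbox 0 (pi/2)) (\<lambda>t. 1 / (\<alpha> - 3 * (cubp \<alpha> (sin t))\<^sup>2))) (at \<alpha> within {3<..})"
  proof (rule leibniz_rule_field_derivative)
    fix x t :: real assume x: "x \<in> {3<..}"
    define p where "p = cubp x (sin t)"
    have p: "x - 3 * p\<^sup>2 > 0" "x - p\<^sup>2 > 0" using cubp_lt_1[of x "sin t"] x by (auto simp: p_def)
    have "((\<lambda>x. ln (x - (cubp x (sin t))\<^sup>2)) has_field_derivative (1 - 2 * p * (- p / (x - 3 * p\<^sup>2))) * inverse (x - p\<^sup>2)) (at x)"
    proof -
      have dp: "((\<lambda>x. cubp x (sin t)) has_field_derivative - p / (x - 3 * p\<^sup>2)) (at x)"
        unfolding p_def using x by (intro cubp_deriv) auto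
      have "((\<lambda>x. x - (cubp x (sin t))\<^sup>2) has_field_derivative (1 - 2 * p * (- p / (x - 3 * p\<^sup>2)))) (at x)"
        by (rule derivative_eq_intros dp refl | simp add: p_def)+
      from DERIV_chain2[where f = ln and x = x and g = "\<lambda>x. x - (cubp x (sin t))\<^sup>2", OF DERIV_ln this] p
      show ?thesis by (simp add: p_def mult.commute)
    qed
    also have "(1 - 2 * p * (- p / (x - 3 * p\<^sup>2))) * inverse (x - p\<^sup>2) = 1 / (x - 3 * p\<^sup>2)"
    proof -
      have "1 - 2 * p * (- p / (x - 3 * p\<^sup>2)) = (x - p\<^sup>2) / (x - 3 * p\<^sup>2)"
        using p by (simp add: field_simps power2_eq_square)
      thus ?thesis using p by simp
    qed
    finally show "((\<lambda>x. ln (x - (cubp x (sin t))\<^sup>2)) has_field_derivative 1 / (x - 3 * (cubp x (sin t))\<^sup>2)) (at x within {3<..})"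
      unfolding p_def by (rule has_field_derivative_at_within)
  next
    fix x :: real assume x: "x \<in> {3<..}"
    have nz: "x - (cubp x (sin t))\<^sup>2 \<noteq> 0" for t using cubp_lt_1(3)[of x "sin t"] x by auto
    show "(\<lambda>t. ln (x - (cubp x (sin t))\<^sup>2)) integrable_on cbox 0 (pi/2)"
      using x by (intro integrable_continuous continuous_intros continuous_on_cubp ballI nz) auto
  next
    have nz: "x - 3 * (cubp x (sin t))\<^sup>2 \<noteq> 0" if "x > 3" for t x using cubp_lt_1(2)[of x "sin t"] that by auto
    show "continuous_on ({3<..} \<times> cbox 0 (pi/2)) (\<lambda>(x, t). 1 / (x - 3 * (cubp x (sin t))\<^sup>2))"
      unfolding split_beta
      by (intro continuous_intros continuous_on_cubp ballI nz) auto
  qed (use \<alpha> in auto)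
  moreover have "at \<alpha> within {3<..} = at \<alpha>" using \<alpha> by (intro at_within_open) auto
  ultimately show ?thesis unfolding mahler_jensen_def [abs_def] by (intro DERIV_cmult) simp
qed

lemma mahler_jensen_continuous: "continuous_on {3..4} mahler_jensen"
proof -
  have "continuous_on {3..4} (\<lambda>x. integral (cbox 0 (pi/2)) (\<lambda>t. ln (x - (cubp x (sin t))\<^sup>2)))"
  proof (rule integral_continuous_on_param)
    have nz: "x - (cubp x (sin t))\<^sup>2 \<noteq> 0" if "x \<ge> 3" for t x :: real
    proof -
      have "(cubp x (sin t))\<^sup>2 \<le> 1" using cubp_sq_le(2)[of x "sin t"] that by (simp add: abs_square_le_1)
      thus ?thesis using that by linarith
    qed
    show "continuous_on ({3..4} \<times> cbox 0 (pi/2)) (\<lambda>(x, t). ln (x - (cubp x (sin t))\<^sup>2))"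
      unfolding split_beta by (intro continuous_intros continuous_on_cubp ballI nz) auto
  qed
  thus ?thesis unfolding mahler_jensen_def [abs_def] by (intro continuous_intros) simp
qed

text \<open>At alpha = 3 the scale factor in \<open>cubp\<close> is 1 and \<open>arcsin\<close>
  undoes \<open>sin\<close>, so the root is 2 sin (t / 3) and the integrand becomes
  elementary.\<close>

lemma MM_3: "mahler_jensen 3 = 3 / pi * integral {0..pi/3} (\<lambda>v. ln (1 + 2 * cos v))"
proof -
  have c: "3 - (cubp 3 (sin t))\<^sup>2 = 1 + 2 * cos (2 / 3 * t)" if "t \<in> {0..pi/2}" for t
  proof -
    have "arcsin (sin t) = t" using that by (intro arcsin_sin) auto
    hence "cubp 3 (sin t) = 2 * sin (t / 3)" by (simp add: cubp_def)
    moreover have "2 / 3 * t = 2 * (t / 3)" by simp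
    hence "cos (2 / 3 * t) = 1 - 2 * (sin (t / 3))\<^sup>2" by (simp only: cos_double_sin)
    ultimately show ?thesis by (simp add: power_mult_distrib)
  qed
  have pos: "1 + 2 * cos v > 0" if "v \<in> {0..pi/3}" for v
  proof -
    have "cos (pi / 3) \<le> cos v" using that by (intro cos_monotone_0_pi_le) auto
    thus ?thesis by (simp add: cos_60)
  qed
  have "((\<lambda>v. ln (1 + 2 * cos v)) has_integral integral {0..pi/3} (\<lambda>v. ln (1 + 2 * cos v))) (cbox 0 (pi/3))"
    using pos by (auto intro!: integrable_integral integrable_continuous_real continuous_intros simp: less_imp_neq) (metis less_irrefl pos atLeastAtMost_iff)
  from has_integral_affinity[OF this, of "2/3" 0]
  have "((\<lambda>t. ln (1 + 2 * cos (2 / 3 * t))) has_integral 3 / 2 * integral {0..pi/3} (\<lambda>v. ln (1 + 2 * cos v))) ((\<lambda>x. 3 / 2 * x) ` {0..pi/3})"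
    by simp
  also have "(\<lambda>x. 3 / 2 * x) ` {0..pi/3} = {0..pi/2}"
    by (subst image_mult_atLeastAtMost) auto
  finally have "integral {0..pi/2} (\<lambda>t. ln (1 + 2 * cos (2 / 3 * t))) = 3 / 2 * integral {0..pi/3} (\<lambda>v. ln (1 + 2 * cos v))"
    by (rule integral_unique)
  moreover have "integral {0..pi/2} (\<lambda>t. ln (3 - (cubp 3 (sin t))\<^sup>2)) = integral {0..pi/2} (\<lambda>t. ln (1 + 2 * cos (2 / 3 * t)))"
    by (rule integral_cong) (simp add: c)
  ultimately show ?thesis by (simp add: mahler_jensen_def)
qed

section \<open>The Bloch-Wigner function on rays\<close>

text \<open>In contrast to \<open>bloch_wigner_domain\<close> this set contains 0. It is star-shaped
  about 0, the starting point of the path that defines \<open>dilog\<close>, so a global primitive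
  exists on it.\<close>

definition slit :: "complex set" where "slit = {z. \<not> (z \<in> \<real> \<and> Re z \<ge> 1)}"

lemma slit_iff: "z \<in> slit \<longleftrightarrow> 1 - z \<notin> \<real>\<^sub>\<le>\<^sub>0"
  by (auto simp: slit_def complex_nonpos_Reals_iff complex_is_Real_iff)

lemma open_slit: "open slit"
proof -
  have "open ((\<lambda>z::complex. 1 - z) -` (- \<real>\<^sub>\<le>\<^sub>0))"
    by (intro open_vimage open_Compl closed_nonpos_Reals_complex continuous_on_diff continuous_on_const continuous_on_id)
  also have "(\<lambda>z::complex. 1 - z) -` (- \<real>\<^sub>\<le>\<^sub>0) = slit" by (auto simp: slit_iff)
  finally show ?thesis .
qed

lemma zero_in_slit: "0 \<in> slit" by (simp add: slit_def)

lemma slit_segment: "z \<in> slit \<Longrightarrow> closed_segment 0 z \<subseteq> slit"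
proof safe
  fix w assume z: "z \<in> slit" and "w \<in> closed_segment 0 z"
  then obtain u where u: "0 \<le> u" "u \<le> 1" "w = of_real u * z"
    by (auto simp: closed_segment_def scaleR_conv_of_real)
  show "w \<in> slit"
  proof (rule ccontr)
    assume "w \<notin> slit"
    hence w: "Im w = 0" "Re w \<ge> 1" by (auto simp: slit_def complex_is_Real_iff)
    hence 1: "u * Im z = 0" "u * Re z \<ge> 1" using u by auto
    hence "u > 0" using u by (cases "u = 0") auto
    hence z1: "Im z = 0" using 1 by simp
    have "0 < u * Re z" using 1 by linarith
    hence "Re z > 0" using \<open>u > 0\<close> by (simp add: zero_less_mult_iff)
    hence "u * Re z \<le> 1 * Re z" using u by (intro mult_right_mono) auto
    thus False using z z1 1 by (auto simp: slit_def complex_is_Real_iff)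
  qed
qed

lemma dilog_props:
  shows dilog_0: "dilog 0 = 0"
    and dilog_deriv: "z \<in> slit \<Longrightarrow> (dilog has_field_derivative (if z = 0 then 1 else - Ln (1 - z) / z)) (at z)"
proof -
  show d0: "dilog 0 = 0" by (simp add: dilog_def)
  define g where "g = (\<lambda>w. - Ln (1 - w))"
  have holg: "g holomorphic_on slit" unfolding g_def by (intro holomorphic_intros) (auto simp: slit_iff)
  have dg: "deriv g 0 = 1" unfolding g_def by (rule DERIV_imp_deriv) (auto intro!: derivative_eq_intros)
  define f where "f = (\<lambda>w. if w = 0 then 1 else - Ln (1 - w) / w)"
  have "(\<lambda>w. if w = 0 then deriv g 0 else (g w - g 0) / (w - 0)) holomorphic_on slit"
    by (rule pole_lemma_open[OF holg open_slit])
  also have "(\<lambda>w. if w = 0 then deriv g 0 else (g w - g 0) / (w - 0)) = f"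
    using dg by (auto simp: f_def g_def)
  finally have holf: "f holomorphic_on slit" .
  have "starlike slit" using zero_in_slit slit_segment by (auto simp: starlike_def)
  then obtain F where F: "\<And>z. z \<in> slit \<Longrightarrow> (F has_field_derivative f z) (at z)"
    using holomorphic_starlike_primitive[OF holomorphic_on_imp_continuous_on[OF holf] _ open_slit, of "{}"]
      holomorphic_on_imp_differentiable_at[OF holf open_slit] by auto
  have dil: "dilog z = F z - F 0" if z: "z \<in> slit" for z
  proof (cases "z = 0")
    case False
    have pi: "path_image (linepath 0 z) \<subseteq> slit" using slit_segment[OF z] by (simp only: path_image_linepath)
    have "(f has_contour_integral (F (pathfinish (linepath 0 z)) - F (pathstart (linepath 0 z)))) (linepath 0 z)"
      by (rule contour_integral_primitive[OF has_field_derivative_at_within[OF F] valid_path_linepath pi])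
    hence "((\<lambda>t. f (linepath 0 z t) * (z - 0)) has_integral (F z - F 0)) {0..1}"
      by (simp add: has_contour_integral_linepath)
    \<comment> \<open>At t = 0 the integrand of \<open>dilog\<close> is a division by zero with
      value 0, while \<open>f\<close> has its limit 1 there; a single point does not affect the
      integral.\<close>
    hence "((\<lambda>t. - Ln (1 - linepath 0 z t) / linepath 0 z t * (z - 0)) has_integral (F z - F 0)) {0..1}"
      by (rule has_integral_spike_finite[of "{0}", rotated 2])
         (use False in \<open>auto simp: f_def linepath_def\<close>)
    hence "((\<lambda>w. - Ln (1 - w) / w) has_contour_integral (F z - F 0)) (linepath 0 z)"
      by (simp add: has_contour_integral_linepath)
    thus ?thesis by (simp add: dilog_def contour_integral_unique)
  qed (simp add: d0)
  show "(dilog has_field_derivative (if z = 0 then 1 else - Ln (1 - z) / z)) (at z)" if z: "z \<in> slit"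
  proof -
    have "eventually (\<lambda>z. z \<in> slit) (nhds z)" using open_slit z by (rule eventually_nhds_in_open)
    hence ev: "eventually (\<lambda>z. F z - F 0 = dilog z) (nhds z)" by eventually_elim (simp add: dil)
    have D: "((\<lambda>z. F z - F 0) has_field_derivative f z - 0) (at z)" by (intro DERIV_diff F z DERIV_const)
    have "(dilog has_field_derivative f z - 0) (at z)"
      by (rule DERIV_cong_ev[THEN iffD1, OF refl ev refl D])
    thus ?thesis by (simp add: f_def)
  qed
qed

text \<open>The Bloch-Wigner function on the ray of angle \<theta> in the coordinate t = ln |z|. Its
  derivative is elementary, so functional equations follow by comparing derivatives and one value,
  usually the limit 0 at the origin.\<close>

definition bwray :: "real \<Rightarrow> real \<Rightarrow> real" where
  "bwray \<theta> t = bloch_wigner (of_real (exp t) * cis \<theta>)"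

lemma ray_slit:
  assumes "cos \<theta> < 1" shows "of_real (exp t) * cis \<theta> \<in> slit"
proof (rule ccontr)
  assume "of_real (exp t) * cis \<theta> \<notin> slit"
  hence "exp t * sin \<theta> = 0" "exp t * cos \<theta> \<ge> 1" by (auto simp: slit_def complex_is_Real_iff)
  hence "sin \<theta> = 0" "cos \<theta> > 0" by (auto simp: zero_less_mult_iff) (smt (verit) exp_gt_zero mult_nonneg_nonpos)
  thus False using assms sin_cos_squared_add[of \<theta>] by (simp add: power2_eq_1_iff)
qed

lemma bwray_eq:
  fixes \<theta> t :: real
  assumes "cos \<theta> < 1"
  defines "z \<equiv> of_real (exp t) * cis \<theta>"
  shows "bwray \<theta> t = Im (dilog z) + t * Im (Ln (1 - z))"
proof -
  have "z \<in> bloch_wigner_domain" using ray_slit[OF assms(1), of t] by (auto simp: z_def bloch_wigner_domain_def slit_def)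
  moreover have "norm z = exp t" by (simp add: z_def norm_mult)
  ultimately show ?thesis by (simp add: bwray_def bloch_wigner_def flip: z_def)
qed

lemma dist_one_cis: "(norm (1 - of_real \<rho> * cis \<theta>))\<^sup>2 = 1 - 2 * \<rho> * cos \<theta> + \<rho>\<^sup>2"
proof -
  have "(norm (1 - of_real \<rho> * cis \<theta>))\<^sup>2 = (1 - \<rho> * cos \<theta>)\<^sup>2 + (\<rho> * sin \<theta>)\<^sup>2"
    by (simp add: cmod_power2)
  also have "(1 - \<rho> * c)\<^sup>2 + (\<rho> * s)\<^sup>2 = 1 - 2 * \<rho> * c + \<rho>\<^sup>2 * (s\<^sup>2 + c\<^sup>2)" for c s
    by (simp add: algebra_simps power2_eq_square)
  finally show ?thesis by simp
qed

text \<open>Differentiating \<open>dilog\<close> along the ray gives - Ln (1 - z), whose imaginary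
  part cancels against the one produced by the factor t = ln |z|. Only t times the imaginary part of
  - z / (1 - z) survives.\<close>

lemma bwray_deriv:
  assumes th: "cos \<theta> < 1"
  shows "(bwray \<theta> has_real_derivative (- t * sin \<theta> / (2 * cosh t - 2 * cos \<theta>))) (at t)"
proof -
  define z where "z = (\<lambda>t. of_real (exp t) * cis \<theta>)"
  have zs: "z t \<in> slit" and z0: "z t \<noteq> 0" for t using ray_slit[OF th] by (auto simp: z_def)
  have dz: "(z has_vector_derivative z t) (at t)"
    unfolding z_def by (intro has_vector_derivative_mult_left has_vector_derivative_of_real DERIV_exp)
  have "(dilog has_field_derivative - Ln (1 - z t) / z t) (at (z t))"
    using dilog_deriv[OF zs, of t] z0[of t] by simp
  from field_vector_diff_chain_at[OF dz this]
  have "((\<lambda>t. dilog (z t)) has_vector_derivative - Ln (1 - z t)) (at t)" using z0 by (simp add: o_def)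
  hence 1: "((\<lambda>t. Im (dilog (z t))) has_real_derivative Im (- Ln (1 - z t))) (at t)"
    unfolding has_real_derivative_iff_has_vector_derivative by (rule bounded_linear.has_vector_derivative[OF bounded_linear_Im])
  have "((\<lambda>w. Ln (1 - w)) has_field_derivative - 1 / (1 - z t)) (at (z t))"
    using zs[of t] by (auto intro!: derivative_eq_intros simp: slit_iff field_simps)
  from field_vector_diff_chain_at[OF dz this]
  have "((\<lambda>t. Ln (1 - z t)) has_vector_derivative z t * (- 1 / (1 - z t))) (at t)" by (simp add: o_def)
  hence 2: "((\<lambda>t. Im (Ln (1 - z t))) has_real_derivative Im (z t * (- 1 / (1 - z t)))) (at t)"
    unfolding has_real_derivative_iff_has_vector_derivative by (rule bounded_linear.has_vector_derivative[OF bounded_linear_Im])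
  have "((\<lambda>t. Im (dilog (z t)) + t * Im (Ln (1 - z t))) has_real_derivative 
      Im (- Ln (1 - z t)) + (1 * Im (Ln (1 - z t)) + Im (z t * (- 1 / (1 - z t))) * t)) (at t)"
    by (intro DERIV_add DERIV_mult 1 2 DERIV_ident)
  moreover have "(\<lambda>t. Im (dilog (z t)) + t * Im (Ln (1 - z t))) = bwray \<theta>"
    using bwray_eq[OF th] by (auto simp: z_def)
  moreover have "Im (- Ln (1 - z t)) + (1 * Im (Ln (1 - z t)) + Im (z t * (- 1 / (1 - z t))) * t) = - t * sin \<theta> / (2 * cosh t - 2 * cos \<theta>)"
  proof -
    have "z t / (1 - z t) = z t * cnj (1 - z t) / (norm (1 - z t))\<^sup>2"
      by (simp only: complex_div_cnj[of "z t"])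
    hence "Im (z t / (1 - z t)) = Im (z t * cnj (1 - z t)) / (norm (1 - z t))\<^sup>2"
      by (simp add: Im_divide_of_real flip: of_real_power)
    also have "Im (z t * cnj (1 - z t)) = exp t * sin \<theta>" by (simp add: z_def algebra_simps)
    also have "(norm (1 - z t))\<^sup>2 = exp t * (2 * cosh t - 2 * cos \<theta>)"
    proof -
      have e: "exp t * exp (- t) = 1" by (simp flip: exp_add)
      have "exp t * (2 * cosh t - 2 * cos \<theta>) = exp t * (exp t + exp (- t) - 2 * cos \<theta>)"
        by (simp add: cosh_field_def)
      also have "\<dots> = (exp t)\<^sup>2 + exp t * exp (- t) - 2 * exp t * cos \<theta>"
        by (simp add: algebra_simps power2_eq_square del: exp_minus)
      finally show ?thesis unfolding z_def dist_one_cis e by simp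
    qed
    finally have "Im (z t / (1 - z t)) = sin \<theta> / (2 * cosh t - 2 * cos \<theta>)" by simp
    thus ?thesis by simp
  qed
  ultimately show ?thesis by simp
qed

lemma bwray_bound:
  assumes th: "cos \<theta> < 1"
  shows "\<exists>T<0. \<forall>t\<le>T. \<bar>bwray \<theta> t\<bar> \<le> exp (t / 2)"
proof -
  have "((\<lambda>z. dilog z / z) \<longlongrightarrow> 1) (at 0)"
    using dilog_deriv[OF zero_in_slit] by (simp add: has_field_derivative_iff dilog_0)
  hence "eventually (\<lambda>z. dist (dilog z / z) 1 < 1) (at 0)" by (rule tendstoD) simp
  then obtain d where d: "d > 0" "\<And>z. z \<noteq> 0 \<Longrightarrow> dist z 0 < d \<Longrightarrow> dist (dilog z / z) 1 < 1"
    unfolding eventually_at by auto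
  have bd: "norm (dilog z) \<le> 2 * norm z" if "norm z < d" for z
  proof (cases "z = 0")
    case False
    have "norm (dilog z / z - 1) < 1" using d(2)[of z] that False by (simp add: dist_norm)
    hence "norm (dilog z / z) < 2" using norm_triangle_ineq2[of "dilog z / z" 1] by simp
    thus ?thesis using False by (simp add: norm_divide divide_simps)
  qed (simp add: dilog_0)
  have "((\<lambda>t::real. (2 + 2 * \<bar>t\<bar>) * exp (t / 2)) \<longlongrightarrow> 0) at_bot" by real_asymp
  hence e1: "eventually (\<lambda>t. (2 + 2 * \<bar>t\<bar>) * exp (t / 2) < 1) (at_bot :: real filter)"
    by (rule order_tendstoD) simp
  have "((\<lambda>t::real. exp t) \<longlongrightarrow> 0) at_bot" by (rule exp_at_bot)
  hence e2: "eventually (\<lambda>t::real. exp t < min d (1/2)) at_bot" using d(1) by (intro order_tendstoD) auto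
  have e3: "eventually (\<lambda>t::real. t < 0) at_bot" by (rule eventually_gt_at_bot)
  have "eventually (\<lambda>t. t < 0 \<and> \<bar>bwray \<theta> t\<bar> \<le> exp (t / 2)) at_bot"
    using e1 e2 e3
  proof eventually_elim
    case (elim t)
    define z where "z = of_real (exp t) * cis \<theta>"
    have nz: "norm z = exp t" by (simp add: z_def norm_mult)
    have "norm (Ln (1 + - z)) \<le> 2 * norm (- z)" using elim nz by (intro norm_Ln_le) simp
    hence 1: "\<bar>Im (Ln (1 - z))\<bar> \<le> 2 * exp t" using abs_Im_le_cmod[of "Ln (1 - z)"] nz by simp
    have 2: "\<bar>Im (dilog z)\<bar> \<le> 2 * exp t" using abs_Im_le_cmod[of "dilog z"] bd[of z] nz elim by simp
    have "\<bar>bwray \<theta> t\<bar> \<le> \<bar>Im (dilog z)\<bar> + \<bar>t\<bar> * \<bar>Im (Ln (1 - z))\<bar>"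
      unfolding bwray_eq[OF th] z_def[symmetric] by (metis abs_mult abs_triangle_ineq)
    also have "\<dots> \<le> 2 * exp t + \<bar>t\<bar> * (2 * exp t)" using 1 2 by (intro add_mono mult_left_mono) auto
    also have "\<dots> = ((2 + 2 * \<bar>t\<bar>) * exp (t / 2)) * exp (t / 2)"
      by (simp add: algebra_simps flip: exp_add)
    also have "\<dots> \<le> 1 * exp (t / 2)" using elim by (intro mult_right_mono) auto
    finally show ?case using elim by simp
  qed
  then obtain T where T: "\<And>t. t \<le> T \<Longrightarrow> t < 0 \<and> \<bar>bwray \<theta> t\<bar> \<le> exp (t / 2)"
    by (auto simp: eventually_at_bot_linorder)
  thus ?thesis by (intro exI[of _ T]) auto
qed

lemma bwray_lim: "cos \<theta> < 1 \<Longrightarrow> (bwray \<theta> \<longlongrightarrow> 0) at_bot"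
proof -
  assume th: "cos \<theta> < 1"
  obtain T where T: "\<And>t. t \<le> T \<Longrightarrow> \<bar>bwray \<theta> t\<bar> \<le> exp (t / 2)" using bwray_bound[OF th] by blast
  have "eventually (\<lambda>t. norm (bwray \<theta> t) \<le> exp (t / 2)) at_bot"
    unfolding eventually_at_bot_linorder using T by auto
  moreover have "((\<lambda>t::real. exp (t / 2)) \<longlongrightarrow> 0) at_bot" by real_asymp
  ultimately show ?thesis by (rule Lim_null_comparison)
qed

lemma zero_of_deriv_zero:
  fixes f :: "real \<Rightarrow> real"
  assumes "\<And>t. (f has_real_derivative 0) (at t)" and "(f \<longlongrightarrow> 0) at_bot"
  shows "f t = 0"
proof -
  have "f = (\<lambda>_. f t)" using DERIV_isconst_all assms(1) by blast
  hence "((\<lambda>_. f t) \<longlongrightarrow> 0) (at_bot :: real filter)" using assms(2) by simp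
  thus ?thesis by (simp add: tendsto_const_iff)
qed

text \<open>This is the invariance of D under inversion in the unit circle. The derivative of
  \<open>bwray\<close> is odd in t, and the two sides agree at t = 0.\<close>

lemma bwray_even: "cos \<theta> < 1 \<Longrightarrow> bwray \<theta> (- t) = bwray \<theta> t"
proof -
  assume th: "cos \<theta> < 1"
  have "((\<lambda>t. bwray \<theta> (- t) - bwray \<theta> t) has_real_derivative 0) (at t)" for t
  proof -
    have "((\<lambda>t. bwray \<theta> (- t)) has_real_derivative (- (- t) * sin \<theta> / (2 * cosh (- t) - 2 * cos \<theta>)) * (- 1)) (at t)"
      by (rule DERIV_chain2[where f = "bwray \<theta>" and g = uminus and x = t, OF bwray_deriv[OF th]]) (auto intro!: derivative_eq_intros)
    from DERIV_diff[OF this bwray_deriv[OF th]] show ?thesis by simp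
  qed
  hence "bwray \<theta> (- t) - bwray \<theta> t = bwray \<theta> (- 0) - bwray \<theta> 0"
    using DERIV_isconst_all[of "\<lambda>t. bwray \<theta> (- t) - bwray \<theta> t"] by blast
  thus ?thesis by simp
qed

lemma bwray_minus_angle: "cos \<theta> < 1 \<Longrightarrow> bwray (- \<theta>) t = - bwray \<theta> t"
proof -
  assume th: "cos \<theta> < 1"
  have "(\<lambda>t. bwray (- \<theta>) t + bwray \<theta> t) t = 0"
  proof (rule zero_of_deriv_zero[where f = "\<lambda>t. bwray (- \<theta>) t + bwray \<theta> t"])
    fix t
    show "((\<lambda>t. bwray (- \<theta>) t + bwray \<theta> t) has_real_derivative 0) (at t)"
      using DERIV_add[OF bwray_deriv[of "- \<theta>" t] bwray_deriv[OF th, of t]] th by simp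
    show "((\<lambda>t. bwray (- \<theta>) t + bwray \<theta> t) \<longlongrightarrow> 0) at_bot"
      using tendsto_add[OF bwray_lim[of "- \<theta>"] bwray_lim[OF th]] th by simp
  qed
  thus ?thesis by simp
qed

lemma bwray_pi: "bwray pi t = 0"
proof (rule zero_of_deriv_zero[where f = "bwray pi"])
  fix t show "(bwray pi has_real_derivative 0) (at t)" using bwray_deriv[of pi t] by simp
qed (use bwray_lim[of pi] in simp)

abbreviation "bw3 \<equiv> bwray (2 * pi / 3)"

lemma bw3_deriv: "(bw3 has_real_derivative (- t * (sqrt 3 / 2) / (2 * cosh t + 1))) (at t)"
  using bwray_deriv[of "2 * pi / 3" t] by (simp add: cos_120 sin_120)

text \<open>The duplication formula D(z^2) = 2 D(z) + 2 D(-z) for z on the ray of angle -pi/3, where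
  z^2 has angle -2 pi/3 and -z has angle 2 pi/3. In terms of derivatives it is the factorisation 2
  cosh 2t + 1 = (2 cosh t + 1) (2 cosh t - 1).\<close>

lemma bwray_pi_3: "bwray (pi / 3) t = bw3 (2 * t) / 2 + bw3 t"
proof -
  have "(\<lambda>t. bw3 (2 * t) / 2 + bw3 t - bwray (pi / 3) t) t = 0"
  proof (rule zero_of_deriv_zero[where f = "\<lambda>t. bw3 (2 * t) / 2 + bw3 t - bwray (pi / 3) t"])
    fix t
    define s where "s = sqrt 3 / 2"
    have "(bwray (pi / 3) has_real_derivative (- t * s / (2 * cosh t - 1))) (at t)"
      using bwray_deriv[of "pi / 3" t] by (simp add: cos_60 sin_60 s_def)
    moreover have "((\<lambda>t. bw3 (2 * t)) has_real_derivative (- (2 * t) * s / (2 * cosh (2 * t) + 1)) * 2) (at t)"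
      unfolding s_def by (rule DERIV_chain2[where f = bw3 and g = "\<lambda>t. 2 * t" and x = t, OF bw3_deriv]) (auto intro!: derivative_eq_intros)
    moreover have "(bw3 has_real_derivative (- t * s / (2 * cosh t + 1))) (at t)" unfolding s_def by (rule bw3_deriv)
    ultimately have "((\<lambda>t. bw3 (2 * t) / 2 + bw3 t - bwray (pi / 3) t) has_real_derivative
       (- (2 * t) * s / (2 * cosh (2 * t) + 1)) * 2 / 2 + (- t * s / (2 * cosh t + 1)) - (- t * s / (2 * cosh t - 1))) (at t)"
      by (intro DERIV_diff DERIV_add DERIV_cdivide)
    also have "(- (2 * t) * s / (2 * cosh (2 * t) + 1)) * 2 / 2 + (- t * s / (2 * cosh t + 1)) - (- t * s / (2 * cosh t - 1)) = 0"
    proof -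
      have c: "cosh t \<ge> 1" by (rule cosh_real_ge_1)
      have e: "2 * cosh (2 * t) + 1 = (2 * cosh t + 1) * (2 * cosh t - 1)"
        unfolding cosh_double_cosh by (simp add: algebra_simps power2_eq_square)
      have "2 * cosh t + 1 \<noteq> 0" "2 * cosh t - 1 \<noteq> 0" using c by auto
      thus ?thesis unfolding e by (simp add: divide_simps) (simp add: algebra_simps)
    qed
    finally show "((\<lambda>t. bw3 (2 * t) / 2 + bw3 t - bwray (pi / 3) t) has_real_derivative 0) (at t)" .
    have l: "(bw3 \<longlongrightarrow> 0) at_bot" by (rule bwray_lim) (simp add: cos_120)
    have "filterlim (\<lambda>t::real. 2 * t) at_bot at_bot" by real_asymp
    from filterlim_compose[OF l this] l
    have "((\<lambda>t. bw3 (2 * t) / 2 + bw3 t - bwray (pi / 3) t) \<longlongrightarrow> 0 / 2 + 0 - 0) at_bot"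
      by (intro tendsto_intros bwray_lim) (auto simp: cos_60 cos_120)
    thus "((\<lambda>t. bw3 (2 * t) / 2 + bw3 t - bwray (pi / 3) t) \<longlongrightarrow> 0) at_bot" by simp
  qed
  thus ?thesis by simp
qed

lemma dilog_circle_deriv:
  assumes "cos \<theta> < 1"
  shows "((\<lambda>\<theta>. Im (dilog (cis \<theta>))) has_real_derivative - ln (norm (1 - cis \<theta>))) (at \<theta>)"
proof -
  have zs: "cis \<theta> \<in> slit" using ray_slit[OF assms, of 0] by simp
  have "((\<lambda>\<theta>. cis \<theta>) has_vector_derivative \<i> * cis \<theta>) (at \<theta>)"
    using has_derivative_cis[of "\<lambda>x. x" "\<lambda>x. x" \<theta> UNIV] by (simp add: has_vector_derivative_def scaleR_conv_of_real mult_ac)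
  moreover have "(dilog has_field_derivative - Ln (1 - cis \<theta>) / cis \<theta>) (at (cis \<theta>))"
    using dilog_deriv[OF zs] by simp
  ultimately have "(dilog \<circ> cis has_vector_derivative \<i> * cis \<theta> * (- Ln (1 - cis \<theta>) / cis \<theta>)) (at \<theta>)"
    by (rule field_vector_diff_chain_at)
  hence "((\<lambda>\<theta>. dilog (cis \<theta>)) has_vector_derivative \<i> * cis \<theta> * (- Ln (1 - cis \<theta>) / cis \<theta>)) (at \<theta>)" by (simp add: o_def)
  from bounded_linear.has_vector_derivative[OF bounded_linear_Im this]
  have "((\<lambda>\<theta>. Im (dilog (cis \<theta>))) has_real_derivative Im (\<i> * cis \<theta> * (- Ln (1 - cis \<theta>) / cis \<theta>))) (at \<theta>)"
    by (simp add: has_real_derivative_iff_has_vector_derivative)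
  also have "Im (\<i> * cis \<theta> * (- Ln (1 - cis \<theta>) / cis \<theta>)) = - ln (norm (1 - cis \<theta>))"
  proof -
    have "1 - cis \<theta> \<noteq> 0" using assms by (auto simp: complex_eq_iff)
    thus ?thesis by simp
  qed
  finally show ?thesis .
qed

text \<open>For a = 2 pi/3 the number 1 + 2 cos v is |1 - cis (a + v)| |1 - cis (-a + v)|, and the
  logarithm of each factor is minus a derivative of Im \<open>dilog\<close> on the circle. The
  contributions at v = 0 cancel by oddness; at v = pi/3 the point -1 contributes 0 and the other
  point gives the value.\<close>

lemma integral_ln_trinomial: "integral {0..pi/3} (\<lambda>v. ln (1 + 2 * cos v)) = bwray (pi / 3) 0"
proof -
  define a where "a = 2 * pi / 3"
  let ?h = "\<lambda>v. - (Im (dilog (cis (a + v))) + Im (dilog (cis (- a + v))))"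
  have "((\<lambda>v. ln (1 + 2 * cos v)) has_integral ?h (pi/3) - ?h 0) {0..pi/3}"
  proof (rule fundamental_theorem_of_calculus)
    fix v :: real assume v: "v \<in> {0..pi/3}"
    have c1: "cos (a + v) < 1"
    proof -
      have "cos (a + v) \<le> cos (pi / 2)" using v by (intro cos_monotone_0_pi_le) (auto simp: a_def)
      thus ?thesis by simp
    qed
    have c2: "cos (- a + v) < 1"
    proof -
      have "cos (a - v) \<le> cos (pi / 3)" using v by (intro cos_monotone_0_pi_le) (auto simp: a_def)
      moreover have "cos (- a + v) = cos (a - v)" by (metis add.commute cos_minus minus_diff_eq uminus_add_conv_diff)
      ultimately show ?thesis by (simp add: cos_60)
    qed
    have "((\<lambda>v. Im (dilog (cis (b + v)))) has_real_derivative - ln (norm (1 - cis (b + v))) * 1) (at v)"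
      if "cos (b + v) < 1" for b
      by (rule DERIV_chain2[where f = "\<lambda>\<theta>. Im (dilog (cis \<theta>))" and g = "\<lambda>v. b + v" and x = v, OF dilog_circle_deriv[OF that]])
         (auto intro!: derivative_eq_intros)
    hence D: "(?h has_real_derivative - (- ln (norm (1 - cis (a + v))) * 1 + - ln (norm (1 - cis (- a + v))) * 1)) (at v)"
      using c1 c2 by (intro DERIV_minus DERIV_add) blast+
    have n: "1 - cis (a + v) \<noteq> 0" "1 - cis (- a + v) \<noteq> 0" using c1 c2 by (auto simp: complex_eq_iff)
    have "(1 - cis (a + v)) * (1 - cis (- a + v)) = cis v * of_real (1 + 2 * cos v)"
    proof -
      have "(1 - cis (a + v)) * (1 - cis (- a + v)) = 1 - (cis a + cis (- a)) * cis v + cis v * cis v"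
        by (simp add: algebra_simps cis_mult flip: cis_mult)  (simp add: cis_mult add_ac)
      also have "cis a + cis (- a) = - 1" by (simp add: complex_eq_iff a_def cos_120)
      also have "1 - (- 1) * cis v + cis v * cis v = cis v * (cis (- v) + 1 + cis v)"
        by (simp add: algebra_simps cis_mult)
      also have "cis (- v) + 1 + cis v = of_real (1 + 2 * cos v)" by (simp add: complex_eq_iff)
      finally show ?thesis .
    qed
    hence "norm (1 - cis (a + v)) * norm (1 - cis (- a + v)) = norm (cis v) * norm (complex_of_real (1 + 2 * cos v))"
      by (metis norm_mult)
    moreover have "cos (pi / 3) \<le> cos v" using v by (intro cos_monotone_0_pi_le) auto
    ultimately have "norm (1 - cis (a + v)) * norm (1 - cis (- a + v)) = 1 + 2 * cos v" 
      by (simp add: cos_60 del: of_real_add of_real_mult)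
    moreover have "ln (norm (1 - cis (a + v)) * norm (1 - cis (- a + v))) = ln (norm (1 - cis (a + v))) + ln (norm (1 - cis (- a + v)))"
      using n by (simp add: ln_mult)
    ultimately have "- (- ln (norm (1 - cis (a + v))) * 1 + - ln (norm (1 - cis (- a + v))) * 1) = ln (1 + 2 * cos v)"
      by simp
    with D have "(?h has_real_derivative ln (1 + 2 * cos v)) (at v)" by (simp only:)
    thus "(?h has_vector_derivative ln (1 + 2 * cos v)) (at v within {0..pi/3})"
      by (simp add: has_real_derivative_iff_has_vector_derivative has_vector_derivative_at_within)
  qed auto
  hence "integral {0..pi/3} (\<lambda>v. ln (1 + 2 * cos v)) = ?h (pi/3) - ?h 0" by (rule integral_unique)
  also have "\<dots> = bwray (pi / 3) 0"
  proof -
    have b: "bwray \<theta> 0 = Im (dilog (cis \<theta>))" if "cos \<theta> < 1" for \<theta>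
      using bwray_eq[OF that, of 0] by simp
    have e: "a + pi / 3 = pi" "- a + pi / 3 = - (pi / 3)" by (auto simp: a_def)
    have "Im (dilog (cis pi)) = 0" using b[of pi] bwray_pi[of 0] by simp
    moreover have "Im (dilog (cis (- (pi / 3)))) = - bwray (pi / 3) 0"
      using b[of "- (pi / 3)"] bwray_minus_angle[of "pi / 3" 0] by (simp add: cos_60)
    moreover have "Im (dilog (cis (- a))) = - Im (dilog (cis a))"
      using b[of "- a"] b[of a] bwray_minus_angle[of a 0] by (simp add: a_def cos_120)
    ultimately show ?thesis unfolding e by simp
  qed
  finally show ?thesis .
qed

lemma MM_3_eq: "mahler_jensen 3 = 9 / (2 * pi) * bw3 0"
  unfolding MM_3 integral_ln_trinomial bwray_pi_3 by (simp add: field_simps)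

section \<open>Lattice sums of the Bloch-Wigner function\<close>

lemma has_sum_int:
  fixes f :: "int \<Rightarrow> 'a :: {topological_comm_monoid_add, t2_space}"
  assumes "((\<lambda>n. f (int n)) has_sum a) UNIV" "((\<lambda>n. f (- int (Suc n))) has_sum b) UNIV"
  shows "(f has_sum (a + b)) UNIV"
proof -
  have "(f has_sum a) (range int)"
    using assms(1) by (subst has_sum_reindex) (auto simp: o_def)
  moreover have "(f has_sum b) (range (\<lambda>n. - int (Suc n)))"
    using assms(2) by (subst has_sum_reindex) (auto simp: o_def inj_on_def)
  ultimately have "(f has_sum (a + b)) (range int \<union> range (\<lambda>n. - int (Suc n)))"
    by (rule has_sum_Un_disjoint) auto
  also have "range int \<union> range (\<lambda>n. - int (Suc n)) = UNIV"
  proof safe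
    fix n :: int assume "n \<notin> range (\<lambda>n. - int (Suc n))"
    show "n \<in> range int"
    proof (rule ccontr)
      assume "n \<notin> range int"
      hence "n < 0" by (metis nonneg_int_cases not_less rangeI)
      hence "n = - int (Suc (nat (- n - 1)))" by simp
      thus False using \<open>n \<notin> range (\<lambda>n. - int (Suc n))\<close> by blast
    qed
  qed auto
  finally show ?thesis .
qed

lemma bwray_bound_exp:
  assumes th: "cos \<theta> < 1"
  shows "\<exists>K\<ge>0. \<forall>t. \<bar>bwray \<theta> t\<bar> \<le> K * exp (- \<bar>t\<bar> / 2)"
proof -
  obtain T where T: "T < 0" "\<And>t. t \<le> T \<Longrightarrow> \<bar>bwray \<theta> t\<bar> \<le> exp (t / 2)" using bwray_bound[OF th] by blast
  have "continuous_on {T..-T} (bwray \<theta>)"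
    using bwray_deriv[OF th] by (intro continuous_at_imp_continuous_on ballI) (blast intro: DERIV_isCont)
  hence "bounded (bwray \<theta> ` {T..-T})" by (intro compact_imp_bounded compact_continuous_image) auto
  then obtain M where "\<forall>t\<in>{T..-T}. \<bar>bwray \<theta> t\<bar> \<le> M" by (auto simp: bounded_iff)
  hence M: "\<And>t. t \<in> {T..-T} \<Longrightarrow> \<bar>bwray \<theta> t\<bar> \<le> M" by blast
  have M0: "M \<ge> 0" using M[of 0] T(1) by auto
  define K where "K = 1 + M * exp (- T / 2)"
  have K: "K \<ge> 0" "K \<ge> 1" using M0 by (auto simp: K_def)
  have le: "\<bar>bwray \<theta> t\<bar> \<le> K * exp (- \<bar>t\<bar> / 2)" if "t \<le> 0" for t
  proof (cases "t \<le> T")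
    case True
    have "\<bar>bwray \<theta> t\<bar> \<le> 1 * exp (- \<bar>t\<bar> / 2)" using T(2)[OF True] that by simp
    also have "\<dots> \<le> K * exp (- \<bar>t\<bar> / 2)" using K by (intro mult_right_mono) auto
    finally show ?thesis .
  next
    case False
    have "\<bar>bwray \<theta> t\<bar> \<le> M" using M[of t] False that T(1) by simp
    also have "M = M * exp (- T / 2) * exp (T / 2)" by (simp flip: exp_add)
    also have "\<dots> \<le> K * exp (- \<bar>t\<bar> / 2)"
      unfolding K_def using False that M0 by (intro mult_mono) auto
    finally show ?thesis .
  qed
  have "\<bar>bwray \<theta> t\<bar> \<le> K * exp (- \<bar>t\<bar> / 2)" for t
    using le[of t] le[of "- t"] bwray_even[OF th, of t] by (cases "t \<le> 0") auto
  thus ?thesis using K by blast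
qed

lemma summable_bwray:
  assumes th: "cos \<theta> < 1" and L: "L < 0"
  shows "(\<lambda>n::int. bwray \<theta> ((of_int n + a) * L)) summable_on UNIV"
proof -
  obtain K where K: "K \<ge> 0" "\<And>t. \<bar>bwray \<theta> t\<bar> \<le> K * exp (- \<bar>t\<bar> / 2)" using bwray_bound_exp[OF th] by blast
  define \<rho> where "\<rho> = exp (L / 2)"
  define C where "C = K * exp (\<bar>a * L\<bar> / 2)"
  have \<rho>: "0 < \<rho>" "\<rho> < 1" using L by (auto simp: \<rho>_def)
  have bd: "\<bar>bwray \<theta> ((of_int n + a) * L)\<bar> \<le> C * exp (\<bar>of_int n\<bar> * L / 2)" for n :: int
  proof -
    have "(of_int n + a) * L = of_int n * L + a * L" by (simp add: algebra_simps)
    hence "\<bar>of_int n * L\<bar> - \<bar>a * L\<bar> \<le> \<bar>(of_int n + a) * L\<bar>" by linarith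
    moreover have "\<bar>of_int n * L\<bar> = - (\<bar>of_int n\<bar> * L)" using L by (simp add: abs_mult)
    ultimately have "- \<bar>(of_int n + a) * L\<bar> / 2 \<le> \<bar>a * L\<bar> / 2 + \<bar>of_int n\<bar> * L / 2" by (simp add: field_simps)
    hence "exp (- \<bar>(of_int n + a) * L\<bar> / 2) \<le> exp (\<bar>a * L\<bar> / 2) * exp (\<bar>of_int n\<bar> * L / 2)"
      by (simp flip: exp_add)
    hence "K * exp (- \<bar>(of_int n + a) * L\<bar> / 2) \<le> K * (exp (\<bar>a * L\<bar> / 2) * exp (\<bar>of_int n\<bar> * L / 2))"
      using K(1) by (rule mult_left_mono)
    with K(2)[of "(of_int n + a) * L"] show ?thesis unfolding C_def by (simp only: mult.assoc)
  qed
  have ex: "exp (real n * L / 2) = \<rho> ^ n" for n :: nat by (simp add: \<rho>_def flip: exp_of_nat_mult)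
  have "summable (\<lambda>n. norm (C * \<rho> ^ n))" using \<rho> by (simp add: abs_mult summable_mult summable_geometric)
  hence 1: "(\<lambda>n. C * exp (\<bar>of_int (int n)\<bar> * L / 2)) summable_on UNIV"
    by (simp add: ex norm_summable_imp_summable_on)
  have sm: "summable (\<lambda>n. norm (C * \<rho> ^ Suc n))" using \<rho> by (simp add: abs_mult summable_mult summable_geometric)
  have 2: "(\<lambda>n. C * exp (\<bar>of_int (- int (Suc n))\<bar> * L / 2)) summable_on UNIV"
  proof -
    have "\<bar>real_of_int (- int (Suc n))\<bar> = real (Suc n)" for n by simp
    hence "exp (\<bar>of_int (- int (Suc n))\<bar> * L / 2) = \<rho> ^ Suc n" for n by (simp only: ex)
    thus ?thesis using sm by (simp only: norm_summable_imp_summable_on)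
  qed
  have "(\<lambda>n::int. C * exp (\<bar>of_int n\<bar> * L / 2)) summable_on UNIV"
    using has_sum_int[of "\<lambda>n::int. C * exp (\<bar>of_int n\<bar> * L / 2)", OF has_sum_infsum[OF 1] has_sum_infsum[OF 2]] by (rule has_sum_imp_summable)
  hence "(\<lambda>n::int. norm (bwray \<theta> ((of_int n + a) * L))) summable_on UNIV"
    by (rule summable_on_comparison_test) (use bd in auto)
  thus ?thesis by (rule abs_summable_summable)
qed

text \<open>The function S of the overview in the variable L = ln q: the summands are D at
  \<open>zeta3\<close> times q^n. Halving and doubling L correspond to the nomes sqrt q and
  q^2.\<close>

definition dilog_sum :: "real \<Rightarrow> real" where "dilog_sum L = (\<Sum>\<^sub>\<infinity>n::int. bw3 (of_int n * L))"

lemma cos_120_lt: "cos (2 * pi / 3) < 1" by (simp add: cos_120)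
lemma cos_60_lt: "cos (pi / 3) < 1" by (simp add: cos_60)

lemma dilog_sum_has_sum: "L < 0 \<Longrightarrow> ((\<lambda>n::int. bw3 (of_int n * L)) has_sum dilog_sum L) UNIV"
  using summable_bwray[OF cos_120_lt, of L 0] by (simp add: dilog_sum_def)

lemma odd_has_sum:
  assumes L: "L < 0"
  shows "((\<lambda>n::int. bw3 ((2 * of_int n + 1) * L)) has_sum (dilog_sum L - dilog_sum (2 * L))) UNIV"
proof -
  let ?f = "\<lambda>n::int. bw3 (of_int n * L)"
  have "((\<lambda>n::int. ?f (2 * n)) has_sum dilog_sum (2 * L)) UNIV"
    using dilog_sum_has_sum[of "2 * L"] L by (simp add: mult_ac)
  hence "(?f has_sum dilog_sum (2 * L)) (range (\<lambda>n. 2 * n))"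
    by (subst has_sum_reindex) (auto simp: o_def inj_on_def)
  hence "(?f has_sum (dilog_sum L - dilog_sum (2 * L))) (UNIV - range (\<lambda>n. 2 * n))"
    by (intro has_sum_Diff dilog_sum_has_sum L) auto
  also have "UNIV - range (\<lambda>n. 2 * n) = range (\<lambda>n::int. 2 * n + 1)"
  proof -
    have "range (\<lambda>n::int. 2 * n) = {n. even n}" by (auto elim: evenE)
    moreover have "range (\<lambda>n::int. 2 * n + 1) = {n. odd n}" by (auto elim: oddE)
    ultimately show ?thesis by auto
  qed
  finally have "((\<lambda>n::int. ?f (2 * n + 1)) has_sum (dilog_sum L - dilog_sum (2 * L))) UNIV"
    by (subst (asm) has_sum_reindex) (auto simp: o_def inj_on_def)
  thus ?thesis by simp
qed

text \<open>By \<open>bwray_pi_3\<close> the sum over half-integral multiples of L on the ray pi/3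
  becomes sums over odd multiples of L and of L/2 on the ray 2 pi/3, and each of these is a full sum
  minus its even part.\<close>

lemma sixth_has_sum:
  assumes L: "L < 0"
  shows "((\<lambda>n::int. bwray (pi / 3) ((of_int n + 1 / 2) * L)) has_sum (dilog_sum (L / 2) - dilog_sum L / 2 - dilog_sum (2 * L) / 2)) UNIV"
proof -
  have "((\<lambda>n::int. bw3 ((2 * of_int n + 1) * L) / 2 + bw3 ((2 * of_int n + 1) * (L / 2))) has_sum
      ((dilog_sum L - dilog_sum (2 * L)) / 2 + (dilog_sum (L / 2) - dilog_sum (2 * (L / 2))))) UNIV"
    by (intro has_sum_add has_sum_divide_const odd_has_sum) (use L in auto)
  thus ?thesis
    unfolding bwray_pi_3 by (simp add: algebra_simps diff_divide_distrib add_divide_distrib)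
qed

text \<open>Evenness of \<open>bw3\<close> folds the two-sided sum, which can then be treated by the
  theorems on ordinary series.\<close>

lemma dilog_sum_series:
  assumes L: "L < 0"
  shows "(\<lambda>n. bw3 (real (Suc n) * L)) sums ((dilog_sum L - bw3 0) / 2)"
proof -
  let ?f = "\<lambda>n::int. bw3 (of_int n * L)"
  define b where "b = (\<Sum>\<^sub>\<infinity>n. bw3 (real (Suc n) * L))"
  have "(\<lambda>n. ?f (int n)) summable_on UNIV"
    using summable_on_reindex[of int UNIV ?f] summable_on_subset_banach[OF has_sum_imp_summable[OF dilog_sum_has_sum[OF L]], of "range int"]
    by (simp add: o_def)
  hence s: "((\<lambda>n. ?f (int n)) has_sum (\<Sum>\<^sub>\<infinity>n. ?f (int n))) UNIV" by (rule has_sum_infsum)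
  have "(\<lambda>n. ?f (int n)) sums (\<Sum>\<^sub>\<infinity>n. ?f (int n))" using s by (rule has_sum_imp_sums)
  hence "(\<lambda>n. ?f (int (Suc n))) sums ((\<Sum>\<^sub>\<infinity>n. ?f (int n)) - ?f (int 0))"
    by (subst sums_Suc_iff) simp
  hence sb: "(\<lambda>n. bw3 (real (Suc n) * L)) sums ((\<Sum>\<^sub>\<infinity>n. ?f (int n)) - bw3 0)" by simp
  have inj: "(\<lambda>n. bw3 (real (Suc n) * L)) summable_on UNIV"
    using summable_on_reindex[of "\<lambda>n. int (Suc n)" UNIV ?f] 
      summable_on_subset_banach[OF has_sum_imp_summable[OF dilog_sum_has_sum[OF L]], of "range (\<lambda>n. int (Suc n))"]
    by (simp add: o_def inj_on_def)
  have hb: "((\<lambda>n. bw3 (real (Suc n) * L)) has_sum ((\<Sum>\<^sub>\<infinity>n. ?f (int n)) - bw3 0)) UNIV"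
    using has_sum_infsum[OF inj] has_sum_imp_sums[OF has_sum_infsum[OF inj]] sb sums_unique2 by metis
  have "?f (- int (Suc n)) = bw3 (real (Suc n) * L)" for n
  proof -
    have "of_int (- int (Suc n)) * L = - (real (Suc n) * L)" by (simp add: algebra_simps)
    thus ?thesis using bwray_even[OF cos_120_lt, of "real (Suc n) * L"] by (simp only:)
  qed
  with hb have "((\<lambda>n. ?f (- int (Suc n))) has_sum ((\<Sum>\<^sub>\<infinity>n. ?f (int n)) - bw3 0)) UNIV" by simp
  from has_sum_int[OF s this] have "dilog_sum L = (\<Sum>\<^sub>\<infinity>n. ?f (int n)) + ((\<Sum>\<^sub>\<infinity>n. ?f (int n)) - bw3 0)"
    using dilog_sum_has_sum[OF L] infsumI by metis
  hence "(\<Sum>\<^sub>\<infinity>n. ?f (int n)) - bw3 0 = (dilog_sum L - bw3 0) / 2" by simp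
  thus ?thesis using sb by (simp only:)
qed

definition eta_quotient :: "real \<Rightarrow> real" where "eta_quotient q = q * eul (q ^ 3) ^ 9 / eul q ^ 3"

text \<open>With y = exp (n L) one has 1 / (2 cosh (n L) + 1) = y / (1 + y + y^2). One factor n
  comes from the derivative of \<open>bw3\<close> and one from the chain rule, so the differentiated
  series is the one in \<open>eisenstein_sums\<close>.\<close>

lemma dilog_sum_deriv:
  assumes L: "L < 0"
  shows "(dilog_sum has_real_derivative - sqrt 3 * L * eta_quotient (exp L)) (at L)"
proof -
  define s where "s = sqrt 3 / 2"
  have s: "s > 0" by (simp add: s_def)
  define f' where "f' = (\<lambda>n x. - (real (Suc n) * x) * s / (2 * cosh (real (Suc n) * x) + 1) * real (Suc n))"
  define a b where "a = 2 * L" "b = L / 2"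
  have ab: "a < L" "L < b" "b < 0" using L by (auto simp: a_b_def)
  have D: "((\<lambda>x. \<Sum>n. bw3 (real (Suc n) * x)) has_field_derivative (\<Sum>n. f' n L)) (at L)"
  proof (rule has_field_derivative_series'(2)[where S = "{a..b}" and x0 = L])
    fix n x
    show "((\<lambda>x. bw3 (real (Suc n) * x)) has_field_derivative f' n x) (at x within {a..b})"
      unfolding f'_def s_def
      by (rule has_field_derivative_at_within, rule DERIV_chain2[where f = bw3 and g = "\<lambda>x. real (Suc n) * x" and x = x, OF bw3_deriv])
         (auto intro!: derivative_eq_intros)
  next
    show "uniformly_convergent_on {a..b} (\<lambda>n x. \<Sum>i<n. f' i x)"
    proof (rule Weierstrass_m_test')
      have "\<bar>exp b\<bar> < 1" using ab by simp
      from second_geometric_sums[OF this]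
      show "summable (\<lambda>n. - a * s * (real (Suc n) ^ 2 * exp b ^ Suc n))"
        by (intro summable_mult) (auto simp: sums_iff)
      fix n x assume x: "x \<in> {a..b}"
      define t where "t = real (Suc n) * x"
      have x0: "x < 0" using x ab by simp
      have "2 * cosh t = exp t + exp (- t)" by (simp add: cosh_field_def)
      hence "exp (- t) \<le> 2 * cosh t + 1" using exp_ge_zero[of t] by linarith
      hence "1 / (2 * cosh t + 1) \<le> 1 / exp (- t)" by (intro divide_left_mono) (auto simp: add_pos_pos)
      also have "\<dots> = exp t" by (simp add: exp_minus field_simps)
      also have "\<dots> \<le> exp (real (Suc n) * b)" using x by (auto simp: t_def intro!: mult_left_mono)
      also have "\<dots> = exp b ^ Suc n" by (rule exp_of_nat_mult)
      finally have 1: "1 / (2 * cosh t + 1) \<le> exp b ^ Suc n" .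
      have c: "2 * cosh t + 1 > 0" by (simp add: add_pos_pos)
      have "norm (f' n x) = (- x) * s * (real (Suc n) ^ 2 * (1 / (2 * cosh t + 1)))"
        unfolding f'_def t_def[symmetric] using x0 s c by (simp add: abs_mult t_def power2_eq_square)
      also have "\<dots> \<le> (- a) * s * (real (Suc n) ^ 2 * exp b ^ Suc n)"
      proof (intro mult_mono)
        have "a < 0" using ab by linarith
        thus "0 \<le> - a * s" using s by (simp add: mult_nonpos_nonneg)
      qed (use 1 x s x0 ab c in auto)
      finally show "norm (f' n x) \<le> - a * s * (real (Suc n) ^ 2 * exp b ^ Suc n)" .
    qed
  next
    show "convex {a..b}" "L \<in> {a..b}" using ab by auto
    show "summable (\<lambda>n. bw3 (real (Suc n) * L))" using dilog_sum_series[OF L] by (simp only: sums_iff)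
    show "L \<in> interior {a..b}" using ab by (simp add: interior_atLeastAtMost_real)
  qed
  interpret nome "exp L" using L by unfold_locales auto
  have sum: "(\<Sum>n. f' n L) = - L * s * eta_quotient (exp L)"
  proof -
    have e: "f' n L = - L * s * (real (Suc n) ^ 2 * (exp L ^ Suc n / (1 + exp L ^ Suc n + (exp L ^ Suc n)\<^sup>2)))" for n
    proof -
      define y where "y = exp L ^ Suc n"
      define t where "t = real (Suc n) * L"
      have y: "y = exp t" "y > 0" by (simp_all add: y_def t_def flip: exp_of_nat_mult del: power_Suc of_nat_Suc)
      have "2 * cosh t + 1 = (1 + y + y\<^sup>2) / y"
        unfolding cosh_field_def y by (simp add: exp_minus field_simps power2_eq_square)
      hence "f' n L = - (real (Suc n) * L) * s / ((1 + y + y\<^sup>2) / y) * real (Suc n)"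
        unfolding f'_def t_def[symmetric] by simp
      thus ?thesis unfolding y_def[symmetric] by (simp add: power2_eq_square)
    qed
    have "(\<lambda>n. f' n L) sums (- L * s * eta_quotient (exp L))"
      unfolding e eta_quotient_def by (intro sums_mult eisenstein_sums)
    thus ?thesis by (simp add: sums_iff)
  qed
  have "eventually (\<lambda>x. x \<in> {..<0}) (nhds L)" using L by (intro eventually_nhds_in_open) auto
  hence ev: "eventually (\<lambda>x. bw3 0 + 2 * (\<Sum>n. bw3 (real (Suc n) * x)) = dilog_sum x) (nhds L)"
  proof eventually_elim
    case (elim x)
    hence "(\<Sum>n. bw3 (real (Suc n) * x)) = (dilog_sum x - bw3 0) / 2" using dilog_sum_series[of x] by (simp add: sums_iff)
    thus ?case by simp
  qed
  have "((\<lambda>x. bw3 0 + 2 * (\<Sum>n. bw3 (real (Suc n) * x))) has_field_derivative 0 + 2 * (\<Sum>n. f' n L)) (at L)"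
    by (intro DERIV_add DERIV_const DERIV_cmult D)
  from DERIV_cong_ev[THEN iffD1, OF refl ev refl this] show ?thesis
    unfolding sum by (simp add: s_def mult_ac)
qed

lemma dilog_sum_lim: "(dilog_sum \<longlongrightarrow> bw3 0) at_bot"
proof -
  obtain K where K: "K \<ge> 0" "\<And>t. \<bar>bw3 t\<bar> \<le> K * exp (- \<bar>t\<bar> / 2)" using bwray_bound_exp[OF cos_120_lt] by blast
  have bd: "norm (dilog_sum L - bw3 0) \<le> 2 * K * (exp (L / 2) / (1 - exp (L / 2)))" if L: "L < 0" for L
  proof -
    define \<rho> where "\<rho> = exp (L / 2)"
    have \<rho>: "norm \<rho> < 1" using L by (simp add: \<rho>_def)
    have g: "(\<lambda>n. K * (\<rho> * \<rho> ^ n)) sums (K * (\<rho> * (1 / (1 - \<rho>))))"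
      by (intro sums_mult geometric_sums \<rho>)
    have le: "norm (bw3 (real (Suc n) * L)) \<le> K * (\<rho> * \<rho> ^ n)" for n
    proof -
      have "- \<bar>real (Suc n) * L\<bar> / 2 = real (Suc n) * (L / 2)" using L by (simp add: abs_mult)
      hence "exp (- \<bar>real (Suc n) * L\<bar> / 2) = \<rho> ^ Suc n" by (simp only: exp_of_nat_mult \<rho>_def)
      thus ?thesis using K(2)[of "real (Suc n) * L"] by simp
    qed
    have "norm (\<Sum>n. bw3 (real (Suc n) * L)) \<le> (\<Sum>n. K * (\<rho> * \<rho> ^ n))"
      by (rule norm_suminf_le[OF le]) (use g in \<open>simp add: sums_iff\<close>)
    also have "\<dots> = K * (\<rho> * (1 / (1 - \<rho>)))" using g by (simp add: sums_iff)
    also have "(\<Sum>n. bw3 (real (Suc n) * L)) = (dilog_sum L - bw3 0) / 2" using dilog_sum_series[OF L] by (simp only: sums_iff)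
    finally have "2 * norm ((dilog_sum L - bw3 0) / 2) \<le> 2 * (K * (\<rho> * (1 / (1 - \<rho>))))" by (intro mult_left_mono) auto
    thus ?thesis by (simp add: \<rho>_def)
  qed
  have ev: "eventually (\<lambda>L. norm (dilog_sum L - bw3 0) \<le> 2 * K * (exp (L / 2) / (1 - exp (L / 2)))) at_bot"
    using eventually_gt_at_bot[of 0] by eventually_elim (use bd in auto)
  have "((\<lambda>L::real. exp (L / 2) / (1 - exp (L / 2))) \<longlongrightarrow> 0) at_bot" by real_asymp
  hence "((\<lambda>L::real. 2 * K * (exp (L / 2) / (1 - exp (L / 2)))) \<longlongrightarrow> 0) at_bot" by (rule tendsto_mult_right_zero)
  from Lim_null_comparison[OF ev this] show ?thesis by (rule LIM_zero_cancel)
qed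

section \<open>The Mahler measure as a lattice sum\<close>

definition alpha :: "real \<Rightarrow> real" where "alpha q = root 3 (27 + hauptmodul q)"

context nome
begin

lemma alpha_cube: "alpha q ^ 3 = 27 + hauptmodul q"
  using hauptmodul_pos by (simp add: alpha_def)

lemma alpha_gt_3: "alpha q > 3"
proof (rule ccontr)
  assume "\<not> alpha q > 3"
  moreover have "alpha q \<ge> 0" using hauptmodul_pos by (simp add: alpha_def)
  ultimately have "alpha q ^ 3 \<le> 3 ^ 3" by (intro power_mono) auto
  thus False using alpha_cube hauptmodul_pos by simp
qed

text \<open>Since A^3 = alpha^3 B, this real cube root gives A = alpha B3. It is the scale at which
  p = B3 / sqrt X turns the line A X - B into the polynomial p (alpha - p^2).\<close>

definition "B3 = root 3 B"

lemma B3: "B3 > 0" "B3 ^ 3 = B" using B_pos by (auto simp: B3_def)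

lemma A_eq: "A = alpha q * B3"
proof -
  have "A ^ 3 = (alpha q * B3) ^ 3"
    unfolding power_mult_distrib alpha_cube B3(2) hauptmodul_eq[symmetric] using B_pos by simp
  moreover have "alpha q * B3 > 0" using alpha_gt_3 B3 by simp
  ultimately show ?thesis using A_pos by (metis less_imp_le power_eq_imp_eq_base zero_less_numeral)
qed

section \<open>The real ray from the origin to a half period, and the period integral\<close>

definition "Xr x = Re (qW q (of_real (exp (- x))) - W0)"
definition "Dr x = Re (DW (of_real (exp (- x))))"

lemma exp_annulus:
  assumes "0 < x" "x < - ln q"
  shows "q < exp (- x)" "exp (- x) < 1"
proof -
  have "exp (ln q) < exp (- x)" using assms by (subst exp_less_cancel_iff) linarith
  thus "q < exp (- x)" using q by simp
qed (use assms in simp)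

lemma ln_q: "ln q < 0" using q by simp

lemma ray_real:
  assumes "0 < x" "x < - ln q"
  shows "of_real (exp (- x)) \<in> tdom q" "qW q (of_real (exp (- x))) - W0 = of_real (Xr x)" "DW (of_real (exp (- x))) = of_real (Dr x)"
proof -
  show t: "of_real (exp (- x)) \<in> tdom q" using tdom_annulus exp_annulus[OF assms] by blast
  have "qW q (of_real (exp (- x))) - W0 \<in> \<real>" by (intro Reals_diff qW_real t W0_real) auto
  thus "qW q (of_real (exp (- x))) - W0 = of_real (Xr x)" unfolding Xr_def by (rule of_real_Re[symmetric])
  have "DW (of_real (exp (- x))) \<in> \<real>"
    unfolding DW_def Q_eul by (intro Reals_mult Reals_divide Reals_power qtheta_Real) auto
  thus "DW (of_real (exp (- x))) = of_real (Dr x)" by (simp add: Dr_def)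
qed

lemma curve_real:
  assumes "0 < x" "x < - ln q"
  shows "Dr x ^ 2 = 4 * Xr x ^ 3 - (A * Xr x - B)\<^sup>2" "Xr x > 0"
proof -
  have "complex_of_real (Dr x ^ 2) = of_real (4 * Xr x ^ 3 - (A * Xr x - B)\<^sup>2)"
    using zeta3_curve_eq[OF ray_real(1)[OF assms]] unfolding ray_real(2,3)[OF assms] by simp
  thus *: "Dr x ^ 2 = 4 * Xr x ^ 3 - (A * Xr x - B)\<^sup>2" unfolding of_real_eq_iff .
  hence "4 * Xr x ^ 3 = Dr x ^ 2 + (A * Xr x - B)\<^sup>2" by simp
  moreover have "Dr x ^ 2 + (A * Xr x - B)\<^sup>2 \<ge> 0" by simp
  ultimately have "Xr x ^ 3 \<ge> 0" by linarith
  hence "Xr x \<ge> 0" by (simp add: zero_le_power_eq)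
  moreover have "Xr x \<noteq> 0"
  proof
    assume "Xr x = 0"
    hence "Dr x ^ 2 = - (B\<^sup>2)" using * by simp
    thus False using B_pos by (metis less_irrefl neg_less_0_iff_less not_less zero_le_power2 zero_less_power2)
  qed
  ultimately show "Xr x > 0" by simp
qed

lemma qtheta_annulus_pos:
  assumes "q < y" "y < 1"
  shows "\<exists>u>0. qtheta q (of_real y) = of_real u"
proof -
  have "q / y < 1" "0 < y" using assms q by (auto simp: divide_simps)
  with qprod_pos[OF q, of y] qprod_pos[OF q, of "q / y"] assms
  have "qtheta q (of_real y) = of_real (Re (qprod q (of_real y)) * Re (qprod q (of_real (q / y))))"
    "Re (qprod q (of_real y)) * Re (qprod q (of_real (q / y))) > 0"
    by (simp_all add: qtheta_def)
  thus ?thesis by blast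
qed

text \<open>Before the half period both z and z^2 stay inside the annulus between \<open>q\<close>
  and 1, where \<open>qtheta\<close> is positive. The sign selects the branch of the square root of
  1 - Sh^2 in \<open>period\<close>.\<close>

lemma Dr_pos:
  assumes "0 < x" "x < - ln q / 2"
  shows "Dr x > 0"
proof -
  define y where "y = exp (- x)"
  have x: "x < - ln q" "2 * x < - ln q" "0 < 2 * x" using assms ln_q by linarith+
  have y: "q < y" "y < 1" using exp_annulus[OF assms(1) x(1)] by (auto simp: y_def)
  have "y\<^sup>2 = exp (- (2 * x))" by (simp add: y_def power2_eq_square flip: exp_add)
  hence y2: "q < y\<^sup>2" "y\<^sup>2 < 1" using exp_annulus[OF x(3,2)] by auto
  obtain u v where uv: "u > 0" "qtheta q (of_real y) = of_real u" "v > 0" "qtheta q (of_real (y\<^sup>2)) = of_real v"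
    using qtheta_annulus_pos y y2 by meson
  have "DW (of_real y) = of_real (y * eul q ^ 6 * v / u ^ 4)"
    unfolding DW_def Q_eul using uv by simp
  hence "Dr x = y * eul q ^ 6 * v / u ^ 4" by (simp only: Dr_def y_def Re_complex_of_real)
  thus ?thesis using uv eul_pos by (simp add: y_def)
qed

lemma Dr_half: "Dr (- ln q / 2) = 0"
proof -
  have "(exp (ln q / 2))\<^sup>2 = q" using q by (simp add: power2_eq_square flip: exp_add)
  hence "(of_real (exp (- (- ln q / 2))) :: complex)\<^sup>2 = of_real q" by (simp flip: of_real_power)
  moreover have "qtheta q (of_real q) = 0" using q by (simp add: qtheta_def)
  ultimately show ?thesis by (simp add: Dr_def DW_def)
qed

lemma Xr_deriv:
  assumes "0 < x" "x < - ln q"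
  shows "(Xr has_real_derivative - Dr x) (at x)"
proof -
  define z where "z = (\<lambda>x. complex_of_real (exp (- x)))"
  have "((\<lambda>x. exp (- x)) has_real_derivative - exp (- x)) (at x)" by (auto intro!: derivative_eq_intros)
  hence dz: "(z has_vector_derivative of_real (- exp (- x))) (at x)"
    unfolding z_def by (intro has_vector_derivative_of_real)
  have "(qW q has_field_derivative DW (z x) / z x) (at (z x))"
    using ray_real(1)[OF assms] by (intro qW_deriv_DW) (simp add: z_def)
  from field_vector_diff_chain_at[OF dz this]
  have "((\<lambda>x. qW q (z x)) has_vector_derivative - DW (z x)) (at x)" by (simp add: o_def z_def)
  hence "((\<lambda>x. qW q (z x) - W0) has_vector_derivative - DW (z x) - 0) (at x)"
    by (intro has_vector_derivative_diff has_vector_derivative_const)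
  from bounded_linear.has_vector_derivative[OF bounded_linear_Re this]
  show ?thesis unfolding has_real_derivative_iff_has_vector_derivative
    by (simp add: Xr_def [abs_def] Dr_def z_def)
qed

text \<open>All terms of the two series are nonnegative apart from the head, which is kept. The
  bound makes \<open>Xr\<close> tend to infinity at the origin of the curve, so that
  \<open>ph\<close> is continuous there.\<close>

lemma Xr_lower:
  assumes "0 < x" "x < - ln q"
  shows "Xr x \<ge> exp (- x) / (1 - exp (- x))\<^sup>2 - Re W0"
proof -
  define y where "y = exp (- x)"
  have y: "q < y" "y < 1" using exp_annulus[OF assms] by (auto simp: y_def)
  have pos: "Re (qsum2 q (of_real v)) \<ge> 0" if v: "0 < v" "v < 1" for v
  proof -
    have su: "(\<lambda>n. Re ((of_real (q ^ n) * of_real v) / (1 - of_real (q ^ n) * of_real v)\<^sup>2)) sums Re (qsum2 q (of_real v))"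
      by (intro sums_Re qsum2_props(1)[OF q] qdom_of_real v)
    have nn: "Re ((of_real (q ^ n) * of_real v) / (1 - of_real (q ^ n) * of_real v)\<^sup>2) \<ge> 0" for n
    proof -
      have "(of_real (q ^ n) * of_real v) / (1 - of_real (q ^ n) * of_real v)\<^sup>2 = complex_of_real ((q ^ n * v) / (1 - q ^ n * v)\<^sup>2)" by simp
      hence "Re ((of_real (q ^ n) * of_real v) / (1 - of_real (q ^ n) * of_real v)\<^sup>2) = (q ^ n * v) / (1 - q ^ n * v)\<^sup>2"
        by (simp only: Re_complex_of_real)
      also have "\<dots> \<ge> 0" using q v by (intro divide_nonneg_nonneg mult_nonneg_nonneg) auto
      finally show ?thesis .
    qed
    show ?thesis by (rule sums_le[OF nn sums_zero su])
  qed
  have "q * y < 1 * 1" using q y by (intro mult_strict_mono) auto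
  hence v: "0 < q * y" "q * y < 1" "0 < q / y" "q / y < 1" using q y by auto
  have "of_real y \<in> qdom q" using y by (intro qdom_of_real)
  hence "qW q (of_real y) = of_real (y / (1 - y)\<^sup>2) + qsum2 q (of_real (q * y)) + qsum2 q (of_real (q / y))"
    unfolding qW_def using qsum2_rec[of "of_real y"] by simp
  hence "Re (qW q (of_real y)) = y / (1 - y)\<^sup>2 + Re (qsum2 q (of_real (q * y))) + Re (qsum2 q (of_real (q / y)))"
    by (simp only: plus_complex.sel Re_complex_of_real)
  thus ?thesis using pos[OF v(1,2)] pos[OF v(3,4)] by (simp add: Xr_def y_def)
qed

text \<open>Along the ray this is the root p of the Jensen computation: \<open>Sh\<close>, defined
  below as p (alpha - p^2) / 2, equals (A X - B) / (2 X^(3/2)), and the equation of the curve says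
  that 1 - Sh^2 is the square of Y / (2 X^(3/2)). The value 0 at x = 0 corresponds to the pole of
  X.\<close>

definition "ph x = (if x = 0 then 0 else B3 / sqrt (Xr x))"

lemma ph_cont: "continuous_on {0..- ln q / 2} ph"
proof -
  have half: "- ln q / 2 < - ln q" using ln_q by simp
  have at_pos: "isCont ph x" if x: "0 < x" "x < - ln q" for x
  proof -
    have "isCont Xr x" using Xr_deriv[OF x] by (rule DERIV_isCont)
    hence c: "isCont (\<lambda>x. B3 / sqrt (Xr x)) x" using curve_real(2)[OF x] by (intro continuous_intros) auto
    have "eventually (\<lambda>y. y \<in> {0<..}) (nhds x)" using x by (intro eventually_nhds_in_open) auto
    hence "eventually (\<lambda>y. B3 / sqrt (Xr y) = ph y) (nhds x)" by eventually_elim (auto simp: ph_def)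
    thus ?thesis using c by (simp add: isCont_cong)
  qed
  have lim: "(ph \<longlongrightarrow> 0) (at_right 0)"
  proof -
    have "filterlim (\<lambda>x::real. exp (- x) / (1 - exp (- x))\<^sup>2) at_top (at_right 0)" by real_asymp
    hence "filterlim (\<lambda>x::real. - Re W0 + exp (- x) / (1 - exp (- x))\<^sup>2) at_top (at_right 0)"
      by (rule filterlim_tendsto_add_at_top[OF tendsto_const])
    moreover have "eventually (\<lambda>x. x \<in> {0<..<- ln q}) (at_right 0)"
      using ln_q by (intro eventually_at_right_real) auto
    hence evx: "eventually (\<lambda>x. - Re W0 + exp (- x) / (1 - exp (- x))\<^sup>2 \<le> Xr x) (at_right 0)"
      by eventually_elim (use Xr_lower in force)
    ultimately have "filterlim Xr at_top (at_right 0)" by (rule filterlim_at_top_mono)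
    hence "filterlim (\<lambda>x. sqrt (Xr x)) at_top (at_right 0)" by (rule filterlim_compose[OF sqrt_at_top])
    hence "((\<lambda>x. B3 / sqrt (Xr x)) \<longlongrightarrow> 0) (at_right 0)" 
      by (rule real_tendsto_divide_at_top[OF tendsto_const])
    moreover have "eventually (\<lambda>x. B3 / sqrt (Xr x) = ph x) (at_right 0)"
      using eventually_at_right_less[of 0] by eventually_elim (auto simp: ph_def)
    ultimately show ?thesis by (simp cong: tendsto_cong)
  qed
  show ?thesis
  proof (rule continuous_on_IccI)
    show "(ph \<longlongrightarrow> ph 0) (at_right 0)" using lim by (simp add: ph_def)
    have "isCont ph (- ln q / 2)" using at_pos[of "- ln q / 2"] ln_q by simp
    thus "(ph \<longlongrightarrow> ph (- ln q / 2)) (at_left (- ln q / 2))"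
      by (simp add: isCont_def tendsto_within_subset filterlim_at_split)
    fix x assume "0 < x" "x < - ln q / 2"
    thus "ph \<midarrow>x\<rightarrow> ph x" using at_pos[of x] half by (simp add: isCont_def)
  qed (use ln_q in auto)
qed

definition "Sh x = ph x * (alpha q - ph x ^ 2) / 2"

lemma Sh_eq:
  assumes "0 < x" "x < - ln q"
  shows "Sh x = (A * Xr x - B) / (2 * sqrt (Xr x) ^ 3)" "1 - Sh x ^ 2 = (Dr x / (2 * sqrt (Xr x) ^ 3)) ^ 2"
proof -
  define u where "u = sqrt (Xr x)"
  have u: "u > 0" "Xr x = u\<^sup>2" using curve_real(2)[OF assms] by (auto simp: u_def)
  have "Sh x = (B3 / u) * (alpha q - (B3 / u)\<^sup>2) / 2" using assms by (simp add: Sh_def ph_def u_def)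
  also have "\<dots> = (alpha q * B3 * u\<^sup>2 - B3 ^ 3) / (2 * u ^ 3)"
    using u by (simp add: field_simps power2_eq_square power3_eq_cube)
  finally show 1: "Sh x = (A * Xr x - B) / (2 * sqrt (Xr x) ^ 3)"
    unfolding A_eq[symmetric] B3(2) u(2)[symmetric] by (simp add: u_def)
  have "1 - Sh x ^ 2 = (4 * u ^ 6 - (A * Xr x - B)\<^sup>2) / (2 * u ^ 3)\<^sup>2"
    unfolding 1 u_def[symmetric] using u(1) by (simp add: field_simps power_divide power_mult_distrib flip: power_mult)
  also have "4 * u ^ 6 = 4 * Xr x ^ 3" unfolding u(2) by (simp flip: power_mult)
  also have "4 * Xr x ^ 3 - (A * Xr x - B)\<^sup>2 = Dr x ^ 2" using curve_real(1)[OF assms] by simp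
  finally show "1 - Sh x ^ 2 = (Dr x / (2 * sqrt (Xr x) ^ 3)) ^ 2" by (simp add: power_divide u_def)
qed

lemma Sh_le: "0 < x \<Longrightarrow> x < - ln q \<Longrightarrow> \<bar>Sh x\<bar> \<le> 1"
proof -
  assume x: "0 < x" "x < - ln q"
  have "1 - Sh x ^ 2 \<ge> 0" unfolding Sh_eq(2)[OF x] by simp
  thus ?thesis by (simp add: abs_square_le_1)
qed

lemma ph_pos: "0 < x \<Longrightarrow> x < - ln q \<Longrightarrow> ph x > 0"
  using curve_real(2) B3 by (simp add: ph_def)

text \<open>If \<open>ph\<close> reached 1 it would equal 1 somewhere by the intermediate value
  theorem, and there \<open>Sh\<close> would be (alpha - 1) / 2 > 1, against
  \<open>Sh_le\<close>.\<close>

lemma ph_lt_1: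
  assumes x: "0 < x" "x \<le> - ln q / 2"
  shows "ph x < 1"
proof (rule ccontr)
  assume "\<not> ph x < 1"
  moreover have "ph 0 \<le> 1" by (simp add: ph_def)
  moreover have "continuous_on {0..x} ph" by (rule continuous_on_subset[OF ph_cont]) (use x in auto)
  ultimately obtain y where y: "0 \<le> y" "y \<le> x" "ph y = 1"
    using IVT'[of ph 0 1 x] x by auto
  have "y \<noteq> 0" using y by (auto simp: ph_def)
  hence "\<bar>Sh y\<bar> \<le> 1" using y x ln_q by (intro Sh_le) auto
  thus False using alpha_gt_3 y(3) by (simp add: Sh_def)
qed

lemma Sh_pos:
  assumes x: "0 < x" "x \<le> - ln q / 2"
  shows "Sh x > 0"
proof -
  have p: "0 < ph x" "ph x < 1" using ph_pos[of x] ph_lt_1[OF x] x ln_q by auto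
  hence "ph x ^ 2 < 1" by (simp add: abs_square_less_1)
  thus ?thesis using p alpha_gt_3 by (simp add: Sh_def)
qed

lemma Sh_half: "Sh (- ln q / 2) = 1"
proof -
  have h: "0 < - ln q / 2" "- ln q / 2 < - ln q" using ln_q by auto
  have "1 - Sh (- ln q / 2) ^ 2 = 0" unfolding Sh_eq(2)[OF h] Dr_half by simp
  hence "Sh (- ln q / 2) ^ 2 = 1" by linarith
  thus ?thesis using Sh_pos[of "- ln q / 2"] h by (auto simp: power2_eq_1_iff)
qed

text \<open>The substitution \<open>sin t = Sh x\<close> turns the left-hand side into the integral of a constant multiple of the
  invariant differential \<open>dz / z\<close> along the real ray \<open>z = exp (- x)\<close> from the origin of the curve to a half period.\<close>

lemma period: "integral {0..pi/2} (\<lambda>t. 1 / (alpha q - 3 * (cubp (alpha q) (sin t))\<^sup>2)) = B3 * (- ln q) / 4"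
proof -
  define a where "a = alpha q"
  define h where "h = - ln q / 2"
  have h: "h > 0" "h < - ln q" using ln_q by (auto simp: h_def)
  have a: "a > 3" by (simp add: a_def alpha_gt_3)
  define g where "g = (\<lambda>t. 2 / (a - 3 * (cubp a (sin t))\<^sup>2))"
  have nz: "a - 3 * (cubp a (sin t))\<^sup>2 \<noteq> 0" for t using cubp_lt_1(2)[OF a, of "sin t"] by auto
  have contg: "continuous_on {0..pi/2} g" unfolding g_def
    using a by (intro continuous_intros continuous_on_cubp ballI nz) auto
  define G where "G = (\<lambda>u. integral {0..u} g)"
  have contG: "continuous_on {0..pi/2} G"
    unfolding G_def by (intro indefinite_integral_continuous_1 integrable_continuous_real contg)
  have Shc: "continuous_on {0..h} Sh" unfolding Sh_def h_def by (intro continuous_intros ph_cont) auto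
  have Sh01: "0 \<le> Sh x \<and> Sh x \<le> 1" if "x \<in> {0..h}" for x
  proof (cases "x = 0")
    case False
    thus ?thesis using Sh_pos[of x] Sh_le[of x] that h by (auto simp: h_def)
  qed (simp add: Sh_def ph_def)
  \<comment> \<open>At the half period \<open>Sh\<close> is 1 and \<open>arcsin\<close> is not
    differentiable, so the substitution is carried out by showing that this difference has
    derivative 0 in the interior and is continuous at both ends.\<close>
  define \<Psi> where "\<Psi> = (\<lambda>x. G (arcsin (Sh x)) - B3 * x)"
  have "\<Psi> h = \<Psi> 0"
  proof (rule DERIV_isconst_end[where f = \<Psi> and a = 0 and b = h])
    have "continuous_on {0..h} (\<lambda>x. G (arcsin (Sh x)))"
    proof (rule continuous_on_compose2[OF contG])
      show "continuous_on {0..h} (\<lambda>x. arcsin (Sh x))"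
        using Sh01 by (intro continuous_intros Shc) force
      show "(\<lambda>x. arcsin (Sh x)) ` {0..h} \<subseteq> {0..pi/2}"
      proof safe
        fix x assume "x \<in> {0..h}"
        with Sh01 have "0 \<le> Sh x" "Sh x \<le> 1" by auto
        thus "arcsin (Sh x) \<in> {0..pi/2}"
          using arcsin_bounded[of "Sh x"] arcsin_le_arcsin[of 0 "Sh x"] by auto
      qed
    qed
    thus "continuous_on {0..h} \<Psi>" unfolding \<Psi>_def by (intro continuous_intros)
    fix x assume x: "0 < x" "x < h"
    have xq: "x < - ln q" and x2: "x < - ln q / 2" "x \<le> - ln q / 2" using x h by (auto simp: h_def)
    define X where "X = Xr x"
    define D where "D = Dr x"
    define u where "u = sqrt X"
    have X: "X > 0" using curve_real(2)[OF x(1) xq] by (simp add: X_def)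
    have u: "u > 0" "X = u\<^sup>2" using X by (auto simp: u_def)
    have D: "D > 0" using Dr_pos[OF x(1) x2(1)] by (simp add: D_def)
    have S1: "1 - Sh x ^ 2 = (D / (2 * u ^ 3))\<^sup>2" using Sh_eq(2)[OF x(1) xq] by (simp add: D_def u_def X_def)
    have "1 - Sh x ^ 2 > 0" unfolding S1 using D u by simp
    hence Sl: "\<bar>Sh x\<bar> < 1" by (simp add: abs_square_less_1)
    have S0: "Sh x > 0" using Sh_pos[OF x(1) x2(2)] .
    have rt: "sqrt (1 - Sh x ^ 2) = D / (2 * u ^ 3)" unfolding S1 using D u by simp
    have p: "cubp a (Sh x) = ph x"
      using ph_lt_1[OF x(1) x2(2)] ph_pos[OF x(1) xq] Sl by (intro cubp_unique a) (auto simp: Sh_def a_def)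
    have dph: "(ph has_real_derivative B3 * D / (2 * u ^ 3)) (at x)"
    proof -
      have "((\<lambda>x. B3 / sqrt (Xr x)) has_real_derivative (0 * sqrt (Xr x) - B3 * (inverse (sqrt (Xr x)) / 2 * (- Dr x))) / (sqrt (Xr x) * sqrt (Xr x))) (at x)"
      proof (rule DERIV_divide[OF DERIV_const])
        show "((\<lambda>x. sqrt (Xr x)) has_real_derivative inverse (sqrt (Xr x)) / 2 * (- Dr x)) (at x)"
          by (rule DERIV_chain2[where f = sqrt and g = Xr, OF DERIV_real_sqrt Xr_deriv[OF x(1) xq]])
             (use X in \<open>simp add: X_def\<close>)
        show "sqrt (Xr x) \<noteq> 0" using X by (simp add: X_def)
      qed
      also have "(0 * sqrt (Xr x) - B3 * (inverse (sqrt (Xr x)) / 2 * (- Dr x))) / (sqrt (Xr x) * sqrt (Xr x)) = B3 * D / (2 * u ^ 3)"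
      proof -
        have s: "sqrt (Xr x) = u" "Dr x = D" by (simp_all add: u_def X_def D_def)
        show ?thesis unfolding s using u(1) by (simp add: power3_eq_cube field_simps)
      qed
      finally have d: "((\<lambda>x. B3 / sqrt (Xr x)) has_real_derivative B3 * D / (2 * u ^ 3)) (at x)" .
      have "eventually (\<lambda>y. y \<in> {0<..}) (nhds x)" using x by (intro eventually_nhds_in_open) auto
      hence ev: "eventually (\<lambda>y. B3 / sqrt (Xr y) = ph y) (nhds x)" by eventually_elim (auto simp: ph_def)
      show ?thesis by (rule DERIV_cong_ev[THEN iffD1, OF refl ev refl d])
    qed
    define p' where "p' = B3 * D / (2 * u ^ 3)"
    have dS: "(Sh has_real_derivative p' * (a - 3 * ph x ^ 2) / 2) (at x)"
      unfolding Sh_def [abs_def] a_def[symmetric]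
      by (rule derivative_eq_intros dph[folded p'_def] refl)+ (simp_all add: field_simps power2_eq_square)
    have dA: "((\<lambda>x. arcsin (Sh x)) has_real_derivative inverse (sqrt (1 - Sh x ^ 2)) * (p' * (a - 3 * ph x ^ 2) / 2)) (at x)"
      by (rule DERIV_chain2[where f = arcsin and g = Sh and x = x, OF DERIV_arcsin dS]) (use Sl in auto)
    have in1: "0 < arcsin (Sh x)" "arcsin (Sh x) < pi / 2"
      using arcsin_less_arcsin[of 0 "Sh x"] arcsin_lt_bounded[of "Sh x"] S0 Sl by auto
    have "(G has_real_derivative g (arcsin (Sh x))) (at (arcsin (Sh x)) within {0..pi/2})"
      unfolding G_def by (rule integral_has_real_derivative[OF contg]) (use in1 in auto)
    hence dG: "(G has_real_derivative g (arcsin (Sh x))) (at (arcsin (Sh x)))"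
      using at_within_Icc_at[OF in1] by simp
    have gv: "g (arcsin (Sh x)) = 2 / (a - 3 * ph x ^ 2)" using Sl by (simp add: g_def p)
    have nz': "a - 3 * ph x ^ 2 \<noteq> 0" using nz[of "arcsin (Sh x)"] Sl by (simp add: p)
    have "(\<Psi> has_real_derivative g (arcsin (Sh x)) * (inverse (sqrt (1 - Sh x ^ 2)) * (p' * (a - 3 * ph x ^ 2) / 2)) - B3) (at x)"
      unfolding \<Psi>_def using DERIV_diff[OF DERIV_chain2[where f = G and g = "\<lambda>x. arcsin (Sh x)" and x = x, OF dG dA] DERIV_cmult_Id[of B3]] by simp
    also have "g (arcsin (Sh x)) * (inverse (sqrt (1 - Sh x ^ 2)) * (p' * (a - 3 * ph x ^ 2) / 2)) - B3 = 0"
      unfolding gv rt p'_def using nz' D u(1) by (simp add: divide_simps)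
    finally show "(\<Psi> has_real_derivative 0) (at x)" .
  qed (use h in auto)
  moreover have "\<Psi> 0 = 0" by (simp add: \<Psi>_def Sh_def ph_def G_def)
  moreover have "\<Psi> h = integral {0..pi/2} g - B3 * h" using Sh_half by (simp add: \<Psi>_def h_def G_def)
  ultimately have "integral {0..pi/2} g = B3 * h" by simp
  moreover have "integral {0..pi/2} g = 2 * integral {0..pi/2} (\<lambda>t. 1 / (a - 3 * (cubp a (sin t))\<^sup>2))"
    unfolding g_def by (subst integral_mult_right[symmetric]) simp
  ultimately show ?thesis by (simp add: a_def h_def)
qed

lemma alpha_deriv: "(alpha has_real_derivative hauptmodul q * B3 ^ 2 / (9 * q)) (at q)"
proof -
  have pos: "27 + hauptmodul q > 0" using hauptmodul_pos by simp
  have "(root 3 has_real_derivative inverse (real 3 * root 3 (27 + hauptmodul q) ^ (3 - Suc 0))) (at (27 + hauptmodul q))"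
    by (rule DERIV_real_root) (use pos in auto)
  from DERIV_chain2[where f = "root 3" and g = "\<lambda>q. 27 + hauptmodul q" and x = q, OF this DERIV_add[OF DERIV_const hauptmodul_deriv]]
  have "(alpha has_real_derivative inverse (3 * alpha q ^ 2) * (hauptmodul q * (A\<^sup>2 / 3) / q)) (at q)"
    by (simp add: alpha_def [abs_def] eval_nat_numeral)
  also have "inverse (3 * alpha q ^ 2) * (hauptmodul q * (A\<^sup>2 / 3) / q) = hauptmodul q * B3 ^ 2 / (9 * q)"
    unfolding A_eq using alpha_gt_3 q by (simp add: field_simps power2_eq_square)
  finally show ?thesis .
qed

text \<open>The period contributes a factor B3 and the derivative of \<open>alpha\<close> a factor
  B3^2; their product is B, and multiplied by the Hauptmodul it becomes the eta quotient of
  \<open>dilog_sum_deriv\<close>.\<close>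

lemma hauptmodul_B: "hauptmodul q * B = 81 * sqrt 3 * eta_quotient q"
proof -
  interpret c: nome "q ^ 3" by (rule nome_q3)
  have s: "(3 * sqrt 3) ^ 1 = 3 * sqrt 3" "sqrt 3 * sqrt 3 = 3" by simp_all
  have "hauptmodul q * B = 729 * q * eul (q ^ 3) ^ 9 / eul q ^ 3 / (3 * sqrt 3)"
    unfolding hauptmodul_def B_def using eul_pos c.eul_pos by (simp add: field_simps eval_nat_numeral)
  also have "\<dots> = (729 / (3 * sqrt 3)) * eta_quotient q" by (simp add: eta_quotient_def)
  also have "729 / (3 * sqrt 3) = 81 * sqrt 3" by (simp add: field_simps)
  finally show ?thesis .
qed

lemma eul_le_1: "eul q \<le> 1"
proof -
  have "ln (eul q) \<le> 0"
  proof (rule sums_le[OF _ ln_eul_sums sums_zero])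
    fix n show "ln (1 - q ^ Suc n) \<le> 0" using q_pow_less[of n] by (intro ln_le_zero_iff[THEN iffD2]) auto
  qed
  thus ?thesis using eul_pos by simp
qed

lemma sig_nonneg: "sig q \<ge> 0"
  by (rule sums_le[OF _ sums_zero sig_sums]) (use q in auto)

end

lemma eul_antimono: "0 < x \<Longrightarrow> x \<le> y \<Longrightarrow> y < 1 \<Longrightarrow> eul y \<le> eul x"
proof -
  assume xy: "0 < x" "x \<le> y" "y < 1"
  show ?thesis
  proof (rule DERIV_nonpos_imp_nonincreasing[OF xy(2)])
    fix z assume z: "x \<le> z" "z \<le> y"
    interpret nome z using z xy by unfold_locales auto
    have "- eul z * sig z / z \<le> 0" using eul_pos sig_nonneg q by (simp add: divide_nonneg_pos)
    thus "\<exists>d. (eul has_real_derivative d) (at z) \<and> d \<le> 0" using eul_deriv by blast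
  qed
qed

text \<open>For L < -1 the nome is at most 1/2, and since \<open>eul\<close> is decreasing and at
  most 1 the quotient of Euler products stays bounded. The factor q then forces
  \<open>hauptmodul\<close> to 0.\<close>

lemma alpha_lim: "((\<lambda>L. alpha (exp L)) \<longlongrightarrow> 3) at_bot"
proof -
  interpret half: nome "1/2" by unfold_locales auto
  define C where "C = 729 / eul (1/2) ^ 12"
  have bd: "norm (hauptmodul (exp L)) \<le> C * exp L" if L: "L < - 1" for L
  proof -
    interpret nome "exp L" using L by unfold_locales auto
    interpret c: nome "exp L ^ 3" by (rule nome_q3)
    have "exp L \<le> 1 / 2"
    proof -
      have "exp L \<le> exp (- 1)" using L by simp
      also have "exp (- 1 :: real) \<le> 1 / 2" using exp_ge_add_one_self[of "1::real"] by (simp add: exp_minus field_simps)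
      finally show ?thesis .
    qed
    hence "eul (1/2) \<le> eul (exp L)" by (intro eul_antimono) auto
    hence "eul (exp L ^ 3) / eul (exp L) \<le> 1 / eul (1/2)"
      using c.eul_le_1 half.eul_pos c.eul_pos by (intro frac_le) auto
    hence "(eul (exp L ^ 3) / eul (exp L)) ^ 12 \<le> (1 / eul (1/2)) ^ 12"
      using c.eul_pos eul_pos by (intro power_mono) auto
    hence "729 * exp L * (eul (exp L ^ 3) / eul (exp L)) ^ 12 \<le> 729 * exp L * (1 / eul (1/2)) ^ 12"
      by (intro mult_left_mono) auto
    thus ?thesis using hauptmodul_pos by (simp add: hauptmodul_def C_def power_divide mult_ac)
  qed
  have ev: "eventually (\<lambda>L. norm (hauptmodul (exp L)) \<le> C * exp L) at_bot"
    using eventually_gt_at_bot[of "- 1"] by eventually_elim (use bd in auto)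
  have "((\<lambda>L::real. C * exp L) \<longlongrightarrow> 0) at_bot" by (rule tendsto_mult_right_zero[OF exp_at_bot])
  from Lim_null_comparison[OF ev this]
  have "((\<lambda>L. root 3 (27 + hauptmodul (exp L))) \<longlongrightarrow> root 3 (27 + 0)) at_bot"
    by (intro tendsto_real_root tendsto_intros)
  moreover have "root 3 (27 + 0) = 3" by (rule real_root_pos_unique) auto
  ultimately show ?thesis by (simp add: alpha_def)
qed

theorem mahler_alpha:
  assumes L: "L < 0"
  shows "mahler_n (alpha (exp L)) = 9 / (2 * pi) * dilog_sum L"
proof -
  define f where "f = (\<lambda>L. mahler_jensen (alpha (exp L)) - 9 / (2 * pi) * dilog_sum L)"
  have D: "(f has_real_derivative 0) (at x)" if x: "x < 0" for x
  proof -
    interpret nome "exp x" using x by unfold_locales auto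
    have "((\<lambda>L. alpha (exp L)) has_real_derivative hauptmodul (exp x) * B3 ^ 2 / (9 * exp x) * exp x) (at x)"
      by (rule DERIV_chain2[where f = alpha and g = exp and x = x, OF alpha_deriv DERIV_exp])
    from DERIV_chain2[where f = mahler_jensen and g = "\<lambda>L. alpha (exp L)" and x = x, OF mahler_jensen_deriv[OF alpha_gt_3] this]
    have "((\<lambda>L. mahler_jensen (alpha (exp L))) has_real_derivative
       2 / pi * (B3 * (- x) / 4) * (hauptmodul (exp x) * B3 ^ 2 / (9 * exp x) * exp x)) (at x)"
      unfolding period by simp
    from DERIV_diff[OF this DERIV_cmult[OF dilog_sum_deriv[OF x], of "9 / (2 * pi)"]]
    have "(f has_real_derivative 2 / pi * (B3 * (- x) / 4) * (hauptmodul (exp x) * B3 ^ 2 / (9 * exp x) * exp x)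
       - 9 / (2 * pi) * (- sqrt 3 * x * eta_quotient (exp x))) (at x)" unfolding f_def .
    \<comment> \<open>The factors exp x from the chain rule and from \<open>alpha_deriv\<close>
      cancel, and B3 B3^2 = B.\<close>
    also have "2 / pi * (B3 * (- x) / 4) * (hauptmodul (exp x) * B3 ^ 2 / (9 * exp x) * exp x) =
       - x / (18 * pi) * (hauptmodul (exp x) * B)"
      unfolding B3(2)[symmetric] by (simp add: field_simps power2_eq_square power3_eq_cube)
    also have "\<dots> - 9 / (2 * pi) * (- sqrt 3 * x * eta_quotient (exp x)) = 0"
      unfolding hauptmodul_B by (simp add: field_simps)
    finally show ?thesis .
  qed
  have const: "f x = f L" if "x < L" for x
    by (rule DERIV_isconst3[of "x - 1" 0 x L]) (use that L D in auto)
  have "((\<lambda>L. mahler_jensen (alpha (exp L))) \<longlongrightarrow> mahler_jensen 3) at_bot"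
  proof -
    have gt: "alpha (exp x) > 3" if "x < 0" for x
    proof -
      interpret nome "exp x" using that by unfold_locales auto
      show ?thesis by (rule alpha_gt_3)
    qed
    have "eventually (\<lambda>x::real. x < 0) at_bot" by (rule eventually_gt_at_bot)
    moreover have "eventually (\<lambda>x. alpha (exp x) < 4) at_bot"
      using alpha_lim by (rule order_tendstoD) simp
    ultimately have "eventually (\<lambda>x. alpha (exp x) \<in> {3..4}) at_bot"
      by eventually_elim (use gt in force)
    thus ?thesis using continuous_on_tendsto_compose[OF mahler_jensen_continuous alpha_lim] by simp
  qed
  hence "(f \<longlongrightarrow> mahler_jensen 3 - 9 / (2 * pi) * bw3 0) at_bot"
    unfolding f_def by (intro tendsto_intros dilog_sum_lim)
  hence "(f \<longlongrightarrow> 0) at_bot" by (simp add: MM_3_eq)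
  moreover have "eventually (\<lambda>x. f x = f L) at_bot"
    using eventually_gt_at_bot[of L] by eventually_elim (use const in auto)
  ultimately have "((\<lambda>_. f L) \<longlongrightarrow> 0) (at_bot :: real filter)" by (simp cong: tendsto_cong)
  hence "f L = 0" by (simp add: tendsto_const_iff)
  moreover have "alpha (exp L) > 3"
  proof -
    interpret nome "exp L" using L by unfold_locales auto
    show ?thesis by (rule alpha_gt_3)
  qed
  ultimately show ?thesis by (simp add: f_def mahler_n_eq_MM)
qed

section \<open>The Weierstrass function as a \<open>q\<close>-series\<close>

text \<open>The logarithmic derivative of the reflection formula for \<open>Gamma\<close>,
  differentiated once more. As \<open>Polygamma 1\<close> is a one-sided sum of inverse squares,
  this evaluates the two-sided sum over a row of the lattice.\<close>

lemma Polygamma_1_reflection: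
  fixes z :: complex
  assumes z: "z \<notin> \<int>"
  shows "Polygamma 1 z + Polygamma 1 (1 - z) = (of_real pi / sin (of_real pi * z))\<^sup>2"
proof -
  have nn: "w \<notin> \<int>\<^sub>\<le>\<^sub>0" "1 - w \<notin> \<int>\<^sub>\<le>\<^sub>0" "w \<notin> \<int>" "sin (of_real pi * w) \<noteq> 0" if "w \<in> - \<int>" for w :: complex
  proof -
    show w: "w \<notin> \<int>" using that by simp
    show "w \<notin> \<int>\<^sub>\<le>\<^sub>0" using w nonpos_Ints_Int by blast
    show "1 - w \<notin> \<int>\<^sub>\<le>\<^sub>0"
      using w nonpos_Ints_Int by (metis Ints_1 Ints_diff diff_diff_eq2 add_diff_cancel_left')
    show "sin (of_real pi * w) \<noteq> 0" using w sin_eq_0[of "of_real pi * w"]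
      by (auto simp: mult_ac)
  qed
  have op: "open (- \<int> :: complex set)" by (intro open_Compl closed_Ints)
  have refl1: "Gamma w * Gamma (1 - w) = of_real pi / sin (of_real pi * w)" for w :: complex
    by (rule Gamma_reflection_complex)
  have dig: "Digamma w - Digamma (1 - w) = - of_real pi * cos (of_real pi * w) / sin (of_real pi * w)" if w: "w \<in> - \<int>" for w :: complex
  proof -
    let ?g = "Gamma w * Gamma (1 - w)" and ?s = "sin (of_real pi * w)" and ?c = "cos (of_real pi * w)"
    have "((\<lambda>w. Gamma (1 - w)) has_field_derivative Gamma (1 - w) * Digamma (1 - w) * (- 1)) (at w)"
      by (rule DERIV_chain2[where f = Gamma and g = "\<lambda>w. 1 - w" and x = w, OF has_field_derivative_Gamma])
         (use nn[OF w] in \<open>auto intro!: derivative_eq_intros\<close>)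
    from DERIV_mult[OF has_field_derivative_Gamma this] nn[OF w]
    have "((\<lambda>w. Gamma w * Gamma (1 - w)) has_field_derivative
       Gamma w * Digamma w * Gamma (1 - w) + Gamma (1 - w) * Digamma (1 - w) * (- 1) * Gamma w) (at w)" by blast
    moreover have "((\<lambda>w. Gamma w * Gamma (1 - w)) has_field_derivative - (of_real pi * (?c * of_real pi)) / (?s * ?s)) (at w)"
      unfolding refl1 using nn[OF w] by (auto intro!: derivative_eq_intros)
    ultimately have "Gamma w * Digamma w * Gamma (1 - w) + Gamma (1 - w) * Digamma (1 - w) * (- 1) * Gamma w =
       - (of_real pi * (?c * of_real pi)) / (?s * ?s)" by (rule DERIV_unique)
    hence "?g * (Digamma w - Digamma (1 - w)) = - (of_real pi * (?c * of_real pi)) / (?s * ?s)"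
      by (simp add: algebra_simps)
    hence "of_real pi / ?s * (Digamma w - Digamma (1 - w)) = of_real pi / ?s * (- of_real pi * ?c / ?s)"
      unfolding refl1 by simp
    moreover have "of_real pi / ?s \<noteq> 0" using nn[OF w] by simp
    ultimately show ?thesis by (metis mult_left_cancel)
  qed
  have zc: "z \<in> - \<int>" using z by simp
  have "((\<lambda>w. Digamma (1 - w)) has_field_derivative Polygamma (Suc 0) (1 - z) * (- 1)) (at z)"
    by (rule DERIV_chain2[where f = Digamma and g = "\<lambda>w. 1 - w" and x = z, OF has_field_derivative_Polygamma])
       (use nn[OF zc] in \<open>auto intro!: derivative_eq_intros\<close>)
  hence D1: "((\<lambda>w. Digamma w - Digamma (1 - w)) has_field_derivative Polygamma (Suc 0) z - Polygamma (Suc 0) (1 - z) * (- 1)) (at z)"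
    by (intro DERIV_diff has_field_derivative_Polygamma nn[OF zc])
  have ev: "eventually (\<lambda>w. Digamma w - Digamma (1 - w) = - of_real pi * cos (of_real pi * w) / sin (of_real pi * w)) (nhds z)"
    using eventually_nhds_in_open[OF op zc] by eventually_elim (rule dig)
  let ?s = "sin (of_real pi * z)" and ?c = "cos (of_real pi * z)"
  have "((\<lambda>w. - of_real pi * cos (of_real pi * w) / sin (of_real pi * w)) has_field_derivative
      ((of_real pi * (?s * of_real pi)) * ?s - (- of_real pi * ?c) * (?c * of_real pi)) / (?s * ?s)) (at z)"
    using nn[OF zc] by (auto intro!: derivative_eq_intros simp: field_simps)
  from DERIV_unique[OF DERIV_cong_ev[THEN iffD1, OF refl ev refl D1] this]
  have "Polygamma 1 z + Polygamma 1 (1 - z) = ((of_real pi * (?s * of_real pi)) * ?s - (- of_real pi * ?c) * (?c * of_real pi)) / (?s * ?s)"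
    by simp
  also have "\<dots> = (of_real pi)\<^sup>2 * (?s\<^sup>2 + ?c\<^sup>2) / ?s\<^sup>2"
  proof -
    have "((p * (s * p)) * s - (- p * c) * (c * p)) / (s * s) = p\<^sup>2 * (s\<^sup>2 + c\<^sup>2) / s\<^sup>2" for p s c :: complex
      by (simp add: algebra_simps power2_eq_square)
    thus ?thesis .
  qed
  also have "\<dots> = (of_real pi / ?s)\<^sup>2" by (simp add: power_divide)
  finally show ?thesis .
qed

lemma norm_summable_inverse_square:
  fixes z :: complex
  shows "summable (\<lambda>n. norm (inverse ((z + of_nat n) ^ 2)))"
proof (rule summable_comparison_test_ev)
  show "summable (\<lambda>n. 4 * inverse (real n ^ 2))" by (intro summable_mult inverse_power_summable) auto
  have "eventually (\<lambda>n. real n \<ge> 2 * norm z + 1) sequentially" by real_asymp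
  thus "\<forall>\<^sub>F n in sequentially. norm (norm (inverse ((z + of_nat n) ^ 2))) \<le> 4 * inverse (real n ^ 2)"
  proof eventually_elim
    case (elim n)
    have n: "real n > 0" using elim norm_ge_zero[of z] by linarith
    have "norm (z + of_nat n) \<ge> real n - norm z" using norm_triangle_ineq2[of "of_nat n" "- z"] by (simp add: add.commute)
    hence "norm (z + of_nat n) \<ge> real n / 2" using elim by simp
    hence "(real n / 2) ^ 2 \<le> norm (z + of_nat n) ^ 2" using n by (intro power_mono) auto
    hence "inverse (norm (z + of_nat n) ^ 2) \<le> inverse ((real n / 2) ^ 2)" using n by (intro le_imp_inverse_le) auto
    thus ?case by (simp add: norm_inverse norm_divide norm_power power_divide field_simps)
  qed
qed

lemma inverse_square_has_sum:
  fixes u :: complex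
  assumes u: "u \<notin> \<int>"
  shows "((\<lambda>m::int. 1 / (u - of_int m)\<^sup>2) has_sum (of_real pi / sin (of_real pi * u))\<^sup>2) UNIV"
proof -
  have u0: "u \<noteq> 0" "1 - u \<noteq> 0" using u by auto
  have P: "((\<lambda>n. inverse ((w + of_nat n) ^ 2)) has_sum Polygamma 1 w) UNIV" if "w \<noteq> 0" for w :: complex
    using norm_summable_imp_has_sum[OF norm_summable_inverse_square] Polygamma_LIMSEQ[OF that, of 1]
    by (simp add: eval_nat_numeral)
  have eq: "1 / (u + of_int (- int (Suc n)))\<^sup>2 = inverse ((1 - u + of_nat n)\<^sup>2)" for n
  proof -
    have "u + of_int (- int (Suc n)) = - (1 - u + of_nat n)" by simp
    thus ?thesis by (simp only: power2_minus divide_inverse mult_1)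
  qed
  have "((\<lambda>m::int. 1 / (u + of_int m)\<^sup>2) has_sum (Polygamma 1 u + Polygamma 1 (1 - u))) UNIV"
  proof (rule has_sum_int)
    show "((\<lambda>n. 1 / (u + of_int (int n))\<^sup>2) has_sum Polygamma 1 u) UNIV"
      using P[OF u0(1)] by (simp add: inverse_eq_divide)
    show "((\<lambda>n. 1 / (u + of_int (- int (Suc n)))\<^sup>2) has_sum Polygamma 1 (1 - u)) UNIV"
      unfolding eq by (rule P[OF u0(2)])
  qed
  hence "((\<lambda>m::int. 1 / (u + of_int m)\<^sup>2) has_sum (of_real pi / sin (of_real pi * u))\<^sup>2) (range uminus)"
    using Polygamma_1_reflection[OF u] by (simp add: surj_uminus)
  thus ?thesis by (subst (asm) has_sum_reindex) (auto simp: o_def)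
qed

lemma inverse_sin_square:
  fixes v :: complex
  assumes "v \<notin> \<int>"
  defines "x \<equiv> exp (2 * of_real pi * \<i> * v)"
  shows "(of_real pi / sin (of_real pi * v))\<^sup>2 = - 4 * (of_real pi)\<^sup>2 * (x / (1 - x)\<^sup>2)"
proof -
  define e where "e = exp (\<i> * (of_real pi * v))"
  have e0: "e \<noteq> 0" by (simp add: e_def)
  have x: "x = e\<^sup>2" unfolding x_def e_def exp_double[symmetric] by (simp add: mult_ac)
  have s: "sin (of_real pi * v) = (e - 1 / e) / (2 * \<i>)"
    unfolding e_def sin_exp_eq by (simp add: exp_minus inverse_eq_divide)
  have "sin (of_real pi * v) \<noteq> 0" using assms(1) sin_eq_0[of "of_real pi * v"] by (auto simp: mult_ac)
  hence "e - 1 / e \<noteq> 0" unfolding s by simp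
  hence x1: "1 - e\<^sup>2 \<noteq> 0" using e0 by (auto simp: power2_eq_square field_simps)
  have eq: "(sin (of_real pi * v))\<^sup>2 = - ((1 - e\<^sup>2)\<^sup>2 / (4 * e\<^sup>2))"
    unfolding s using e0 by (simp add: power_divide power_mult_distrib field_simps power2_eq_square)
  show ?thesis unfolding x power_divide eq using x1 e0 by (simp add: field_simps)
qed

lemma qsum2_has_sum:
  assumes q: "0 < q" "q < 1" and z: "z \<in> qdom q"
  shows "((\<lambda>n. (of_real (q ^ n) * z) / (1 - of_real (q ^ n) * z)\<^sup>2) has_sum qsum2 q z) UNIV"
proof (rule norm_summable_imp_has_sum[OF _ qsum2_props(1)[OF q z]])
  show "summable (\<lambda>n. norm ((of_real (q ^ n) * z) / (1 - of_real (q ^ n) * z)\<^sup>2))"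
  proof (rule summable_comparison_test_ev)
    show "summable (\<lambda>n. 4 * (q ^ n * norm z))" using q by (intro summable_mult summable_mult2 summable_geometric) auto
    have "(\<lambda>n. q ^ n * norm z) \<longlonglongrightarrow> 0" using q by (intro tendsto_mult_left_zero LIMSEQ_realpow_zero) auto
    hence "eventually (\<lambda>n. q ^ n * norm z < 1/2) sequentially" by (rule order_tendstoD) auto
    thus "\<forall>\<^sub>F n in sequentially. norm (norm ((of_real (q ^ n) * z) / (1 - of_real (q ^ n) * z)\<^sup>2)) \<le> 4 * (q ^ n * norm z)"
    proof eventually_elim
      case (elim n)
      define x where "x = of_real (q ^ n) * z"
      have nx: "norm x = q ^ n * norm z" using q by (simp add: x_def norm_mult norm_power)
      have "norm (1 - x) \<ge> 1/2" using elim nx by (intro norm_one_minus_ge_half) simp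
      hence "(1/2)\<^sup>2 \<le> norm (1 - x) ^ 2" by (intro power_mono) auto
      hence 1: "1 \<le> 4 * norm (1 - x) ^ 2" by (simp add: power2_eq_square)
      hence "norm x * 1 \<le> norm x * (4 * norm (1 - x) ^ 2)" by (intro mult_left_mono) auto
      moreover have "norm (1 - x) ^ 2 > 0" using 1 by linarith
      ultimately have "norm (x / (1 - x)\<^sup>2) \<le> 4 * norm x" by (simp add: norm_divide norm_power field_simps)
      thus ?case using nx by (simp add: x_def)
    qed
  qed
qed

context nome
begin

lemma qW_has_sum:
  assumes z: "z \<in> tdom q"
  shows "((\<lambda>n::int. (z / of_real q powi n) / (1 - z / of_real q powi n)\<^sup>2) has_sum qW q z) UNIV"
proof -
  have z0: "z \<noteq> 0" using z by (auto simp: tdom_def)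
  have iz: "1 / z \<in> tdom q" using z by (simp add: tdom_inverse_iff)
  have d: "1 / z \<in> qdom q" "of_real q * z \<in> qdom q" using iz z by (auto simp: tdom_iff qdom_scale)
  have inv: "x / (1 - x)\<^sup>2 = (1 / x) / (1 - 1 / x)\<^sup>2" if "x \<noteq> 0" for x :: complex
  proof -
    have "1 - 1 / x = (x - 1) / x" using that by (simp add: field_simps)
    hence "(1 - 1 / x)\<^sup>2 = (1 - x)\<^sup>2 / x\<^sup>2" by (simp add: power_divide power2_commute)
    thus ?thesis using that by (simp add: power2_eq_square)
  qed
  have "((\<lambda>n::int. (z / of_real q powi n) / (1 - z / of_real q powi n)\<^sup>2) has_sum (qsum2 q (1 / z) + qsum2 q (of_real q * z))) UNIV"
  proof (rule has_sum_int)
    have "(z / of_real q powi int n) / (1 - z / of_real q powi int n)\<^sup>2 = (of_real (q ^ n) * (1 / z)) / (1 - of_real (q ^ n) * (1 / z))\<^sup>2" for n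
      using inv[of "z / of_real q powi int n"] z0 q by simp
    thus "((\<lambda>n. (z / of_real q powi int n) / (1 - z / of_real q powi int n)\<^sup>2) has_sum qsum2 q (1 / z)) UNIV"
      using qsum2_has_sum[OF q d(1)] by simp
    have "z / of_real q powi (- int (Suc n)) = of_real (q ^ n) * (of_real q * z)" for n
    proof -
      have "of_real q powi (- int (Suc n)) = inverse (of_real q ^ Suc n :: complex)"
        by (simp only: power_int_minus power_int_of_nat)
      thus ?thesis by (simp add: divide_inverse mult_ac)
    qed
    thus "((\<lambda>n. (z / of_real q powi (- int (Suc n))) / (1 - z / of_real q powi (- int (Suc n)))\<^sup>2) has_sum qsum2 q (of_real q * z)) UNIV"
      using qsum2_has_sum[OF q d(2)] by (simp only:)
  qed
  also have "qsum2 q (1 / z) + qsum2 q (of_real q * z) = qW q (1 / z)" by (simp add: qW_def)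
  also have "\<dots> = qW q z" by (rule qW_inverse[OF z])
  finally show ?thesis .
qed

end

text \<open>For a nonzero period l with coefficients n and m the product (1 + n^2) (1 + m^2) is at
  most a constant times |l|^4. The exponent -3/4 turns this into a bound for |l|^(-3) by a product
  of weights, each decaying like |m|^(-3/2) and hence summable.\<close>

lemma summable_weight: "(\<lambda>m::int. (1 + (of_int m)\<^sup>2) powr (- 3 / 4 :: real)) summable_on UNIV"
proof -
  have le: "(1 + x\<^sup>2) powr (- 3 / 4) \<le> x powr (- 3 / 2)" if "x > 0" for x :: real
  proof -
    have "(1 + x\<^sup>2) powr (- 3 / 4) \<le> (x\<^sup>2) powr (- 3 / 4)" using that by (intro powr_mono2') auto
    also have "(x\<^sup>2) powr (- 3 / 4) = x powr (- 3 / 2)" using that by (simp add: powr_powr flip: powr_numeral)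
    finally show ?thesis .
  qed
  have "summable (\<lambda>n. real n powr (- 3 / 2))" by (subst summable_real_powr_iff) simp
  hence s: "summable (\<lambda>n. real (Suc n) powr (- 3 / 2))" by (subst summable_Suc_iff)
  have 2: "(\<lambda>n. (1 + (of_int (- int (Suc n)))\<^sup>2) powr (- 3 / 4 :: real)) summable_on UNIV"
  proof (rule summable_nonneg_imp_summable_on)
    show "summable (\<lambda>n. (1 + (of_int (- int (Suc n)))\<^sup>2) powr (- 3 / 4 :: real))"
      by (rule summable_comparison_test'[OF s]) (use le[of "real (Suc n)" for n] in \<open>simp add: power2_eq_square algebra_simps\<close>)
  qed simp
  have 1: "(\<lambda>n. (1 + (of_int (int n))\<^sup>2) powr (- 3 / 4 :: real)) summable_on UNIV"
  proof (rule summable_nonneg_imp_summable_on)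
    have "summable (\<lambda>n. (1 + (real (Suc n))\<^sup>2) powr (- 3 / 4 :: real))"
      by (rule summable_comparison_test'[OF s]) (use le in auto)
    thus "summable (\<lambda>n. (1 + (of_int (int n))\<^sup>2) powr (- 3 / 4 :: real))"
      by (subst (asm) summable_Suc_iff) simp
  qed simp
  show ?thesis
    using has_sum_int[OF has_sum_infsum[OF 1] has_sum_infsum[OF 2]] by (rule has_sum_imp_summable)
qed

lemma weierstrass_term_bound:
  fixes u l :: complex
  assumes l: "l \<noteq> 0" "2 * norm u \<le> norm l"
  shows "norm (1 / (u - l)\<^sup>2 - 1 / l\<^sup>2) \<le> 10 * norm u / norm l ^ 3"
proof -
  have "norm l - norm u \<le> norm (u - l)" using norm_triangle_ineq2[of l u] by (simp add: norm_minus_commute)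
  hence d: "norm l / 2 \<le> norm (u - l)" using l by linarith
  have l0: "norm l > 0" using l by simp
  hence ul: "u - l \<noteq> 0" using d by auto
  have "norm (2 * l - u) \<le> 2 * norm l + norm u" using norm_triangle_ineq4[of "2 * l" u] by (simp add: norm_mult)
  hence n: "norm (2 * l - u) \<le> 5 / 2 * norm l" using l by linarith
  have "1 / (u - l)\<^sup>2 - 1 / l\<^sup>2 = (l\<^sup>2 - (u - l)\<^sup>2) / ((u - l)\<^sup>2 * l\<^sup>2)"
    using ul l by (simp add: diff_frac_eq)
  also have "l\<^sup>2 - (u - l)\<^sup>2 = u * (2 * l - u)" by (simp add: power2_eq_square algebra_simps)
  finally have "norm (1 / (u - l)\<^sup>2 - 1 / l\<^sup>2) = norm u * norm (2 * l - u) / (norm (u - l) ^ 2 * norm l ^ 2)"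
    by (simp add: norm_divide norm_mult norm_power)
  also have "\<dots> \<le> norm u * (5 / 2 * norm l) / ((norm l / 2)\<^sup>2 * norm l ^ 2)"
    using d n l0 by (intro frac_le mult_left_mono mult_right_mono power_mono mult_pos_pos mult_nonneg_nonneg) auto
  also have "\<dots> = 10 * norm u / norm l ^ 3" using l0 by (simp add: field_simps eval_nat_numeral)
  finally show ?thesis .
qed

lemma summable_product_weight:
  "(\<lambda>(n, m). (1 + (of_int n)\<^sup>2) powr (- 3 / 4 :: real) * (1 + (of_int m)\<^sup>2) powr (- 3 / 4)) summable_on (UNIV :: (int \<times> int) set)"
proof -
  define \<nu> where "\<nu> = (\<lambda>m::int. (1 + (of_int m)\<^sup>2) powr (- 3 / 4 :: real))"
  have s: "\<nu> summable_on UNIV" unfolding \<nu>_def by (rule summable_weight)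
  have nn: "\<nu> m \<ge> 0" for m by (simp add: \<nu>_def)
  have "(\<lambda>p. norm ((\<lambda>(n, m). \<nu> n * \<nu> m) p)) summable_on Sigma UNIV (\<lambda>_. UNIV)"
    unfolding Infinite_Sum.abs_summable_on_Sigma_iff
  proof (intro conjI ballI)
    fix n show "(\<lambda>m. norm (case (n, m) of (n, m) \<Rightarrow> \<nu> n * \<nu> m)) summable_on UNIV"
      using summable_on_cmult_right[OF s, of "\<nu> n"] nn by (simp add: abs_mult)
    have "infsum (\<lambda>m. norm (case (n, m) of (n, m) \<Rightarrow> \<nu> n * \<nu> m)) UNIV = \<nu> n * infsum \<nu> UNIV" for n
      using infsum_cmult_right[of "\<nu> n" \<nu> UNIV] s nn by (simp add: abs_mult)
    thus "(\<lambda>n. norm (infsum (\<lambda>m. norm (case (n, m) of (n, m) \<Rightarrow> \<nu> n * \<nu> m)) UNIV)) summable_on UNIV"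
      using summable_on_cmult_left[OF s, of "infsum \<nu> UNIV"] nn infsum_nonneg[of UNIV \<nu>] by (simp add: abs_mult)
  qed
  hence "(\<lambda>(n, m). \<nu> n * \<nu> m) summable_on UNIV" using abs_summable_summable by fastforce
  thus ?thesis by (simp add: \<nu>_def)
qed

lemma has_sum_minus:
  fixes f g :: "'a \<Rightarrow> complex"
  assumes "(f has_sum a) A" "(g has_sum b) A"
  shows "((\<lambda>x. f x - g x) has_sum (a - b)) A"
  using has_sum_add[OF assms(1), of "\<lambda>x. - g x" "- b"] assms(2) by (simp add: has_sum_uminus)

text \<open>A rectangular lattice with periods w and \<i> w'. Only the sign of the ratio is fixed,
  so w and w' may both be negative; this is the source of the sign in
  \<open>py_zeta3_eps\<close>.\<close>

locale period_pair =
  fixes w w' :: real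
  assumes ratio: "0 < w' / w"
begin

abbreviation "\<Omega> \<equiv> complex_of_real w"
abbreviation "\<Omega>' \<equiv> \<i> * complex_of_real w'"

text \<open>The first index counts the imaginary period and thus the power of the nome
  \<open>q0\<close>; the second one is the inner index and runs along the real period, where the sum
  is a trigonometric function.\<close>

definition lattice_point :: "int \<times> int \<Rightarrow> complex" where "lattice_point = (\<lambda>(n, m). of_int m * \<Omega> + of_int n * \<Omega>')"
definition q0 :: real where "q0 = exp (- 2 * pi * (w' / w))"
definition \<mu> :: complex where "\<mu> = 2 * of_real pi * \<i> / \<Omega>"
text \<open>For the period \<open>0\<close> the second summand is \<open>1 / 0 = 0\<close>, so the sum of \<open>T u\<close> is exactly \<open>wp\<close>.\<close>

definition T :: "complex \<Rightarrow> int \<times> int \<Rightarrow> complex" where "T u p = 1 / (u - lattice_point p)\<^sup>2 - 1 / (lattice_point p)\<^sup>2"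

lemma w_nz: "w \<noteq> 0" "w' \<noteq> 0" using ratio by auto

lemma lattice_point_eq: "lattice_point (n, m) = Complex (of_int m * w) (of_int n * w')"
  by (simp add: lattice_point_def complex_eq_iff)

lemma inj_lattice_point: "inj lattice_point"
  using w_nz by (auto simp: inj_def lattice_point_eq)

lemma lattice_point_zero_iff: "lattice_point p = 0 \<longleftrightarrow> p = (0, 0)"
  using w_nz by (cases p) (auto simp: lattice_point_eq complex_eq_iff)

lemma range_lattice_point: "range lattice_point = period_lattice \<Omega> \<Omega>'"
  unfolding lattice_point_def period_lattice_def by (auto simp: image_iff)

lemma norm_lattice_point_ge:
  obtains c where "c > 0" "\<And>n m. c\<^sup>2 * ((of_int m)\<^sup>2 + (of_int n)\<^sup>2) \<le> norm (lattice_point (n, m)) ^ 2"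
proof
  define c where "c = min \<bar>w\<bar> \<bar>w'\<bar>"
  show "c > 0" using w_nz by (simp add: c_def)
  have "c\<^sup>2 \<le> \<bar>w\<bar>\<^sup>2" "c\<^sup>2 \<le> \<bar>w'\<bar>\<^sup>2" using \<open>c > 0\<close> by (intro power_mono; simp add: c_def)+
  hence c: "c\<^sup>2 \<le> w\<^sup>2" "c\<^sup>2 \<le> w'\<^sup>2" by simp_all
  show "c\<^sup>2 * ((of_int m)\<^sup>2 + (of_int n)\<^sup>2) \<le> norm (lattice_point (n, m)) ^ 2" for n m
  proof -
    have "c\<^sup>2 * (of_int m)\<^sup>2 \<le> w\<^sup>2 * (of_int m)\<^sup>2" "c\<^sup>2 * (of_int n)\<^sup>2 \<le> w'\<^sup>2 * (of_int n)\<^sup>2"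
      using c by (intro mult_right_mono; simp)+
    thus ?thesis unfolding lattice_point_eq cmod_power2 by (simp add: power_mult_distrib algebra_simps)
  qed
qed

lemma norm_lattice_point_weight:
  obtains K where "K > 0" "\<And>n m. (n, m) \<noteq> (0, 0) \<Longrightarrow>
    1 / norm (lattice_point (n, m)) ^ 3 \<le> K * ((1 + (of_int n)\<^sup>2) powr (- 3 / 4) * (1 + (of_int m)\<^sup>2) powr (- 3 / 4))"
proof -
  obtain c where c: "c > 0" "\<And>n m. c\<^sup>2 * ((of_int m)\<^sup>2 + (of_int n)\<^sup>2) \<le> norm (lattice_point (n, m)) ^ 2"
    by (rule norm_lattice_point_ge) blast
  define k where "k = ((2 / c\<^sup>2)\<^sup>2) powr (- 3 / 4)"
  have k: "k > 0" using c by (simp add: k_def)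
  show ?thesis
  proof (rule that[of "1 / k"])
    show "1 / k > 0" using k by simp
    fix n m :: int assume nm: "(n, m) \<noteq> (0, 0)"
    define L where "L = norm (lattice_point (n, m))"
    define s where "s = (of_int m)\<^sup>2 + (of_int n :: real)\<^sup>2"
    have L: "L > 0" using lattice_point_zero_iff nm by (auto simp: L_def)
    have "of_int (m\<^sup>2 + n\<^sup>2) \<ge> (1 :: real)"
    proof -
      have "m\<^sup>2 + n\<^sup>2 > 0" using nm by (auto simp: sum_power2_gt_zero_iff)
      thus ?thesis by linarith
    qed
    hence s1: "s \<ge> 1" by (simp add: s_def)
    have sL: "s \<le> L\<^sup>2 / c\<^sup>2" using c(2)[of m n] c(1) by (simp add: s_def L_def field_simps)
    have nn: "0 \<le> (of_int m :: real)\<^sup>2" "0 \<le> (of_int n :: real)\<^sup>2" by simp_all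
    have "1 + y \<le> 2 * (x + y)" "1 + x \<le> 2 * (x + y)" if "1 \<le> x + y" "0 \<le> x" "0 \<le> y" for x y :: real
      using that by auto
    from this[OF s1[unfolded s_def] nn] have "1 + (of_int n)\<^sup>2 \<le> 2 * s" "1 + (of_int m)\<^sup>2 \<le> 2 * s"
      by (auto simp: s_def)
    hence "(1 + (of_int n)\<^sup>2) * (1 + (of_int m)\<^sup>2) \<le> (2 * s) * (2 * s)"
      using s1 nn by (intro mult_mono) auto
    also have "\<dots> \<le> (2 * (L\<^sup>2 / c\<^sup>2)) * (2 * (L\<^sup>2 / c\<^sup>2))" using sL s1 by (intro mult_mono) auto
    also have "\<dots> = (2 / c\<^sup>2)\<^sup>2 * L ^ 4" by (simp add: power2_eq_square eval_nat_numeral)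
    finally have "((2 / c\<^sup>2)\<^sup>2 * L ^ 4) powr (- 3 / 4) \<le> ((1 + (of_int n)\<^sup>2) * (1 + (of_int m)\<^sup>2)) powr (- 3 / 4)"
      using nn by (intro powr_mono2') (auto intro!: mult_pos_pos add_pos_nonneg)
    hence "k * (L ^ 4) powr (- 3 / 4) \<le> (1 + (of_int n)\<^sup>2) powr (- 3 / 4) * (1 + (of_int m)\<^sup>2) powr (- 3 / 4)"
      using nn by (simp add: powr_mult k_def)
    moreover have "(L ^ 4) powr (- 3 / 4) = 1 / L ^ 3"
    proof -
      have "(L ^ 4) powr (- 3 / 4) = (L powr 4) powr (- 3 / 4)" using L by simp
      also have "\<dots> = L powr (- 3)" by (simp add: powr_powr)
      also have "\<dots> = 1 / L ^ 3" using L by (simp add: powr_minus inverse_eq_divide)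
      finally show ?thesis .
    qed
    ultimately have "k * (1 / L ^ 3) \<le> (1 + (of_int n)\<^sup>2) powr (- 3 / 4) * (1 + (of_int m)\<^sup>2) powr (- 3 / 4)"
      by (simp only:)
    hence "1 / k * (k * (1 / L ^ 3)) \<le> 1 / k * ((1 + (of_int n)\<^sup>2) powr (- 3 / 4) * (1 + (of_int m)\<^sup>2) powr (- 3 / 4))"
      using k by (intro mult_left_mono) auto
    thus "1 / norm (lattice_point (n, m)) ^ 3 \<le> 1 / k * ((1 + (of_int n)\<^sup>2) powr (- 3 / 4) * (1 + (of_int m)\<^sup>2) powr (- 3 / 4))"
      using k by (simp add: L_def)
  qed
qed

lemma finite_lattice_point: "finite {p. norm (lattice_point p) < R}"
proof -
  obtain c where c: "c > 0" "\<And>n m. c\<^sup>2 * ((of_int m)\<^sup>2 + (of_int n)\<^sup>2) \<le> norm (lattice_point (n, m)) ^ 2"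
    by (rule norm_lattice_point_ge) blast
  define N where "N = \<lceil>R / c\<rceil>"
  have bd: "\<bar>k\<bar> \<le> N" if "c\<^sup>2 * (of_int k)\<^sup>2 \<le> norm (lattice_point p) ^ 2" "norm (lattice_point p) < R" for k p
  proof -
    have "(c * \<bar>of_int k\<bar>)\<^sup>2 \<le> norm (lattice_point p) ^ 2" using that by (simp add: power_mult_distrib)
    hence "c * \<bar>of_int k\<bar> \<le> norm (lattice_point p)" by (rule power2_le_imp_le) simp
    hence "of_int \<bar>k\<bar> \<le> R / c" using that c by (simp add: field_simps)
    thus ?thesis unfolding N_def by linarith
  qed
  have "(n, m) \<in> {- N..N} \<times> {- N..N}" if "norm (lattice_point (n, m)) < R" for n m
  proof -
    have "0 \<le> c\<^sup>2 * (of_int m)\<^sup>2" "0 \<le> c\<^sup>2 * (of_int n)\<^sup>2" by simp_all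
    hence "c\<^sup>2 * (of_int m)\<^sup>2 \<le> norm (lattice_point (n, m)) ^ 2" "c\<^sup>2 * (of_int n)\<^sup>2 \<le> norm (lattice_point (n, m)) ^ 2"
      using c(2)[of m n] unfolding distrib_left by linarith+
    from bd[OF this(1) that] bd[OF this(2) that] show ?thesis by auto
  qed
  hence "{p. norm (lattice_point p) < R} \<subseteq> {- N..N} \<times> {- N..N}" by auto
  thus ?thesis by (rule finite_subset) auto
qed

lemma summable_T: "T u summable_on UNIV"
proof -
  obtain K where K: "K > 0" "\<And>n m. (n, m) \<noteq> (0, 0) \<Longrightarrow>
    1 / norm (lattice_point (n, m)) ^ 3 \<le> K * ((1 + (of_int n)\<^sup>2) powr (- 3 / 4) * (1 + (of_int m)\<^sup>2) powr (- 3 / 4))"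
    by (rule norm_lattice_point_weight) blast
  define F where "F = insert (0, 0) {p. norm (lattice_point p) < 2 * norm u}"
  define g where "g = (\<lambda>p. (10 * norm u * K) * (case p of (n, m) \<Rightarrow> (1 + (of_int n)\<^sup>2) powr (- 3 / 4) * (1 + (of_int m)\<^sup>2) powr (- 3 / 4 :: real)))"
  have "g summable_on UNIV" unfolding g_def by (intro summable_on_cmult_right summable_product_weight)
  hence "g summable_on - F" by (rule summable_on_subset_banach) simp
  moreover have gn: "norm (g p) = g p" for p using K by (auto simp: g_def split: prod.splits)
  ultimately have "(\<lambda>p. norm (g p)) summable_on - F" by simp
  hence "(\<lambda>p. norm (T u p)) summable_on - F"
  proof (rule Infinite_Sum.abs_summable_on_comparison_test)
    fix p assume p: "p \<in> - F"
    obtain n m where nm: "p = (n, m)" by (cases p)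
    have "norm (T u p) \<le> 10 * norm u / norm (lattice_point p) ^ 3"
      unfolding T_def by (rule weierstrass_term_bound) (use p lattice_point_zero_iff in \<open>auto simp: F_def\<close>)
    also have "\<dots> = (10 * norm u) * (1 / norm (lattice_point p) ^ 3)" by simp
    also have "\<dots> \<le> g p"
      using mult_left_mono[OF K(2)[of n m], of "10 * norm u"] p by (auto simp: g_def nm F_def mult.assoc)
    finally show "norm (T u p) \<le> norm (g p)" using gn by simp
  qed
  hence "T u summable_on - F" by (rule abs_summable_summable)
  moreover have "T u summable_on F" by (rule summable_on_finite) (auto simp: F_def finite_lattice_point)
  ultimately have "T u summable_on (F \<union> - F)" by (intro summable_on_Un_disjoint) auto
  thus ?thesis by simp
qed

lemma wp_has_sum: "(T u has_sum wp \<Omega> \<Omega>' u) UNIV"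
proof -
  have im: "lattice_point ` (UNIV - {(0, 0)}) = period_lattice \<Omega> \<Omega>' - {0}"
    using inj_lattice_point lattice_point_zero_iff range_lattice_point by (auto simp: image_set_diff)
  have "infsum (\<lambda>l. 1 / (u - l)\<^sup>2 - 1 / l\<^sup>2) (period_lattice \<Omega> \<Omega>' - {0}) = infsum (T u) (UNIV - {(0, 0)})"
    unfolding im[symmetric] using inj_lattice_point
    by (subst infsum_reindex) (auto simp: T_def [abs_def] o_def intro: inj_on_subset)
  hence "wp \<Omega> \<Omega>' u = T u (0, 0) + infsum (T u) (UNIV - {(0, 0)})"
    by (simp add: wp_def T_def lattice_point_eq complex_eq_iff flip: zero_complex.code)
  moreover have "(T u has_sum infsum (T u) (UNIV - {(0, 0)})) (UNIV - {(0, 0)})"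
    by (intro has_sum_infsum summable_on_subset_banach[OF summable_T]) auto
  from has_sum_insert[OF _ this, of "(0, 0)"]
  have "(T u has_sum (T u (0, 0) + infsum (T u) (UNIV - {(0, 0)}))) UNIV" by (simp add: insert_absorb)
  ultimately show ?thesis by simp
qed

lemma q0: "0 < q0" "q0 < 1"
proof -
  have "- 2 * pi * (w' / w) < 0" using ratio by (intro mult_neg_pos) auto
  thus "q0 < 1" by (simp only: q0_def exp_less_one_iff)
qed (simp add: q0_def)

sublocale nome q0 by unfold_locales (fact q0)+

lemma exp_mu: "of_real q0 powi n = exp (\<mu> * (of_int n * \<Omega>'))"
proof -
  have "\<mu> * \<Omega>' = of_real (- 2 * pi * (w' / w))" using w_nz by (simp add: \<mu>_def field_simps)
  hence "of_real q0 = exp (\<mu> * \<Omega>')" by (simp only: q0_def exp_of_real)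
  thus ?thesis by (simp add: exp_power_int mult_ac)
qed

lemma mu_nz: "\<mu> \<noteq> 0" using w_nz by (simp add: \<mu>_def)

lemma lattice_iff: "u \<in> period_lattice \<Omega> \<Omega>' \<longleftrightarrow> exp (\<mu> * u) \<notin> tdom q0"
proof -
  have "exp (\<mu> * u) \<notin> tdom q0 \<longleftrightarrow> (\<exists>n k. \<mu> * u = \<mu> * (of_int n * \<Omega>') + of_int (2 * k) * of_real pi * \<i>)"
    unfolding tdom_iff_powi exp_mu by (simp add: exp_eq)
  also have "\<dots> \<longleftrightarrow> (\<exists>n k. \<mu> * u = \<mu> * (of_int k * \<Omega> + of_int n * \<Omega>'))"
  proof -
    have "of_int (2 * k) * of_real pi * \<i> = \<mu> * (of_int k * \<Omega>)" for k using w_nz by (simp add: \<mu>_def)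
    thus ?thesis by (simp only: distrib_left add.commute)
  qed
  also have "\<dots> \<longleftrightarrow> (\<exists>n k. u = of_int k * \<Omega> + of_int n * \<Omega>')" using mu_nz by simp
  also have "\<dots> \<longleftrightarrow> u \<in> period_lattice \<Omega> \<Omega>'" by (auto simp: period_lattice_def)
  finally show ?thesis by simp
qed

text \<open>After dividing by the real period this is the expansion of pi^2 / sin^2 in inverse
  squares, rewritten in exponential form.\<close>

lemma row_has_sum:
  assumes u: "u \<notin> period_lattice \<Omega> \<Omega>'"
  defines "x \<equiv> \<lambda>n. exp (\<mu> * u) / of_real q0 powi n"
  shows "((\<lambda>m. 1 / (u - lattice_point (n, m))\<^sup>2) has_sum (\<mu>\<^sup>2 * (x n / (1 - x n)\<^sup>2))) UNIV"
proof -
  define v where "v = (u - of_int n * \<Omega>') / \<Omega>"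
  have v: "v \<notin> \<int>"
  proof
    assume "v \<in> \<int>"
    then obtain k where "v = of_int k" by (elim Ints_cases)
    hence "u = of_int k * \<Omega> + of_int n * \<Omega>'" using w_nz by (simp add: v_def field_simps)
    thus False using u by (auto simp: period_lattice_def)
  qed
  have "exp (2 * of_real pi * \<i> * v) = exp (\<mu> * u - \<mu> * (of_int n * \<Omega>'))"
    by (simp add: v_def \<mu>_def diff_divide_distrib algebra_simps)
  also have "\<dots> = x n" by (simp add: exp_diff exp_mu x_def)
  finally have xn: "exp (2 * of_real pi * \<i> * v) = x n" .
  have "((\<lambda>m. (1 / \<Omega>)\<^sup>2 * (1 / (v - of_int m)\<^sup>2)) has_sum ((1 / \<Omega>)\<^sup>2 * (of_real pi / sin (of_real pi * v))\<^sup>2)) UNIV"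
    by (intro has_sum_cmult_right inverse_square_has_sum v)
  also have "(1 / \<Omega>)\<^sup>2 * (of_real pi / sin (of_real pi * v))\<^sup>2 = \<mu>\<^sup>2 * (x n / (1 - x n)\<^sup>2)"
    unfolding inverse_sin_square[OF v] xn by (simp add: \<mu>_def power_divide power_mult_distrib)
  also have "(\<lambda>m. (1 / \<Omega>)\<^sup>2 * (1 / (v - of_int m)\<^sup>2)) = (\<lambda>m. 1 / (u - lattice_point (n, m))\<^sup>2)"
  proof
    fix m
    have "\<Omega> * v = u - of_int n * \<Omega>'" using w_nz by (simp add: v_def)
    hence "\<Omega> * (v - of_int m) = u - lattice_point (n, m)" by (simp add: lattice_point_def algebra_simps)
    thus "(1 / \<Omega>)\<^sup>2 * (1 / (v - of_int m)\<^sup>2) = 1 / (u - lattice_point (n, m))\<^sup>2"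
      by (simp add: power_divide flip: power_mult_distrib)
  qed
  finally show ?thesis .
qed

text \<open>Absolute summability allows the Weierstrass series to be summed by rows. Each row is a
  term of the series for \<open>qW\<close> minus a row sum of 1 / l^2, and the latter depends on the
  lattice alone.\<close>

theorem wp_eq_qW:
  obtains C where "\<And>u. u \<notin> period_lattice \<Omega> \<Omega>' \<Longrightarrow> wp \<Omega> \<Omega>' u = \<mu>\<^sup>2 * qW q0 (exp (\<mu> * u)) + C"
proof
  define a where "a = (\<lambda>n. infsum (\<lambda>m. 1 / (lattice_point (n, m))\<^sup>2) UNIV)"
  fix u assume u: "u \<notin> period_lattice \<Omega> \<Omega>'"
  define x where "x = (\<lambda>n. exp (\<mu> * u) / of_real q0 powi n)"
  have row: "((\<lambda>m. 1 / (u - lattice_point (n, m))\<^sup>2) has_sum (\<mu>\<^sup>2 * (x n / (1 - x n)\<^sup>2))) UNIV" for n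
    unfolding x_def by (rule row_has_sum[OF u])
  have "(\<lambda>m. T u (n, m)) summable_on UNIV" for n
  proof -
    have "T u summable_on (Pair n ` UNIV)" by (rule summable_on_subset_banach[OF summable_T]) simp
    thus ?thesis by (subst (asm) summable_on_reindex) (auto simp: inj_on_def o_def)
  qed
  hence rT: "((\<lambda>m. T u (n, m)) has_sum infsum (\<lambda>m. T u (n, m)) UNIV) UNIV" for n by (rule has_sum_infsum)
  have "((\<lambda>m. 1 / (u - lattice_point (n, m))\<^sup>2 - T u (n, m)) has_sum
      (\<mu>\<^sup>2 * (x n / (1 - x n)\<^sup>2) - infsum (\<lambda>m. T u (n, m)) UNIV)) UNIV" for n
    by (intro has_sum_minus row rT)
  hence ra: "infsum (\<lambda>m. T u (n, m)) UNIV = \<mu>\<^sup>2 * (x n / (1 - x n)\<^sup>2) - a n" for n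
    unfolding a_def by (subst infsumI) (auto simp: T_def)
  have "((\<lambda>n. \<mu>\<^sup>2 * (x n / (1 - x n)\<^sup>2) - a n) has_sum wp \<Omega> \<Omega>' u) UNIV"
    by (rule has_sum_SigmaD[where f = "T u" and A = UNIV and B = "\<lambda>_. UNIV"])
       (use wp_has_sum rT ra in auto)
  moreover have "((\<lambda>n. \<mu>\<^sup>2 * (x n / (1 - x n)\<^sup>2)) has_sum \<mu>\<^sup>2 * qW q0 (exp (\<mu> * u))) UNIV"
    unfolding x_def using u lattice_iff by (intro has_sum_cmult_right qW_has_sum) auto
  \<comment> \<open>Convergence of the sum of the \<open>a n\<close> is obtained here as that of a
    difference of two convergent series. Since \<open>a\<close> does not involve \<open>u\<close>,
    its sum is the required constant up to sign.\<close>
  ultimately have "((\<lambda>n. \<mu>\<^sup>2 * (x n / (1 - x n)\<^sup>2) - (\<mu>\<^sup>2 * (x n / (1 - x n)\<^sup>2) - a n)) has_sum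
     (\<mu>\<^sup>2 * qW q0 (exp (\<mu> * u)) - wp \<Omega> \<Omega>' u)) UNIV"
    by (intro has_sum_minus)
  hence "(a has_sum (\<mu>\<^sup>2 * qW q0 (exp (\<mu> * u)) - wp \<Omega> \<Omega>' u)) UNIV" by simp
  hence "infsum a UNIV = \<mu>\<^sup>2 * qW q0 (exp (\<mu> * u)) - wp \<Omega> \<Omega>' u" by (rule infsumI)
  thus "wp \<Omega> \<Omega>' u = \<mu>\<^sup>2 * qW q0 (exp (\<mu> * u)) + - infsum a UNIV" by simp
qed

lemma deriv_wp:
  assumes u: "u \<notin> period_lattice \<Omega> \<Omega>'"
  shows "deriv (wp \<Omega> \<Omega>') u = \<mu> ^ 3 * DW (exp (\<mu> * u))"
proof -
  obtain C where C: "\<And>u. u \<notin> period_lattice \<Omega> \<Omega>' \<Longrightarrow> wp \<Omega> \<Omega>' u = \<mu>\<^sup>2 * qW q0 (exp (\<mu> * u)) + C"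
    by (rule wp_eq_qW) blast
  have z: "exp (\<mu> * u) \<in> tdom q0" using u lattice_iff by simp
  have "open ((\<lambda>u. exp (\<mu> * u)) -` tdom q0)" by (intro open_vimage open_tdom continuous_intros)
  hence "eventually (\<lambda>v. v \<in> (\<lambda>u. exp (\<mu> * u)) -` tdom q0) (nhds u)"
    using z by (intro eventually_nhds_in_open) auto
  hence ev: "eventually (\<lambda>v. wp \<Omega> \<Omega>' v = \<mu>\<^sup>2 * qW q0 (exp (\<mu> * v)) + C) (nhds u)"
    by eventually_elim (use C lattice_iff in auto)
  have "(qW q0 has_field_derivative DW (exp (\<mu> * u)) / exp (\<mu> * u)) (at (exp (\<mu> * u)))"
    using qW_has_deriv[OF z] by (simp add: DW_def)
  hence "((\<lambda>u. qW q0 (exp (\<mu> * u))) has_field_derivative DW (exp (\<mu> * u)) / exp (\<mu> * u) * (exp (\<mu> * u) * \<mu>)) (at u)"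
    by (rule DERIV_chain2[where f = "qW q0" and g = "\<lambda>u. exp (\<mu> * u)" and x = u])
       (auto intro!: derivative_eq_intros)
  hence "((\<lambda>u. \<mu>\<^sup>2 * qW q0 (exp (\<mu> * u)) + C) has_field_derivative \<mu> ^ 3 * DW (exp (\<mu> * u))) (at u)"
    by (auto intro!: derivative_eq_intros simp: eval_nat_numeral)
  hence "(wp \<Omega> \<Omega>' has_field_derivative \<mu> ^ 3 * DW (exp (\<mu> * u))) (at u)"
    using DERIV_cong_ev[OF refl ev refl] by simp
  thus ?thesis by (rule DERIV_imp_deriv)
qed

lemma exp_mu_surj: "z \<noteq> 0 \<Longrightarrow> \<exists>u. exp (\<mu> * u) = z"
  using mu_nz by (intro exI[of _ "Ln z / \<mu>"]) simp

end

section \<open>The elliptic curve of the theorem\<close>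

text \<open>The cubic is 4 (x - 3) (x^2 + 3 x - 99), and the quadratic factor has discriminant 405 =
  81 * 5.\<close>

lemma cubic_roots:
  fixes x s :: complex
  assumes "s\<^sup>2 = 5" "4 * x ^ 3 - 432 * x + 1188 = 0"
  shows "x = 3 \<or> x = (- 3 + 9 * s) / 2 \<or> x = (- 3 - 9 * s) / 2"
proof -
  have "(x - 3) * ((2 * x + 3 - 9 * s) * (2 * x + 3 + 9 * s)) = (4 * x ^ 3 - 432 * x + 1188) + (x - 3) * (81 * (5 - s\<^sup>2))"
    by (simp add: algebra_simps power2_eq_square power3_eq_cube)
  hence "(x - 3) * ((2 * x + 3 - 9 * s) * (2 * x + 3 + 9 * s)) = 0" using assms by simp
  then consider "x - 3 = 0" | "2 * x + 3 - 9 * s = 0" | "2 * x + 3 + 9 * s = 0" by auto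
  thus ?thesis
  proof cases
    case 2
    have "x = (2 * x + 3 - 9 * s) / 2 + (- 3 + 9 * s) / 2" by (simp add: field_simps)
    hence "x = 0 / 2 + (- 3 + 9 * s) / 2" unfolding 2 .
    thus ?thesis by simp
  next
    case 3
    have "x = (2 * x + 3 + 9 * s) / 2 + (- 3 - 9 * s) / 2" by (simp add: field_simps)
    hence "x = 0 / 2 + (- 3 - 9 * s) / 2" unfolding 3 .
    thus ?thesis by simp
  qed simp
qed

text \<open>The translate of a point (12, y0) of order three by the point of order two with abscissa
  (-3 - 9 s) / 2 is (21 - 9 s, (2 s - 5) y0). The number 648 is 6 * 12^2 - 216. Keeping s as any
  square root of 5 covers two half periods at once.\<close>

lemma translate_value:
  fixes s x y y0 :: complex
  assumes s: "s\<^sup>2 = 5" and y0: "y0\<^sup>2 = 2916"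
    and x: "(x - (- 3 - 9 * s) / 2) * (12 - (- 3 - 9 * s) / 2) = 9 * s * (3 - (- 3 - 9 * s) / 2)"
    and y: "y * (12 - (- 3 - 9 * s) / 2) + (x - (- 3 - 9 * s) / 2) * y0 = 0"
  shows "(648 + (6 * x\<^sup>2 - 216)) ^ 3 / (y0 + y) ^ 4 = 112 + 38 * s"
proof -
  have s3: "s + 3 \<noteq> 0"
  proof
    assume "s + 3 = 0"
    hence "s\<^sup>2 = 9" by (simp add: eq_neg_iff_add_eq_0[symmetric])
    thus False using s by simp
  qed
  have s2: "s - 2 \<noteq> 0"
  proof
    assume "s - 2 = 0"
    hence "s\<^sup>2 = 4" by simp
    thus False using s by simp
  qed
  have "(s + 3) * (x - (21 - 9 * s)) =
      2 / 9 * ((x - (- 3 - 9 * s) / 2) * (12 - (- 3 - 9 * s) / 2) - 9 * s * (3 - (- 3 - 9 * s) / 2)) + 27 / 2 * (s\<^sup>2 - 5)"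
    by (simp add: field_simps power2_eq_square)
  hence "(s + 3) * (x - (21 - 9 * s)) = 0" unfolding x s by simp
  hence xv: "x = 21 - 9 * s" using s3 by simp
  have "(s + 3) * (y - (2 * s - 5) * y0) =
      2 / 9 * (y * (12 - (- 3 - 9 * s) / 2) + (x - (- 3 - 9 * s) / 2) * y0) - 2 * (s\<^sup>2 - 5) * y0"
    unfolding xv by (simp add: field_simps power2_eq_square)
  hence "(s + 3) * (y - (2 * s - 5) * y0) = 0" unfolding y s by simp
  hence yv: "y = (2 * s - 5) * y0" using s3 by simp
  have p4: "a ^ 4 = (a\<^sup>2)\<^sup>2" for a :: complex by (simp flip: power_mult)
  have y04: "y0 ^ 4 = 2916\<^sup>2" unfolding p4 y0 ..
  have "y0 + y = y0 * (2 * (s - 2))" unfolding yv by (simp add: algebra_simps)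
  hence "(y0 + y) ^ 4 = 2916\<^sup>2 * (2 ^ 4 * (s - 2) ^ 4)" by (simp only: power_mult_distrib y04)
  hence d: "(y0 + y) ^ 4 = 2916\<^sup>2 * 16 * (s - 2) ^ 4" by simp
  have n: "(648 + (6 * x\<^sup>2 - 216)) ^ 3 = (112 + 38 * s) * (2916\<^sup>2 * 16 * (s - 2) ^ 4)"
  proof -
    have ss: "s * s = 5" "s * (s * a) = 5 * a" for a
      using s by (simp_all add: power2_eq_square flip: mult.assoc)
    have "(s - 2)\<^sup>2 = 9 - 4 * s" by (simp add: power2_eq_square algebra_simps ss)
    hence 1: "(s - 2) ^ 4 = 161 - 72 * s" unfolding p4 by (simp add: power2_eq_square algebra_simps ss)
    have 2: "648 + (6 * (21 - 9 * s)\<^sup>2 - 216) = 108 * (51 - 21 * s)" by (simp add: power2_eq_square algebra_simps ss)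
    have 3: "(51 - 21 * s) ^ 3 = 470016 - 210168 * s" by (simp add: power3_eq_cube algebra_simps ss)
    show ?thesis unfolding xv 1 2 power_mult_distrib 3 by (simp add: algebra_simps ss)
  qed
  show ?thesis unfolding d n using s2 by simp
qed

lemma cube_7:
  fixes t :: real
  assumes "t\<^sup>2 = 5"
  shows "(7 + t) ^ 3 = 4 * (112 + 38 * t)"
proof -
  have "t * t = 5" "t * (t * a) = 5 * a" for a
    using assms by (simp_all add: power2_eq_square flip: mult.assoc)
  thus ?thesis by (simp add: power3_eq_cube algebra_simps)
qed

lemma cube_eq_root_quotient:
  fixes a b :: real
  assumes "a \<ge> 0" "b \<ge> 0" "a ^ 3 = b ^ 3 / 4"
  shows "a = b / root 3 4"
proof -
  have "(b / root 3 4) ^ 3 = b ^ 3 / 4" by (simp add: power_divide)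
  hence "a ^ 3 = (b / root 3 4) ^ 3" using assms by simp
  thus ?thesis using assms by (intro power_eq_imp_eq_base[of a 3]) auto
qed

definition bw_sum :: "real \<Rightarrow> complex \<Rightarrow> real" where
  "bw_sum q z = (\<Sum>\<^sub>\<infinity>n::int. bloch_wigner (z * of_real q powi n))"

lemma bw_sum_powi:
  assumes "q > 0"
  shows "bw_sum q (z * of_real q powi k) = bw_sum q z"
proof -
  have "bw_sum q (z * of_real q powi k) = (\<Sum>\<^sub>\<infinity>n::int. bloch_wigner (z * of_real q powi (k + n)))"
    unfolding bw_sum_def using assms by (simp add: power_int_add mult.assoc)
  also have "\<dots> = bw_sum q z" unfolding bw_sum_def
    by (rule infsum_reindex_bij_betw[where g = "\<lambda>n. k + n" and f = "\<lambda>n. bloch_wigner (z * of_real q powi n)"])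
       (auto intro!: bij_betwI[of _ _ _ "\<lambda>n. n - k"])
  finally show ?thesis .
qed

lemma bw_sum_ray: "bw_sum (exp L) (of_real (exp t) * cis \<theta>) = (\<Sum>\<^sub>\<infinity>n::int. bwray \<theta> (t + of_int n * L))"
proof -
  have *: "of_real (exp t) * cis \<theta> * of_real (exp L) powi n = of_real (exp (t + of_int n * L)) * cis \<theta>" for n
  proof -
    have "exp (of_int n * L) = exp L powi n" by (simp add: exp_power_int mult.commute)
    thus ?thesis by (simp add: exp_add)
  qed
  show ?thesis unfolding bw_sum_def bwray_def * ..
qed

text \<open>The invariants 432 and -1188 are tied to the lattice only by this surjectivity: it gives
  both the equation satisfied by the coordinates and the existence of a parameter for every point of
  the curve.\<close>

locale uniformized = period_pair +
  assumes range_wp: "range (wp_point \<Omega> \<Omega>') = weierstrass_curve 432 (- 1188)"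
begin

definition C where "C = (SOME C. \<forall>u. u \<notin> period_lattice \<Omega> \<Omega>' \<longrightarrow> wp \<Omega> \<Omega>' u = \<mu>\<^sup>2 * qW q0 (exp (\<mu> * u)) + C)"

definition pe :: "complex \<Rightarrow> complex" where "pe z = \<mu>\<^sup>2 * qW q0 z + C"
definition py :: "complex \<Rightarrow> complex" where "py z = \<mu> ^ 3 * DW z"

lemma wp_pe: "u \<notin> period_lattice \<Omega> \<Omega>' \<Longrightarrow> wp \<Omega> \<Omega>' u = pe (exp (\<mu> * u))"
proof -
  have "\<exists>C. \<forall>u. u \<notin> period_lattice \<Omega> \<Omega>' \<longrightarrow> wp \<Omega> \<Omega>' u = \<mu>\<^sup>2 * qW q0 (exp (\<mu> * u)) + C"
    using wp_eq_qW by metis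
  from someI_ex[OF this, folded C_def] show "u \<notin> period_lattice \<Omega> \<Omega>' \<Longrightarrow> ?thesis" unfolding pe_def by blast
qed

lemma wp_point_eq:
  "wp_point \<Omega> \<Omega>' u = (if exp (\<mu> * u) \<in> tdom q0 then Affine (pe (exp (\<mu> * u))) (py (exp (\<mu> * u))) else Infinity)"
  using lattice_iff[of u] wp_pe[of u] deriv_wp[of u] by (simp add: wp_point_def py_def)

lemma curve_eq:
  assumes z: "z \<in> tdom q0"
  shows "(py z)\<^sup>2 = 4 * pe z ^ 3 - 432 * pe z + 1188"
proof -
  have "z \<noteq> 0" using z by (auto simp: tdom_def)
  then obtain u where u: "exp (\<mu> * u) = z" using exp_mu_surj by blast
  have "wp_point \<Omega> \<Omega>' u \<in> weierstrass_curve 432 (- 1188)" using range_wp by blast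
  thus ?thesis using z by (simp add: wp_point_eq u weierstrass_curve_def)
qed

lemma curve_surj:
  assumes "y\<^sup>2 = 4 * x ^ 3 - 432 * x + 1188"
  shows "\<exists>u. wp_point \<Omega> \<Omega>' u = Affine x y"
proof -
  have "Affine x y \<in> range (wp_point \<Omega> \<Omega>')" unfolding range_wp using assms by (simp add: weierstrass_curve_def)
  thus ?thesis by auto
qed

text \<open>The classical formula for the second derivative, 6 x^2 - g2 / 2 with g2 = 432, obtained
  by differentiating \<open>curve_eq\<close> and dividing by \<open>DW\<close>, which is nonzero
  away from the half periods.\<close>

lemma DDW_pe:
  assumes z2: "z\<^sup>2 \<in> tdom q0"
  shows "\<mu> ^ 4 * DDW z = 6 * pe z ^ 2 - 216"
proof -
  have z: "z \<in> tdom q0" by (rule tdom_sq[OF z2])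
  have z0: "z \<noteq> 0" using z by (auto simp: tdom_def)
  have nz: "DW z \<noteq> 0" using DW_nonzero_iff[OF z] z2 by simp
  have dpy: "(py has_field_derivative \<mu> ^ 3 * (DDW z / z)) (at z)"
    unfolding py_def [abs_def] by (intro DERIV_cmult DW_has_deriv z)
  have dW: "(qW q0 has_field_derivative DW z / z) (at z)"
    using qW_has_deriv[OF z] z0 by (simp add: DW_def)
  have dpe: "(pe has_field_derivative \<mu>\<^sup>2 * (DW z / z)) (at z)"
    unfolding pe_def [abs_def] using DERIV_add[OF DERIV_cmult[OF dW] DERIV_const] by simp
  have 1: "((\<lambda>z. (py z)\<^sup>2) has_field_derivative 2 * py z * (\<mu> ^ 3 * (DDW z / z))) (at z)"
    by (rule derivative_eq_intros dpy refl)+ simp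
  have 2: "((\<lambda>z. 4 * pe z ^ 3 - 432 * pe z + 1188) has_field_derivative (12 * pe z ^ 2 - 432) * (\<mu>\<^sup>2 * (DW z / z))) (at z)"
    by (rule derivative_eq_intros dpe refl)+ (simp add: algebra_simps power2_eq_square)
  have ev: "eventually (\<lambda>z. (py z)\<^sup>2 = 4 * pe z ^ 3 - 432 * pe z + 1188) (nhds z)"
    using eventually_nhds_in_open[OF open_tdom z] by eventually_elim (rule curve_eq)
  have "2 * py z * (\<mu> ^ 3 * (DDW z / z)) = (12 * pe z ^ 2 - 432) * (\<mu>\<^sup>2 * (DW z / z))"
    by (rule DERIV_unique[OF DERIV_cong_ev[THEN iffD1, OF refl ev refl 1] 2])
  hence "(2 * \<mu>\<^sup>2 * DW z / z) * (\<mu> ^ 4 * DDW z) = (2 * \<mu>\<^sup>2 * DW z / z) * (6 * pe z ^ 2 - 216)"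
    by (simp add: py_def algebra_simps eval_nat_numeral)
  moreover have "2 * \<mu>\<^sup>2 * DW z / z \<noteq> 0" using nz z0 mu_nz by simp
  ultimately show ?thesis by (metis mult_left_cancel)
qed

definition s5 :: complex where "s5 = of_real (sqrt 5)"

lemma s5: "s5\<^sup>2 = 5" unfolding s5_def by (metis of_real_numeral of_real_power real_sqrt_pow2 zero_le_numeral)

lemma mu_sq: "\<mu>\<^sup>2 = of_real (- (2 * pi / w)\<^sup>2)"
  by (simp add: \<mu>_def power_divide power_mult_distrib)

lemma half_period_root:
  assumes "z \<in> tdom q0" "z\<^sup>2 \<notin> tdom q0"
  shows "pe z = 3 \<or> pe z = (- 3 + 9 * s5) / 2 \<or> pe z = (- 3 - 9 * s5) / 2"
proof (rule cubic_roots[OF s5])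
  have "DW z = 0" using DW_nonzero_iff[OF assms(1)] assms(2) by simp
  thus "4 * pe z ^ 3 - 432 * pe z + 1188 = 0" using curve_eq[OF assms(1)] by (simp add: py_def)
qed

lemma pe_e: "pe (- 1) = \<mu>\<^sup>2 * e1 + C" "pe (- of_real r) = \<mu>\<^sup>2 * e2 + C" "pe (of_real r) = \<mu>\<^sup>2 * e3 + C"
  by (simp_all add: pe_def e1_def e2_def e3_def)

text \<open>The factor \<open>\<mu>\<^sup>2\<close> is negative and so reverses the order
  \<open>e1\<close> < \<open>e2\<close> < \<open>e3\<close>. Comparison with the order of the three
  real roots, for which sqrt 5 > 2 suffices, assigns a root to each half period.\<close>

lemma pe_half_periods:
  "pe (- 1) = (- 3 + 9 * s5) / 2" "pe (- of_real r) = 3" "pe (of_real r) = (- 3 - 9 * s5) / 2"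
proof -
  have q_notin: "of_real q0 \<notin> tdom q0" "1 \<notin> tdom q0"
    using tdom_iff_powi[of "of_real q0"] tdom_iff_powi[of 1] power_int_1_right[of "complex_of_real q0"]
      power_int_0_right[of "complex_of_real q0"] by metis+
  define \<rho>1 \<rho>2 :: real where "\<rho>1 = (- 3 + 9 * sqrt 5) / 2" and "\<rho>2 = (- 3 - 9 * sqrt 5) / 2"
  have \<rho>: "(- 3 + 9 * s5) / 2 = of_real \<rho>1" "(- 3 - 9 * s5) / 2 = of_real \<rho>2"
    by (simp_all add: \<rho>1_def \<rho>2_def s5_def)
  have "2 < sqrt 5" by (rule real_less_rsqrt) simp
  hence ord: "\<rho>2 < 3" "3 < \<rho>1" by (simp_all add: \<rho>1_def \<rho>2_def)
  have half: "pe z \<in> {3, of_real \<rho>1, of_real \<rho>2}" if "z \<in> tdom q0" "z\<^sup>2 \<notin> tdom q0" for z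
    using half_period_root[OF that] unfolding \<rho> by simp
  have "(- 1 :: complex)\<^sup>2 \<notin> tdom q0" using q_notin(2) by simp
  note rt = half[OF tdom_m1 this] half[OF tdom_mr q_notin(1)[folded rc(2), folded power2_minus[of "complex_of_real r"]]]
    half[OF tdom_r q_notin(1)[folded rc(2)]]
  have neg: "- (2 * pi / w)\<^sup>2 < 0" using w_nz by simp
  have "Re (pe (- 1)) - Re (pe (- of_real r)) = - (2 * pi / w)\<^sup>2 * (Re e1 - Re e2)"
    "Re (pe (- of_real r)) - Re (pe (of_real r)) = - (2 * pi / w)\<^sup>2 * (Re e2 - Re e3)"
    unfolding pe_e mu_sq by (simp_all add: algebra_simps)
  moreover have "- (2 * pi / w)\<^sup>2 * (Re e1 - Re e2) > 0" "- (2 * pi / w)\<^sup>2 * (Re e2 - Re e3) > 0"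
    using mult_neg_neg[OF neg, of "Re e1 - Re e2"] mult_neg_neg[OF neg, of "Re e2 - Re e3"] e_order by simp_all
  ultimately have o: "Re (pe (- 1)) > Re (pe (- of_real r))" "Re (pe (- of_real r)) > Re (pe (of_real r))"
    by linarith+
  have "pe (- 1) = of_real \<rho>1 \<and> pe (- of_real r) = 3 \<and> pe (of_real r) = of_real \<rho>2"
    using rt o ord by auto
  thus "pe (- 1) = (- 3 + 9 * s5) / 2" "pe (- of_real r) = 3" "pe (of_real r) = (- 3 - 9 * s5) / 2"
    unfolding \<rho> by simp_all
qed

lemma py_zeta3: "\<exists>Y. Y \<noteq> 0 \<and> py zeta3 = of_real Y"
proof -
  have m: "\<mu> = \<i> * of_real (2 * pi / w)" by (simp add: \<mu>_def)
  have i3: "\<i> ^ 3 = - \<i>" by (simp add: power3_eq_cube)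
  have ii: "(- \<i> * x) * (- \<i> * y) = - (x * y)" for x y by (simp add: complex_eq_iff algebra_simps)
  have "py zeta3 = of_real (- ((2 * pi / w) ^ 3 * B))"
    unfolding py_def m power_mult_distrib i3 DW_zeta3 ii by simp
  thus ?thesis using B_pos w_nz by (intro exI[of _ "- ((2 * pi / w) ^ 3 * B)"]) simp
qed

text \<open>The inflection condition becomes (6 x^2 - 216)^2 = 12 x y^2, the 3-division polynomial,
  which factors as (x - 12) (x^3 + 12 x^2 - 72 x + 324) up to a constant. On the cubic factor y^2 =
  -12 (2 x + 3)^2, which is excluded because x and y are real and y is nonzero.\<close>

lemma pe_zeta3: "pe zeta3 = 12" and py_zeta3_sq: "(py zeta3)\<^sup>2 = 2916"
proof -
  note z = tdom_zeta3(1)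
  define x y where "x = pe zeta3" and "y = py zeta3"
  obtain Y where Y: "Y \<noteq> 0" "y = of_real Y" using py_zeta3 unfolding y_def by blast
  have y0: "y \<noteq> 0" using Y by simp
  have cv: "y\<^sup>2 = 4 * x ^ 3 - 432 * x + 1188" using curve_eq[OF z] by (simp add: x_def y_def)
  have D0: "DW zeta3 \<noteq> 0" using DW_nonzero_iff[OF z] tdom_zeta3(2) by simp
  have se: "\<mu>\<^sup>2 * (e1 + e2 + e3) = - 3 * C"
  proof -
    have "(\<mu>\<^sup>2 * e1 + C) + (\<mu>\<^sup>2 * e2 + C) + (\<mu>\<^sup>2 * e3 + C) = (- 3 + 9 * s5) / 2 + 3 + (- 3 - 9 * s5) / 2"
      unfolding pe_half_periods[unfolded pe_e] ..
    also have "\<dots> = 0" by (simp add: field_simps)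
    finally have "(\<mu>\<^sup>2 * e1 + C) + (\<mu>\<^sup>2 * e2 + C) + (\<mu>\<^sup>2 * e3 + C) = 0" .
    thus ?thesis by algebra
  qed
  have "(\<mu> * (DDW zeta3 / DW zeta3))\<^sup>2 = \<mu>\<^sup>2 * (12 * W0 - 4 * (e1 + e2 + e3))"
    unfolding power_mult_distrib zeta3_inflection ..
  also have "\<dots> = 12 * x"
    using se unfolding x_def pe_def W0_def by algebra
  also have "\<mu> * (DDW zeta3 / DW zeta3) = (6 * x\<^sup>2 - 216) / y"
    using DDW_pe[OF tdom_zeta3(2)] mu_nz D0 by (simp add: x_def y_def py_def field_simps eval_nat_numeral)
  finally have "(6 * x\<^sup>2 - 216)\<^sup>2 = 12 * x * y\<^sup>2" using y0 by (simp add: power_divide field_simps)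
  hence "(x - 12) * (x ^ 3 + 12 * x\<^sup>2 - 72 * x + 324) = 0" using cv by algebra
  moreover have "x ^ 3 + 12 * x\<^sup>2 - 72 * x + 324 \<noteq> 0"
  proof
    assume f: "x ^ 3 + 12 * x\<^sup>2 - 72 * x + 324 = 0"
    have "C = 3 - \<mu>\<^sup>2 * e2" using pe_half_periods(2) unfolding pe_e by (simp add: algebra_simps)
    hence "x \<in> \<real>" unfolding x_def pe_def W0_def[symmetric] mu_sq using W0_real e_real(2)
      by (intro Reals_add Reals_mult) (auto intro!: Reals_diff Reals_mult)
    then obtain X where X: "x = of_real X" by (elim Reals_cases)
    have "y\<^sup>2 = - 12 * (2 * x + 3)\<^sup>2" using cv f by algebra
    hence "complex_of_real (Y\<^sup>2) = of_real (- 12 * (2 * X + 3)\<^sup>2)" by (simp add: Y X)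
    hence "Y\<^sup>2 = - 12 * (2 * X + 3)\<^sup>2" by (simp only: of_real_eq_iff)
    moreover have "Y\<^sup>2 > 0" using Y by simp
    moreover have "(2 * X + 3)\<^sup>2 \<ge> 0" by simp
    ultimately show False by linarith
  qed
  ultimately have x12: "x = 12" by simp
  thus "pe zeta3 = 12" by (simp add: x_def)
  show "(py zeta3)\<^sup>2 = 2916" using cv unfolding x12 by (simp add: y_def)
qed

lemma pe_translate:
  assumes "(qW q0 a - e) * (qW q0 b - e) = (e' - e) * (e'' - e)"
    "pe_e = \<mu>\<^sup>2 * e + C" "pe_e' = \<mu>\<^sup>2 * e' + C" "pe_e'' = \<mu>\<^sup>2 * e'' + C"
  shows "(pe a - pe_e) * (pe b - pe_e) = (pe_e' - pe_e) * (pe_e'' - pe_e)"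
  using assms unfolding pe_def by algebra

lemma py_translate:
  assumes "DW a * (qW q0 b - e) + (qW q0 a - e) * DW b = 0" "pe_e = \<mu>\<^sup>2 * e + C"
  shows "py a * (pe b - pe_e) + (pe a - pe_e) * py b = 0"
  using assms unfolding pe_def py_def by algebra

text \<open>The proof of \<open>py_zeta3\<close> shows that the sign is opposite to that of the real
  period \<open>w\<close>. Both cases are carried through in
  \<open>elliptic_dilog_relation\<close>.\<close>

lemma py_zeta3_eps: "\<exists>\<epsilon>. (\<epsilon> = 1 \<or> \<epsilon> = - 1) \<and> py zeta3 = \<epsilon> * 54"
proof -
  have "(py zeta3 - 54) * (py zeta3 + 54) = (py zeta3)\<^sup>2 - 2916" by (simp add: algebra_simps power2_eq_square)
  hence "(py zeta3 - 54) * (py zeta3 + 54) = 0" unfolding py_zeta3_sq by simp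
  hence "py zeta3 = 54 \<or> py zeta3 = - 54" by (auto simp: eq_neg_iff_add_eq_0)
  thus ?thesis by auto
qed

text \<open>-\<open>r\<close> is the point of order two with abscissa 3. With centre 3 the
  translation formula reads 9 (x - 3) = (81 - 405) / 4 = -81, whence x = -6, and the second
  coordinate is that of \<open>zeta3\<close>. So P is, up to sign, a point of order three plus one
  of order two.\<close>

lemma point_P: "pe (- of_real r * zeta3) = - 6" "py (- of_real r * zeta3) = py zeta3"
proof -
  note z = tdom_zeta3(1) and cz = tdom_m_zeta3(3)
  have "(pe (- of_real r * zeta3) - 3) * (12 - 3) = ((- 3 + 9 * s5) / 2 - 3) * ((- 3 - 9 * s5) / 2 - 3)"
    using pe_translate[OF translate_e2[OF z cz] pe_e(2) pe_e(1) pe_e(3)] unfolding pe_half_periods pe_zeta3 .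
  hence 9: "9 * (pe (- of_real r * zeta3) + 6) = 0" using s5 by algebra
  have "a = - 6" if "9 * (a + 6) = 0" for a :: complex
    using that unfolding eq_neg_iff_add_eq_0 mult_eq_0_iff by simp
  from this[OF 9] show x: "pe (- of_real r * zeta3) = - 6" .
  have "py (- of_real r * zeta3) * (12 - 3) + (- 6 - 3) * py zeta3 = 0"
    using py_translate[OF translate_deriv[OF z cz _ translate_e2] pe_e(2)] r
    unfolding pe_half_periods pe_zeta3 x by simp
  thus "py (- of_real r * zeta3) = py zeta3" by (simp add: algebra_simps)
qed

definition L where "L = - 2 * pi * (w' / w)"

lemma L: "L < 0" "exp L = q0" "sqrt q0 = exp (L / 2)"
proof -
  show "L < 0" unfolding L_def using ratio by (intro mult_neg_pos) auto
  show e: "exp L = q0" by (simp add: L_def q0_def)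
  have "exp (L / 2) ^ 2 = exp L" by (simp flip: exp_double)
  thus "sqrt q0 = exp (L / 2)" using e by (intro real_sqrt_unique) auto
qed

text \<open>The parameter chosen in \<open>elliptic_dilog\<close> is unknown, but the x-coordinate
  determines exp (\<mu> u) up to powers of the nome and inversion. Inversion changes the sign of y,
  so y nonzero excludes it, and powers of the nome leave the sum unchanged.\<close>

lemma elliptic_dilog_cases:
  assumes z: "z \<in> tdom q0" and P: "pe z = x" "py z = y" and y: "y \<noteq> 0"
  shows "elliptic_dilog \<Omega> \<Omega>' (Affine x y) = bw_sum q0 z"
proof -
  define u where "u = (SOME u. wp_point \<Omega> \<Omega>' u = Affine x y)"
  have "wp_point \<Omega> \<Omega>' u = Affine x y" unfolding u_def
    by (rule someI_ex, rule curve_surj) (use curve_eq[OF z] P in simp)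
  hence u: "exp (\<mu> * u) \<in> tdom q0" "pe (exp (\<mu> * u)) = x" "py (exp (\<mu> * u)) = y"
    by (auto simp: wp_point_eq split: if_splits)
  have "\<mu>\<^sup>2 * qW q0 (exp (\<mu> * u)) = \<mu>\<^sup>2 * qW q0 z"
    using u(2) P(1) unfolding pe_def by (metis add_right_cancel)
  hence "qW q0 (exp (\<mu> * u)) = qW q0 z" using mu_nz by simp
  from qW_eq_imp[OF u(1) z this] obtain n where n: "exp (\<mu> * u) = z * of_real q0 powi n \<or> exp (\<mu> * u) = of_real q0 powi n / z"
    by blast
  have "exp (\<mu> * u) \<noteq> of_real q0 powi n / z"
  proof
    assume e: "exp (\<mu> * u) = of_real q0 powi n / z"
    have "DW (1 / z * of_real q0 powi n) = - DW z"
      using DW_powi[of "1 / z" n] DW_inverse[OF z] z by (simp add: tdom_inverse_iff)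
    hence "y = - y" using u(3) P(2) e by (auto simp: py_def)
    thus False using y by simp
  qed
  hence e: "exp (\<mu> * u) = z * of_real q0 powi n" using n by simp
  have q: "exp (2 * of_real pi * \<i> * (\<Omega>' / \<Omega>)) = of_real q0"
    using exp_mu[of 1] by (simp add: \<mu>_def)
  have "elliptic_dilog \<Omega> \<Omega>' (Affine x y) = bw_sum q0 (exp (\<mu> * u))"
    unfolding elliptic_dilog_def Let_def u_def[symmetric] q bw_sum_def by (simp add: \<mu>_def)
  thus ?thesis unfolding e using bw_sum_powi q0 by simp
qed

text \<open>Since -\<open>zeta3\<close> has angle -pi/3 and \<open>r\<close> = exp (L/2), the sum at
  -\<open>r\<close> \<open>zeta3\<close> runs over the half-integral multiples of L of
  \<open>sixth_has_sum\<close>, while the sum at \<open>zeta3\<close> is \<open>dilog_sum\<close>.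
  The signs come from oddness of D in the angle.\<close>

lemma bw_sum_values:
  defines "X \<equiv> dilog_sum (L / 2) - dilog_sum L / 2 - dilog_sum (2 * L) / 2"
  shows "bw_sum q0 (- of_real r * zeta3) = - X" "bw_sum q0 (1 / (- of_real r * zeta3)) = X"
    "bw_sum q0 zeta3 = dilog_sum L" "bw_sum q0 (1 / zeta3) = - dilog_sum L"
proof -
  have X: "((\<lambda>n::int. bwray (pi / 3) ((of_int n + 1 / 2) * L)) has_sum X) UNIV"
    unfolding X_def by (rule sixth_has_sum[OF L(1)])
  have Y: "((\<lambda>n::int. bw3 (of_int n * L)) has_sum dilog_sum L) UNIV" by (rule dilog_sum_has_sum[OF L(1)])
  have mz: "- zeta3 = cis (- (pi / 3))"
    by (simp add: zeta3_def complex_eq_iff cos_60 sin_60)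
  have iz: "1 / zeta3 = cis (- (2 * pi / 3))" unfolding cis_2pi3[symmetric] by (simp add: cis_inverse flip: inverse_eq_divide)
  have ray: "bw_sum q0 (of_real (exp t) * cis \<theta>) = (\<Sum>\<^sub>\<infinity>n::int. bwray \<theta> (t + of_int n * L))" for t \<theta>
    using bw_sum_ray[of L t \<theta>] unfolding L(2) .
  have "- of_real r * zeta3 = of_real r * (- zeta3)" by simp
  hence a: "- of_real r * zeta3 = of_real (exp (L / 2)) * cis (- (pi / 3))" unfolding mz L(3) .
  have "bw_sum q0 (- of_real r * zeta3) = (\<Sum>\<^sub>\<infinity>n::int. bwray (- (pi / 3)) (L / 2 + of_int n * L))"
    unfolding a by (rule ray)
  also have "\<dots> = (\<Sum>\<^sub>\<infinity>n::int. - bwray (pi / 3) ((of_int n + 1 / 2) * L))"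
    by (simp add: bwray_minus_angle[OF cos_60_lt] algebra_simps)
  also have "\<dots> = - X" using X by (intro infsumI) (simp add: has_sum_uminus)
  finally show "bw_sum q0 (- of_real r * zeta3) = - X" .
  \<comment> \<open>The inverse has modulus exp (- L/2); one factor of the nome moves it to exp
    (L/2), where \<open>sixth_has_sum\<close> applies directly.\<close>
  have "1 / (- of_real r * zeta3) * of_real q0 powi 1 = of_real (exp (L / 2)) * cis (pi / 3)"
  proof -
    have "1 / - zeta3 = cis (pi / 3)" unfolding mz by (simp add: cis_inverse flip: inverse_eq_divide)
    moreover have "1 / (- of_real r * zeta3) * of_real q0 powi 1 = of_real r * (1 / - zeta3)"
      using r by (simp flip: rc(1))
    ultimately show ?thesis by (simp add: L(3))
  qed
  hence "bw_sum q0 (1 / (- of_real r * zeta3)) = bw_sum q0 (of_real (exp (L / 2)) * cis (pi / 3))"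
    using bw_sum_powi[OF q0(1), of "1 / (- of_real r * zeta3)" 1] by simp
  also have "\<dots> = (\<Sum>\<^sub>\<infinity>n::int. bwray (pi / 3) (L / 2 + of_int n * L))"
    by (rule ray)
  also have "\<dots> = X" using X by (intro infsumI) (simp add: algebra_simps)
  finally show "bw_sum q0 (1 / (- of_real r * zeta3)) = X" .
  show "bw_sum q0 zeta3 = dilog_sum L"
    using bw_sum_ray[of L 0 "2 * pi / 3"] infsumI[OF Y] by (simp add: cis_2pi3 L(2))
  have "bw_sum q0 (1 / zeta3) = (\<Sum>\<^sub>\<infinity>n::int. - bw3 (of_int n * L))"
    using bw_sum_ray[of L 0 "- (2 * pi / 3)"] by (simp add: iz L(2) bwray_minus_angle[OF cos_120_lt])
  also have "\<dots> = - dilog_sum L" using Y by (intro infsumI) (simp add: has_sum_uminus)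
  finally show "bw_sum q0 (1 / zeta3) = - dilog_sum L" .
qed

text \<open>In both cases the left-hand side is, up to a common sign, 16 X - 11 S(q), where X =
  S(sqrt q) - S(q) / 2 - S(q^2) / 2. The 19 is 8 + 11.\<close>

lemma elliptic_dilog_relation:
  "16 * elliptic_dilog \<Omega> \<Omega>' (Affine (- 6) 54) - 11 * elliptic_dilog \<Omega> \<Omega>' (ec_double 432 (Affine (- 6) 54)) = 0
   \<longleftrightarrow> 16 * dilog_sum (L / 2) - 8 * dilog_sum (2 * L) - 19 * dilog_sum L = 0"
proof -
  \<comment> \<open>The tangent at P is horizontal since 12 * 36 = 432, so the third intersection
    has the same y-coordinate 54 and abscissa 6 + 6.\<close>
  have dbl: "ec_double 432 (Affine (- 6) 54) = Affine 12 (- 54)"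
    by (simp add: ec_double_def Let_def eq_neg_iff_add_eq_0)
  define X where "X = dilog_sum (L / 2) - dilog_sum L / 2 - dilog_sum (2 * L) / 2"
  note z = tdom_zeta3(1) and cz = tdom_m_zeta3(3)
  have pe_inv: "pe (1 / z) = pe z" "py (1 / z) = - py z" "1 / z \<in> tdom q0" if "z \<in> tdom q0" for z
    using qW_inverse[OF that] DW_inverse[OF that] that by (simp_all add: pe_def py_def tdom_inverse_iff)
  obtain \<epsilon> where e: "\<epsilon> = 1 \<or> \<epsilon> = - 1" "py zeta3 = \<epsilon> * 54" using py_zeta3_eps by blast
  from e(1) show ?thesis
  proof
    assume e1: "\<epsilon> = 1"
    have "elliptic_dilog \<Omega> \<Omega>' (Affine (- 6) 54) = - X"
      using elliptic_dilog_cases[OF cz point_P(1), of 54] point_P(2) e e1 bw_sum_values(1) by (simp add: X_def)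
    moreover have "elliptic_dilog \<Omega> \<Omega>' (Affine 12 (- 54)) = - dilog_sum L"
      using elliptic_dilog_cases[OF pe_inv(3)[OF z], of 12 "- 54"] pe_inv[OF z] pe_zeta3 e e1 bw_sum_values(4) by simp
    ultimately show ?thesis unfolding dbl X_def by (auto simp: field_simps)
  next
    assume e1: "\<epsilon> = - 1"
    have "elliptic_dilog \<Omega> \<Omega>' (Affine (- 6) 54) = X"
      using elliptic_dilog_cases[OF pe_inv(3)[OF cz], of "- 6" 54] pe_inv[OF cz] point_P e e1 bw_sum_values(2)
      by (simp add: X_def)
    moreover have "elliptic_dilog \<Omega> \<Omega>' (Affine 12 (- 54)) = dilog_sum L"
      using elliptic_dilog_cases[OF z pe_zeta3, of "- 54"] e e1 bw_sum_values(3) by simp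
    ultimately show ?thesis unfolding dbl X_def by (auto simp: field_simps)
  qed
qed

lemma DDW_zeta3_value: "\<mu> ^ 4 * DDW zeta3 = 648"
  using DDW_pe[OF tdom_zeta3(2)] pe_zeta3 by simp

lemma invariant_rescale: "x ^ 3 / y ^ 4 = (\<mu> ^ 4 * x) ^ 3 / (\<mu> ^ 3 * y) ^ 4"
proof -
  have "(\<mu> ^ 4 * x) ^ 3 / (\<mu> ^ 3 * y) ^ 4 = (\<mu> ^ 12 * x ^ 3) / (\<mu> ^ 12 * y ^ 4)"
    by (simp add: power_mult_distrib flip: power_mult)
  thus ?thesis using mu_nz by simp
qed

text \<open>\<open>invariant\<close> at \<open>zeta3\<close>, rescaled to the Weierstrass model, is
  648^3 / 54^4 = 32.\<close>

lemma alpha_q: "alpha q0 = root 3 32"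
proof -
  have "py zeta3 ^ 4 = ((py zeta3)\<^sup>2)\<^sup>2" by (simp flip: power_mult)
  hence "py zeta3 ^ 4 = 2916\<^sup>2" unfolding py_zeta3_sq .
  hence "of_real (27 + hauptmodul q0) = (648 ^ 3 / 2916\<^sup>2 :: complex)"
    unfolding invariant invariant_rescale[of "DDW zeta3"] DDW_zeta3_value by (simp add: py_def)
  also have "\<dots> = of_real 32" by simp
  finally have "27 + hauptmodul q0 = 32" by (simp only: of_real_eq_iff)
  thus ?thesis by (simp add: alpha_def)
qed

text \<open>The sums over a fibre of the two isogenies are conjugate over the rationals with sqrt 5
  adjoined: translation by \<open>r\<close> is the case s = sqrt 5, translation by -1 the case s =
  -sqrt 5. The right-hand side is (7 + s)^3 / 4 by \<open>cube_7\<close>, which explains the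
  arguments of the Mahler measures.\<close>

lemma DDW_translate:
  assumes c: "c * zeta3 \<in> tdom q0" "c \<noteq> 0" "(c * zeta3)\<^sup>2 \<in> tdom q0"
    and tr: "\<And>z. z \<in> tdom q0 \<Longrightarrow> c * z \<in> tdom q0 \<Longrightarrow> (qW q0 (c * z) - e) * (qW q0 z - e) = (e' - e) * (e2 - e)"
    and e: "\<mu>\<^sup>2 * e + C = (- 3 - 9 * s) / 2" "\<mu>\<^sup>2 * e' + C = (- 3 + 9 * s) / 2"
    and s: "s\<^sup>2 = 5"
  shows "(DDW zeta3 + DDW (c * zeta3)) ^ 3 / (DW zeta3 + DW (c * zeta3)) ^ 4 = 112 + 38 * s"
proof -
  note z = tdom_zeta3(1)
  have 1: "(pe (c * zeta3) - (- 3 - 9 * s) / 2) * (12 - (- 3 - 9 * s) / 2) = 9 * s * (3 - (- 3 - 9 * s) / 2)"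
    using pe_translate[OF tr[OF z c(1)] e(1)[symmetric] e(2)[symmetric] pe_e(2)]
    unfolding pe_half_periods pe_zeta3 by (simp add: field_simps)
  have 2: "py (c * zeta3) * (12 - (- 3 - 9 * s) / 2) + (pe (c * zeta3) - (- 3 - 9 * s) / 2) * py zeta3 = 0"
    using py_translate[OF translate_deriv[OF z c(1,2) tr] e(1)[symmetric]] unfolding pe_zeta3 .
  have "(DDW zeta3 + DDW (c * zeta3)) ^ 3 / (DW zeta3 + DW (c * zeta3)) ^ 4 =
      (\<mu> ^ 4 * DDW zeta3 + \<mu> ^ 4 * DDW (c * zeta3)) ^ 3 / (py zeta3 + py (c * zeta3)) ^ 4"
    unfolding invariant_rescale[of "DDW zeta3 + DDW (c * zeta3)"] by (simp add: py_def distrib_left)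
  also have "\<dots> = (648 + (6 * pe (c * zeta3) ^ 2 - 216)) ^ 3 / (py zeta3 + py (c * zeta3)) ^ 4"
    unfolding DDW_zeta3_value DDW_pe[OF c(3)] ..
  also have "\<dots> = 112 + 38 * s" by (rule translate_value[OF s py_zeta3_sq 1 2])
  finally show ?thesis .
qed

lemma alpha_sqrt_q: "alpha r = (7 + sqrt 5) / root 3 4"
proof -
  interpret h: nome r by (rule nome_r)
  have sq: "(of_real r * zeta3)\<^sup>2 \<in> tdom q0"
    unfolding power_mult_distrib rc(2) using tdom_zeta3(2) tdom_scale_iff[of "zeta3\<^sup>2"] by simp
  have "(DDW zeta3 + DDW (of_real r * zeta3)) ^ 3 / (DW zeta3 + DW (of_real r * zeta3)) ^ 4 = 112 + 38 * s5"
    by (rule DDW_translate[where e = e3 and e' = e1, OF tdom_m_zeta3(2) _ sq translate_e3])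
       (use r s5 pe_half_periods in \<open>auto simp: pe_e\<close>)
  hence "of_real (27 + hauptmodul r) = complex_of_real (112 + 38 * sqrt 5)"
    unfolding invariant_sqrt by (simp add: s5_def)
  hence "27 + hauptmodul r = 112 + 38 * sqrt 5" by (simp only: of_real_eq_iff)
  hence "alpha r ^ 3 = (7 + sqrt 5) ^ 3 / 4" unfolding h.alpha_cube using cube_7[of "sqrt 5"] by simp
  thus ?thesis using h.alpha_gt_3 by (intro cube_eq_root_quotient) auto
qed

lemma alpha_q_square: "alpha (q0\<^sup>2) = (7 - sqrt 5) / root 3 4"
proof -
  interpret h: nome "q0\<^sup>2" by (rule nome_q2)
  have sq: "(- 1 * zeta3)\<^sup>2 \<in> tdom q0" using tdom_zeta3(2) by simp
  have tr: "(qW q0 (- 1 * z) - e1) * (qW q0 z - e1) = (e3 - e1) * (e2 - e1)" if "z \<in> tdom q0" "- 1 * z \<in> tdom q0" for z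
    using translate_e1[of z] that by (simp add: mult.commute)
  have "(DDW zeta3 + DDW (- 1 * zeta3)) ^ 3 / (DW zeta3 + DW (- 1 * zeta3)) ^ 4 = 112 + 38 * (- s5)"
    by (rule DDW_translate[where e = e1 and e' = e3, OF _ _ sq tr])
       (use tdom_m_zeta3(1) s5 pe_half_periods in \<open>auto simp: pe_e\<close>)
  hence "of_real (27 + hauptmodul (q0\<^sup>2)) = complex_of_real (112 - 38 * sqrt 5)"
    unfolding invariant_square by (simp add: s5_def)
  hence "27 + hauptmodul (q0\<^sup>2) = 112 - 38 * sqrt 5" by (simp only: of_real_eq_iff)
  hence "alpha (q0\<^sup>2) ^ 3 = (7 - sqrt 5) ^ 3 / 4" unfolding h.alpha_cube using cube_7[of "- sqrt 5"] by simp
  moreover have "sqrt 5 \<le> 7" by (rule real_le_lsqrt) auto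
  ultimately show ?thesis using h.alpha_gt_3 by (intro cube_eq_root_quotient) auto
qed

lemma mahler_relation:
  "16 * mahler_n ((7 + sqrt 5) / root 3 4) - 8 * mahler_n ((7 - sqrt 5) / root 3 4) = 19 * mahler_n (root 3 32)
   \<longleftrightarrow> 16 * dilog_sum (L / 2) - 8 * dilog_sum (2 * L) - 19 * dilog_sum L = 0"
proof -
  have 1: "mahler_n ((7 + sqrt 5) / root 3 4) = 9 / (2 * pi) * dilog_sum (L / 2)"
    using mahler_alpha[of "L / 2"] L alpha_sqrt_q by simp
  have 2: "mahler_n ((7 - sqrt 5) / root 3 4) = 9 / (2 * pi) * dilog_sum (2 * L)"
    using mahler_alpha[of "2 * L"] L(1) alpha_q_square by (simp add: exp_double L(2))
  have 3: "mahler_n (root 3 32) = 9 / (2 * pi) * dilog_sum L"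
    using mahler_alpha[of L] L alpha_q by simp
  have *: "16 * (c * x) - 8 * (c * y) = 19 * (c * z) \<longleftrightarrow> 16 * x - 8 * y - 19 * z = 0" if "c \<noteq> 0" for c x y z :: real
  proof -
    have "16 * (c * x) - 8 * (c * y) = 19 * (c * z) \<longleftrightarrow> c * (16 * x - 8 * y - 19 * z) = 0"
      by (auto simp: algebra_simps)
    thus ?thesis using that by simp
  qed
  show ?thesis unfolding 1 2 3 by (rule *) simp
qed

end

theorem theorem6:
  fixes \<omega> \<omega>' :: complex and P :: ec_point
  assumes real_period: "\<omega> \<in> \<real>"
    and imaginary_period: "Re \<omega>' = 0"
    and orientation: "Im (\<omega>' / \<omega>) > 0"
    and uniformization: "range (wp_point \<omega> \<omega>') = weierstrass_curve 432 (- 1188)"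
    and P: "P = Affine (- 6) 54"
  shows "16 * elliptic_dilog \<omega> \<omega>' P - 11 * elliptic_dilog \<omega> \<omega>' (ec_double 432 P) = 0 \<longleftrightarrow>
    16 * mahler_n ((7 + sqrt 5) / root 3 4) - 8 * mahler_n ((7 - sqrt 5) / root 3 4)
      = 19 * mahler_n (root 3 32)"
proof -
  obtain w where w: "\<omega> = of_real w" using real_period by (elim Reals_cases)
  define w' where "w' = Im \<omega>'"
  have w': "\<omega>' = \<i> * of_real w'" using imaginary_period by (simp add: w'_def complex_eq_iff)
  have "Im (\<omega>' / \<omega>) = w' / w" unfolding w w' by simp
  then interpret uniformized w w'
    using orientation uniformization by unfold_locales (simp_all add: w w')
  show ?thesis unfolding P w w' elliptic_dilog_relation mahler_relation ..
qed

end
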